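(* The Morse index of the surface $Y_{\pi/6}$ is two, and its nullity is five.
   Context: **The surface $Y_{\pi/6}$.** Put $\alpha_1=\frac{\pi}{6}$, $\alpha_2=\frac{\pi}{6}+\frac{2\pi}{3}=\frac{5\pi}{6}$, $\alpha_3=\frac{\pi}{6}-\frac{2\pi}{3}=-\frac{\pi}{2}$. Let $\Gamma$ be a circle of radius $c>0$ centered at the origin in $\{x_3=0\}$. $Y_{\pi/6}=(\Sigma_1,\Sigma_2,\Sigma_3;\Gamma)$ is the minimal triple junction surface in $\mathbb{R}^3$ whose faces $\Sigma_i$ are rotationally symmetric pieces of catenoids with boundary $\Gamma$ and outward unit conormal along $\Gamma$ equal to $\eta_i=\cos\alpha_i\,e_r+\sin\alpha_i\,e_3$, where $e_r$ is the outward radial unit vector of the plane and $e_3=(0,0,1)$ (so $\eta_1+\eta_2+\eta_3=0$). Explicitly, $\Sigma_i$ is parametrized by $$X_i(t,\theta)=c_i\big(\cosh(t+T_i)\cos\theta,\ \cosh(t+T_i)\sin\theta,\ \epsilon_i t\big),\quad t\in[0,\infty),\ \theta\in[0,2\pi),$$ where $\tanh T_i=-\cos\alpha_i$ (so $T_3=0$), $c_i\cosh T_i=c$, and $\epsilon_1=\epsilon_2=-1$, $\epsilon_3=+1$. The surface is determined up to homothety (choice of $c$); index and nullity do not depend on this choice. **Index form.** Unit normals on the faces are chosen compatibly, so that they sum to $0$ along $\Gamma$; accordingly, an admissible (normal) variation is a triple $\phi=(\phi_1,\phi_2,\phi_3)$ of functions $\phi_i$ on $\Sigma_i$ with $\phi_1+\phi_2+\phi_3=0$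 on $\Gamma$ (in the sense of traces). Let $A_i$ be the second fundamental form of $\Sigma_i$ and $\mathbf{H}_\Gamma$ the curvature vector of the curve $\Gamma$ in $\mathbb{R}^3$. The index form (second variation of area) is $$Q(\phi)=\sum_{i=1}^3\Big(\int_{\Sigma_i}|\nabla\phi_i|^2-|A_i|^2\phi_i^2-\int_\Gamma (\mathbf{H}_\Gamma\cdot\eta_i)\,\phi_i^2\Big),$$ with associated symmetric bilinear form $Q(\cdot,\cdot)$. **Morse index.** The maximal dimension of a subspace of compactly supported admissible $W^{1,2}$ triples (supports may meet $\Gamma$) on which $Q$ is negative definite. **Nullity.** Let $L^2_*$ be the completion of compactly supported smooth functions in the norm $\|f\|_{L^2_*}^2=\int f^2(1+|x|^2)^{-1}(\log(2+|x|))^{-2}$, where $|x|$ is the Euclidean norm of the position. Let $\mathcal D$ be the space of admissible triples $\phi$ with each $\phi_i\in L^2_*(\Sigma_i)$ and $|\nabla\phi_i|\in L^2(\Sigma_i)$. The nullity is the dimension of the null space $\{\phi\in\mathcal D: Q(\phi,\psi)=0\ \text{for all }\psi\in\mathcal D\}$. *)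

theory Defs
  imports "HOL-Analysis.Analysis"
begin

section \<open>Faces\<close>

text \<open>
  A face is given by a parametrization \<open>X (t, \<theta>)\<close> over \<open>t \<ge> 0\<close> which is \<open>2 * pi\<close>-periodic in
  \<open>\<theta>\<close>; the edge is \<open>t = 0\<close>. Maps are defined for all real \<open>t\<close>, so that partial derivatives at the
  edge are two-sided derivatives. Functions on the face are functions on the ambient space, of
  which only the values \<open>f (X p)\<close> on the face matter.
\<close>

type_synonym face = "real \<times> real \<Rightarrow> real^3"

definition cyl :: "(real \<times> real) set" where
  "cyl = {0..} \<times> {0..<2 * pi}"

definition face_set :: "face \<Rightarrow> (real^3) set" where
  "face_set X = X ` ({0..} \<times> UNIV)"

text \<open>Coordinate derivative: \<open>a = 1\<close> is \<open>\<partial>/\<partial>t\<close> and \<open>a = 2\<close> is \<open>\<partial>/\<partial>\<theta>\<close>.\<close>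

definition pd :: "2 \<Rightarrow> (real \<times> real \<Rightarrow> 'a::real_normed_vector) \<Rightarrow> real \<times> real \<Rightarrow> 'a" where
  "pd a f p =
     (if a = 1 then vector_derivative (\<lambda>t. f (t, snd p)) (at (fst p))
      else vector_derivative (\<lambda>\<theta>. f (fst p, \<theta>)) (at (snd p)))"

definition first_ff :: "face \<Rightarrow> real \<times> real \<Rightarrow> real^2^2" where
  "first_ff X p = (\<chi> a b. pd a X p \<bullet> pd b X p)"

definition unit_normal :: "face \<Rightarrow> real \<times> real \<Rightarrow> real^3" where
  "unit_normal X p = sgn (cross3 (pd 1 X p) (pd 2 X p))"

definition second_ff :: "face \<Rightarrow> real \<times> real \<Rightarrow> real^2^2" where
  "second_ff X p = (\<chi> a b. pd a (pd b X) p \<bullet> unit_normal X p)"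

text \<open>\<open>|A|\<^sup>2\<close>, the full contraction of the second fundamental form with the inverse metric;
  it does not depend on the choice of the unit normal.\<close>

definition second_ff_norm_sq :: "face \<Rightarrow> real \<times> real \<Rightarrow> real" where
  "second_ff_norm_sq X p =
     (let g = matrix_inv (first_ff X p); h = second_ff X p in
      \<Sum>a\<in>UNIV. \<Sum>b\<in>UNIV. \<Sum>c\<in>UNIV. \<Sum>d\<in>UNIV. g $ a $ c * g $ b $ d * h $ a $ b * h $ c $ d)"

text \<open>The area measure of the face, on the parameter domain.\<close>

definition area :: "face \<Rightarrow> (real \<times> real) measure" where
  "area X = density (restrict_space lborel cyl) (\<lambda>p. ennreal (norm (cross3 (pd 1 X p) (pd 2 X p))))"

definition edge :: "face \<Rightarrow> real \<Rightarrow> real^3" where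
  "edge X \<theta> = X (0, \<theta>)"

definition arclength :: "(real \<Rightarrow> real^3) \<Rightarrow> real measure" where
  "arclength \<gamma> =
     density (restrict_space lborel {0..<2 * pi}) (\<lambda>\<theta>. ennreal (norm (vector_derivative \<gamma> (at \<theta>))))"

definition unit_tangent :: "(real \<Rightarrow> real^3) \<Rightarrow> real \<Rightarrow> real^3" where
  "unit_tangent \<gamma> \<theta> = sgn (vector_derivative \<gamma> (at \<theta>))"

definition curvature_vector :: "(real \<Rightarrow> real^3) \<Rightarrow> real \<Rightarrow> real^3" where
  "curvature_vector \<gamma> \<theta> =
     vector_derivative (unit_tangent \<gamma>) (at \<theta>) /\<^sub>R norm (vector_derivative \<gamma> (at \<theta>))"

text \<open>Outward conormal: \<open>\<partial>X/\<partial>t\<close> points into the face, whence the sign.\<close>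

definition conormal :: "face \<Rightarrow> real \<Rightarrow> real^3" where
  "conormal X \<theta> =
     (let T = unit_tangent (edge X) \<theta>; v = pd 1 X (0, \<theta>) in - sgn (v - (v \<bullet> T) *\<^sub>R T))"


section \<open>Function spaces on a face\<close>

primrec Ck :: "nat \<Rightarrow> (real \<times> real \<Rightarrow> real) \<Rightarrow> bool" where
  "Ck 0 f \<longleftrightarrow> continuous_on UNIV f"
| "Ck (Suc k) f \<longleftrightarrow> f differentiable_on UNIV \<and> Ck k (pd 1 f) \<and> Ck k (pd 2 f)"

definition periodic :: "(real \<times> real \<Rightarrow> real) \<Rightarrow> bool" where
  "periodic f \<longleftrightarrow> (\<forall>t \<theta>. f (t, \<theta> + 2 * pi) = f (t, \<theta>))"

text \<open>Smoothness is up to the edge, that is, in the sense of surfaces with boundary.\<close>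

definition smooth_on_face :: "face \<Rightarrow> (real^3 \<Rightarrow> real) \<Rightarrow> bool" where
  "smooth_on_face X f \<longleftrightarrow> (\<exists>g. (\<forall>k. Ck k g) \<and> (\<forall>t\<ge>0. \<forall>\<theta>. f (X (t, \<theta>)) = g (t, \<theta>)))"

text \<open>The support is a compact subset of the face including its edge.\<close>

definition cpt_supp :: "face \<Rightarrow> (real^3 \<Rightarrow> real) \<Rightarrow> bool" where
  "cpt_supp X f \<longleftrightarrow>
     (\<exists>K. compact K \<and> K \<subseteq> face_set X \<and> (AE p in area X. X p \<notin> K \<longrightarrow> f (X p) = 0))"

text \<open>
  \<open>G\<close> is a weak gradient of \<open>f\<close>: a tangent vector field with values in the ambient space, such that
  \<open>G \<bullet> \<partial>X/\<partial>t\<close> and \<open>G \<bullet> \<partial>X/\<partial>\<theta>\<close> are the weak partial derivatives of \<open>f \<circ> X\<close> in the interior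
  \<open>t > 0\<close>. The test functions \<open>z\<close> live on the open half-cylinder, i.e. they are periodic in \<open>\<theta>\<close>
  and compactly supported in \<open>t > 0\<close>.
\<close>

definition has_weak_gradient ::
    "face \<Rightarrow> (real^3 \<Rightarrow> real) \<Rightarrow> (real \<times> real \<Rightarrow> real^3) \<Rightarrow> bool" where
  "has_weak_gradient X f G \<longleftrightarrow>
     (\<lambda>p. f (X p)) \<in> borel_measurable (area X) \<and>
     G \<in> borel_measurable (area X) \<and>
     (AE p in area X. G p \<in> span {pd 1 X p, pd 2 X p}) \<and>
     (\<forall>a b. 0 < a \<longrightarrow>
        set_integrable lborel ({a..b} \<times> {0..<2 * pi}) (\<lambda>p. f (X p)) \<and>
        set_integrable lborel ({a..b} \<times> {0..<2 * pi}) G) \<and>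
     (\<forall>z. Ck 1 z \<and> periodic z \<and>
          (\<exists>a b. 0 < a \<and> (\<forall>t \<theta>. t \<notin> {a..b} \<longrightarrow> z (t, \<theta>) = 0)) \<longrightarrow>
        (\<forall>i. (LINT p:cyl|lborel. f (X p) * pd i z p)
              = - (LINT p:cyl|lborel. (G p \<bullet> pd i X p) * z p)))"

definition weak_gradient :: "face \<Rightarrow> (real^3 \<Rightarrow> real) \<Rightarrow> real \<times> real \<Rightarrow> real^3" where
  "weak_gradient X f = (SOME G. has_weak_gradient X f G)"

text \<open>
  \<open>\<tau>\<close> is the trace of \<open>f\<close> on the edge: \<open>f\<close> is, on the compact collar \<open>0 \<le> t \<le> 1\<close>, a \<open>W\<^sup>1\<^sup>,\<^sup>2\<close>-limit
  of functions that are \<open>C\<^sup>1\<close> up to the edge and whose boundary values tend to \<open>\<tau>\<close> in \<open>L\<^sup>2\<close>. The norms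
  are taken in the coordinates, which on a compact collar gives norms equivalent to those of the
  induced metric.
\<close>

definition has_trace :: "face \<Rightarrow> (real^3 \<Rightarrow> real) \<Rightarrow> (real \<Rightarrow> real) \<Rightarrow> bool" where
  "has_trace X f \<tau> \<longleftrightarrow>
     \<tau> \<in> borel_measurable (restrict_space lborel {0..<2 * pi}) \<and>
     (\<exists>g :: nat \<Rightarrow> real \<times> real \<Rightarrow> real.
        (\<forall>n. Ck 1 (g n) \<and> periodic (g n)) \<and>
        (\<lambda>n. \<integral>\<^sup>+p. ennreal ((g n p - f (X p))\<^sup>2
               + (\<Sum>i\<in>UNIV. (pd i (g n) p - weak_gradient X f p \<bullet> pd i X p)\<^sup>2))
             \<partial>restrict_space lborel ({0..1} \<times> {0..<2 * pi})) \<longlonglongrightarrow> 0 \<and>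
        (\<lambda>n. \<integral>\<^sup>+\<theta>. ennreal ((g n (0, \<theta>) - \<tau> \<theta>)\<^sup>2) \<partial>restrict_space lborel {0..<2 * pi}) \<longlonglongrightarrow> 0)"

definition edge_trace :: "face \<Rightarrow> (real^3 \<Rightarrow> real) \<Rightarrow> real \<Rightarrow> real" where
  "edge_trace X f = (SOME \<tau>. has_trace X f \<tau>)"

definition gradient_L2 :: "face \<Rightarrow> (real^3 \<Rightarrow> real) \<Rightarrow> bool" where
  "gradient_L2 X f \<longleftrightarrow> integrable (area X) (\<lambda>p. (norm (weak_gradient X f p))\<^sup>2)"

definition W12 :: "face \<Rightarrow> (real^3 \<Rightarrow> real) \<Rightarrow> bool" where
  "W12 X f \<longleftrightarrow>
     (\<exists>G. has_weak_gradient X f G) \<and> integrable (area X) (\<lambda>p. (f (X p))\<^sup>2) \<and> gradient_L2 X f"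

definition Lstar_weight :: "real^3 \<Rightarrow> real" where
  "Lstar_weight x = 1 / ((1 + (norm x)\<^sup>2) * (ln (2 + norm x))\<^sup>2)"

text \<open>The completion is realized as the space of measurable functions that are limits, in the
  weighted norm, of compactly supported smooth functions.\<close>

definition Lstar :: "face \<Rightarrow> (real^3 \<Rightarrow> real) \<Rightarrow> bool" where
  "Lstar X f \<longleftrightarrow>
     (\<lambda>p. f (X p)) \<in> borel_measurable (area X) \<and>
     (\<exists>g :: nat \<Rightarrow> real^3 \<Rightarrow> real.
        (\<forall>n. smooth_on_face X (g n) \<and> cpt_supp X (g n)) \<and>
        (\<lambda>n. \<integral>\<^sup>+p. ennreal ((f (X p) - g n (X p))\<^sup>2 * Lstar_weight (X p)) \<partial>area X) \<longlonglongrightarrow> 0)"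


section \<open>Index form, Morse index and nullity of a triple junction surface\<close>

text \<open>The three faces share their edge: \<open>edge (Y i)\<close> is the same curve for all \<open>i\<close>.\<close>

type_synonym triple = "3 \<Rightarrow> real^3 \<Rightarrow> real"

definition admissible :: "(3 \<Rightarrow> face) \<Rightarrow> triple \<Rightarrow> bool" where
  "admissible Y \<phi> \<longleftrightarrow>
     (\<forall>i. (\<exists>G. has_weak_gradient (Y i) (\<phi> i) G) \<and> (\<exists>\<tau>. has_trace (Y i) (\<phi> i) \<tau>)) \<and>
     (AE \<theta> in restrict_space lborel {0..<2 * pi}. (\<Sum>i\<in>UNIV. edge_trace (Y i) (\<phi> i) \<theta>) = 0)"

definition index_form :: "(3 \<Rightarrow> face) \<Rightarrow> triple \<Rightarrow> triple \<Rightarrow> real" where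
  "index_form Y \<phi> \<psi> =
     (\<Sum>i\<in>UNIV.
        (LINT p|area (Y i).
           weak_gradient (Y i) (\<phi> i) p \<bullet> weak_gradient (Y i) (\<psi> i) p
           - second_ff_norm_sq (Y i) p * \<phi> i (Y i p) * \<psi> i (Y i p))
        - (LINT \<theta>|arclength (edge (Y i)).
             (curvature_vector (edge (Y i)) \<theta> \<bullet> conormal (Y i) \<theta>)
             * edge_trace (Y i) (\<phi> i) \<theta> * edge_trace (Y i) (\<psi> i) \<theta>))"

text \<open>Triples are identified when they agree almost everywhere; linear independence and dimension
  are therefore taken modulo the null triples.\<close>

definition null_triple :: "(3 \<Rightarrow> face) \<Rightarrow> triple \<Rightarrow> bool" where
  "null_triple Y \<phi> \<longleftrightarrow> (\<forall>i. AE p in area (Y i). \<phi> i (Y i p) = 0)"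

definition lin_comb :: "nat \<Rightarrow> (nat \<Rightarrow> real) \<Rightarrow> (nat \<Rightarrow> triple) \<Rightarrow> triple" where
  "lin_comb n a b = (\<lambda>i x. \<Sum>j<n. a j * b j i x)"

definition lin_indep :: "(3 \<Rightarrow> face) \<Rightarrow> nat \<Rightarrow> (nat \<Rightarrow> triple) \<Rightarrow> bool" where
  "lin_indep Y n b \<longleftrightarrow> (\<forall>a. null_triple Y (lin_comb n a b) \<longrightarrow> (\<forall>j<n. a j = 0))"

definition triple_dim :: "(3 \<Rightarrow> face) \<Rightarrow> triple set \<Rightarrow> enat" where
  "triple_dim Y V = Sup {enat n | n. \<exists>b. (\<forall>j<n. b j \<in> V) \<and> lin_indep Y n b}"

definition linear_subspace :: "triple set \<Rightarrow> bool" where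
  "linear_subspace V \<longleftrightarrow>
     (\<lambda>i x. 0) \<in> V \<and>
     (\<forall>\<phi>\<in>V. \<forall>\<psi>\<in>V. (\<lambda>i x. \<phi> i x + \<psi> i x) \<in> V) \<and>
     (\<forall>r. \<forall>\<phi>\<in>V. (\<lambda>i x. r * \<phi> i x) \<in> V)"

definition cpt_variations :: "(3 \<Rightarrow> face) \<Rightarrow> triple set" where
  "cpt_variations Y = {\<phi>. admissible Y \<phi> \<and> (\<forall>i. W12 (Y i) (\<phi> i) \<and> cpt_supp (Y i) (\<phi> i))}"

definition morse_index :: "(3 \<Rightarrow> face) \<Rightarrow> enat" where
  "morse_index Y =
     Sup {triple_dim Y V | V.
            V \<subseteq> cpt_variations Y \<and> linear_subspace V \<and>
            (\<forall>\<phi>\<in>V. \<not> null_triple Y \<phi> \<longrightarrow> index_form Y \<phi> \<phi> < 0)}"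

definition D_space :: "(3 \<Rightarrow> face) \<Rightarrow> triple set" where
  "D_space Y = {\<phi>. admissible Y \<phi> \<and> (\<forall>i. Lstar (Y i) (\<phi> i) \<and> gradient_L2 (Y i) (\<phi> i))}"

definition nullity :: "(3 \<Rightarrow> face) \<Rightarrow> enat" where
  "nullity Y = triple_dim Y {\<phi> \<in> D_space Y. \<forall>\<psi>\<in>D_space Y. index_form Y \<phi> \<psi> = 0}"


section \<open>The surface\<close>

definition Y_angle :: "3 \<Rightarrow> real" where
  "Y_angle i = (if i = 1 then pi / 6 else if i = 2 then pi / 6 + 2 * pi / 3 else pi / 6 - 2 * pi / 3)"

definition Y_sign :: "3 \<Rightarrow> real" where
  "Y_sign i = (if i = 3 then 1 else -1)"

definition Y_shift :: "3 \<Rightarrow> real" where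
  "Y_shift i = artanh (- cos (Y_angle i))"

definition Y_scale :: "real \<Rightarrow> 3 \<Rightarrow> real" where
  "Y_scale c i = c / cosh (Y_shift i)"

definition Y_surface :: "real \<Rightarrow> 3 \<Rightarrow> face" where
  "Y_surface c i = (\<lambda>(t, \<theta>). Y_scale c i *\<^sub>R
     vector [cosh (t + Y_shift i) * cos \<theta>, cosh (t + Y_shift i) * sin \<theta>, Y_sign i * t])"

text \<open>The data of the explicit parametrization agree with the geometric description: the faces have
  the circle of radius \<open>c\<close> as common edge, and the prescribed outward conormals.\<close>

lemma Y_cos: "cos (Y_angle i) = (if i = 1 then sqrt 3 / 2 else if i = 2 then - sqrt 3 / 2 else 0)"
  and Y_sin: "sin (Y_angle i) = (if i = 3 then -1 else 1 / 2)"
proof -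
  have a2: "pi / 6 + 2 * pi / 3 = pi - pi / 6" and a3: "pi / 6 - 2 * pi / 3 = - (pi / 2)"
    by (simp_all add: field_simps)
  have c2: "cos (pi / 6 + 2 * pi / 3) = - sqrt 3 / 2" "sin (pi / 6 + 2 * pi / 3) = 1 / 2"
    unfolding a2 cos_pi_minus sin_pi_minus by (simp_all add: cos_30 sin_30)
  have c3: "cos (pi / 6 - 2 * pi / 3) = 0" "sin (pi / 6 - 2 * pi / 3) = -1"
    unfolding a3 by simp_all
  show "cos (Y_angle i) = (if i = 1 then sqrt 3 / 2 else if i = 2 then - sqrt 3 / 2 else 0)"
    unfolding Y_angle_def using c2 c3 by (auto simp only: cos_30 split: if_splits)
  show "sin (Y_angle i) = (if i = 3 then -1 else 1 / 2)"
    using exhaust_3[of i] c2 c3 sin_30 unfolding Y_angle_def by (elim disjE) (simp_all del: sin_30)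
qed

lemma tanh_Y_shift: "tanh (Y_shift i) = - cos (Y_angle i)"
proof -
  define x where "x = - cos (Y_angle i)"
  have "sqrt 3 < sqrt 4" by (intro real_sqrt_less_mono) simp
  then have x: "\<bar>x\<bar> < 1" unfolding x_def Y_cos by auto
  then have "exp (2 * artanh x) = (1 + x) / (1 - x)" by (auto simp: artanh_def abs_less_iff)
  then have e: "exp (- 2 * artanh x) = (1 - x) / (1 + x)" by (simp add: exp_minus)
  have "tanh (artanh x) = x"
    unfolding tanh_real_altdef e using x by (simp add: abs_less_iff divide_simps)
  then show ?thesis by (simp add: Y_shift_def x_def)
qed

lemma edge_Y_surface: "edge (Y_surface c i) = (\<lambda>\<theta>. c *\<^sub>R vector [cos \<theta>, sin \<theta>, 0])"
  by (rule ext) (simp add: edge_def Y_surface_def Y_scale_def vec_eq_iff forall_3)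

lemma has_vector_derivative_vector_3:
  fixes f g h :: "real \<Rightarrow> real"
  assumes "(f has_real_derivative f') (at x)" "(g has_real_derivative g') (at x)"
    "(h has_real_derivative h') (at x)"
  shows "((\<lambda>x. vector [f x, g x, h x] :: real^3) has_vector_derivative vector [f', g', h']) (at x)"
proof -
  have v: "(vector [a, b, c] :: real^3) = a *\<^sub>R axis 1 1 + b *\<^sub>R axis 2 1 + c *\<^sub>R axis 3 1" for a b c
    by (simp add: vec_eq_iff forall_3 axis_def)
  show ?thesis unfolding v
    using assms by (auto intro!: derivative_eq_intros simp: has_real_derivative_iff_has_vector_derivative)
qed

lemma pd_Y_surface:
  "pd 1 (Y_surface c i) (t, \<theta>) = Y_scale c i *\<^sub>R
     vector [sinh (t + Y_shift i) * cos \<theta>, sinh (t + Y_shift i) * sin \<theta>, Y_sign i]"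
  "pd 2 (Y_surface c i) (t, \<theta>) = Y_scale c i *\<^sub>R
     vector [- cosh (t + Y_shift i) * sin \<theta>, cosh (t + Y_shift i) * cos \<theta>, 0]"
proof -
  show "pd 1 (Y_surface c i) (t, \<theta>) = Y_scale c i *\<^sub>R
     vector [sinh (t + Y_shift i) * cos \<theta>, sinh (t + Y_shift i) * sin \<theta>, Y_sign i]"
    unfolding pd_def Y_surface_def
    by (auto intro!: vector_derivative_at derivative_eq_intros has_vector_derivative_vector_3
        has_vector_derivative_scaleR[OF DERIV_const, simplified])
  show "pd 2 (Y_surface c i) (t, \<theta>) = Y_scale c i *\<^sub>R
     vector [- cosh (t + Y_shift i) * sin \<theta>, cosh (t + Y_shift i) * cos \<theta>, 0]"
    unfolding pd_def Y_surface_def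
    by (auto intro!: vector_derivative_at derivative_eq_intros has_vector_derivative_vector_3
        has_vector_derivative_scaleR[OF DERIV_const, simplified])
qed

lemma Y_scale_pos: "c > 0 \<Longrightarrow> Y_scale c i > 0"
  by (simp add: Y_scale_def)

lemma edge_derivative:
  "vector_derivative (edge (Y_surface c i)) (at \<theta>) = c *\<^sub>R vector [- sin \<theta>, cos \<theta>, 0]"
  unfolding edge_Y_surface
  by (auto intro!: vector_derivative_at derivative_eq_intros has_vector_derivative_vector_3
      has_vector_derivative_scaleR[OF DERIV_const, simplified])

lemma norm_e_theta: "norm (vector [- sin \<theta>, cos \<theta>, 0] :: real^3) = 1"
  by (simp add: norm_eq_sqrt_inner inner_vec_def sum_3 flip: power2_eq_square)

lemma unit_tangent_Y:
  assumes "c > 0"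
  shows "unit_tangent (edge (Y_surface c i)) = (\<lambda>\<theta>. vector [- sin \<theta>, cos \<theta>, 0])"
  by (rule ext) (use assms in \<open>simp add: unit_tangent_def edge_derivative sgn_div_norm norm_e_theta\<close>)

lemma curvature_vector_Y:
  assumes "c > 0"
  shows "curvature_vector (edge (Y_surface c i)) \<theta> = - (1 / c) *\<^sub>R vector [cos \<theta>, sin \<theta>, 0]"
proof -
  have "vector_derivative (\<lambda>\<theta>. vector [- sin \<theta>, cos \<theta>, 0] :: real^3) (at \<theta>)
      = vector [- cos \<theta>, - sin \<theta>, 0]"
    by (auto intro!: vector_derivative_at derivative_eq_intros has_vector_derivative_vector_3)
  then show ?thesis
    using assms by (simp add: curvature_vector_def unit_tangent_Y edge_derivative norm_e_theta
        vec_eq_iff forall_3 divide_simps)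
qed

lemma conormal_Y:
  assumes "c > 0"
  shows "conormal (Y_surface c i) \<theta> =
    cos (Y_angle i) *\<^sub>R vector [cos \<theta>, sin \<theta>, 0] + sin (Y_angle i) *\<^sub>R vector [0, 0, 1]"
proof -
  define T where "T = Y_shift i"
  let ?v = "vector [sinh T * cos \<theta>, sinh T * sin \<theta>, Y_sign i] :: real^3"
  have orth: "?v \<bullet> vector [- sin \<theta>, cos \<theta>, 0] = 0"
    by (simp add: inner_vec_def sum_3)
  have "(sinh T * x)\<^sup>2 + (sinh T * y)\<^sup>2 = (sinh T)\<^sup>2" if "x\<^sup>2 + y\<^sup>2 = 1" for x y
    using that by algebra
  from this[of "cos \<theta>" "sin \<theta>"] have "?v \<bullet> ?v = (cosh T)\<^sup>2"
    by (simp add: inner_vec_def sum_3 Y_sign_def cosh_square_eq flip: power2_eq_square)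
  then have nv: "norm ?v = cosh T" by (simp add: norm_eq_sqrt_inner)
  have th: "sinh T / cosh T = - cos (Y_angle i)"
    using tanh_Y_shift[of i] by (simp add: T_def tanh_def)
  have "(1 / cosh T)\<^sup>2 = (sin (Y_angle i))\<^sup>2"
  proof -
    have "(1 / cosh T)\<^sup>2 = 1 - (sinh T / cosh T)\<^sup>2"
    proof -
      have "(cosh T)\<^sup>2 \<noteq> 0" "(cosh T)\<^sup>2 - (sinh T)\<^sup>2 = 1"
        using hyperbolic_pythagoras[of T] by simp_all
      then show ?thesis unfolding power_divide by (metis diff_divide_distrib divide_self power_one)
    qed
    then show ?thesis by (simp add: th sin_squared_eq)
  qed
  then have ab: "1 / cosh T = \<bar>sin (Y_angle i)\<bar>"
    by (metis abs_of_pos cosh_real_pos power2_eq_iff_nonneg abs_ge_zero power2_abs zero_less_divide_1_iff)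
  have "Y_sign i / cosh T = Y_sign i * \<bar>sin (Y_angle i)\<bar>" by (simp flip: ab)
  then have sn: "Y_sign i / cosh T = - sin (Y_angle i)"
    unfolding Y_sin Y_sign_def by (simp split: if_splits)
  have "conormal (Y_surface c i) \<theta> = - sgn (Y_scale c i *\<^sub>R ?v)"
    using orth by (simp add: conormal_def unit_tangent_Y assms pd_Y_surface T_def Let_def)
  also have "\<dots> = - (?v /\<^sub>R cosh T)"
    using Y_scale_pos[OF assms, of i] by (simp add: sgn_div_norm nv)
  also have "\<dots> = cos (Y_angle i) *\<^sub>R vector [cos \<theta>, sin \<theta>, 0] + sin (Y_angle i) *\<^sub>R vector [0, 0, 1]"
    using th sn by (simp add: vec_eq_iff forall_3 divide_simps)
  finally show ?thesis .
qed

end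

(*
In the parameters (t, theta) the index form of the face i is
  Q_i(f) = int f_t^2 + f_theta^2 - 2 sech^2(t + T_i) f^2 - tanh T_i int_Gamma f^2,
and the weak formulation says that f is, up to the edge, an indefinite integral of its weak derivatives.
On functions of mean zero in theta, Q_i is int (f_t + tanh(t + T_i) f)^2 + (int f_theta^2 - int f^2), which is nonnegative
by Wirtinger's inequality and vanishes only for f = sech(t + T_i) (a cos theta + b sin theta). What remains is the
radial Sturm-Liouville problem with solutions tanh s and 1 - s tanh s (s = t + T_i). Prescribing the zero of the radial part
of face 1 at s = 0 and a vanishing mean trace on face 3, Riccati substitution gives Q >= 0; hence the index is at most 2, and slowly
decaying cutoffs of the constants (a_1, a_2, a_3) with sum 0 make Q negative. A field in the null space has constant
Wronskians with both radial solutions; finite energy leaves K_i tanh s, the junction condition forces K_1 = K_2 = K_3, and the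
mean-zero part is in the equality case above, where the traces must add up to 0. This gives 1 + 2 * 2 dimensions.
*)
theory Submission
  imports Defs
begin

text \<open>The two constraints are dictated by the zero of \<open>tanh s\<close>. The Riccati
  comparison needs a positive solution; \<open>tanh s\<close> is one on face 2, where
  \<open>s >= T > 0\<close>, but its zero lies on the edge of face 3 and in the interior of face 1.
  Requiring the radial part to vanish exactly there restores the comparison, and what remains are
  edge terms of faces 1 and 2, which cancel with nothing to spare. The analytic obstacle is low
  regularity. Weak gradient and trace are arbitrary choices, known up to null sets, and a field of
  the nullity problem need not be square integrable. Wirtinger's inequality makes its mean-zero part
  square integrable; its radial part grows at most like the square root of \<open>t\<close>. That is
  tame enough against the exponentially decaying potential, and too slow for
  \<open>1 - s tanh s\<close>, which grows linearly. The Euler-Lagrange equation is never solved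
  classically: the Wronskians are obtained from weak tests, and the angular modes are read off from
  the equality cases of the inequalities behind the index bound.\<close>

lemmas L1_add = Bochner_Integration.integrable_add
lemmas L1_diff = Bochner_Integration.integrable_diff
lemmas LINT_add = Bochner_Integration.integral_add
lemmas LINT_diff = Bochner_Integration.integral_diff
lemmas L1_bound = Bochner_Integration.integrable_bound
lemmas LINT_cong = Bochner_Integration.integral_cong
lemmas L1_cong = Bochner_Integration.integrable_cong

section \<open>Absolutely continuous functions\<close>

text \<open>The density \<open>p\<close> is carried as data, because the functions met later have
  only weak derivatives, fixed up to null sets. For \<open>b < a\<close> both clauses are trivially
  true, so hypotheses may range over every real \<open>R\<close> in
  \<open>ac_on 0 R\<close>.\<close>

definition ac_on :: "real => real => (real => real) => (real => real) => bool" where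
 "ac_on a b u p \<longleftrightarrow> set_integrable lborel {a..b} p \<and> (\<forall>t\<in>{a..b}. u t = u a + (LINT s:{a..t}|lborel. p s))"

lemma ac_on_integrable: "ac_on a b u p ==> set_integrable lborel {a..b} p"
 by (simp add: ac_on_def)

lemma ac_onD: "ac_on a b u p ==> a \<le> t ==> t \<le> b ==> u t = u a + (LINT s:{a..t}|lborel. p s)"
 unfolding ac_on_def by (metis atLeastAtMost_iff)

lemma ac_onI:
 assumes "set_integrable lborel {a..b} p"
  "\<And>t. a \<le> t ==> t \<le> b ==> u t = u a + (LINT s:{a..t}|lborel. p s)"
 shows "ac_on a b u p"
 unfolding ac_on_def using assms(1) by (metis assms(2) atLeastAtMost_iff)

lemma ac_on_integrable_sub:
 "ac_on a b u p ==> a \<le> c ==> d \<le> b ==> set_integrable lborel {c..d} p"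
 by (rule set_integrable_subset[OF ac_on_integrable]) auto

lemma set_integrable_mult_continuous:
 fixes p w :: "real => real"
 assumes "set_integrable lborel {a..b} p" "continuous_on {a..b} w"
 shows "set_integrable lborel {a..b} (\<lambda>t. p t * w t)"
proof -
 obtain B where B: "\<And>t. t \<in> {a..b} ==> \<bar>w t\<bar> \<le> B"
  using compact_imp_bounded[OF compact_continuous_image[OF assms(2) compact_Icc]]
  by (force simp: bounded_iff)
 have m: "set_borel_measurable lborel {a..b} (\<lambda>t. p t * w t)"
 proof -
  have 1: "(\<lambda>t. indicator {a..b} t *\<^sub>R p t) \<in> borel_measurable borel"
   using assms(1) by (simp add: set_integrable_def borel_measurable_integrable)
  have 2: "(\<lambda>t. indicator {a..b} t *\<^sub>R w t) \<in> borel_measurable borel"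
   by (rule borel_measurable_continuous_on_indicator[OF _ assms(2)]) simp
  have "(\<lambda>t. (indicator {a..b} t *\<^sub>R p t) * (indicator {a..b} t *\<^sub>R w t)) \<in> borel_measurable borel"
   using 1 2 by measurable
  moreover have "(\<lambda>t. (indicator {a..b} t *\<^sub>R p t) * (indicator {a..b} t *\<^sub>R w t)) = (\<lambda>t. indicator {a..b} t *\<^sub>R (p t * w t))"
   by (auto simp: indicator_def)
  ultimately show ?thesis by (simp add: set_borel_measurable_def)
 qed
 show ?thesis
 proof (rule set_integrable_bound[OF set_integrable_mult_left[of B, OF set_integrable_abs[OF assms(1)]] m])
  show "AE x in lborel. x \<in> {a..b} \<longrightarrow> norm (p x * w x) \<le> norm (\<bar>p x\<bar> * B)"
   using B by (auto simp: abs_mult intro!: AE_I2 mult_left_mono order_trans[OF B abs_ge_self])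
 qed
qed

lemma ac_on_continuous: assumes "ac_on a b u p" shows "continuous_on {a..b} u"
proof -
 note i = ac_on_integrable[OF assms]
 have "p integrable_on {a..b}" by (rule set_borel_integral_eq_integral(1)[OF i])
 then have "continuous_on {a..b} (\<lambda>t. u a + integral {a..t} p)"
  by (intro continuous_intros indefinite_integral_continuous_1)
 moreover have "u a + integral {a..t} p = u t" if "t \<in> {a..b}" for t
  using ac_onD[OF assms, of t] that
   set_borel_integral_eq_integral(2)[OF set_integrable_subset[OF i, of "{a..t}"]] by simp
 ultimately show ?thesis by (rule continuous_on_eq)
qed

lemma ac_on_FTC: "ac_on a b u p ==> a \<le> b ==> (LINT s:{a..b}|lborel. p s) = u b - u a"
 using ac_onD[of a b u p b] by simp

lemma set_integral_Icc_split:
 fixes p :: "real => real"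
 assumes "set_integrable lborel {a..c} p" "a \<le> b" "b \<le> c"
 shows "(LINT s:{a..c}|lborel. p s) = (LINT s:{a..b}|lborel. p s) + (LINT s:{b..c}|lborel. p s)"
proof -
 have e: "{a..c} = {a..b} \<union> {b..c}" using assms by auto
 have "AE x in lborel. \<not> (x \<in> {a..b} \<and> x \<in> {b..c})"
  by (rule AE_mp[OF AE_lborel_singleton[of b]]) (auto intro!: AE_I2)
 moreover have "set_integrable lborel {a..b} p" "set_integrable lborel {b..c} p"
  by (rule set_integrable_subset[OF assms(1)]; use assms in auto)+
 ultimately show ?thesis unfolding e
  by (intro set_integral_Un_AE) auto
qed

lemma ac_on_subinterval:
 assumes u: "ac_on a b u p" and c: "a \<le> c" "d \<le> b"
 shows "ac_on c d u p"
proof (rule ac_onI)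
 show "set_integrable lborel {c..d} p" using ac_on_integrable_sub[OF u c] .
 fix t assume t: "c \<le> t" "t \<le> d"
 have i: "set_integrable lborel {a..t} p" using ac_on_integrable_sub[OF u] t c by simp
 from set_integral_Icc_split[OF this, of c] t c ac_onD[OF u, of c] ac_onD[OF u, of t]
 show "u t = u c + (LINT s:{c..t}|lborel. p s)" by linarith
qed

lemma ac_on_C1:
 assumes "\<And>t. t \<in> {a..b} ==> (u has_real_derivative u' t) (at t)" "continuous_on {a..b} u'"
 shows "ac_on a b u u'"
 unfolding ac_on_def
proof
 show i: "set_integrable lborel {a..b} u'"
  unfolding set_integrable_def by (rule borel_integrable_compact) (use assms in auto)
 show "\<forall>t\<in>{a..b}. u t = u a + (LINT s:{a..t}|lborel. u' s)"
 proof
  fix t assume t: "t \<in> {a..b}"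
  have d: "(u has_vector_derivative u' x) (at x within {a..t})" if "a \<le> x" "x \<le> t" for x
   by (rule has_vector_derivative_at_within)
     (use assms(1)[of x] t that in \<open>simp add: has_real_derivative_iff_has_vector_derivative\<close>)
  have "continuous_on {a..t} u'" by (rule continuous_on_subset[OF assms(2)]) (use t in auto)
  from integral_FTC_atLeastAtMost[OF _ d this] t
  have "(LINT s:{a..t}|lborel. u' s) = u t - u a"
   by (simp add: set_lebesgue_integral_def)
  then show "u t = u a + (LINT s:{a..t}|lborel. u' s)" by simp
 qed
qed

lemma ac_on_add:
 assumes u: "ac_on a b u p" and w: "ac_on a b w q"
 shows "ac_on a b (\<lambda>t. u t + w t) (\<lambda>t. p t + q t)"
proof (rule ac_onI)
 show "set_integrable lborel {a..b} (\<lambda>t. p t + q t)"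
  by (rule set_integral_add(1)[OF ac_on_integrable[OF u] ac_on_integrable[OF w]])
 fix t assume t: "a \<le> t" "t \<le> b"
 have "set_integrable lborel {a..t} p" "set_integrable lborel {a..t} q"
  using ac_on_integrable_sub[OF u] ac_on_integrable_sub[OF w] t by auto
 from set_integral_add(2)[OF this] ac_onD[OF u t] ac_onD[OF w t]
 show "u t + w t = u a + w a + (LINT s:{a..t}|lborel. p s + q s)" by linarith
qed

lemma ac_on_cmult:
 assumes u: "ac_on a b u p" shows "ac_on a b (\<lambda>t. c * u t) (\<lambda>t. c * p t)"
proof (rule ac_onI)
 show "set_integrable lborel {a..b} (\<lambda>t. c * p t)" using ac_on_integrable[OF u] by simp
 fix t assume t: "a \<le> t" "t \<le> b"
 show "c * u t = c * u a + (LINT s:{a..t}|lborel. c * p s)"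
  unfolding ac_onD[OF u t] by (simp add: distrib_left)
qed

lemma ac_on_const: "ac_on a b (\<lambda>t. c) (\<lambda>t. 0)"
 by (simp add: ac_on_def set_integrable_def)

lemma ac_on_diff: "ac_on a b u p ==> ac_on a b w q ==> ac_on a b (\<lambda>t. u t - w t) (\<lambda>t. p t - q t)"
 using ac_on_add[of a b u p "\<lambda>t. (-1) * w t" "\<lambda>t. (-1) * q t"] ac_on_cmult[of a b w q "-1"] by simp

lemma set_integral_Icc_self:
 fixes a :: real and p :: "real => real"
 shows "(LINT s:{a}|lborel. p s) = 0"
 unfolding set_lebesgue_integral_def
 by (rule integral_eq_zero_AE, rule AE_mp[OF AE_lborel_singleton[of a]]) (auto simp: indicator_def intro!: AE_I2)

text \<open>Fubini on the square: the product of the two integrals is the integral of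
  \<open>p x * q y\<close> over the square on \<open>{a..b}\<close>, and the diagonal cuts it into
  two triangles, whose iterated integrals are the two summands on the left.\<close>

lemma ac_on_mult_aux:
 fixes p q :: "real => real"
 assumes ab: "a \<le> b" and p: "set_integrable lborel {a..b} p" and q: "set_integrable lborel {a..b} q"
 shows "(LINT t:{a..b}|lborel. p t * (LINT s:{a..t}|lborel. q s) + (LINT s:{a..t}|lborel. p s) * q t)
   = (LINT t:{a..b}|lborel. p t) * (LINT t:{a..b}|lborel. q t)"
proof -
 let ?p = "\<lambda>t. indicator {a..b} t * p t" and ?q = "\<lambda>t. indicator {a..b} t * q t"
 have ip: "integrable lborel ?p" "integrable lborel ?q"
  using p q unfolding set_integrable_def real_scaleR_def by auto
 note [measurable] = borel_measurable_integrable[OF ip(1)] borel_measurable_integrable[OF ip(2)]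
 have I: "integrable (lborel \<Otimes>\<^sub>M lborel) (\<lambda>(x,y). ?p x * ?q y)"
 proof (rule lborel_pair.Fubini_integrable)
  show "(\<lambda>(x,y). ?p x * ?q y) \<in> borel_measurable (lborel \<Otimes>\<^sub>M lborel)" by measurable
  have "integrable lborel (\<lambda>x. \<bar>?p x\<bar> * (LINT y|lborel. \<bar>?q y\<bar>))"
   by (intro integrable_mult_left integrable_abs ip)
  then show "integrable lborel (\<lambda>x. LINT y|lborel. norm (case (x, y) of (x, y) => ?p x * ?q y))"
   by (simp add: abs_mult flip: integral_mult_right_zero)
  show "AE x in lborel. integrable lborel (\<lambda>y. case (x, y) of (x, y) => ?p x * ?q y)"
   using ip by (auto intro!: AE_I2)
 qed
 let ?A = "\<lambda>x y::real. of_bool (y \<le> x) :: real" and ?B = "\<lambda>x y::real. of_bool (x < y) :: real"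
 have IA: "integrable (lborel \<Otimes>\<^sub>M lborel) (\<lambda>(x,y). ?A x y * (?p x * ?q y))"
  by (rule L1_bound[OF I]) (auto intro!: AE_I2 simp: split_beta abs_mult)
 have IB: "integrable (lborel \<Otimes>\<^sub>M lborel) (\<lambda>(x,y). ?B x y * (?p x * ?q y))"
  by (rule L1_bound[OF I]) (auto intro!: AE_I2 simp: split_beta abs_mult)
 have tot: "(LINT t:{a..b}|lborel. p t) * (LINT t:{a..b}|lborel. q t)
   = integral\<^sup>L (lborel \<Otimes>\<^sub>M lborel) (\<lambda>(x,y). ?p x * ?q y)"
  using lborel_pair.integral_fst[OF I] by (simp add: set_lebesgue_integral_def)
 also have "... = integral\<^sup>L (lborel \<Otimes>\<^sub>M lborel) (\<lambda>(x,y). ?A x y * (?p x * ?q y))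
   + integral\<^sup>L (lborel \<Otimes>\<^sub>M lborel) (\<lambda>(x,y). ?B x y * (?p x * ?q y))"
  by (subst LINT_add[OF IA IB, symmetric])
    (auto intro!: LINT_cong simp: split_beta)
 also have "integral\<^sup>L (lborel \<Otimes>\<^sub>M lborel) (\<lambda>(x,y). ?A x y * (?p x * ?q y))
   = (LINT x|lborel. LINT y|lborel. ?A x y * (?p x * ?q y))"
  using lborel_pair.integral_fst[OF IA] by simp
 also have "... = (LINT x|lborel. ?p x * (LINT y:{a..x}|lborel. q y))"
 proof (rule LINT_cong[OF refl])
  fix x
  have "(LINT y|lborel. ?A x y * (?p x * ?q y)) = (LINT y|lborel. ?p x * (indicator {a..x} y * q y))"
   by (rule LINT_cong) (auto simp: indicator_def)
  then show "(LINT y|lborel. ?A x y * (?p x * ?q y)) = ?p x * (LINT y:{a..x}|lborel. q y)"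
   by (simp add: set_lebesgue_integral_def)
 qed
 also have "integral\<^sup>L (lborel \<Otimes>\<^sub>M lborel) (\<lambda>(x,y). ?B x y * (?p x * ?q y))
   = (LINT y|lborel. LINT x|lborel. ?B x y * (?p x * ?q y))"
  using lborel_pair.integral_snd[OF IB] by simp
 also have "... = (LINT y|lborel. ?q y * (LINT x:{a..y}|lborel. p x))"
 proof (rule LINT_cong[OF refl])
  fix y
  have "(LINT x|lborel. ?B x y * (?p x * ?q y)) = (LINT x|lborel. ?q y * (indicator {a..y} x * ?p x))"
  proof (rule integral_cong_AE)
   \<comment> \<open>The open condition \<open>x < y\<close> and the closed interval
     \<open>{a..y}\<close> differ only in the single point \<open>x = y\<close>.\<close>
   show "AE x in lborel. ?B x y * (?p x * ?q y) = ?q y * (indicator {a..y} x * ?p x)"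
    by (rule AE_mp[OF AE_lborel_singleton[of y] AE_I2]) (auto simp: indicator_def)
  qed simp_all
  also have "(\<lambda>x. ?q y * (indicator {a..y} x * ?p x)) = (\<lambda>x. ?q y * (indicator {a..y} x * p x))"
   by (auto simp: indicator_def fun_eq_iff)
  finally have "(LINT x|lborel. ?B x y * (?p x * ?q y)) = (LINT x|lborel. ?q y * (indicator {a..y} x * p x))" .
  then show "(LINT x|lborel. ?B x y * (?p x * ?q y)) = ?q y * (LINT x:{a..y}|lborel. p x)"
   by (simp add: set_lebesgue_integral_def)
 qed
 finally have "(LINT t:{a..b}|lborel. p t) * (LINT t:{a..b}|lborel. q t)
  = (LINT x|lborel. ?p x * (LINT y:{a..x}|lborel. q y)) + (LINT y|lborel. ?q y * (LINT x:{a..y}|lborel. p x))" .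
 also have "... = (LINT t:{a..b}|lborel. p t * (LINT s:{a..t}|lborel. q s))
   + (LINT t:{a..b}|lborel. (LINT s:{a..t}|lborel. p s) * q t)"
  unfolding set_lebesgue_integral_def
  by (intro arg_cong2[where f="(+)"] LINT_cong) (auto simp: mult_ac)
 also have "... = (LINT t:{a..b}|lborel. p t * (LINT s:{a..t}|lborel. q s) + (LINT s:{a..t}|lborel. p s) * q t)"
 proof (rule set_integral_add(2)[symmetric])
  have "ac_on a b (\<lambda>t. LINT s:{a..t}|lborel. q s) q" "ac_on a b (\<lambda>t. LINT s:{a..t}|lborel. p s) p"
   using p q by (auto intro!: ac_onI simp: set_integral_Icc_self)
  note c = this[THEN ac_on_continuous]
  show "set_integrable lborel {a..b} (\<lambda>t. p t * (LINT s:{a..t}|lborel. q s))"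
   "set_integrable lborel {a..b} (\<lambda>t. (LINT s:{a..t}|lborel. p s) * q t)"
   using set_integrable_mult_continuous[OF p c(1)] set_integrable_mult_continuous[OF q c(2)]
   by (simp_all add: mult.commute)
 qed
 finally show ?thesis ..
qed

text \<open>Subtracting the initial values reduces the product rule to functions that vanish at
  \<open>a\<close>, which is \<open>ac_on_mult_aux\<close>; applied on every \<open>{a..c}\<close>,
  it exhibits the product as an indefinite integral.\<close>

lemma ac_on_mult:
 assumes u: "ac_on a b u p" and w: "ac_on a b w q"
 shows "ac_on a b (\<lambda>t. u t * w t) (\<lambda>t. p t * w t + u t * q t)"
 unfolding ac_on_def
proof
 note iu = ac_on_integrable[OF u] and iw = ac_on_integrable[OF w]
 note cu = ac_on_continuous[OF u] and cw = ac_on_continuous[OF w]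
 show "set_integrable lborel {a..b} (\<lambda>t. p t * w t + u t * q t)"
  using set_integrable_mult_continuous[OF iu cw] set_integrable_mult_continuous[OF iw cu]
  by (intro set_integral_add(1)) (auto simp: mult.commute)
 show "\<forall>t\<in>{a..b}. u t * w t = u a * w a + (LINT s:{a..t}|lborel. p s * w s + u s * q s)"
 proof
  fix c assume c: "c \<in> {a..b}"
  have u': "ac_on a c u p" and w': "ac_on a c w q"
   using ac_on_subinterval[OF u, of a c] ac_on_subinterval[OF w, of a c] c by auto
  let ?P = "\<lambda>t. LINT s:{a..t}|lborel. p s" and ?Q = "\<lambda>t. LINT s:{a..t}|lborel. q s"
  have ut: "u t = u a + ?P t" and wt: "w t = w a + ?Q t" if "t \<in> {a..c}" for t
   using that by (auto intro!: ac_onD[OF u'] ac_onD[OF w'])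
  note iu = ac_on_integrable[OF u'] and iw = ac_on_integrable[OF w']
  have cP: "continuous_on {a..c} ?P" "continuous_on {a..c} ?Q"
  proof -
   have "continuous_on {a..c} (\<lambda>t. u t - u a)" "continuous_on {a..c} (\<lambda>t. w t - w a)"
    using ac_on_continuous[OF u'] ac_on_continuous[OF w'] by (auto intro!: continuous_intros)
   then show "continuous_on {a..c} ?P" "continuous_on {a..c} ?Q"
    by - (erule continuous_on_eq, simp only: ut wt add_diff_cancel_left')+
  qed
  have "(LINT s:{a..c}|lborel. p s * w s + u s * q s)
    = (LINT s:{a..c}|lborel. (w a * p s + u a * q s) + (p s * ?Q s + ?P s * q s))"
  proof (rule set_lebesgue_integral_cong, simp, intro allI impI)
   fix x assume "x \<in> {a..c}"
   from ut[OF this] wt[OF this]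
   show "p x * w x + u x * q x = (w a * p x + u a * q x) + (p x * ?Q x + ?P x * q x)"
    by algebra
  qed
  also have "... = (w a * ?P c + u a * ?Q c) + ?P c * ?Q c"
  proof -
   have i1: "set_integrable lborel {a..c} (\<lambda>s. w a * p s)" "set_integrable lborel {a..c} (\<lambda>s. u a * q s)"
    using iu iw by auto
   have i2: "set_integrable lborel {a..c} (\<lambda>s. p s * ?Q s)" "set_integrable lborel {a..c} (\<lambda>s. ?P s * q s)"
    using set_integrable_mult_continuous[OF iu cP(2)] set_integrable_mult_continuous[OF iw cP(1)]
    by (simp_all add: mult.commute)
   have ac: "a \<le> c" using c by simp
   show ?thesis
    unfolding set_integral_add(2)[OF set_integral_add(1)[OF i1] set_integral_add(1)[OF i2]]
     set_integral_add(2)[OF i1] ac_on_mult_aux[OF ac iu iw] by simp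
  qed
  also have "... = u c * w c - u a * w a"
   using ut[of c] wt[of c] c by (simp add: algebra_simps)
  finally show "u c * w c = u a * w a + (LINT s:{a..c}|lborel. p s * w s + u s * q s)" by simp
 qed
qed

section \<open>Riccati and Wirtinger inequalities\<close>

lemma ac_on_cong:
 assumes "ac_on a b u p" "\<And>t. a \<le> t ==> t \<le> b ==> u t = u' t" "\<And>t. a \<le> t ==> t \<le> b ==> p t = p' t"
 shows "ac_on a b u' p'"
proof (rule ac_onI)
 have "set_integrable lborel {a..b} p' = set_integrable lborel {a..b} p"
  by (rule set_integrable_cong) (use assms(3) in auto)
 then show "set_integrable lborel {a..b} p'" using ac_on_integrable[OF assms(1)] by simp
 fix t assume t: "a \<le> t" "t \<le> b"
 have "(LINT s:{a..t}|lborel. p' s) = (LINT s:{a..t}|lborel. p s)"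
  by (rule set_lebesgue_integral_cong) (use assms(3) t in auto)
 then show "u' t = u' a + (LINT s:{a..t}|lborel. p' s)"
  using ac_onD[OF assms(1) t] assms(2)[of t] assms(2)[of a] t by simp
qed

lemma set_integrable_continuous_Icc:
 fixes f :: "real => real"
 shows "continuous_on {a..b} f ==> set_integrable lborel {a..b} f"
 unfolding set_integrable_def by (rule borel_integrable_compact) auto

text \<open>Completing the square: the cross term of \<open>(g - v u)^2\<close>, together with the
  term in \<open>v' u^2\<close>, is up to sign the derivative of \<open>v u^2\<close> and integrates
  to boundary values. For \<open>v = w'/w\<close> with a positive solution of
  \<open>w'' + q w = 0\<close> the coefficient \<open>v' + v^2\<close> equals \<open>- q\<close>,
  which turns the identity into a lower bound for the integral of
  \<open>g^2 - q u^2\<close>.\<close>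

lemma riccati_identity:
 assumes ab: "a \<le> b" and u: "ac_on a b u g" and g2: "set_integrable lborel {a..b} (\<lambda>t. (g t)^2)"
  and v: "\<And>t. t \<in> {a..b} ==> (v has_real_derivative v' t) (at t)" and v': "continuous_on {a..b} v'"
 shows "set_integrable lborel {a..b} (\<lambda>t. (g t - v t * u t)^2)"
  and "(LINT t:{a..b}|lborel. (g t - v t * u t)^2)
   = (LINT t:{a..b}|lborel. (g t)^2) + (LINT t:{a..b}|lborel. (v' t + (v t)^2) * (u t)^2)
    - (v b * (u b)^2 - v a * (u a)^2)"
proof -
 have cu: "continuous_on {a..b} u" by (rule ac_on_continuous[OF u])
 have cv: "continuous_on {a..b} v"
  using v by (meson DERIV_isCont continuous_at_imp_continuous_on)
 have acv: "ac_on a b v v'" using ac_on_C1[OF v v'] by blast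
 have y: "ac_on a b (\<lambda>t. v t * (u t * u t)) (\<lambda>t. v' t * (u t * u t) + v t * (g t * u t + u t * g t))"
  by (rule ac_on_mult[OF acv ac_on_mult[OF u u]])
 note iy = ac_on_integrable[OF y] and ey = ac_on_FTC[OF y ab]
 have i2: "set_integrable lborel {a..b} (\<lambda>t. (v' t + (v t)^2) * (u t)^2)"
  by (intro set_integrable_continuous_Icc continuous_intros cu cv v')
 have eq: "(g t - v t * u t)^2 = ((g t)^2 + (v' t + (v t)^2) * (u t)^2)
   - (v' t * (u t * u t) + v t * (g t * u t + u t * g t))" for t
  by algebra
 show "set_integrable lborel {a..b} (\<lambda>t. (g t - v t * u t)^2)"
  unfolding eq by (intro set_integral_diff(1) set_integral_add(1) g2 i2 iy)
 show "(LINT t:{a..b}|lborel. (g t - v t * u t)^2)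
   = (LINT t:{a..b}|lborel. (g t)^2) + (LINT t:{a..b}|lborel. (v' t + (v t)^2) * (u t)^2)
    - (v b * (u b)^2 - v a * (u a)^2)"
  unfolding eq set_integral_diff(2)[OF set_integral_add(1)[OF g2 i2] iy] set_integral_add(2)[OF g2 i2] ey
  by (simp add: power2_eq_square)
qed

lemma riccati_inequality:
 assumes "a \<le> b" "ac_on a b u g" "set_integrable lborel {a..b} (\<lambda>t. (g t)^2)"
  "\<And>t. t \<in> {a..b} ==> (v has_real_derivative v' t) (at t)" "continuous_on {a..b} v'"
 shows "v b * (u b)^2 - v a * (u a)^2
  \<le> (LINT t:{a..b}|lborel. (g t)^2) + (LINT t:{a..b}|lborel. (v' t + (v t)^2) * (u t)^2)"
proof -
 have "0 \<le> (LINT t:{a..b}|lborel. (g t - v t * u t)^2)"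
  unfolding set_lebesgue_integral_def by (rule integral_nonneg_AE) (auto intro!: AE_I2)
 with riccati_identity(2)[OF assms] show ?thesis by linarith
qed

text \<open>\<open>v = - \<beta> tan (\<beta> (x - m))\<close> is a Riccati solution with
  \<open>v' + v^2 = - \<beta>^2\<close>. The strict inequality \<open>\<beta> < 1\<close> keeps the
  argument of \<open>tan\<close> away from its poles on points within distance pi/2 of
  \<open>m\<close>, so that intervals of the critical length pi are allowed.\<close>

lemma tan_inequality:
 assumes ab: "a \<le> b" and u: "ac_on a b u g" and g2: "set_integrable lborel {a..b} (\<lambda>t. (g t)^2)"
  and \<beta>: "0 < \<beta>" "\<beta> < 1" and m: "m - pi / 2 \<le> a" "b \<le> m + pi / 2"
 shows "\<beta>^2 * (LINT t:{a..b}|lborel. (u t)^2) \<le> (LINT t:{a..b}|lborel. (g t)^2)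
  + \<beta> * tan (\<beta> * (b - m)) * (u b)^2 - \<beta> * tan (\<beta> * (a - m)) * (u a)^2"
proof -
 define v where "v x = - \<beta> * tan (\<beta> * (x - m))" for x
 define v' where "v' x = - \<beta>\<^sup>2 * (1 + (tan (\<beta> * (x - m)))^2)" for x
 have c: "cos (\<beta> * (x - m)) > 0" if "x \<in> {a..b}" for x
 proof (rule cos_gt_zero_pi)
  have x: "\<bar>x - m\<bar> \<le> pi / 2" using that m unfolding atLeastAtMost_iff by linarith
  have "\<bar>\<beta> * (x - m)\<bar> \<le> \<beta> * (pi / 2)" using x \<beta> by (simp add: abs_mult mult_left_mono)
  also have "... < pi / 2" using \<beta> by simp
  finally have "\<bar>\<beta> * (x - m)\<bar> < pi / 2" .
  then show "- (pi / 2) < \<beta> * (x - m)" "\<beta> * (x - m) < pi / 2" by linarith+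
 qed
 have v: "(v has_real_derivative v' x) (at x)" if "x \<in> {a..b}" for x
 proof -
  have "cos (\<beta> * (x - m)) \<noteq> 0" using c[OF that] by simp
  then have "(v has_real_derivative - \<beta> * (inverse ((cos (\<beta> * (x - m)))^2) * \<beta>)) (at x)"
   unfolding v_def by (auto intro!: derivative_eq_intros)
  moreover have "inverse ((cos (\<beta> * (x - m)))^2) = 1 + (tan (\<beta> * (x - m)))^2"
   using \<open>cos (\<beta> * (x - m)) \<noteq> 0\<close> by (simp add: tan_sec power_inverse)
  ultimately show ?thesis by (simp add: v'_def power2_eq_square algebra_simps)
 qed
 have "continuous_on {a..b} v'"
  unfolding v'_def using c by (intro continuous_intros) (auto simp: less_le)
 from riccati_inequality[OF ab u g2 v this]
 have "v b * (u b)^2 - v a * (u a)^2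
   \<le> (LINT t:{a..b}|lborel. (g t)^2) + (LINT t:{a..b}|lborel. (v' t + (v t)^2) * (u t)^2)" .
 also have "(\<lambda>t. (v' t + (v t)^2) * (u t)^2) = (\<lambda>t. (- \<beta>\<^sup>2) * (u t)^2)"
  by (auto simp: v'_def v_def algebra_simps power2_eq_square)
 finally show ?thesis unfolding set_integral_mult_right by (simp add: v_def)
qed

text \<open>Two antipodal points with a common value \<open>c\<close> cut the circle into two arcs
  of length pi, and \<open>w - c\<close> vanishes at the ends of both. On each arc the Dirichlet
  inequality holds with any constant \<open>\<beta>^2 < 1\<close>, and the constant is let tend to 1
  at the end.\<close>

lemma wirtinger_aux:
 assumes w: "ac_on 0 (2*pi) w h" and h2: "set_integrable lborel {0..2*pi} (\<lambda>t. (h t)^2)"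
  and per: "w 0 = w (2*pi)"
 obtains c where "(LINT t:{0..2*pi}|lborel. (w t - c)^2) \<le> (LINT t:{0..2*pi}|lborel. (h t)^2)"
proof -
 have cw: "continuous_on {0..2*pi} w" by (rule ac_on_continuous[OF w])
 \<comment> \<open>\<open>w (x + pi) - w x\<close> takes opposite values at \<open>0\<close> and
   \<open>pi\<close> because \<open>w\<close> closes up, so the intermediate value theorem yields
   the antipodal pair.\<close>
 have "\<exists>x\<ge>0. x \<le> pi \<and> w (x + pi) - w x = 0"
 proof (cases "w pi - w 0 \<ge> 0")
  case True
  have "continuous_on {0..pi} (\<lambda>x. w (x + pi) - w x)"
   by (intro continuous_intros continuous_on_subset[OF cw] continuous_on_compose2[OF cw]) auto
  from IVT2'[OF _ _ _ this, of 0] True per show ?thesis by auto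
 next
  case False
  have "continuous_on {0..pi} (\<lambda>x. w (x + pi) - w x)"
   by (intro continuous_intros continuous_on_subset[OF cw] continuous_on_compose2[OF cw]) auto
  from IVT'[OF _ _ _ this, of 0] False per show ?thesis by auto
 qed
 then obtain x where x: "0 \<le> x" "x \<le> pi" "w (x + pi) = w x" by auto
 define c where "c = w x"
 define u where "u t = w t - c" for t
 have u: "ac_on 0 (2*pi) u h"
  using ac_on_diff[OF w ac_on_const[of 0 "2*pi" c]] by (simp add: u_def[abs_def])
 have ux: "u x = 0" "u (x + pi) = 0" "u (2*pi) = u 0" using x per by (auto simp: u_def c_def)
 have cu: "continuous_on {0..2*pi} u" by (rule ac_on_continuous[OF u])
 have u2: "set_integrable lborel {0..2*pi} (\<lambda>t. (u t)^2)"
  by (intro set_integrable_continuous_Icc continuous_intros cu)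
 have split: "(LINT t:{0..2*pi}|lborel. f t) = (LINT t:{0..x}|lborel. f t)
   + (LINT t:{x..x+pi}|lborel. f t) + (LINT t:{x+pi..2*pi}|lborel. f t)"
  if "set_integrable lborel {0..2*pi} f" for f :: "real => real"
  using set_integral_Icc_split[OF that, of "x + pi"]
   set_integral_Icc_split[OF set_integrable_subset[OF that, of "{0..x+pi}"], of x] x by simp
 have key: "z * (LINT t:{0..2*pi}|lborel. (u t)^2) \<le> (LINT t:{0..2*pi}|lborel. (h t)^2)"
  if z: "0 < z" "z < 1" for z
 proof -
  define \<beta> where "\<beta> = sqrt z"
  have \<beta>: "0 < \<beta>" "\<beta> < 1" "\<beta>^2 = z" using z by (auto simp: \<beta>_def)
  have s: "ac_on 0 x u h" "ac_on x (x+pi) u h" "ac_on (x+pi) (2*pi) u h"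
   by (rule ac_on_subinterval[OF u]; use x in simp)+
  have s2: "set_integrable lborel {0..x} (\<lambda>t. (h t)^2)" "set_integrable lborel {x..x+pi} (\<lambda>t. (h t)^2)"
   "set_integrable lborel {x+pi..2*pi} (\<lambda>t. (h t)^2)"
   by (rule set_integrable_subset[OF h2]; use x in auto)+
  \<comment> \<open>One of the arcs passes through the seam and is treated as two pieces, whose
    centres \<open>x - pi/2\<close> and \<open>x + 3 pi/2\<close> agree modulo \<open>2 pi\<close>;
    hence their \<open>tan\<close> terms at \<open>0\<close> and at \<open>2 pi\<close> cancel in
    the sum.\<close>
  have 1: "z * (LINT t:{0..x}|lborel. (u t)^2) \<le> (LINT t:{0..x}|lborel. (h t)^2)
    - \<beta> * tan (\<beta> * (pi / 2 - x)) * (u 0)^2"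
   using tan_inequality[OF x(1) s(1) s2(1) \<beta>(1,2), of "x - pi/2"] x ux \<beta>(3) by (simp add: algebra_simps)
  have 2: "z * (LINT t:{x..x+pi}|lborel. (u t)^2) \<le> (LINT t:{x..x+pi}|lborel. (h t)^2)"
   using tan_inequality[OF _ s(2) s2(2) \<beta>(1,2), of "x + pi/2"] x ux \<beta>(3) by simp
  have 3: "z * (LINT t:{x+pi..2*pi}|lborel. (u t)^2) \<le> (LINT t:{x+pi..2*pi}|lborel. (h t)^2)
    + \<beta> * tan (\<beta> * (pi / 2 - x)) * (u 0)^2"
   using tan_inequality[OF _ s(3) s2(3) \<beta>(1,2), of "x + 3 * pi/2"] x ux \<beta>(3) by (simp add: algebra_simps)
  show ?thesis unfolding split[OF u2] split[OF h2] using 1 2 3 by (simp add: distrib_left)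
 qed
 from field_le_mult_one_interval[OF key]
 show ?thesis by (intro that[of c]) (simp add: u_def)
qed

text \<open>For mean zero, the integral of \<open>(w - c)^2\<close> exceeds that of
  \<open>w^2\<close> by that of \<open>c^2\<close>, so the unknown constant supplied by
  \<open>wirtinger_aux\<close> only helps.\<close>

lemma wirtinger:
 assumes w: "ac_on 0 (2*pi) w h" and h2: "set_integrable lborel {0..2*pi} (\<lambda>t. (h t)^2)"
  and per: "w 0 = w (2*pi)" and mean: "(LINT t:{0..2*pi}|lborel. w t) = 0"
 shows "(LINT t:{0..2*pi}|lborel. (w t)^2) \<le> (LINT t:{0..2*pi}|lborel. (h t)^2)"
proof -
 obtain c where c: "(LINT t:{0..2*pi}|lborel. (w t - c)^2) \<le> (LINT t:{0..2*pi}|lborel. (h t)^2)"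
  using wirtinger_aux[OF w h2 per] .
 have cw: "continuous_on {0..2*pi} w" by (rule ac_on_continuous[OF w])
 have i: "set_integrable lborel {0..2*pi} (\<lambda>t. (w t)^2)" "set_integrable lborel {0..2*pi} (\<lambda>t. (2 * c) * w t)"
   "set_integrable lborel {0..2*pi} (\<lambda>t. c^2)"
  by (intro set_integrable_continuous_Icc continuous_intros cw)+
 have eq: "(w t - c)^2 = ((w t)^2 - (2 * c) * w t) + c^2" for t by algebra
 have "(LINT t:{0..2*pi}|lborel. (w t - c)^2) = (LINT t:{0..2*pi}|lborel. (w t)^2) - 2 * c * 0
   + (LINT t:{0..2*pi}|lborel. c^2)"
  unfolding eq set_integral_add(2)[OF set_integral_diff(1)[OF i(1,2)] i(3)] set_integral_diff(2)[OF i(1,2)]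
   set_integral_mult_right mean by simp
 moreover have "(LINT t:{0..2*pi}|lborel. c^2) \<ge> 0"
  unfolding set_lebesgue_integral_def by (rule integral_nonneg_AE) (auto intro!: AE_I2)
 ultimately show ?thesis using c by simp
qed

lemma continuous_nonneg_integral_zero:
 fixes f :: "real => real"
 assumes "continuous_on {a..b} f" "\<And>x. x \<in> {a..b} ==> f x \<ge> 0" "(LINT t:{a..b}|lborel. f t) = 0" "a < b" "x \<in> {a..b}"
 shows "f x = 0"
proof -
 have i: "set_integrable lborel {a..b} f" by (rule set_integrable_continuous_Icc[OF assms(1)])
 have "(f has_integral 0) (cbox a b)"
  using has_integral_set_lebesgue[of "{a..b}" f] set_borel_integral_eq_integral[OF i] assms(3)
  by (simp add: has_integral_iff)
 then show ?thesis
  using has_integral_0_cbox_imp_0[of a b f x] assms by (simp add: box_real)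
qed

text \<open>In the equality case the Euler--Lagrange equation is tested against the solution \<open>k\<close> of
 \<open>k'' + k = w - a cos - b sin\<close>, which is periodic because the right-hand side is orthogonal
 to \<open>cos\<close> and \<open>sin\<close>.\<close>

lemma wirtinger_equality:
 assumes w: "ac_on 0 (2*pi) w h" and h2: "set_integrable lborel {0..2*pi} (\<lambda>t. (h t)^2)"
  and per: "w 0 = w (2*pi)" and mean: "(LINT t:{0..2*pi}|lborel. w t) = 0"
  and eq: "(LINT t:{0..2*pi}|lborel. (h t)^2) = (LINT t:{0..2*pi}|lborel. (w t)^2)"
 obtains a b where "\<And>t. t \<in> {0..2*pi} ==> w t = a * cos t + b * sin t"
proof -
 let ?I = "\<lambda>f. (LINT t:{0..2*pi}|lborel. f t) :: real"
 note int = set_integrable_continuous_Icc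
 have cw: "continuous_on {0..2*pi} w" by (rule ac_on_continuous[OF w])
 have trig: "ac_on 0 (2*pi) cos (\<lambda>t. - sin t)" "ac_on 0 (2*pi) sin cos"
  by (rule ac_on_C1; auto intro!: derivative_eq_intros continuous_intros)+
 have Fc: "?I cos = 0" "?I sin = 0"
  using ac_on_FTC[OF trig(2)] ac_on_FTC[OF ac_on_cmult[OF trig(1), of "-1"]] by auto
 have cc: "?I (\<lambda>t. cos t * cos t) = pi" "?I (\<lambda>t. sin t * sin t) = pi" "?I (\<lambda>t. sin t * cos t) = 0"
 proof -
  have 1: "ac_on 0 (2*pi) (\<lambda>t. (t + sin t * cos t) / 2) (\<lambda>t. cos t * cos t)"
  proof (rule ac_on_C1)
   fix t :: real
   have "((\<lambda>t. (t + sin t * cos t) / 2) has_real_derivative (1 + (cos t * cos t - sin t * sin t)) / 2) (at t)"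
    by (auto intro!: derivative_eq_intros)
   moreover have "(1 + (cos t * cos t - sin t * sin t)) / 2 = cos t * cos t"
    using sin_cos_squared_add[of t] by (simp add: power2_eq_square)
   ultimately show "((\<lambda>t. (t + sin t * cos t) / 2) has_real_derivative cos t * cos t) (at t)" by simp
  qed (intro continuous_intros)
  have 2: "ac_on 0 (2*pi) (\<lambda>t. (t - sin t * cos t) / 2) (\<lambda>t. sin t * sin t)"
  proof (rule ac_on_C1)
   fix t :: real
   have "((\<lambda>t. (t - sin t * cos t) / 2) has_real_derivative (1 - (cos t * cos t - sin t * sin t)) / 2) (at t)"
    by (auto intro!: derivative_eq_intros)
   moreover have "(1 - (cos t * cos t - sin t * sin t)) / 2 = sin t * sin t"
    using sin_cos_squared_add[of t] by (simp add: power2_eq_square)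
   ultimately show "((\<lambda>t. (t - sin t * cos t) / 2) has_real_derivative sin t * sin t) (at t)" by simp
  qed (intro continuous_intros)
  have 3: "ac_on 0 (2*pi) (\<lambda>t. sin t * sin t / 2) (\<lambda>t. sin t * cos t)"
   by (rule ac_on_C1) (auto intro!: derivative_eq_intros continuous_intros)
  show "?I (\<lambda>t. cos t * cos t) = pi" using ac_on_FTC[OF 1] by simp
  show "?I (\<lambda>t. sin t * sin t) = pi" using ac_on_FTC[OF 2] by simp
  show "?I (\<lambda>t. sin t * cos t) = 0" using ac_on_FTC[OF 3] by simp
 qed
 define a where "a = ?I (\<lambda>t. w t * cos t) / pi"
 define b where "b = ?I (\<lambda>t. w t * sin t) / pi"
 define p where "p t = w t - (a * cos t + b * sin t)" for t
 have cp: "continuous_on {0..2*pi} p" unfolding p_def by (intro continuous_intros cw)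
 have iw: "set_integrable lborel {0..2*pi} w" by (rule int[OF cw])
 have pcos: "?I (\<lambda>t. p t * cos t) = 0"
 proof -
  have e: "p t * cos t = w t * cos t - (a * (cos t * cos t) + b * (sin t * cos t))" for t
   by (simp add: p_def algebra_simps)
  have i: "set_integrable lborel {0..2*pi} (\<lambda>t. w t * cos t)"
    "set_integrable lborel {0..2*pi} (\<lambda>t. a * (cos t * cos t))" "set_integrable lborel {0..2*pi} (\<lambda>t. b * (sin t * cos t))"
   by (intro int continuous_intros cw)+
  show ?thesis unfolding e set_integral_diff(2)[OF i(1) set_integral_add(1)[OF i(2,3)]]
    set_integral_add(2)[OF i(2,3)] set_integral_mult_right cc by (simp add: a_def)
 qed
 have psin: "?I (\<lambda>t. p t * sin t) = 0"
 proof -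
  have e: "p t * sin t = w t * sin t - (a * (sin t * cos t) + b * (sin t * sin t))" for t
   by (simp add: p_def algebra_simps)
  have i: "set_integrable lborel {0..2*pi} (\<lambda>t. w t * sin t)"
    "set_integrable lborel {0..2*pi} (\<lambda>t. a * (sin t * cos t))" "set_integrable lborel {0..2*pi} (\<lambda>t. b * (sin t * sin t))"
   by (intro int continuous_intros cw)+
  show ?thesis unfolding e set_integral_diff(2)[OF i(1) set_integral_add(1)[OF i(2,3)]]
    set_integral_add(2)[OF i(2,3)] set_integral_mult_right cc by (simp add: b_def)
 qed
 have pmean: "?I p = 0"
 proof -
  have i: "set_integrable lborel {0..2*pi} (\<lambda>t. a * cos t)" "set_integrable lborel {0..2*pi} (\<lambda>t. b * sin t)"
   by (intro int continuous_intros)+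
  show ?thesis unfolding p_def set_integral_diff(2)[OF iw set_integral_add(1)[OF i]]
    set_integral_add(2)[OF i] set_integral_mult_right Fc mean by simp
 qed
 define C where "C t = (LINT s:{0..t}|lborel. p s * cos s)" for t
 define S where "S t = (LINT s:{0..t}|lborel. p s * sin s)" for t
 have acC: "ac_on 0 (2*pi) C (\<lambda>t. p t * cos t)" and acS: "ac_on 0 (2*pi) S (\<lambda>t. p t * sin t)"
  by (rule ac_onI; auto intro!: int continuous_intros cp simp: C_def S_def set_integral_Icc_self)+
 have ends: "C 0 = 0" "S 0 = 0" "C (2*pi) = 0" "S (2*pi) = 0"
  using pcos psin by (auto simp: C_def S_def set_integral_Icc_self)
 \<comment> \<open>Variation of parameters for \<open>k'' + k = p\<close> with \<open>k\<close> and
   \<open>k'\<close> zero at \<open>0\<close>; the vanishing of \<open>C\<close> and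
   \<open>S\<close> at \<open>2 pi\<close> makes both zero again at the other end.\<close>
 define k where "k t = sin t * C t - cos t * S t" for t
 define k1 where "k1 t = cos t * C t + sin t * S t" for t
 have k: "ac_on 0 (2*pi) k k1"
  using ac_on_diff[OF ac_on_mult[OF trig(2) acC] ac_on_mult[OF trig(1) acS]]
  by (rule ac_on_cong) (auto simp: k_def k1_def algebra_simps)
 have k1: "ac_on 0 (2*pi) k1 (\<lambda>t. p t - k t)"
  using ac_on_add[OF ac_on_mult[OF trig(1) acC] ac_on_mult[OF trig(2) acS]]
 proof (rule ac_on_cong)
  fix t :: real
  have "cos t * cos t + sin t * sin t = 1"
   using sin_cos_squared_add[of t] by (simp add: power2_eq_square)
  then show "- sin t * C t + cos t * (p t * cos t) + (cos t * S t + sin t * (p t * sin t)) = p t - k t"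
   unfolding k_def by algebra
 qed (auto simp: k1_def)
 have kend: "k 0 = 0" "k (2*pi) = 0" "k1 0 = 0" "k1 (2*pi) = 0"
  using ends by (auto simp: k_def k1_def)
 have ck: "continuous_on {0..2*pi} k" "continuous_on {0..2*pi} k1"
  using ac_on_continuous[OF k] ac_on_continuous[OF k1] by auto
 have kmean: "?I k = 0"
  using ac_on_FTC[OF k1] set_integral_diff(2)[OF int[OF cp] int[OF ck(1)]] pmean kend by simp
 let ?L = "?I (\<lambda>t. h t * k1 t) - ?I (\<lambda>t. w t * k t)" and ?M = "?I (\<lambda>t. (k1 t)^2) - ?I (\<lambda>t. (k t)^2)"
 have ih: "set_integrable lborel {0..2*pi} h" by (rule ac_on_integrable[OF w])
 \<comment> \<open>Wirtinger's inequality for \<open>w + e k\<close>, with the assumed equality for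
   \<open>w\<close> subtracted. A quadratic in \<open>e\<close> without constant term that is
   nonnegative for all \<open>e\<close> has vanishing linear part \<open>?L\<close>.\<close>
 have quad: "0 \<le> 2 * e * ?L + e^2 * ?M" for e
 proof -
  have ac: "ac_on 0 (2*pi) (\<lambda>t. w t + e * k t) (\<lambda>t. h t + e * k1 t)"
   by (intro ac_on_add ac_on_cmult w k)
  have e1: "(h t + e * k1 t)^2 = (h t)^2 + ((2 * e) * (h t * k1 t) + e^2 * (k1 t)^2)"
   "(w t + e * k t)^2 = (w t)^2 + ((2 * e) * (w t * k t) + e^2 * (k t)^2)" for t by algebra+
  have i1: "set_integrable lborel {0..2*pi} (\<lambda>t. (2 * e) * (h t * k1 t))"
    "set_integrable lborel {0..2*pi} (\<lambda>t. e^2 * (k1 t)^2)"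
   by (intro set_integrable_mult_right set_integrable_mult_continuous[OF ih ck(2)],
     intro int continuous_intros ck)
  have i2: "set_integrable lborel {0..2*pi} (\<lambda>t. (w t)^2)" "set_integrable lborel {0..2*pi} (\<lambda>t. (2 * e) * (w t * k t))"
    "set_integrable lborel {0..2*pi} (\<lambda>t. e^2 * (k t)^2)"
   by (intro int continuous_intros ck cw)+
  have "?I (\<lambda>t. (w t + e * k t)^2) \<le> ?I (\<lambda>t. (h t + e * k1 t)^2)"
  proof (rule wirtinger[OF ac])
   show "set_integrable lborel {0..2*pi} (\<lambda>t. (h t + e * k1 t)^2)"
    unfolding e1 by (intro set_integral_add(1) h2 i1)
   show "w 0 + e * k 0 = w (2*pi) + e * k (2*pi)" using per kend by simp
   show "?I (\<lambda>t. w t + e * k t) = 0"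
    using set_integral_add(2)[OF iw set_integrable_mult_right[of e, OF int[OF ck(1)]]] mean kmean by simp
  qed
  then show ?thesis
   unfolding e1 set_integral_add(2)[OF h2 set_integral_add(1)[OF i1]]
    set_integral_add(2)[OF i2(1) set_integral_add(1)[OF i2(2,3)]] set_integral_add(2)[OF i1]
    set_integral_add(2)[OF i2(2,3)] set_integral_mult_right eq by (simp add: algebra_simps)
 qed
 have L0: "?L = 0"
 proof (rule ccontr)
  assume L: "?L \<noteq> 0"
  define m where "m = \<bar>?M\<bar> + 1"
  have m: "m > 0" "?M \<le> m" "?M < m" by (auto simp: m_def)
  have "0 \<le> 2 * (- ?L / m) * ?L + (- ?L / m)^2 * ?M" by (rule quad)
  also have "(- ?L / m)^2 * ?M \<le> (- ?L / m)^2 * m" by (rule mult_left_mono[OF m(2)]) simp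
  also have "2 * (- ?L / m) * ?L + (- ?L / m)^2 * m = - (?L^2 / m)"
   using m by (simp add: power2_eq_square field_simps)
  also have "... < 0" using L m by simp
  finally show False by simp
 qed
 \<comment> \<open>The derivative of \<open>w k'\<close> integrates to zero since \<open>k'\<close>
   vanishes at both ends. Together with \<open>?L = 0\<close> this makes \<open>w\<close> orthogonal
   to \<open>p\<close>; as \<open>p\<close> is also orthogonal to cosine and sine, it is orthogonal
   to itself.\<close>
 have "?I (\<lambda>t. h t * k1 t + w t * (p t - k t)) = 0"
  using ac_on_FTC[OF ac_on_mult[OF w k1]] kend by simp
 also have "(\<lambda>t. h t * k1 t + w t * (p t - k t)) = (\<lambda>t. h t * k1 t + (w t * p t - w t * k t))"
  by (simp add: algebra_simps)
 finally have "?I (\<lambda>t. h t * k1 t) + (?I (\<lambda>t. w t * p t) - ?I (\<lambda>t. w t * k t)) = 0"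
  using set_integral_add(2)[OF set_integrable_mult_continuous[OF ih ck(2)]
    set_integral_diff(1)[OF int[OF continuous_on_mult[OF cw cp]] int[OF continuous_on_mult[OF cw ck(1)]]]]
   set_integral_diff(2)[OF int[OF continuous_on_mult[OF cw cp]] int[OF continuous_on_mult[OF cw ck(1)]]]
  by simp
 with L0 have wp: "?I (\<lambda>t. w t * p t) = 0" by simp
 have "?I (\<lambda>t. (p t)^2) = 0"
 proof -
  have e: "(p t)^2 = w t * p t - (a * (p t * cos t) + b * (p t * sin t))" for t
   by (simp add: p_def power2_eq_square algebra_simps)
  have i: "set_integrable lborel {0..2*pi} (\<lambda>t. w t * p t)"
    "set_integrable lborel {0..2*pi} (\<lambda>t. a * (p t * cos t))" "set_integrable lborel {0..2*pi} (\<lambda>t. b * (p t * sin t))"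
   by (intro int continuous_intros cw cp)+
  show ?thesis unfolding e set_integral_diff(2)[OF i(1) set_integral_add(1)[OF i(2,3)]]
    set_integral_add(2)[OF i(2,3)] set_integral_mult_right pcos psin wp by simp
 qed
 then have "(p t)^2 = 0" if "t \<in> {0..2*pi}" for t
  using continuous_nonneg_integral_zero[of 0 "2*pi" "\<lambda>t. (p t)^2" t] that cp
  by (simp add: continuous_intros)
 then show ?thesis by (intro that[of a b]) (simp add: p_def)
qed

section \<open>Integration on the half-line\<close>

abbreviation lT :: "real measure" where "lT \<equiv> restrict_space lborel {0..}"
abbreviation lC :: "real measure" where "lC \<equiv> restrict_space lborel {0..<2 * pi}"

lemma integrable_lT: "integrable lT f \<longleftrightarrow> set_integrable lborel {0..} (f :: real => real)"
 by (simp add: set_integrable_def integrable_restrict_space)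

lemma integral_lT: "(LINT t|lT. f t) = (LINT t:{0..}|lborel. (f t :: real))"
 by (simp add: set_lebesgue_integral_def integral_restrict_space)

text \<open>Integrability of \<open>p\<close> gives \<open>y\<close> a limit at infinity, and
  integrability of \<open>y\<close> forces that limit to be zero. This disposes of the boundary
  terms at infinity in the later integrations by parts.\<close>

lemma half_line_FTC:
 assumes ac: "\<And>R. R \<ge> 0 ==> ac_on 0 R y p" and iy: "integrable lT y" and ip: "integrable lT p"
 shows "(LINT t|lT. p t) = - y 0"
proof -
 note iy = iy[unfolded integrable_lT] and ip = ip[unfolded integrable_lT]
 have "((\<lambda>R. LINT t:{0..R}|lborel. p t) \<longlongrightarrow> (LINT t:{0..}|lborel. p t)) at_top"
  by (rule tendsto_set_lebesgue_integral_at_top[OF _ ip]) simp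
 moreover have "\<forall>\<^sub>F R in at_top. (LINT t:{0..R}|lborel. p t) = y R - y 0"
  using eventually_ge_at_top[of 0] by eventually_elim (rule ac_on_FTC[OF ac])
 ultimately have "((\<lambda>R. y R - y 0) \<longlongrightarrow> (LINT t:{0..}|lborel. p t)) at_top"
  using tendsto_cong by fastforce
 then have lim: "(y \<longlongrightarrow> (LINT t:{0..}|lborel. p t) + y 0) at_top"
  using tendsto_add[of "\<lambda>R. y R - y 0" _ at_top "\<lambda>R. y 0" "y 0"] by simp
 define L where "L = (LINT t:{0..}|lborel. p t) + y 0"
 have "L = 0"
 proof (rule ccontr)
  assume L: "L \<noteq> 0"
  have "((\<lambda>R. \<bar>y R\<bar>) \<longlongrightarrow> \<bar>L\<bar>) at_top" using lim by (intro tendsto_intros) (simp add: L_def)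
  then have "\<forall>\<^sub>F R in at_top. \<bar>L\<bar> / 2 < \<bar>y R\<bar>" by (rule order_tendstoD) (use L in simp)
  then obtain R0 where R0: "\<And>R. R \<ge> R0 ==> \<bar>L\<bar> / 2 < \<bar>y R\<bar>" by (auto simp: eventually_at_top_linorder)
  define R1 where "R1 = max 0 R0"
  have "set_integrable lborel {R1..} y"
   by (rule set_integrable_subset[OF iy]) (auto simp: R1_def)
  then have "set_integrable lborel {R1..} (\<lambda>t. \<bar>L\<bar> / 2)"
   by (rule set_integrable_bound) (use R0 in \<open>auto simp: R1_def set_borel_measurable_def less_imp_le intro!: AE_I2\<close>)
  then have "integrable lborel (\<lambda>t. (2 / \<bar>L\<bar>) * (indicator {R1..} t *\<^sub>R (\<bar>L\<bar> / 2)))"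
   unfolding set_integrable_def by (rule integrable_mult_right)
  then have "integrable lborel (indicator {R1..} :: real => real)"
   using L by (simp add: field_simps)
  then have fin: "emeasure lborel {R1..} < top" by (simp add: integrable_indicator_iff)
  then obtain m where m: "emeasure lborel {R1..} = ennreal m" "m \<ge> 0"
   by (cases "emeasure lborel {R1..}") auto
  have "ennreal (m + 1) = emeasure lborel {R1..R1 + (m + 1)}" using m(2) by simp
  also have "... \<le> emeasure lborel {R1..}" by (rule emeasure_mono) auto
  finally show False using m by (simp add: ennreal_le_iff)
 qed
 then show ?thesis by (simp add: integral_lT L_def)
qed

text \<open>Bounded \<open>v\<close> and \<open>v'\<close> make \<open>v u^2\<close> and its
  derivative integrable when \<open>u\<close> and \<open>g\<close> are square integrable, so no
  boundary term survives at infinity. The intended instance is \<open>v = - tanh\<close>.\<close>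

lemma riccati_half_line:
 assumes ac: "\<And>R. R \<ge> 0 ==> ac_on 0 R u g"
  and [measurable]: "u \<in> borel_measurable lT" "g \<in> borel_measurable lT"
  and u2: "integrable lT (\<lambda>t. (u t)^2)" and g2: "integrable lT (\<lambda>t. (g t)^2)"
  and v: "\<And>t. (v has_real_derivative v' t) (at t)" and v': "continuous_on UNIV v'"
  and K: "\<And>t. \<bar>v t\<bar> \<le> K" "\<And>t. \<bar>v' t\<bar> \<le> K"
 shows "integrable lT (\<lambda>t. (g t - v t * u t)^2)"
  and "integrable lT (\<lambda>t. (v' t + (v t)^2) * (u t)^2)"
  and "(LINT t|lT. (g t)^2) + (LINT t|lT. (v' t + (v t)^2) * (u t)^2)
   = (LINT t|lT. (g t - v t * u t)^2) - v 0 * (u 0)^2"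
proof -
 have cv: "continuous_on UNIV v" using v by (meson DERIV_isCont continuous_at_imp_continuous_on)
 have [measurable]: "v \<in> borel_measurable lT" "v' \<in> borel_measurable lT"
  using cv v' by (auto intro!: measurable_restrict_space1 borel_measurable_continuous_onI)
 have acv: "ac_on 0 R v v'" for R by (rule ac_on_C1[OF v]) (rule continuous_on_subset[OF v'], simp)
 let ?p = "\<lambda>t. v' t * (u t * u t) + v t * (g t * u t + u t * g t)"
 have K0: "K \<ge> 0" using K(1)[of 0] by linarith
 have b1: "\<bar>v t * (u t * u t)\<bar> \<le> \<bar>K * (u t)^2\<bar>" "\<bar>v' t * (u t * u t)\<bar> \<le> K * (u t)^2" for t
  using mult_right_mono[OF K(1)[of t], of "(u t)^2"] mult_right_mono[OF K(2)[of t], of "(u t)^2"] K0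
  by (auto simp: abs_mult power2_eq_square)
 have iy: "integrable lT (\<lambda>t. v t * (u t * u t))"
  by (rule L1_bound[OF integrable_mult_right[of K, OF u2]])
    (use b1 in \<open>auto intro!: AE_I2\<close>)
 have b2: "\<bar>?p t\<bar> \<le> \<bar>K * (u t)^2 + (K * (u t)^2 + K * (g t)^2)\<bar>" for t
 proof -
  have "\<bar>g t * u t + u t * g t\<bar> \<le> (u t)^2 + (g t)^2"
   using sum_squares_bound[of "u t" "g t"] sum_squares_bound[of "- u t" "g t"] by (simp add: abs_le_iff mult.commute mult.left_commute)
  then have "\<bar>v t * (g t * u t + u t * g t)\<bar> \<le> K * ((u t)^2 + (g t)^2)"
   unfolding abs_mult using K K0 by (intro mult_mono) auto
  then show ?thesis using b1(2)[of t] by (simp add: distrib_left)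
 qed
 have ip: "integrable lT ?p"
  by (rule L1_bound[OF L1_add[OF
     integrable_mult_right[of K, OF u2] L1_add[OF integrable_mult_right[of K, OF u2] integrable_mult_right[of K, OF g2]]]])
    (use b2 in \<open>auto intro!: AE_I2\<close>)
 have ftc: "(LINT t|lT. ?p t) = - (v 0 * (u 0 * u 0))"
  by (rule half_line_FTC[OF ac_on_mult[OF acv ac_on_mult[OF ac ac]] iy ip])
 have b3: "\<bar>(v' t + (v t)^2) * (u t)^2\<bar> \<le> \<bar>(K + K^2) * (u t)^2\<bar>" for t
 proof -
  have "(v t)^2 \<le> K^2" using K(1)[of t] K0 by (metis abs_le_square_iff abs_of_nonneg)
  then have "\<bar>v' t + (v t)^2\<bar> \<le> K + K^2" using K(2)[of t] by (simp add: abs_le_iff) (smt (verit) zero_le_power2)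
  then show ?thesis using K0 by (simp add: abs_mult mult_right_mono)
 qed
 show i2: "integrable lT (\<lambda>t. (v' t + (v t)^2) * (u t)^2)"
  by (rule L1_bound[OF integrable_mult_right[of "K + K^2", OF u2]])
    (use b3 in \<open>auto intro!: AE_I2\<close>)
 have eq: "(g t - v t * u t)^2 = ((g t)^2 + (v' t + (v t)^2) * (u t)^2) - ?p t" for t by algebra
 show "integrable lT (\<lambda>t. (g t - v t * u t)^2)"
  unfolding eq by (intro L1_diff L1_add g2 i2 ip)
 show "(LINT t|lT. (g t)^2) + (LINT t|lT. (v' t + (v t)^2) * (u t)^2)
   = (LINT t|lT. (g t - v t * u t)^2) - v 0 * (u 0)^2"
  unfolding eq LINT_diff[OF L1_add[OF g2 i2] ip]
   LINT_add[OF g2 i2] ftc by (simp add: power2_eq_square)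
qed

section \<open>Smooth cutoffs and test functions\<close>

text \<open>The one-variable companion of \<open>Ck\<close>. Existentially quantified derivatives
  make closure under products, compositions and reciprocals a plain induction;
  \<open>Ck_product\<close> carries the result to the plane.\<close>

primrec C1k :: "nat => (real => real) => bool" where
 "C1k 0 f \<longleftrightarrow> continuous_on UNIV f"
| "C1k (Suc k) f \<longleftrightarrow> (\<exists>f'. (\<forall>x. (f has_real_derivative f' x) (at x)) \<and> C1k k f')"

lemma C1k_SucD: "C1k (Suc k) f ==> C1k k f"
proof (induction k arbitrary: f)
 case 0
 then show ?case by (meson C1k.simps DERIV_isCont continuous_at_imp_continuous_on)
next
 case (Suc k)
 then show ?case by (metis C1k.simps(2))
qed

lemma C1k_SucI: "(\<And>x. (f has_real_derivative f' x) (at x)) ==> C1k k f' ==> C1k (Suc k) f"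
 by auto

lemma C1k_continuous: "C1k k f ==> continuous_on UNIV f"
proof (induction k)
 case (Suc k) then show ?case using C1k_SucD by blast
qed simp

lemma C1k_const: "C1k k (\<lambda>x. c)"
 by (induction k arbitrary: c) (auto intro!: exI[of _ "\<lambda>x. 0"])

lemma C1k_ident: "C1k k (\<lambda>x. x)"
 by (cases k) (auto intro!: exI[of _ "\<lambda>x. 1"] C1k_const continuous_intros)

lemma C1k_add: "C1k k f ==> C1k k g ==> C1k k (\<lambda>x. f x + g x)"
proof (induction k arbitrary: f g)
 case 0 then show ?case by (auto intro: continuous_intros)
next
 case (Suc k)
 then obtain f' g' where "\<forall>x. (f has_real_derivative f' x) (at x)" "C1k k f'"
  "\<forall>x. (g has_real_derivative g' x) (at x)" "C1k k g'" by auto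
 then show ?case using Suc.IH by (auto intro!: exI[of _ "\<lambda>x. f' x + g' x"] derivative_intros)
qed

lemma C1k_mult: "C1k k f ==> C1k k g ==> C1k k (\<lambda>x. f x * g x)"
proof (induction k arbitrary: f g)
 case 0 then show ?case by (auto intro: continuous_intros)
next
 case (Suc k)
 then obtain f' g' where d: "\<forall>x. (f has_real_derivative f' x) (at x)" "C1k k f'"
  "\<forall>x. (g has_real_derivative g' x) (at x)" "C1k k g'" by auto
 have "C1k k (\<lambda>x. f' x * g x + g' x * f x)"
  by (rule C1k_add[OF Suc.IH[OF d(2) C1k_SucD[OF Suc.prems(2)]] Suc.IH[OF d(4) C1k_SucD[OF Suc.prems(1)]]])
 with d show ?case by (auto intro!: exI[of _ "\<lambda>x. f' x * g x + g' x * f x"] derivative_eq_intros)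
qed

lemma C1k_comp: "C1k k f ==> C1k k g ==> C1k k (\<lambda>x. f (g x))"
proof (induction k arbitrary: f)
 case 0 then show ?case by (auto intro: continuous_on_compose2)
next
 case (Suc k)
 then obtain f' g' where d: "\<forall>x. (f has_real_derivative f' x) (at x)" "C1k k f'"
  "\<forall>x. (g has_real_derivative g' x) (at x)" "C1k k g'" by auto
 have "C1k k (\<lambda>x. f' (g x) * g' x)"
  by (rule C1k_mult[OF Suc.IH[OF d(2) C1k_SucD[OF Suc.prems(2)]] d(4)])
 then show ?case
  by (rule C1k_SucI[rotated]) (use d(1,3) DERIV_chain2 in blast)
qed

lemma C1k_cmult: "C1k k f ==> C1k k (\<lambda>x. c * f x)"
 by (rule C1k_mult[OF C1k_const])

lemma C1k_inverse: "C1k k f ==> (\<And>x. f x \<noteq> 0) ==> C1k k (\<lambda>x. 1 / f x)"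
proof (induction k)
 case 0 then show ?case by (auto intro: continuous_intros)
next
 case (Suc k)
 then obtain f' where d: "\<forall>x. (f has_real_derivative f' x) (at x)" "C1k k f'" by auto
 have "C1k k (\<lambda>x. 1 / f x)" using Suc C1k_SucD by blast
 with d have "C1k k (\<lambda>x. (-1) * (f' x * ((1 / f x) * (1 / f x))))"
  by (intro C1k_cmult C1k_mult) auto
 with d Suc.prems show ?case
  by (auto intro!: exI[of _ "\<lambda>x. (-1) * (f' x * ((1 / f x) * (1 / f x)))"] derivative_eq_intros)
qed

lemma C1k_affine: "C1k k (\<lambda>x. a * x + b)"
 by (intro C1k_add C1k_mult C1k_const C1k_ident)

lemma C1k_sin_cos: "C1k k sin \<and> C1k k cos"
proof (induction k)
 case 0 show ?case by (auto intro: continuous_intros)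
next
 case (Suc k)
 have "C1k k (\<lambda>x. (-1) * sin x)" using Suc by (intro C1k_cmult) auto
 with Suc show ?case
  by (intro conjI C1k_SucI[of sin cos] C1k_SucI[of cos "\<lambda>x. (-1) * sin x"])
    (auto intro!: derivative_eq_intros)
qed

lemma C1k_sinh_cosh: "C1k k (sinh :: real => real) \<and> C1k k (cosh :: real => real)"
proof (induction k)
 case 0 show ?case by (auto intro: continuous_intros)
next
 case (Suc k)
 then show ?case
  by (intro conjI C1k_SucI[of sinh cosh] C1k_SucI[of cosh sinh])
    (auto intro!: derivative_eq_intros)
qed

definition sech :: "real => real" where "sech x = 1 / cosh x"

lemma C1k_sech: "C1k k (\<lambda>x. sech (x + T))"
proof -
 have "C1k k sech" unfolding sech_def using C1k_sinh_cosh by (intro C1k_inverse) auto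
 from C1k_comp[OF this C1k_affine[of k 1 T]] show ?thesis by simp
qed

lemma C1k_tanh: "C1k k (\<lambda>x. tanh (x + T))"
proof -
 have "C1k k sech" unfolding sech_def using C1k_sinh_cosh by (intro C1k_inverse) auto
 then have "C1k k (\<lambda>x. sinh x * sech x)" using C1k_sinh_cosh by (intro C1k_mult) auto
 then have "C1k k tanh" by (simp add: tanh_def[abs_def] sech_def)
 from C1k_comp[OF this C1k_affine[of k 1 T]] show ?thesis by simp
qed

text \<open>The functions \<open>exp (-1/x) / x^j\<close>, extended by zero, form a family closed
  under differentiation up to linear combinations: the derivative of \<open>flat j\<close> is
  \<open>flat (j + 2) - j * flat (j + 1)\<close>. Smoothness of all members then follows by one
  induction over the order.\<close>

definition flat :: "nat => real => real" where
 "flat j x = (if x > 0 then exp (- (1 / x)) * (1 / x) ^ j else 0)"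

text \<open>With \<open>y = 1 / x\<close>, the single term \<open>y^(j+1) / (j+1)!\<close> of the
  exponential series is at most \<open>exp y\<close>. The linear bound serves for the derivative at
  the origin, where the difference quotient of \<open>flat j\<close> is
  \<open>flat (j + 1)\<close>.\<close>

lemma flat_bound: "\<bar>flat j x\<bar> \<le> fact (j + 1) * \<bar>x\<bar>"
proof (cases "x > 0")
 case True
 define y where "y = 1 / x"
 have y: "y > 0" "x * y = 1" using True by (auto simp: y_def)
 have "sum (\<lambda>n. y ^ n /\<^sub>R fact n) {j + 1} \<le> (\<Sum>n. y ^ n /\<^sub>R fact n)"
  by (rule sum_le_suminf[OF summable_exp_generic]) (use y in auto)
 then have "y ^ (j + 1) / fact (j + 1) \<le> exp y" by (simp add: exp_def divide_inverse mult.commute del: fact_Suc)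
 then have "y ^ (j + 1) \<le> exp y * fact (j + 1)" by (simp add: pos_divide_le_eq del: fact_Suc)
 then have "y ^ (j + 1) * (x * exp (- y)) \<le> exp y * fact (j + 1) * (x * exp (- y))"
  using True by (intro mult_right_mono) auto
 also have "... = fact (j + 1) * x * (exp y * exp (- y))" by (simp only: mult_ac)
 also have "... = fact (j + 1) * x" by (simp add: exp_minus)
 also have "y ^ (j + 1) * (x * exp (- y)) = (x * y) * (exp (- y) * y ^ j)" by simp
 finally have "flat j x \<le> fact (j + 1) * x" using True y by (simp add: flat_def y_def)
 moreover have "flat j x \<ge> 0" using True by (simp add: flat_def)
 ultimately show ?thesis using True by simp
next
 case False
 then have "flat j x = 0" by (simp add: flat_def)
 then show ?thesis by simp
qed

lemma flat_derivative: "(flat j has_real_derivative flat (j + 2) x + (- real j) * flat (j + 1) x) (at x)"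
proof -
 consider "x > 0" | "x < 0" | "x = 0" by linarith
 then show ?thesis
 proof cases
  case 1
  have y: "((\<lambda>x. 1 / x) has_real_derivative - ((1 / x) ^ 2)) (at x)"
   using 1 by (auto intro!: derivative_eq_intros simp: power2_eq_square field_simps)
  have p: "((\<lambda>x. (1 / x) ^ j) has_real_derivative - real j * (1 / x) ^ (j + 1)) (at x)"
  proof (cases j)
   case (Suc n)
   show ?thesis using DERIV_power[OF y, of j] unfolding Suc
    by (elim DERIV_cong) (simp add: power2_eq_square diff_divide_distrib add_divide_distrib algebra_simps)
  qed simp
  have e: "((\<lambda>x. exp (- (1 / x))) has_real_derivative exp (- (1 / x)) * (1 / x) ^ 2) (at x)"
   using DERIV_chain2[OF DERIV_exp DERIV_minus[OF y]] by simp
  have "((\<lambda>x. exp (- (1 / x)) * (1 / x) ^ j) has_real_derivative flat (j + 2) x + (- real j) * flat (j + 1) x) (at x)"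
   using DERIV_mult[OF e p] 1 by (simp add: flat_def power_add power2_eq_square algebra_simps)
  moreover have "\<forall>\<^sub>F y in nhds x. flat j y = exp (- (1 / y)) * (1 / y) ^ j"
   using eventually_nhds_in_open[of "{0<..}" x] 1 by (auto elim!: eventually_mono simp: flat_def)
  ultimately show ?thesis by (subst DERIV_cong_ev[OF refl _ refl]) auto
 next
  case 2
  have "\<forall>\<^sub>F y in nhds x. flat j y = 0"
   using eventually_nhds_in_open[of "{..<0}" x] 2 by (auto elim!: eventually_mono simp: flat_def)
  moreover have "((\<lambda>x. 0) has_real_derivative flat (j + 2) x + (- real j) * flat (j + 1) x) (at x)"
   using 2 by (simp add: flat_def)
  ultimately show ?thesis by (subst DERIV_cong_ev[OF refl _ refl]) auto
 next
  case 3
  have "(\<lambda>h. (flat j (0 + h) - flat j 0) / h) \<midarrow>0\<rightarrow> 0"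
  proof (rule Lim_null_comparison)
   show "\<forall>\<^sub>F h in at 0. norm ((flat j (0 + h) - flat j 0) / h) \<le> fact (j + 2) * \<bar>h\<bar>"
   proof (intro always_eventually allI)
    fix h :: real
    have "(flat j (0 + h) - flat j 0) / h = flat (j + 1) h" by (simp add: flat_def)
    then show "norm ((flat j (0 + h) - flat j 0) / h) \<le> fact (j + 2) * \<bar>h\<bar>"
     using flat_bound[of "j + 1" h] by (simp add: numeral_2_eq_2 del: fact_Suc)
   qed
   show "((\<lambda>h. fact (j + 2) * \<bar>h\<bar>) \<longlongrightarrow> 0) (at (0::real))"
    by (auto intro!: tendsto_eq_intros)
  qed
  then show ?thesis using 3 by (simp add: DERIV_def flat_def)
 qed
qed

lemma C1k_flat: "C1k k (flat j)"
proof (induction k arbitrary: j)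
 case 0
 show ?case using flat_derivative by (auto intro!: continuous_at_imp_continuous_on DERIV_isCont)
next
 case (Suc k)
 have "C1k k (\<lambda>x. flat (j + 2) x + (- real j) * flat (j + 1) x)"
  by (intro C1k_add C1k_cmult Suc)
 then show ?case by (rule C1k_SucI[OF flat_derivative])
qed

definition smooth_step :: "real => real" where "smooth_step x = flat 0 x * (1 / (flat 0 x + flat 0 (1 - x)))"

lemma flat0_pos: "flat 0 x + flat 0 (1 - x) > 0"
 by (auto simp: flat_def intro: add_pos_pos)

lemma C1k_step: "C1k k smooth_step"
proof -
 have "C1k k (\<lambda>x. flat 0 (1 - x))"
  using C1k_comp[OF C1k_flat[of k 0] C1k_affine[of k "-1" 1]] by (simp add: algebra_simps)
 then show ?thesis unfolding smooth_step_def[abs_def]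
  using flat0_pos by (intro C1k_mult C1k_inverse C1k_add C1k_flat) (auto simp: less_le)
qed

lemma step_0: "x \<le> 0 ==> smooth_step x = 0" and step_1: "x \<ge> 1 ==> smooth_step x = 1"
 by (auto simp: smooth_step_def flat_def)

lemma step_bounds: "0 \<le> smooth_step x" "smooth_step x \<le> 1"
 using flat0_pos[of x] by (auto simp: smooth_step_def divide_simps) (auto simp: flat_def)

lemma C1k_step_affine: "C1k k (\<lambda>x. smooth_step (a * x + b))"
 by (rule C1k_comp[OF C1k_step C1k_affine])

lemma pd_product:
 assumes "\<And>x. (a has_real_derivative a' x) (at x)" "\<And>x. (b has_real_derivative b' x) (at x)"
 shows "pd 1 (\<lambda>p. a (fst p) * b (snd p)) = (\<lambda>p. a' (fst p) * b (snd p))"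
  and "pd 2 (\<lambda>p. a (fst p) * b (snd p)) = (\<lambda>p. a (fst p) * b' (snd p))"
proof -
 show "pd 1 (\<lambda>p. a (fst p) * b (snd p)) = (\<lambda>p. a' (fst p) * b (snd p))"
  unfolding pd_def fun_eq_iff
  by (auto intro!: vector_derivative_at DERIV_cmult_right assms
    simp: has_real_derivative_iff_has_vector_derivative[symmetric])
 show "pd 2 (\<lambda>p. a (fst p) * b (snd p)) = (\<lambda>p. a (fst p) * b' (snd p))"
  unfolding pd_def fun_eq_iff
  by (auto intro!: vector_derivative_at DERIV_cmult assms
    simp: has_real_derivative_iff_has_vector_derivative[symmetric])
qed

lemma Ck_product: "C1k k a ==> C1k k b ==> Ck k (\<lambda>p. a (fst p) * b (snd p))"
proof (induction k arbitrary: a b)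
 case 0 then show ?case by (auto intro!: continuous_intros intro: continuous_on_compose2)
next
 case (Suc k)
 then obtain a' b' where d: "\<And>x. (a has_real_derivative a' x) (at x)" "C1k k a'"
  "\<And>x. (b has_real_derivative b' x) (at x)" "C1k k b'" by auto
 have "(\<lambda>p. a (fst p) * b (snd p)) differentiable_on UNIV"
  unfolding differentiable_on_def
 proof
  fix p :: "real \<times> real"
  have A: "((\<lambda>p. a (fst p)) has_derivative (\<lambda>h. fst h * a' (fst p))) (at p)"
   using has_derivative_compose[OF has_derivative_fst[OF has_derivative_ident] d(1)[unfolded has_field_derivative_def], of p UNIV]
   by (simp add: mult.commute)
  have B: "((\<lambda>p. b (snd p)) has_derivative (\<lambda>h. snd h * b' (snd p))) (at p)"
   using has_derivative_compose[OF has_derivative_snd[OF has_derivative_ident] d(3)[unfolded has_field_derivative_def], of p UNIV]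
   by (simp add: mult.commute)
  show "(\<lambda>p. a (fst p) * b (snd p)) differentiable at p within UNIV"
   using has_derivative_mult[OF A B] unfolding differentiable_def by blast
 qed
 moreover have "Ck k (\<lambda>p. a' (fst p) * b (snd p))" "Ck k (\<lambda>p. a (fst p) * b' (snd p))"
  using Suc.IH[OF d(2) C1k_SucD[OF Suc.prems(2)]] Suc.IH[OF C1k_SucD[OF Suc.prems(1)] d(4)] by auto
 ultimately show ?case unfolding Ck.simps pd_product[OF d(1,3)] by blast
qed

text \<open>Lebesgue differentiation along cubes: the averages over shrinking cubes converge to
  \<open>f x\<close> for almost every \<open>x\<close>, and by hypothesis all of them are
  zero.\<close>

lemma box_zero_imp_AE_zero:
 fixes f :: "'a::euclidean_space => real"
 assumes f: "integrable lborel f" and z: "\<And>a b. (LINT x:cbox a b|lborel. f x) = 0"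
 shows "AE x in lborel. f x = 0"
proof -
 have si: "set_integrable lborel (cbox a b) f" for a b
  unfolding set_integrable_def by (rule integrable_mult_indicator[OF _ f]) simp
 have "f integrable_on cbox a b" "integral (cbox a b) f = 0" for a b
  using set_borel_integral_eq_integral[OF si[of a b]] z[of a b] by auto
 then obtain N where N: "negligible N" "\<And>x e. \<lbrakk>x \<notin> N; 0 < e\<rbrakk> \<Longrightarrow>
   \<exists>d>0. \<forall>h. 0 < h \<and> h < d \<longrightarrow>
     norm (integral (cbox x (x + h *\<^sub>R One)) f /\<^sub>R h ^ DIM('a) - f x) < e"
  using integrable_ccontinuous_explicit[of f] by metis
 have "f x = 0" if xN: "x \<notin> N" for x
 proof (rule ccontr)
  assume "f x \<noteq> 0"
  then obtain d where d: "d > 0" "\<And>h. 0 < h \<and> h < d ==> norm (integral (cbox x (x + h *\<^sub>R One)) f /\<^sub>R h ^ DIM('a) - f x) < \<bar>f x\<bar>"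
   using N(2)[OF xN, of "\<bar>f x\<bar>"] by auto
  from d(2)[of "d / 2"] d(1) \<open>\<And>b a. integral (cbox a b) f = 0\<close> show False by simp
 qed
 then have "AE x in lebesgue. f x = 0"
  using N(1) by (intro AE_I'[of N]) (auto simp: negligible_iff_null_sets)
 then show ?thesis by (simp add: AE_completion_iff)
qed

text \<open>Tests are products of a function of \<open>t\<close> supported in \<open>t > 0\<close>
  and a periodic function of the angle. Such products approximate indicators of rectangles, which is
  enough to identify a function almost everywhere.\<close>

definition test_t :: "(real => real) => bool" where
 "test_t a \<longleftrightarrow> (\<forall>k. C1k k a) \<and> (\<exists>l u. 0 < l \<and> (\<forall>t. t \<notin> {l..u} \<longrightarrow> a t = 0))"

definition test_c :: "(real => real) => bool" where
 "test_c b \<longleftrightarrow> (\<forall>k. C1k k b) \<and> (\<forall>y. b (y + 2 * pi) = b y)"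

text \<open>Both ramps have width \<open>1 / n\<close> and lie outside \<open>{x..y}\<close>, so
  that the function is 1 on the interval itself and the pointwise limit is its indicator, end points
  included.\<close>

definition plateau :: "nat => real => real => real => real" where
 "plateau n x y t = smooth_step (n * t + (1 - n * x)) * smooth_step ((- n) * t + (1 + n * y))"

lemma plateau_C1k: "C1k k (plateau n x y)"
 unfolding plateau_def[abs_def] by (intro C1k_mult C1k_step_affine)

lemma plateau_bounds: "0 \<le> plateau n x y t" "plateau n x y t \<le> 1"
 unfolding plateau_def by (auto intro!: mult_nonneg_nonneg mult_le_one step_bounds)

lemma plateau_outside: "n > 0 ==> t \<notin> {x - 1 / n .. y + 1 / n} ==> plateau n x y t = 0"
 unfolding plateau_def using step_0[of "n * t + (1 - n * x)"] step_0[of "(- n) * t + (1 + n * y)"]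
 by (auto simp: field_simps not_le)

lemma step_ramp_tendsto: "(\<lambda>n. smooth_step (1 + real (n + m) * d)) \<longlonglongrightarrow> (if 0 \<le> d then 1 else 0)"
proof (cases "0 \<le> d")
 case True then show ?thesis by (simp add: step_1)
next
 case False
 obtain N :: nat where N: "real N > 1 / (- d)" using reals_Archimedean2 by blast
 have "smooth_step (1 + real (n + m) * d) = 0" if "n \<ge> N" for n
 proof (rule step_0)
  have "1 < real N * (- d)" using N False by (simp add: field_simps)
  also have "real N * (- d) \<le> real (n + m) * (- d)" using that False by (intro mult_right_mono) auto
  finally show "1 + real (n + m) * d \<le> 0" unfolding mult_minus_right by linarith
 qed
 then show ?thesis using False
  by (auto intro!: tendsto_eventually eventually_sequentiallyI[of N])
qed

lemma plateau_tendsto: "(\<lambda>n. plateau (n + m) x y t) \<longlonglongrightarrow> indicator {x..y} t"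
proof -
 have "(\<lambda>n. smooth_step (1 + real (n + m) * (t - x)) * smooth_step (1 + real (n + m) * (y - t)))
   \<longlonglongrightarrow> (if 0 \<le> t - x then 1 else 0) * (if 0 \<le> y - t then 1 else 0)"
  by (intro tendsto_mult step_ramp_tendsto)
 moreover have "smooth_step (1 + real (n + m) * (t - x)) * smooth_step (1 + real (n + m) * (y - t)) = plateau (n + m) x y t" for n
  by (simp add: plateau_def algebra_simps)
 moreover have "(if 0 \<le> t - x then 1 else 0) * (if 0 \<le> y - t then 1 else 0) = (indicator {x..y} t :: real)"
  by (auto simp: indicator_def)
 ultimately show ?thesis by simp
qed

lemma plateau_test_t: "n > 0 ==> 1 / real n < x ==> test_t (plateau n x y)"
 unfolding test_t_def
 by (intro conjI allI plateau_C1k exI[of _ "x - 1 / n"] exI[of _ "y + 1 / n"])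
   (auto intro: plateau_outside)

text \<open>Composition with the cosine of the distance to the midpoint makes periodicity automatic;
  this cosine is at least the cosine of half the length exactly on the arc.\<close>

definition arc_bump :: "nat => real => real => real => real" where
 "arc_bump n p q y = smooth_step (n * (cos (y - (p + q) / 2) - cos ((q - p) / 2)) + 1)"

lemma arc_bump_test_c: "test_c (arc_bump n p q)"
proof -
 define c where "c = (p + q) / 2"
 define d where "d = cos ((q - p) / 2)"
 have e: "arc_bump n p q = (\<lambda>y. smooth_step (real n * cos (1 * y + (- c)) + (1 - n * d)))"
  by (auto simp: arc_bump_def c_def d_def fun_eq_iff right_diff_distrib intro!: arg_cong[of _ _ smooth_step])
 have "C1k k (\<lambda>y. cos (1 * y + (- c)))" for k
  by (rule C1k_comp[OF conjunct2[OF C1k_sin_cos] C1k_affine])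
 then have "C1k k (\<lambda>y. real n * cos (1 * y + (- c)) + (1 - n * d))" for k
  by (rule C1k_add[OF C1k_cmult C1k_const])
 from C1k_comp[OF C1k_step this] have "C1k k (arc_bump n p q)" for k
  unfolding e .
 moreover have "cos (y + 2 * pi - c) = cos (y - c)" for y c :: real
  using cos_periodic[of "y - c"] by (simp add: algebra_simps)
 ultimately show ?thesis by (simp add: test_c_def arc_bump_def)
qed

lemma arc_bump_bounds: "0 \<le> arc_bump n p q y" "arc_bump n p q y \<le> 1"
 unfolding arc_bump_def by (auto intro: step_bounds)

text \<open>The last two hypotheses keep \<open>y\<close> from being the other copy of the seam
  point when the arc ends at \<open>0\<close> or at \<open>2 pi\<close>: there the bumps converge to
  1 although \<open>y\<close> may lie outside \<open>{p..q}\<close>.\<close>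

lemma arc_bump_tendsto:
 assumes "0 \<le> p" "p \<le> q" "q \<le> 2 * pi" "y \<in> {0..2*pi}" "0 < p \<or> y < 2 * pi" "q < 2 * pi \<or> 0 < y"
 shows "(\<lambda>n. arc_bump n p q y) \<longlonglongrightarrow> indicator {p..q} y"
proof -
 define d where "d = (q - p) / 2"
 define x where "x = y - (p + q) / 2"
 have d: "0 \<le> d" "d \<le> pi" using assms(1-3) unfolding d_def by simp_all
 have iff: "cos d \<le> cos x \<longleftrightarrow> \<bar>x\<bar> \<le> d"
 proof (cases "\<bar>x\<bar> \<le> pi")
  case True
  have "cos d \<le> cos \<bar>x\<bar> \<longleftrightarrow> \<bar>x\<bar> \<le> d" using True d cos_mono_le_eq[of d "\<bar>x\<bar>"] by simp
  then show ?thesis by simp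
 next
  \<comment> \<open>Beyond distance pi the cosine increases again; reflection to
    \<open>2 pi - \<bar>x\<bar>\<close>, which still exceeds \<open>d\<close>, shows that it stays
    below \<open>cos d\<close>.\<close>
  case False
  have "q - y < 2 * pi" using assms(3,4,6) unfolding atLeastAtMost_iff by linarith
  moreover have "y - p < 2 * pi" using assms(1,4,5) unfolding atLeastAtMost_iff by linarith
  ultimately have x2: "\<bar>x\<bar> < 2 * pi - d" unfolding x_def d_def abs_less_iff by (simp add: field_simps)
  then have "cos (2 * pi - \<bar>x\<bar>) < cos d" using False d by (intro cos_monotone_0_pi) simp_all
  moreover have "cos (2 * pi - \<bar>x\<bar>) = cos \<bar>x\<bar>" by (metis cos_2pi_minus)
  moreover have "\<not> \<bar>x\<bar> \<le> d" using False d by linarith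
  ultimately show ?thesis by simp
 qed
 have "(\<lambda>n. smooth_step (1 + real (n + 0) * (cos x - cos d))) \<longlonglongrightarrow> (if 0 \<le> cos x - cos d then 1 else 0)"
  by (rule step_ramp_tendsto)
 moreover have "(0 \<le> cos x - cos d) = (y \<in> {p..q})"
 proof -
  have "\<bar>x\<bar> \<le> d \<longleftrightarrow> p \<le> y \<and> y \<le> q"
   unfolding x_def d_def abs_le_iff by (rule iffI) (simp_all add: field_simps)
  then show ?thesis unfolding diff_ge_0_iff_ge iff by simp
 qed
 moreover have "arc_bump n p q y = smooth_step (1 + real (n + 0) * (cos x - cos d))" for n
  unfolding arc_bump_def x_def d_def by (simp add: add.commute)
 ultimately show ?thesis by (simp only: indicator_def of_bool_def)
qed

section \<open>Integration on the half-cylinder\<close>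

abbreviation lM :: "(real \<times> real) measure" where "lM \<equiv> restrict_space lborel cyl"

lemma cyl_borel [measurable, simp]: "cyl \<in> sets borel"
 unfolding cyl_def by (intro borel_Times) auto

text \<open>The integrals of the definitions live on \<open>cyl\<close>; this identity opens them to
  Fubini and to the slicing of null sets along both coordinates.\<close>

lemma lM_pair: "lT \<Otimes>\<^sub>M lC = lM"
proof (rule pair_measure_eqI)
 show "sigma_finite_measure lT" "sigma_finite_measure lC"
  by (rule sigma_finite_measure_restrict_space[OF sigma_finite_lborel]; simp)+
 show "sets (lT \<Otimes>\<^sub>M lC) = sets lM"
 proof
  show "sets (lT \<Otimes>\<^sub>M lC) \<subseteq> sets lM"
  proof (rule sets_pair_in_sets)
   show "A \<times> B \<in> sets lM" if "A \<in> sets lT" "B \<in> sets lC" for A B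
    using that unfolding sets_restrict_space by (auto simp: sets_restrict_space_iff cyl_def intro!: image_eqI[of _ _ "A \<times> B"] borel_Times)
  qed
  have id: "(\<lambda>p. p) \<in> measurable (lT \<Otimes>\<^sub>M lC) (borel \<Otimes>\<^sub>M borel)"
  proof -
   have "fst \<in> measurable (lT \<Otimes>\<^sub>M lC) borel"
    by (rule measurable_compose[OF measurable_fst, of "\<lambda>x. x", simplified]) (simp add: measurable_restrict_space1)
   moreover have "snd \<in> measurable (lT \<Otimes>\<^sub>M lC) borel"
    by (rule measurable_compose[OF measurable_snd, of "\<lambda>x. x", simplified]) (simp add: measurable_restrict_space1)
   ultimately have "(\<lambda>p. (fst p, snd p)) \<in> measurable (lT \<Otimes>\<^sub>M lC) (borel \<Otimes>\<^sub>M borel)"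
    by (rule measurable_Pair)
   then show ?thesis by simp
  qed
  show "sets lM \<subseteq> sets (lT \<Otimes>\<^sub>M lC)"
  proof
   fix A assume "A \<in> sets lM"
   then obtain B where B: "B \<in> sets borel" "A = cyl \<inter> B"
    unfolding sets_restrict_space by auto
   have "(\<lambda>p. p) -` B \<inter> space (lT \<Otimes>\<^sub>M lC) \<in> sets (lT \<Otimes>\<^sub>M lC)"
    by (rule measurable_sets[OF id]) (subst borel_prod, rule B(1))
   then show "A \<in> sets (lT \<Otimes>\<^sub>M lC)" using B
    by (simp add: space_pair_measure space_restrict_space cyl_def Int_commute)
  qed
 qed
 show "emeasure lT A * emeasure lC B = emeasure lM (A \<times> B)"
  if "A \<in> sets lT" "B \<in> sets lC" for A B
 proof -
  have A: "A \<subseteq> {0..}" "A \<in> sets borel" and B: "B \<subseteq> {0..<2*pi}" "B \<in> sets borel"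
   using that by (auto simp: sets_restrict_space_iff)
  have "A \<times> B \<subseteq> cyl" using A B by (auto simp: cyl_def)
  then have "emeasure lM (A \<times> B) = emeasure (lborel \<Otimes>\<^sub>M lborel) (A \<times> B)"
   unfolding lborel_prod by (simp add: emeasure_restrict_space)
  also have "... = emeasure lborel A * emeasure lborel B"
   by (rule lborel.emeasure_pair_measure_Times) (use A B in auto)
  also have "... = emeasure lT A * emeasure lC B"
   using A B by (simp add: emeasure_restrict_space)
  finally show ?thesis ..
 qed
qed

interpretation lT: sigma_finite_measure lT
 by (rule sigma_finite_measure_restrict_space[OF sigma_finite_lborel]) simp

interpretation lC: finite_measure lC
 by (rule finite_measureI) (simp add: space_restrict_space emeasure_restrict_space)

interpretation lTC: pair_sigma_finite lT lC ..

lemma measure_lC: "measure lC (space lC) = 2 * pi"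
 by (simp add: space_restrict_space measure_restrict_space)

lemma borel_measurable_lM_continuous: "continuous_on UNIV f ==> f \<in> borel_measurable lM"
 using borel_measurable_continuous_onI[of f] by (simp add: measurable_restrict_space1 measurable_lborel1)

lemma continuous_on_fst_snd:
 assumes "continuous_on UNIV (a :: real => real)"
 shows "continuous_on UNIV (\<lambda>p :: real \<times> real. a (fst p))" "continuous_on UNIV (\<lambda>p :: real \<times> real. a (snd p))"
 by (rule continuous_on_compose2[OF assms]; auto intro!: continuous_intros)+

lemma integrable_lM: "integrable lM f \<longleftrightarrow> set_integrable lborel cyl (f :: _ => real)"
 by (simp add: set_integrable_def integrable_restrict_space)

lemma integral_lM: "(LINT t|lM. f t) = (LINT t:cyl|lborel. (f t :: real))"
 by (simp add: set_lebesgue_integral_def integral_restrict_space)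

lemma AE_coordinate: "AE p::real\<times>real in lborel. fst p \<noteq> c" "AE p::real\<times>real in lborel. snd p \<noteq> c"
proof -
 have n: "negligible {x::real\<times>real. x \<bullet> (1,0) = c}" "negligible {x::real\<times>real. x \<bullet> (0,1) = c}"
  by (rule negligible_standard_hyperplane; simp add: Basis_prod_def)+
 have "AE p::real\<times>real in lebesgue. fst p \<noteq> c" 
  by (rule AE_I'[of "{x::real\<times>real. x \<bullet> (1,0) = c}"]) (use n(1) in \<open>auto simp: negligible_iff_null_sets\<close>)
 moreover have "AE p::real\<times>real in lebesgue. snd p \<noteq> c"
  by (rule AE_I'[of "{x::real\<times>real. x \<bullet> (0,1) = c}"]) (use n(2) in \<open>auto simp: negligible_iff_null_sets\<close>)
 ultimately show "AE p::real\<times>real in lborel. fst p \<noteq> c" "AE p::real\<times>real in lborel. snd p \<noteq> c"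
  by (simp_all add: AE_completion_iff)
qed

lemma test_c_continuous: "test_c b ==> continuous_on UNIV b" and test_t_continuous: "test_t a ==> continuous_on UNIV a"
 unfolding test_c_def test_t_def by (auto intro: C1k_continuous[of 0])

text \<open>Smoothed indicators of the rectangle are tests, and dominated convergence passes to the
  indicator. Integrability of \<open>D\<close> is given only away from the edge, so the supports of
  all approximants must stay in one box \<open>K\<close> at positive distance from
  \<open>t = 0\<close>; ramps of width at most \<open>1 / m < x\<close> achieve this.\<close>

lemma test_box_integral_zero:
 assumes D: "\<And>a b. 0 < a ==> set_integrable lborel ({a..b} \<times> {0..<2*pi}) (D :: _ => real)"
  and z: "\<And>a b. test_t a ==> test_c b ==> (LINT p:cyl|lborel. D p * (a (fst p) * b (snd p))) = 0"
  and x: "0 < x" "x \<le> y" "0 < p" "p \<le> q" "q < 2*pi"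
 shows "(LINT P:{x..y} \<times> {p..q}|lborel. D P) = 0"
proof -
 obtain m :: nat where m: "real m > 1 / x" using reals_Archimedean2 by blast
 have "real m > 0" using m x(1) by (meson divide_pos_pos less_trans zero_less_one)
 then have m0: "m > 0" "1 / real m < x" using m x(1) by (auto simp: field_simps)
 define K where "K = {x - 1 / m .. y + 1 / m} \<times> {0..<2*pi}"
 have Kb: "K \<in> sets borel" unfolding K_def by (intro borel_Times) auto
 define DK where "DK P = indicator K P *\<^sub>R D P" for P
 have iDK: "integrable lborel DK"
  using D[of "x - 1 / m" "y + 1 / m"] m0 unfolding DK_def[abs_def] K_def set_integrable_def by simp
 note [measurable] = borel_measurable_integrable[OF iDK]
 define s where "s n P = plateau (n + m) x y (fst P) * arc_bump n p q (snd P)" for n P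
 have s: "0 \<le> s n P" "s n P \<le> 1" for n P
  unfolding s_def by (auto intro!: mult_nonneg_nonneg mult_le_one plateau_bounds arc_bump_bounds)
 have cs: "continuous_on UNIV (s n)" for n
  unfolding s_def by (intro continuous_on_mult continuous_on_fst_snd C1k_continuous[OF plateau_C1k]
    test_c_continuous[OF arc_bump_test_c])
 have [measurable]: "s n \<in> borel_measurable borel" for n by (rule borel_measurable_continuous_onI[OF cs])
 have pt: "test_t (plateau (n + m) x y)" for n
  by (rule plateau_test_t) (use m0 in \<open>auto intro: le_less_trans[OF _ m0(2)] simp: frac_le\<close>)
 have eq: "indicator cyl P *\<^sub>R (D P * s n P) = DK P * s n P" for n P
 proof (cases "P \<in> cyl \<and> P \<notin> K")
  case True
  then have "fst P \<notin> {x - 1 / m .. y + 1 / m}" by (auto simp: cyl_def K_def)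
  moreover have "1 / real (n + m) \<le> 1 / m" using m0 by (intro divide_left_mono) auto
  ultimately have "fst P \<notin> {x - 1 / real (n + m) .. y + 1 / real (n + m)}" by auto
  then have "s n P = 0" using plateau_outside[of "n + m" "fst P" x y] m0(1) by (simp add: s_def)
  then show ?thesis by simp
 next
  case False
  have "K \<subseteq> cyl" using m0 by (auto simp: K_def cyl_def)
  then show ?thesis using False by (auto simp: DK_def indicator_def)
 qed
 have zero: "(LINT P|lborel. DK P * s n P) = 0" for n
 proof -
  have "(LINT P:cyl|lborel. D P * s n P) = 0"
   unfolding s_def by (rule z[OF pt arc_bump_test_c])
  then show ?thesis unfolding set_lebesgue_integral_def eq .
 qed
 have "(\<lambda>n. LINT P|lborel. DK P * s n P) \<longlonglongrightarrow> (LINT P|lborel. DK P * indicator ({x..y} \<times> {p..q}) P)"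
 proof (rule integral_dominated_convergence[where w="\<lambda>P. \<bar>DK P\<bar>"])
  have "{x..y} \<times> {p..q} \<in> sets borel" by (intro borel_Times) auto
  then show "(\<lambda>P. DK P * indicator ({x..y} \<times> {p..q}) P) \<in> borel_measurable lborel" by measurable
  show "(\<lambda>P. DK P * s n P) \<in> borel_measurable lborel" for n by measurable
  show "integrable lborel (\<lambda>P. \<bar>DK P\<bar>)" by (rule integrable_abs[OF iDK])
  show "AE P in lborel. (\<lambda>n. DK P * s n P) \<longlonglongrightarrow> DK P * indicator ({x..y} \<times> {p..q}) P"
  proof (rule AE_I2)
   fix P :: "real \<times> real"
   show "(\<lambda>n. DK P * s n P) \<longlonglongrightarrow> DK P * indicator ({x..y} \<times> {p..q}) P"
   proof (cases "P \<in> K")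
    case True
    have "(\<lambda>n. arc_bump n p q (snd P)) \<longlonglongrightarrow> indicator {p..q} (snd P)"
     by (rule arc_bump_tendsto) (use x True in \<open>auto simp: K_def\<close>)
    then have "(\<lambda>n. s n P) \<longlonglongrightarrow> indicator {x..y} (fst P) * indicator {p..q} (snd P)"
     unfolding s_def by (intro tendsto_mult plateau_tendsto)
    moreover have "indicator {x..y} (fst P) * indicator {p..q} (snd P) = (indicator ({x..y} \<times> {p..q}) P :: real)"
     by (cases P) (auto simp: indicator_def)
    ultimately show ?thesis by (auto intro!: tendsto_mult)
   qed (simp add: DK_def)
  qed
  show "AE P in lborel. norm (DK P * s n P) \<le> \<bar>DK P\<bar>" for n
   using s by (auto simp: abs_mult intro!: AE_I2 mult_left_le)
 qed
 then have "(LINT P|lborel. DK P * indicator ({x..y} \<times> {p..q}) P) = 0"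
  unfolding zero using LIMSEQ_unique tendsto_const by blast
 moreover have "DK P * indicator ({x..y} \<times> {p..q}) P = indicator ({x..y} \<times> {p..q}) P *\<^sub>R D P" for P
 proof -
  define e where "e = 1 / real m"
  have "e > 0" using m0(1) by (simp add: e_def)
  then show ?thesis using x unfolding DK_def K_def e_def[symmetric] by (auto simp: indicator_def)
 qed
 ultimately show ?thesis by (simp add: set_lebesgue_integral_def)
qed

text \<open>The fundamental lemma of the calculus of variations on the half-cylinder. The rectangles
  \<open>B n\<close> exhaust everything except the edge and the seam, which are null.\<close>

lemma cyl_test_zero:
 assumes D: "\<And>a b. 0 < a ==> set_integrable lborel ({a..b} \<times> {0..<2*pi}) (D :: _ => real)"
  and z: "\<And>a b. test_t a ==> test_c b ==> (LINT p:cyl|lborel. D p * (a (fst p) * b (snd p))) = 0"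
 shows "AE p in lM. D p = 0"
proof -
 define B where "B n = {1 / real (Suc n) .. real (Suc n)} \<times> {1 / real (Suc n) .. 2*pi - 1 / real (Suc n)}" for n
 have "AE P in lborel. indicator (B n) P *\<^sub>R D P = 0" for n
 proof (rule box_zero_imp_AE_zero)
  have Bb: "B n \<in> sets borel" unfolding B_def by (intro borel_Times) auto
  have "set_integrable lborel (B n) D"
  proof (rule set_integrable_subset[OF D[of "1 / real (Suc n)" "real (Suc n)"]])
   define e where "e = 1 / real (Suc n)"
   have "e > 0" by (simp add: e_def)
   then show "B n \<subseteq> {1 / real (Suc n) .. real (Suc n)} \<times> {0..<2*pi}"
    unfolding B_def e_def[symmetric] by auto
  qed (use Bb in auto)
  then show "integrable lborel (\<lambda>P. indicator (B n) P *\<^sub>R D P)" by (simp add: set_integrable_def)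
  fix a b :: "real \<times> real"
  define x where "x = max (1 / real (Suc n)) (fst a)"
  define y where "y = min (real (Suc n)) (fst b)"
  define p where "p = max (1 / real (Suc n)) (snd a)"
  define q where "q = min (2*pi - 1 / real (Suc n)) (snd b)"
  have pos: "0 < 1 / real (Suc n)" by simp
  have "cbox a b \<inter> B n = {x..y} \<times> {p..q}"
   by (cases a, cases b) (auto simp: B_def x_def y_def p_def q_def cbox_Pair_eq)
  then have e: "(LINT P:cbox a b|lborel. indicator (B n) P *\<^sub>R D P) = (LINT P:{x..y} \<times> {p..q}|lborel. D P)"
   unfolding set_lebesgue_integral_def by (auto intro!: LINT_cong simp: indicator_inter_arith[symmetric] simp flip: indicator_inter_arith)
  show "(LINT P:cbox a b|lborel. indicator (B n) P *\<^sub>R D P) = 0"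
  proof (cases "x \<le> y \<and> p \<le> q")
   case True
   have "0 < x" "0 < p" "q < 2*pi"
    using pos unfolding x_def p_def q_def less_max_iff_disj min_less_iff_disj by simp_all
   then show ?thesis unfolding e using True by (intro test_box_integral_zero[OF D z]) auto
  next
   case False
   then have em: "{x..y} \<times> {p..q} = {}" by auto
   show ?thesis unfolding e em by (simp add: set_lebesgue_integral_def)
  qed
 qed
 then have "AE P in lborel. \<forall>n. indicator (B n) P *\<^sub>R D P = 0"
  by (rule AE_all_countable[THEN iffD2, OF allI])
 then have "AE P in lborel. P \<in> cyl \<longrightarrow> D P = 0"
  using AE_coordinate(1)[of 0] AE_coordinate(2)[of 0]
 proof eventually_elim
  fix P :: "real \<times> real"
  assume h: "\<forall>n. indicator (B n) P *\<^sub>R D P = 0" "fst P \<noteq> 0" "snd P \<noteq> 0"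
  show "P \<in> cyl \<longrightarrow> D P = 0"
  proof
   assume P: "P \<in> cyl"
   then have pos: "0 < fst P" "0 < snd P" "0 < 2*pi - snd P" using h by (auto simp: cyl_def)
   define r where "r = min (fst P) (min (snd P) (2*pi - snd P))"
   obtain n1 where n1: "1 / real (Suc n1) < r" using reals_Archimedean[of r] pos by (auto simp: r_def inverse_eq_divide)
   obtain n2 :: nat where n2: "fst P < real n2" using reals_Archimedean2 by blast
   define n where "n = max n1 n2"
   have "1 / real (Suc n) \<le> 1 / real (Suc n1)" by (intro divide_left_mono) (auto simp: n_def)
   then have 1: "1 / real (Suc n) < r" using n1 by linarith
   have 2: "fst P < real (Suc n)" using n2 by (simp add: n_def)
   have "P \<in> B n" using 1 2 unfolding B_def r_def mem_Times_iff atLeastAtMost_iff by linarith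
   with h(1)[rule_format, of n] show "D P = 0" by simp
  qed
 qed
 then show ?thesis by (subst AE_restrict_space_iff) auto
qed

section \<open>Product functions on the half-cylinder\<close>

lemma integrable_lM_mult:
 assumes f: "integrable lT (f :: real => real)" and g: "integrable lC (g :: real => real)"
 shows "integrable lM (\<lambda>p. f (fst p) * g (snd p))"
  and "(LINT p|lM. f (fst p) * g (snd p)) = (LINT t|lT. f t) * (LINT s|lC. g s)"
proof -
 note [measurable] = borel_measurable_integrable[OF f] borel_measurable_integrable[OF g]
 have I: "integrable (lT \<Otimes>\<^sub>M lC) (\<lambda>p. f (fst p) * g (snd p))"
 proof (rule lTC.Fubini_integrable)
  show "(\<lambda>p. f (fst p) * g (snd p)) \<in> borel_measurable (lT \<Otimes>\<^sub>M lC)" by measurable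
  have "integrable lT (\<lambda>x. \<bar>f x\<bar> * (LINT y|lC. \<bar>g y\<bar>))"
   by (intro integrable_mult_left integrable_abs f)
  then show "integrable lT (\<lambda>x. LINT y|lC. norm (f (fst (x, y)) * g (snd (x, y))))"
   by (simp add: abs_mult)
  show "AE x in lT. integrable lC (\<lambda>y. f (fst (x, y)) * g (snd (x, y)))"
   using g by (auto intro!: AE_I2)
 qed
 from lTC.integral_fst'[OF I] I show "(LINT p|lM. f (fst p) * g (snd p)) = (LINT t|lT. f t) * (LINT s|lC. g s)"
  "integrable lM (\<lambda>p. f (fst p) * g (snd p))"
  by (simp_all add: lM_pair)
qed

lemma integrable_lT_support:
 assumes "continuous_on UNIV (a :: real => real)" "\<And>t. t > R ==> a t = 0"
 shows "integrable lT a"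
proof -
 have "set_integrable lborel {0..R} a"
  by (rule set_integrable_continuous_Icc) (rule continuous_on_subset[OF assms(1)], simp)
 then show ?thesis unfolding integrable_lT set_integrable_def
  by (rule L1_cong[THEN iffD1, rotated -1])
    (use assms(2) in \<open>auto simp: indicator_def not_le\<close>)
qed

lemma test_t_support: assumes "test_t a" obtains R where "R > 0" "\<And>t. t > R ==> a t = 0"
 using assms unfolding test_t_def
proof (elim conjE exE)
 fix l u assume "0 < l" "\<forall>t. t \<notin> {l..u} \<longrightarrow> a t = 0"
 then show thesis by (intro that[of "max 1 u"]) auto
qed

lemma test_t_integrable: "test_t a ==> integrable lT a"
 by (metis test_t_support integrable_lT_support test_t_continuous)

lemma continuous_bound_circle:
 assumes "continuous_on UNIV (b :: real => real)" obtains B where "\<And>y. y \<in> {0..2*pi} ==> \<bar>b y\<bar> \<le> B" "B \<ge> 0"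
proof -
 have "bounded (b ` {0..2*pi})"
  by (rule compact_imp_bounded[OF compact_continuous_image]) (auto intro: continuous_on_subset[OF assms])
 then obtain B where "\<And>y. y \<in> {0..2*pi} ==> \<bar>b y\<bar> \<le> B" by (force simp: bounded_iff)
 moreover from this[of 0] have "B \<ge> 0" by auto
 ultimately show ?thesis using that by blast
qed

lemma integrable_lC_mult_continuous:
 assumes d: "integrable lC (d :: real => real)" and b: "continuous_on UNIV b"
 shows "integrable lC (\<lambda>y. d y * b y)"
proof -
 obtain B where B: "\<And>y. y \<in> {0..2*pi} ==> \<bar>b y\<bar> \<le> B" "B \<ge> 0" using continuous_bound_circle[OF b] by metis
 have [measurable]: "b \<in> borel_measurable lC"
  using borel_measurable_continuous_onI[OF b] by (simp add: measurable_restrict_space1 measurable_lborel1)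
 note [measurable] = borel_measurable_integrable[OF d]
 show ?thesis
  by (rule L1_bound[OF integrable_mult_left[of B, OF d]])
    (use B in \<open>auto simp: abs_mult space_restrict_space intro!: AE_I2 mult_left_mono\<close>)
qed

lemma AE_lT_const: "(AE t in lT. P) ==> P"
proof -
 have "emeasure lT (space lT) \<noteq> 0"
 proof
  assume "emeasure lT (space lT) = 0"
  then have "emeasure lborel {0::real..} = 0" by (simp add: space_restrict_space emeasure_restrict_space)
  moreover have "emeasure lborel {0..1::real} \<le> emeasure lborel {0::real..}" by (rule emeasure_mono) auto
  ultimately show False by simp
 qed
 then have "ae_filter lT \<noteq> bot" by (simp add: ae_filter_eq_bot_iff)
 then show "(AE t in lT. P) ==> P" by (simp add: eventually_const_iff)
qed

text \<open>Reduction to \<open>cyl_test_zero\<close> for a function that does not depend on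
  \<open>t\<close>; vanishing almost everywhere descends to the circle because the half-line is not
  null.\<close>

lemma circle_test_zero:
 assumes d: "integrable lC (d :: real => real)"
  and z: "\<And>b. test_c b ==> (LINT y|lC. d y * b y) = 0"
 shows "AE y in lC. d y = 0"
proof -
 let ?D = "\<lambda>P. d (snd P)"
 have "AE p in lM. ?D p = 0"
 proof (rule cyl_test_zero)
  fix a b :: real assume a: "0 < a"
  then have "{0..} \<inter> {a..b} = {a..b}" by auto
  then have ii: "integrable lT (indicator {a..b} :: real => real)"
   unfolding integrable_lT set_integrable_def real_scaleR_def indicator_inter_arith[symmetric]
   by (simp add: integrable_indicator_iff emeasure_lborel_Icc_eq)
  show "set_integrable lborel ({a..b} \<times> {0..<2*pi}) ?D"
   using integrable_lM_mult(1)[OF ii d] unfolding integrable_lM set_integrable_def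
   by (rule L1_cong[THEN iffD1, rotated -1]) (use a in \<open>auto simp: indicator_def cyl_def\<close>)
 next
  fix a b assume a: "test_t a" and b: "test_c b"
  have "(LINT p|lM. a (fst p) * (d (snd p) * b (snd p))) = 0"
   using integrable_lM_mult(2)[OF test_t_integrable[OF a] integrable_lC_mult_continuous[OF d test_c_continuous[OF b]]]
   by (simp add: z[OF b])
  then show "(LINT p:cyl|lborel. d (snd p) * (a (fst p) * b (snd p))) = 0"
   by (simp add: integral_lM mult_ac)
 qed
 then have "AE t in lT. AE y in lC. d y = 0"
  using lTC.AE_pair[of "\<lambda>p. d (snd p) = 0"] unfolding lM_pair by simp
 then show ?thesis by (rule AE_lT_const)
qed

lemma smooth_antiderivative:
 assumes "\<And>k. C1k k a"
 obtains A where "\<And>x. (A has_real_derivative a x) (at x)" "\<And>k. C1k k A"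
proof -
 have "continuous_on UNIV a" by (rule C1k_continuous[OF assms])
 then have c: "isCont a x" for x by (simp add: continuous_on_eq_continuous_at)
 obtain A where "\<And>x. - \<infinity> < ereal x ==> ereal x < \<infinity> ==> (A has_vector_derivative a x) (at x)"
  using einterval_antiderivative[of "-\<infinity>" "\<infinity>" a] c by auto
 then have A: "(A has_real_derivative a x) (at x)" for x
  by (simp add: has_real_derivative_iff_has_vector_derivative)
 have "C1k (Suc k) A" for k by (rule C1k_SucI[OF A assms])
 then have "C1k k A" for k using C1k_SucD by blast
 with A that show ?thesis by blast
qed

text \<open>Passing to the closed interval costs only the null point \<open>2 pi\<close> and makes
  \<open>ac_on 0 (2*pi)\<close> applicable on the circle.\<close>

lemma integrable_lC: "integrable lC f \<longleftrightarrow> set_integrable lborel {0..2*pi} (f :: real => real)"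
 unfolding set_integrable_def
 by (subst integrable_restrict_space, simp, rule integrable_discrete_difference[of "{2*pi}"])
   (auto simp: indicator_def)

lemma integral_lC: "(LINT y|lC. f y) = (LINT y:{0..2*pi}|lborel. (f y :: real))"
 unfolding set_lebesgue_integral_def
 by (subst integral_restrict_space, simp, rule integral_discrete_difference[of "{2*pi}"])
   (auto simp: indicator_def)

text \<open>Integrability up to and including the edge, in contrast to the boxes with
  \<open>a > 0\<close> in \<open>has_weak_gradient\<close>. Primitives that start at the edge
  require it; the behaviour for large \<open>t\<close> stays free.\<close>

definition loc_int :: "(real \<times> real => real) => bool" where
 "loc_int f \<longleftrightarrow> f \<in> borel_measurable lM \<and> (\<forall>R. integrable lM (\<lambda>p. indicator {..R} (fst p) * f p))"

lemma loc_int_measurable: "loc_int f ==> f \<in> borel_measurable lM"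
 and loc_int_integrable: "loc_int f ==> integrable lM (\<lambda>p. indicator {..R} (fst p) * f p)"
 by (auto simp: loc_int_def)

lemma loc_int_slice_t:
 assumes "loc_int f" shows "AE y in lC. \<forall>R. set_integrable lborel {0..R} (\<lambda>t. f (t, y))"
proof -
 have "AE y in lC. integrable lT (\<lambda>t. indicator {..real n} t * f (t, y))" for n
  using lTC.AE_integrable_snd[of "\<lambda>t y. indicator {..real n} t * f (t, y)"] loc_int_integrable[OF assms, of "real n"]
  by (simp add: lM_pair split_beta')
 then have "AE y in lC. \<forall>n. integrable lT (\<lambda>t. indicator {..real n} t * f (t, y))"
  by (rule AE_all_countable[THEN iffD2, OF allI])
 then show ?thesis
 proof eventually_elim
  case (elim y)
  show ?case
  proof
   fix R :: real
   obtain n :: nat where n: "R < real n" using reals_Archimedean2 by blast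
   have "set_integrable lborel {0..} (\<lambda>t. indicator {..real n} t * f (t, y))"
    using elim[rule_format, of n] by (simp add: integrable_lT)
   then have "set_integrable lborel {0..R} (\<lambda>t. indicator {..real n} t * f (t, y))"
    by (rule set_integrable_subset) auto
   then show "set_integrable lborel {0..R} (\<lambda>t. f (t, y))"
    by (rule set_integrable_cong[THEN iffD1, rotated -1]) (use n in \<open>auto simp: indicator_def\<close>)
  qed
 qed
qed

lemma loc_int_slice_c:
 assumes "loc_int f" shows "AE t in lT. integrable lC (\<lambda>y. f (t, y))"
proof -
 have "AE t in lT. integrable lC (\<lambda>y. indicator {..real n} t * f (t, y))" for n
  using lTC.AE_integrable_fst[of "\<lambda>t y. indicator {..real n} t * f (t, y)"] loc_int_integrable[OF assms, of "real n"]
  by (simp add: lM_pair split_beta')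
 then have "AE t in lT. \<forall>n. integrable lC (\<lambda>y. indicator {..real n} t * f (t, y))"
  by (rule AE_all_countable[THEN iffD2, OF allI])
 then show ?thesis
 proof eventually_elim
  case (elim t)
  obtain n :: nat where n: "t < real n" using reals_Archimedean2 by blast
  then show ?case using elim[rule_format, of n] by simp
 qed
qed

lemma loc_int_add: "loc_int f ==> loc_int g ==> loc_int (\<lambda>p. f p + g p)"
 unfolding loc_int_def by (auto simp: distrib_left)

lemma loc_int_diff: "loc_int f ==> loc_int g ==> loc_int (\<lambda>p. f p - g p)"
 unfolding loc_int_def by (auto simp: right_diff_distrib)

lemma loc_int_mult_integrable:
 assumes f: "loc_int f" and A: "continuous_on UNIV (A :: real => real)" "\<And>t. t > R ==> A t = 0" and b: "continuous_on UNIV b"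
 shows "integrable lM (\<lambda>p. f p * (A (fst p) * b (snd p)))"
proof -
 obtain B where B: "\<And>y. y \<in> {0..2*pi} ==> \<bar>b y\<bar> \<le> B" "B \<ge> 0" using continuous_bound_circle[OF b] by metis
 have "bounded (A ` {0..R})"
  by (rule compact_imp_bounded[OF compact_continuous_image]) (auto intro: continuous_on_subset[OF A(1)])
 then obtain C0 where C0: "\<And>t. t \<in> {0..R} ==> \<bar>A t\<bar> \<le> C0" by (force simp: bounded_iff)
 define C where "C = max 0 C0"
 have C: "\<bar>A t\<bar> \<le> C" if "t \<ge> 0" for t
  using C0[of t] A(2)[of t] that by (cases "t \<le> R") (auto simp: C_def)
 have C0': "C \<ge> 0" by (simp add: C_def)
 have [measurable]: "(\<lambda>p. A (fst p)) \<in> borel_measurable lM" "(\<lambda>p. b (snd p)) \<in> borel_measurable lM"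
  by (rule borel_measurable_lM_continuous[OF continuous_on_fst_snd(1)[OF A(1)]],
    rule borel_measurable_lM_continuous[OF continuous_on_fst_snd(2)[OF b]])
 note [measurable] = loc_int_measurable[OF f]
 show ?thesis
 proof (rule L1_bound[OF integrable_mult_left[of "C * B", OF loc_int_integrable[OF f, of R]]])
  show "AE p in lM. norm (f p * (A (fst p) * b (snd p))) \<le> norm (indicator {..R} (fst p) * f p * (C * B))"
  proof (rule AE_I2)
   fix p assume "p \<in> space lM"
   then have p: "fst p \<ge> 0" "snd p \<in> {0..2*pi}" by (auto simp: space_restrict_space cyl_def)
   show "norm (f p * (A (fst p) * b (snd p))) \<le> norm (indicator {..R} (fst p) * f p * (C * B))"
   proof (cases "fst p \<le> R")
    case True
    have "\<bar>A (fst p) * b (snd p)\<bar> \<le> C * B" unfolding abs_mult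
     by (rule mult_mono) (use C[OF p(1)] B p C0' in auto)
    then show ?thesis using True C0' B by (simp add: abs_mult[of "f p"] mult_left_mono)
   qed (use A(2) in auto)
  qed
 qed measurable
qed

lemma integrable_lT_set_support:
 assumes "set_integrable lborel {0..R} (a :: real => real)" "\<And>t. t > R ==> a t = 0"
 shows "integrable lT a"
 using assms(1) unfolding integrable_lT set_integrable_def
 by (rule L1_cong[THEN iffD1, rotated -1])
   (use assms(2) in \<open>auto simp: indicator_def not_le\<close>)

section \<open>Primitives along the coordinate lines and weak derivatives\<close>

lemma lT_id [measurable]: "(\<lambda>x. x) \<in> borel_measurable lT"
 using borel_measurable_continuous_onI[OF continuous_on_id] by (simp add: measurable_restrict_space1 measurable_lborel1)
lemma lC_id [measurable]: "(\<lambda>x. x) \<in> borel_measurable lC"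
 using borel_measurable_continuous_onI[OF continuous_on_id] by (simp add: measurable_restrict_space1 measurable_lborel1)

definition prim_t :: "(real \<times> real => real) => real \<times> real => real" where
 "prim_t g p = (LINT s:{0..fst p}|lborel. g (s, snd p))"

definition prim_c :: "(real \<times> real => real) => real \<times> real => real" where
 "prim_c h p = (LINT s:{0..snd p}|lborel. h (fst p, s))"

lemma prim_t_alt: "prim_t g p = (LINT s|lT. of_bool (s \<le> fst p) * g (s, snd p))"
 unfolding prim_t_def set_lebesgue_integral_def
 by (subst integral_restrict_space) (auto intro!: LINT_cong simp: indicator_def)

lemma prim_c_alt: "snd p < 2*pi ==> prim_c h p = (LINT s|lC. of_bool (s \<le> snd p) * h (fst p, s))"
 unfolding prim_c_def set_lebesgue_integral_def
 by (subst integral_restrict_space) (auto intro!: LINT_cong simp: indicator_def)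

text \<open>Joint measurability comes from moving the variable limit of integration into the
  integrand as a factor \<open>of_bool\<close>; what remains is a parametric integral over a fixed
  sigma-finite measure.\<close>

lemma prim_measurable:
 assumes g: "g \<in> borel_measurable lM"
 shows "prim_t g \<in> borel_measurable lM" "prim_c g \<in> borel_measurable lM"
proof -
 have [measurable]: "g \<in> borel_measurable (lT \<Otimes>\<^sub>M lC)" using g by (simp add: lM_pair)
 have f1: "(\<lambda>p. fst p) \<in> borel_measurable (lT \<Otimes>\<^sub>M lC)" by (rule measurable_compose[OF measurable_fst lT_id])
 have f2: "(\<lambda>p. snd p) \<in> borel_measurable (lT \<Otimes>\<^sub>M lC)" by (rule measurable_compose[OF measurable_snd lC_id])
 have "(\<lambda>(p, s). of_bool (s \<le> fst p) * g (s, snd p)) \<in> borel_measurable ((lT \<Otimes>\<^sub>M lC) \<Otimes>\<^sub>M lT)"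
 proof -
  have [measurable]: "(\<lambda>x. snd x) \<in> borel_measurable ((lT \<Otimes>\<^sub>M lC) \<Otimes>\<^sub>M lT)"
   by (rule measurable_compose[OF measurable_snd lT_id])
  have [measurable]: "(\<lambda>x. fst (fst x)) \<in> borel_measurable ((lT \<Otimes>\<^sub>M lC) \<Otimes>\<^sub>M lT)"
   by (rule measurable_compose[OF measurable_fst f1])
  have "(\<lambda>x. (snd x, snd (fst x))) \<in> measurable ((lT \<Otimes>\<^sub>M lC) \<Otimes>\<^sub>M lT) (lT \<Otimes>\<^sub>M lC)"
   by (intro measurable_Pair measurable_snd measurable_compose[OF measurable_fst measurable_snd])
  from measurable_compose[OF this, of g borel]
  have [measurable]: "(\<lambda>x. g (snd x, snd (fst x))) \<in> borel_measurable ((lT \<Otimes>\<^sub>M lC) \<Otimes>\<^sub>M lT)" by simp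
  show ?thesis unfolding split_beta' by measurable
 qed
 from lT.borel_measurable_lebesgue_integral[OF this]
 have "prim_t g \<in> borel_measurable (lT \<Otimes>\<^sub>M lC)" by (simp add: prim_t_alt[abs_def])
 then show "prim_t g \<in> borel_measurable lM" by (simp add: lM_pair)
 have "(\<lambda>(p, s). of_bool (s \<le> snd p) * g (fst p, s)) \<in> borel_measurable ((lT \<Otimes>\<^sub>M lC) \<Otimes>\<^sub>M lC)"
 proof -
  have [measurable]: "(\<lambda>x. snd x) \<in> borel_measurable ((lT \<Otimes>\<^sub>M lC) \<Otimes>\<^sub>M lC)"
   by (rule measurable_compose[OF measurable_snd lC_id])
  have [measurable]: "(\<lambda>x. snd (fst x)) \<in> borel_measurable ((lT \<Otimes>\<^sub>M lC) \<Otimes>\<^sub>M lC)"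
   by (rule measurable_compose[OF measurable_fst f2])
  have "(\<lambda>x. (fst (fst x), snd x)) \<in> measurable ((lT \<Otimes>\<^sub>M lC) \<Otimes>\<^sub>M lC) (lT \<Otimes>\<^sub>M lC)"
   by (intro measurable_Pair measurable_snd measurable_compose[OF measurable_fst measurable_fst])
  from measurable_compose[OF this, of g borel]
  have [measurable]: "(\<lambda>x. g (fst (fst x), snd x)) \<in> borel_measurable ((lT \<Otimes>\<^sub>M lC) \<Otimes>\<^sub>M lC)" by simp
  show ?thesis unfolding split_beta' by measurable
 qed
 from lC.borel_measurable_lebesgue_integral[OF this]
 have "(\<lambda>p. LINT s|lC. of_bool (s \<le> snd p) * g (fst p, s)) \<in> borel_measurable (lT \<Otimes>\<^sub>M lC)" by simp
 then have "(\<lambda>p. LINT s|lC. of_bool (s \<le> snd p) * g (fst p, s)) \<in> borel_measurable lM" by (simp add: lM_pair)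
 then show "prim_c g \<in> borel_measurable lM"
  by (rule measurable_cong[THEN iffD1, rotated]) (auto simp: prim_c_alt space_restrict_space cyl_def)
qed

lemma indicator_lT_integrable: "integrable lT (indicator {..R} :: real => real)"
proof -
 have "set_integrable lborel {0..R} (\<lambda>t. 1 :: real)" by (rule set_integrable_continuous_Icc) simp
 then have "set_integrable lborel {0..R} (indicator {..R} :: real => real)"
  by (rule set_integrable_cong[THEN iffD1, rotated -1]) auto
 then show ?thesis by (rule integrable_lT_set_support) auto
qed

lemma AE_lM_snd: assumes "AE s in lC. Q s" shows "AE p in lM. Q (snd p)"
proof -
 obtain N where N: "N \<in> sets lC" "emeasure lC N = 0" "{x\<in>space lC. \<not> Q x} \<subseteq> N"
  using assms unfolding eventually_ae_filter by auto
 have "AE p in lT \<Otimes>\<^sub>M lC. snd p \<notin> N"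
 proof (rule lTC.AE_pair_measure)
  show "{x \<in> space (lT \<Otimes>\<^sub>M lC). snd x \<notin> N} \<in> sets (lT \<Otimes>\<^sub>M lC)"
   using N(1) by measurable
  have "AE y in lC. y \<notin> N" using N by (auto intro!: AE_not_in)
  then show "AE x in lT. AE y in lC. snd (x, y) \<notin> N" by simp
 qed
 then show ?thesis unfolding lM_pair
  by (rule AE_mp) (use N(3) in \<open>auto intro!: AE_I2 simp: space_restrict_space cyl_def\<close>)
qed

lemma AE_lM_fst: assumes "AE t in lT. Q t" shows "AE p in lM. Q (fst p)"
proof -
 obtain N where N: "N \<in> sets lT" "emeasure lT N = 0" "{x\<in>space lT. \<not> Q x} \<subseteq> N"
  using assms unfolding eventually_ae_filter by auto
 have "AE p in lT \<Otimes>\<^sub>M lC. fst p \<notin> N"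
 proof (rule lTC.AE_pair_measure)
  show "{x \<in> space (lT \<Otimes>\<^sub>M lC). fst x \<notin> N} \<in> sets (lT \<Otimes>\<^sub>M lC)"
   using N(1) by measurable
  have "AE y in lT. y \<notin> N" using N by (auto intro!: AE_not_in)
  then show "AE x in lT. AE y in lC. fst (x, y) \<notin> N" by (rule AE_mp) (auto intro!: AE_I2)
 qed
 then show ?thesis unfolding lM_pair
  by (rule AE_mp) (use N(3) in \<open>auto intro!: AE_I2 simp: space_restrict_space cyl_def\<close>)
qed

text \<open>The predicate need not be measurable. A measurable null cover \<open>N\<close> of the
  exceptional set allows the order of the two slices to be exchanged.\<close>

lemma AE_lM_slices: assumes "AE p in lM. P p"
 shows "AE t in lT. AE y in lC. P (t, y)" "AE y in lC. AE t in lT. P (t, y)"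
proof -
 have 1: "AE p in lT \<Otimes>\<^sub>M lC. P p" using assms by (simp only: lM_pair)
 from lTC.AE_pair[OF this] show "AE t in lT. AE y in lC. P (t, y)" .
 interpret Q: pair_sigma_finite lC lT ..
 obtain N where N: "N \<in> sets (lT \<Otimes>\<^sub>M lC)" "emeasure (lT \<Otimes>\<^sub>M lC) N = 0" "{x\<in>space (lT \<Otimes>\<^sub>M lC). \<not> P x} \<subseteq> N"
  using 1 unfolding eventually_ae_filter by auto
 have "AE t in lT. AE y in lC. (t, y) \<notin> N"
  using lTC.AE_pair[of "\<lambda>p. p \<notin> N"] N by (auto intro: AE_not_in)
 moreover have "{x \<in> space (lT \<Otimes>\<^sub>M lC). (fst x, snd x) \<notin> N} \<in> sets (lT \<Otimes>\<^sub>M lC)"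
  using N(1) by simp
 ultimately have "AE y in lC. AE t in lT. (t, y) \<notin> N"
  using lTC.AE_commute[of "\<lambda>t y. (t, y) \<notin> N"] by simp
 then show "AE y in lC. AE t in lT. P (t, y)"
  using AE_space[of lC]
 proof eventually_elim
  case (elim y)
  show ?case using elim(1) AE_space[of lT]
  proof eventually_elim
   case (elim t)
   have "(t, y) \<in> space (lT \<Otimes>\<^sub>M lC)"
    using elim(2) \<open>y \<in> space lC\<close> unfolding space_pair_measure by blast
   then show ?case using N(3) elim(1) by blast
  qed
 qed
qed

lemma indicator_fst_measurable: "(\<lambda>p. indicator {..R} (fst p) :: real) \<in> borel_measurable lM"
proof -
 have "(\<lambda>p. fst p) \<in> borel_measurable lM" by (rule borel_measurable_lM_continuous) (intro continuous_intros)
 then show ?thesis by measurable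
qed

lemma loc_int_bound:
 assumes F: "F \<in> borel_measurable lM"
  and A: "\<And>R. integrable lT (A R)" and B: "\<And>R. integrable lC (B R)"
  and le: "\<And>R. AE p in lM. fst p \<le> R \<longrightarrow> \<bar>F p\<bar> \<le> A R (fst p) * B R (snd p)"
 shows "loc_int F"
 unfolding loc_int_def
proof (intro conjI allI)
 fix R
 show "integrable lM (\<lambda>p. indicator {..R} (fst p) * F p)"
 proof (rule L1_bound[OF integrable_lM_mult(1)[OF A[of R] B[of R]]])
  show "(\<lambda>p. indicator {..R} (fst p) * F p) \<in> borel_measurable lM"
   using F indicator_fst_measurable by measurable
  show "AE p in lM. norm (indicator {..R} (fst p) * F p) \<le> norm (A R (fst p) * B R (snd p))"
   using le[of R] by eventually_elim (auto simp: indicator_def)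
 qed
qed (rule F)

lemma integral_abs_slices:
 assumes g: "loc_int g"
 shows "integrable lC (\<lambda>y. LINT s|lT. \<bar>indicator {..R} s * g (s, y)\<bar>)"
  and "integrable lT (\<lambda>t. LINT s|lC. \<bar>indicator {..R} t * g (t, s)\<bar>)"
proof -
 have "integrable (lT \<Otimes>\<^sub>M lC) (\<lambda>(s, y). \<bar>indicator {..R} s * g (s, y)\<bar>)"
  using integrable_abs[OF loc_int_integrable[OF g, of R]] by (simp add: lM_pair split_beta')
 from lTC.integrable_snd[OF this] lTC.integrable_fst[OF this]
 show "integrable lC (\<lambda>y. LINT s|lT. \<bar>indicator {..R} s * g (s, y)\<bar>)"
  "integrable lT (\<lambda>t. LINT s|lC. \<bar>indicator {..R} t * g (t, s)\<bar>)" by simp_all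
qed

lemma loc_int_prim_t:
 assumes g: "loc_int g" shows "loc_int (prim_t g)"
proof (rule loc_int_bound)
 show "prim_t g \<in> borel_measurable lM" by (rule prim_measurable[OF loc_int_measurable[OF g]])
 fix R
 define B where "B y = (LINT s|lT. \<bar>indicator {..R} s * g (s, y)\<bar>)" for y
 show "integrable lT (\<lambda>t. indicator {..R} t :: real)" by (rule indicator_lT_integrable)
 show "integrable lC (\<lambda>y. LINT s|lT. \<bar>indicator {..R} s * g (s, y)\<bar>)" by (rule integral_abs_slices[OF g])
 show "AE p in lM. fst p \<le> R \<longrightarrow> \<bar>prim_t g p\<bar> \<le> indicator {..R} (fst p) * (LINT s|lT. \<bar>indicator {..R} s * g (s, snd p)\<bar>)"
  using AE_lM_snd[OF loc_int_slice_t[OF g]]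
 proof eventually_elim
  case (elim p)
  have "set_integrable lborel {0..R} (\<lambda>s. g (s, snd p))" using elim by blast
  then have "set_integrable lborel {0..R} (\<lambda>s. indicator {..R} s * g (s, snd p))"
   by (rule set_integrable_cong[THEN iffD1, rotated -1]) auto
  then have i: "integrable lT (\<lambda>s. indicator {..R} s * g (s, snd p))"
   by (rule integrable_lT_set_support) auto
  show ?case
  proof
   assume p: "fst p \<le> R"
   have "\<bar>prim_t g p\<bar> \<le> (LINT s|lT. \<bar>of_bool (s \<le> fst p) * g (s, snd p)\<bar>)"
    unfolding prim_t_alt using integral_norm_bound[of lT "\<lambda>s. of_bool (s \<le> fst p) * g (s, snd p)"] by simp
   also have "... \<le> (LINT s|lT. \<bar>indicator {..R} s * g (s, snd p)\<bar>)"
   proof (rule Bochner_Integration.integral_mono_AE')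
    show "integrable lT (\<lambda>s. \<bar>indicator {..R} s * g (s, snd p)\<bar>)" by (rule integrable_abs[OF i])
   qed (use p in \<open>auto intro!: AE_I2 simp: indicator_def\<close>)
   finally show "\<bar>prim_t g p\<bar> \<le> indicator {..R} (fst p) * (LINT s|lT. \<bar>indicator {..R} s * g (s, snd p)\<bar>)"
    using p by simp
  qed
 qed
qed

lemma loc_int_prim_c:
 assumes h: "loc_int h" shows "loc_int (prim_c h)"
proof (rule loc_int_bound)
 show "prim_c h \<in> borel_measurable lM" by (rule prim_measurable[OF loc_int_measurable[OF h]])
 fix R
 show "integrable lC (\<lambda>y. 1 :: real)" by simp
 show "integrable lT (\<lambda>t. LINT s|lC. \<bar>indicator {..R} t * h (t, s)\<bar>)" by (rule integral_abs_slices[OF h])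
 show "AE p in lM. fst p \<le> R \<longrightarrow> \<bar>prim_c h p\<bar> \<le> (LINT s|lC. \<bar>indicator {..R} (fst p) * h (fst p, s)\<bar>) * 1"
  using AE_lM_fst[OF loc_int_slice_c[OF h]] AE_space
 proof eventually_elim
  case (elim p)
  then have i: "integrable lC (\<lambda>s. h (fst p, s))" and p2: "snd p < 2*pi"
   by (auto simp: space_restrict_space cyl_def)
  show ?case
  proof
   assume p: "fst p \<le> R"
   have "\<bar>prim_c h p\<bar> \<le> (LINT s|lC. \<bar>of_bool (s \<le> snd p) * h (fst p, s)\<bar>)"
    unfolding prim_c_alt[OF p2] using integral_norm_bound[of lC "\<lambda>s. of_bool (s \<le> snd p) * h (fst p, s)"] by simp
   also have "... \<le> (LINT s|lC. \<bar>h (fst p, s)\<bar>)"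
   proof (rule Bochner_Integration.integral_mono_AE')
    show "integrable lC (\<lambda>s. \<bar>h (fst p, s)\<bar>)" by (rule integrable_abs[OF i])
   qed (auto intro!: AE_I2)
   finally show "\<bar>prim_c h p\<bar> \<le> (LINT s|lC. \<bar>indicator {..R} (fst p) * h (fst p, s)\<bar>) * 1"
    using p by simp
  qed
 qed
qed

lemma loc_int_snd: assumes \<tau>: "integrable lC \<tau>" shows "loc_int (\<lambda>p. \<tau> (snd p))"
proof (rule loc_int_bound[where A="\<lambda>R. indicator {..R}" and B="\<lambda>R y. \<bar>\<tau> y\<bar>"])
 show "(\<lambda>p. \<tau> (snd p)) \<in> borel_measurable lM"
  using measurable_compose[OF measurable_snd[of lT lC] borel_measurable_integrable[OF \<tau>]] by (simp add: lM_pair)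
qed (use \<tau> in \<open>auto intro: indicator_lT_integrable\<close>)

lemma loc_int_set_integrable:
 assumes "loc_int f" and that: "0 \<le> a" shows "set_integrable lborel ({a..b} \<times> {0..<2*pi}) f"
proof -
 have "set_integrable lborel cyl (\<lambda>p. indicator {..b} (fst p) * f p)"
  using loc_int_integrable[OF assms(1)] by (simp add: integrable_lM)
 then have "set_integrable lborel ({a..b} \<times> {0..<2*pi}) (\<lambda>p. indicator {..b} (fst p) * f p)"
  by (rule set_integrable_subset) (use that in \<open>auto simp: cyl_def intro!: borel_Times\<close>)
 then show ?thesis
  by (rule set_integrable_cong[THEN iffD1, rotated -1]) (auto simp: indicator_def)
qed

text \<open>The candidate \<open>F = \<tau> + prim_t g\<close> satisfies the same weak identity,
  line by line through \<open>half_line_FTC\<close>. For a test \<open>\<alpha>\<close>, the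
  antiderivative vanishing for large \<open>t\<close> is a legitimate \<open>A\<close>, in general
  with \<open>A 0\<close> nonzero, which is why the hypothesis carries an edge term. Subtraction
  shows that \<open>f - F\<close> annihilates \<open>\<alpha> b\<close>.\<close>

lemma weak_derivative_t:
 assumes f: "loc_int f" and g: "loc_int g" and \<tau>: "integrable lC \<tau>"
  and weak: "\<And>A A' R b. (\<And>k. C1k k A) ==> (\<And>t. (A has_real_derivative A' t) (at t)) ==> (\<And>k. C1k k A') ==>
    (\<And>t. t > R ==> A t = 0) ==> test_c b ==>
    (LINT p|lM. f p * (A' (fst p) * b (snd p)) + g p * (A (fst p) * b (snd p))) = - A 0 * (LINT z|lC. \<tau> z * b z)"
 shows "AE p in lM. f p = \<tau> (snd p) + prim_t g p"
proof -
 define F where "F p = \<tau> (snd p) + prim_t g p" for p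
 have F: "loc_int F" unfolding F_def[abs_def] by (intro loc_int_add loc_int_snd \<tau> loc_int_prim_t g)
 have "AE p in lM. f p - F p = 0"
 proof (rule cyl_test_zero)
  fix a b :: real assume "0 < a"
  then show "set_integrable lborel ({a..b} \<times> {0..<2*pi}) (\<lambda>p. f p - F p)"
   by (intro loc_int_set_integrable loc_int_diff f F) simp
 next
  fix \<alpha> b assume \<alpha>: "test_t \<alpha>" and b: "test_c b"
  have s\<alpha>: "C1k k \<alpha>" for k using \<alpha> by (auto simp: test_t_def)
  obtain R where R: "R > 0" "\<And>t. t > R ==> \<alpha> t = 0" using test_t_support[OF \<alpha>] by metis
  obtain A0 where A0: "\<And>x. (A0 has_real_derivative \<alpha> x) (at x)" "\<And>k. C1k k A0"
   using smooth_antiderivative[OF s\<alpha>] by metis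
  \<comment> \<open>Normalisation at a point beyond the support of \<open>\<alpha>\<close>: the
    antiderivative is constant there, hence zero from \<open>R\<close> on.\<close>
  define A where "A t = A0 t + - A0 (R + 1)" for t
  have "C1k k A" for k unfolding A_def[abs_def] by (rule C1k_add[OF A0(2) C1k_const])
  then have A: "(A has_real_derivative \<alpha> x) (at x)" "C1k k A" for x k
   unfolding A_def[abs_def] by (auto intro!: derivative_eq_intros A0(1))
  have AR: "A t = 0" if "t > R" for t
  proof -
   have "\<exists>c. \<forall>x\<in>{R<..}. A x = c"
   proof (rule has_field_derivative_zero_constant)
    show "convex {R<..}" by simp
    fix x assume "x \<in> {R<..}"
    then have "(A has_real_derivative 0) (at x)" using A(1)[of x] R(2)[of x] by simp
    then show "(A has_field_derivative 0) (at x within {R<..})" by (rule has_field_derivative_at_within)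
   qed
   moreover have "A (R + 1) = 0" by (simp add: A_def)
   ultimately show ?thesis using that by force
  qed
  note cb = test_c_continuous[OF b] and c\<alpha> = test_t_continuous[OF \<alpha>]
  have cA: "continuous_on UNIV A" by (rule C1k_continuous[OF A(2)])
  have i: "integrable lM (\<lambda>p. f p * (\<alpha> (fst p) * b (snd p)))" "integrable lM (\<lambda>p. F p * (\<alpha> (fst p) * b (snd p)))"
   "integrable lM (\<lambda>p. g p * (A (fst p) * b (snd p)))"
   by (rule loc_int_mult_integrable[OF f c\<alpha> R(2) cb] loc_int_mult_integrable[OF F c\<alpha> R(2) cb]
     loc_int_mult_integrable[OF g cA AR cb]; simp)+
  have "(LINT p|lM. f p * (\<alpha> (fst p) * b (snd p)) + g p * (A (fst p) * b (snd p))) = - A 0 * (LINT z|lC. \<tau> z * b z)"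
   by (rule weak[OF A(2,1) s\<alpha> AR b])
  moreover have "(LINT p|lM. F p * (\<alpha> (fst p) * b (snd p)) + g p * (A (fst p) * b (snd p))) = - A 0 * (LINT z|lC. \<tau> z * b z)"
  proof -
   let ?G = "\<lambda>t z. F (t, z) * (\<alpha> t * b z) + g (t, z) * (A t * b z)"
   have I: "integrable (lT \<Otimes>\<^sub>M lC) (case_prod ?G)"
    using L1_add[OF i(2,3)] by (simp add: lM_pair split_beta')
   have "(LINT p|lM. F p * (\<alpha> (fst p) * b (snd p)) + g p * (A (fst p) * b (snd p))) = (LINT z|lC. LINT t|lT. ?G t z)"
    using lTC.integral_snd[OF I] by (simp add: lM_pair split_beta')
   also have "... = (LINT z|lC. - A 0 * (\<tau> z * b z))"
   proof (rule integral_cong_AE)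
    show "(\<lambda>z. LINT t|lT. ?G t z) \<in> borel_measurable lC"
     by (rule borel_measurable_integrable[OF lTC.integrable_snd[OF I]])
    show "(\<lambda>z. - A 0 * (\<tau> z * b z)) \<in> borel_measurable lC"
     by (intro borel_measurable_times borel_measurable_const borel_measurable_integrable[OF integrable_lC_mult_continuous[OF \<tau> cb]])
    show "AE z in lC. (LINT t|lT. ?G t z) = - A 0 * (\<tau> z * b z)"
     using loc_int_slice_t[OF g]
    proof eventually_elim
     case (elim z)
     have ac: "ac_on 0 R' (\<lambda>t. F (t, z)) (\<lambda>t. g (t, z))" for R'
      by (rule ac_onI) (use elim in \<open>auto simp: F_def prim_t_def set_integral_Icc_self\<close>)
     have acA: "ac_on 0 R' A \<alpha>" for R'
      by (rule ac_on_C1[OF A(1)]) (rule continuous_on_subset[OF c\<alpha>], simp)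
     note y = ac_on_mult[OF ac acA]
     have "(LINT t|lT. g (t, z) * A t + F (t, z) * \<alpha> t) = - (F (0, z) * A 0)"
     proof (rule half_line_FTC[OF y])
      show "integrable lT (\<lambda>t. F (t, z) * A t)"
       by (rule integrable_lT_set_support[OF set_integrable_continuous_Icc[OF ac_on_continuous[OF y]], of R]) (simp add: AR)
      show "integrable lT (\<lambda>t. g (t, z) * A t + F (t, z) * \<alpha> t)"
       by (rule integrable_lT_set_support[OF ac_on_integrable[OF y], of R]) (simp add: AR R)
     qed
     moreover have "F (0, z) = \<tau> z" by (simp add: F_def prim_t_def set_integral_Icc_self)
     moreover have "(LINT t|lT. ?G t z) = (LINT t|lT. b z * (g (t, z) * A t + F (t, z) * \<alpha> t))"
      by (rule LINT_cong) (auto simp: algebra_simps)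
     ultimately show ?case by simp
    qed
   qed
   finally show ?thesis by simp
  qed
  ultimately have "(LINT p|lM. f p * (\<alpha> (fst p) * b (snd p))) = (LINT p|lM. F p * (\<alpha> (fst p) * b (snd p)))"
   unfolding LINT_add[OF i(1,3)] LINT_add[OF i(2,3)] by simp
  then show "(LINT p:cyl|lborel. (f p - F p) * (\<alpha> (fst p) * b (snd p))) = 0"
   using LINT_diff[OF i(1,2)] by (simp add: integral_lM left_diff_distrib)
 qed
 then show ?thesis by eventually_elim (simp add: F_def)
qed

lemma AE_lM_fstD: assumes "AE p in lM. Q (fst p)" shows "AE t in lT. Q t"
proof -
 have "ae_filter lC \<noteq> bot" using measure_lC by (auto simp: ae_filter_eq_bot_iff measure_def)
 with AE_lM_slices(1)[OF assms] show ?thesis by (simp add: eventually_const_iff)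
qed

lemma test_c_const: "test_c (\<lambda>y. c)" by (simp add: test_c_def C1k_const)

text \<open>On the circle an antiderivative is periodic only for mean zero. The constant test
  therefore shows that \<open>h\<close> has vanishing circle means, and tests of mean zero determine
  \<open>f\<close> up to a function of \<open>t\<close> alone, recovered as the circle mean of
  \<open>f - prim_c h\<close>.\<close>

lemma weak_derivative_c:
 assumes f: "loc_int f" and h: "loc_int h"
  and weak: "\<And>a b b'. test_t a ==> test_c b ==> (\<And>y. (b has_real_derivative b' y) (at y)) ==> continuous_on UNIV b' ==>
    (LINT p|lM. f p * (a (fst p) * b' (snd p)) + h p * (a (fst p) * b (snd p))) = 0"
 shows "AE t in lT. (LINT y|lC. h (t, y)) = 0" "\<exists>c. AE p in lM. f p = c (fst p) + prim_c h p"
proof -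
 have fst_lT: "integrable lT (\<lambda>t. LINT y|lC. indicator {..R} t * u (t, y))" if "loc_int u" for u R
  using lTC.integrable_fst[of "\<lambda>t y. indicator {..R} t * u (t, y)"] loc_int_integrable[OF that, of R]
  by (simp add: lM_pair split_beta')
 have mean: "loc_int (\<lambda>p. LINT y|lC. u (fst p, y))" if u: "loc_int u" for u
 proof (rule loc_int_bound[where A="\<lambda>R t. \<bar>LINT y|lC. indicator {..R} t * u (t, y)\<bar>" and B="\<lambda>R y. 1"])
  have "u \<in> borel_measurable (lT \<Otimes>\<^sub>M lC)" using loc_int_measurable[OF u] by (simp add: lM_pair)
  then have "(\<lambda>t. LINT y|lC. u (t, y)) \<in> borel_measurable lT" by (intro lC.borel_measurable_lebesgue_integral) simp
  from measurable_compose[OF measurable_fst this, of lC]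
  show "(\<lambda>p. LINT y|lC. u (fst p, y)) \<in> borel_measurable lM" by (simp add: lM_pair)
 qed (use fst_lT[OF u] in auto)
 have hmean: "AE t in lT. (LINT y|lC. h (t, y)) = 0"
 proof (rule AE_lM_fstD, rule cyl_test_zero)
  fix a b :: real assume "0 < a"
  then show "set_integrable lborel ({a..b} \<times> {0..<2*pi}) (\<lambda>p. LINT y|lC. h (fst p, y))"
   by (intro loc_int_set_integrable mean h) simp
 next
  fix a b assume a: "test_t a" and b: "test_c b"
  obtain R where R: "R > 0" "\<And>t. t > R ==> a t = 0" using test_t_support[OF a] by metis
  note ca = test_t_continuous[OF a] and cb = test_c_continuous[OF b]
  have i: "integrable (lT \<Otimes>\<^sub>M lC) (\<lambda>p. (LINT y|lC. h (fst p, y)) * (a (fst p) * b (snd p)))"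
   using loc_int_mult_integrable[OF mean[OF h] ca R(2) cb] by (simp add: lM_pair)
  have ih: "integrable (lT \<Otimes>\<^sub>M lC) (\<lambda>p. h p * (a (fst p) * 1))"
   using loc_int_mult_integrable[OF h ca R(2), where b="\<lambda>_. 1"] by (simp add: lM_pair)
  have "(LINT p|lM. (LINT y|lC. h (fst p, y)) * (a (fst p) * b (snd p)))
    = (LINT t|lT. LINT y'|lC. (LINT y|lC. h (t, y)) * (a t * b y'))"
   using lTC.integral_fst'[OF i] by (simp add: lM_pair)
  also have "... = (LINT t|lT. (LINT y|lC. b y) * (LINT y|lC. h (t, y) * (a t * 1)))"
   by (simp add: mult_ac)
  also have "... = (LINT y|lC. b y) * (LINT p|lM. h p * (a (fst p) * 1))"
   using lTC.integral_fst'[OF ih] by (simp add: lM_pair)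
  also have "(LINT p|lM. h p * (a (fst p) * 1)) = 0"
   using weak[OF a test_c_const[of 1], of "\<lambda>_. 0"] by simp
  finally show "(LINT p:cyl|lborel. (LINT y|lC. h (fst p, y)) * (a (fst p) * b (snd p))) = 0"
   by (simp add: integral_lM)
 qed
 then show "AE t in lT. (LINT y|lC. h (t, y)) = 0" .
 define H where "H = prim_c h"
 have H: "loc_int H" unfolding H_def by (rule loc_int_prim_c[OF h])
 have fH: "loc_int (\<lambda>p. f p - H p)" by (rule loc_int_diff[OF f H])
 define c where "c t = (1 / (2*pi)) * (LINT y|lC. f (t, y) - H (t, y))" for t
 have locc: "loc_int (\<lambda>p. c (fst p))"
  using mean[OF fH] unfolding loc_int_def c_def
  by (auto simp: mult.left_commute[of _ "1 / (2*pi)"] simp del: mult_1_left times_divide_eq_left)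
 have "AE p in lM. f p - H p - c (fst p) = 0"
 proof (rule cyl_test_zero)
  fix a b :: real assume "0 < a"
  then show "set_integrable lborel ({a..b} \<times> {0..<2*pi}) (\<lambda>p. f p - H p - c (fst p))"
   by (intro loc_int_set_integrable loc_int_diff f H locc) simp
 next
  fix a b assume a: "test_t a" and b: "test_c b"
  obtain R where R: "R > 0" "\<And>t. t > R ==> a t = 0" using test_t_support[OF a] by metis
  note ca = test_t_continuous[OF a] and cb = test_c_continuous[OF b]
  have ib: "integrable lC b" using integrable_lC_mult_continuous[of "\<lambda>_. 1", OF _ cb] by simp
  \<comment> \<open>Removing the mean of the test makes its antiderivative \<open>k\<close> periodic
    and thus a test itself; the removed constant pairs to zero because \<open>f - H - c\<close> has
    circle mean zero.\<close>
  define m where "m = (LINT y|lC. b y) / (2*pi)"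
  define b0 where "b0 y = b y + - m" for y
  have sb0: "C1k k b0" for k
   using b C1k_add[OF _ C1k_const] unfolding b0_def[abs_def] test_c_def by blast
  have cb0: "continuous_on UNIV b0" by (rule C1k_continuous[OF sb0])
  have ib0: "(LINT y|lC. b0 y) = 0"
   unfolding b0_def using ib measure_lC by (simp add: m_def)
  obtain k where k: "\<And>x. (k has_real_derivative b0 x) (at x)" "\<And>n. C1k n k"
   using smooth_antiderivative[OF sb0] by metis
  have ack: "ac_on 0 (2*pi) k b0" by (rule ac_on_C1[OF k(1)]) (rule continuous_on_subset[OF cb0], simp)
  have k2: "k (2*pi) = k 0" using ac_on_FTC[OF ack] ib0 by (simp add: integral_lC)
  have tk: "test_c k"
   unfolding test_c_def
  proof (intro conjI allI)
   show "C1k n k" for n by (rule k(2))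
   fix y
   have "((\<lambda>x. k (x + 2*pi) - k x) has_real_derivative 0) (at x)" for x
   proof -
    have "b0 (x + 2*pi) = b0 x" using b by (simp add: b0_def test_c_def)
    then show ?thesis using DERIV_diff[OF DERIV_shift[THEN iffD1, OF k(1)[of "x + 2*pi"]] k(1)[of x]] by simp
   qed
   then have "k (y + 2*pi) - k y = k (0 + 2*pi) - k 0"
    using DERIV_isconst_all[of "\<lambda>x. k (x + 2*pi) - k x"] by blast
   then show "k (y + 2*pi) = k y" using k2 by simp
  qed
  note ck = test_c_continuous[OF tk]
  have i: "integrable (lT \<Otimes>\<^sub>M lC) (\<lambda>p. (f p - H p - c (fst p)) * (a (fst p) * b (snd p)))"
   using loc_int_mult_integrable[OF loc_int_diff[OF fH locc] ca R(2) cb] by (simp add: lM_pair)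
  have i2: "integrable (lT \<Otimes>\<^sub>M lC) (\<lambda>p. f p * (a (fst p) * b0 (snd p)) + h p * (a (fst p) * k (snd p)))"
   using L1_add[OF loc_int_mult_integrable[OF f ca R(2) cb0] loc_int_mult_integrable[OF h ca R(2) ck]]
   by (simp add: lM_pair)
  have "(LINT p|lM. (f p - H p - c (fst p)) * (a (fst p) * b (snd p)))
   = (LINT t|lT. LINT y|lC. (f (t, y) - H (t, y) - c t) * (a t * b y))"
   using lTC.integral_fst'[OF i] by (simp add: lM_pair)
  also have "... = (LINT t|lT. LINT y|lC. f (t, y) * (a t * b0 y) + h (t, y) * (a t * k y))"
  proof (rule integral_cong_AE)
   show "(\<lambda>t. LINT y|lC. (f (t, y) - H (t, y) - c t) * (a t * b y)) \<in> borel_measurable lT"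
    using borel_measurable_integrable[OF lTC.integrable_fst'[OF i]] by simp
   show "(\<lambda>t. LINT y|lC. f (t, y) * (a t * b0 y) + h (t, y) * (a t * k y)) \<in> borel_measurable lT"
    using borel_measurable_integrable[OF lTC.integrable_fst'[OF i2]] by simp
   show "AE t in lT. (LINT y|lC. (f (t, y) - H (t, y) - c t) * (a t * b y))
     = (LINT y|lC. f (t, y) * (a t * b0 y) + h (t, y) * (a t * k y))"
    using loc_int_slice_c[OF f] loc_int_slice_c[OF H] loc_int_slice_c[OF h] hmean
   proof eventually_elim
    case (elim t)
    have acH: "ac_on 0 (2*pi) (\<lambda>y. H (t, y)) (\<lambda>y. h (t, y))"
    proof (rule ac_onI)
     have i0: "set_integrable lborel {0..2*pi} (\<lambda>y. h (t, y))" using elim(3) by (simp add: integrable_lC)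
     then show "set_integrable lborel {0..2*pi} (\<lambda>y. h (t, y))" .
    qed (simp add: H_def prim_c_def set_integral_Icc_self)
    have Hend: "H (t, 0) = 0" "H (t, 2*pi) = 0"
     using elim(4) by (auto simp: H_def prim_c_def set_integral_Icc_self integral_lC)
    have Hk: "(LINT y|lC. h (t, y) * k y + H (t, y) * b0 y) = 0"
     using ac_on_FTC[OF ac_on_mult[OF acH ack]] Hend by (simp add: integral_lC)
    note j = integrable_lC_mult_continuous[OF elim(1) cb0] integrable_lC_mult_continuous[OF elim(2) cb0]
     integrable_lC_mult_continuous[OF elim(3) ck]
    have d0: "(LINT y|lC. f (t, y) - H (t, y) - c t) = 0"
     using elim(1,2) measure_lC by (simp add: c_def)
    have id: "integrable lC (\<lambda>y. f (t, y) - H (t, y) - c t)" using elim(1,2) by auto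
    have "(LINT y|lC. (f (t, y) - H (t, y) - c t) * b y)
      = (LINT y|lC. (f (t, y) * b0 y - H (t, y) * b0 y) - c t * b0 y + m * (f (t, y) - H (t, y) - c t))"
     by (rule LINT_cong) (auto simp: b0_def algebra_simps)
    also have "... = (LINT y|lC. f (t, y) * b0 y) - (LINT y|lC. H (t, y) * b0 y)"
    proof -
     have ib0': "integrable lC b0" using integrable_lC_mult_continuous[of "\<lambda>_. 1", OF _ cb0] by simp
     show ?thesis
      unfolding LINT_add[OF L1_diff[OF L1_diff[OF j(1,2)] integrable_mult_right[OF ib0']] integrable_mult_right[OF id]]
       LINT_diff[OF L1_diff[OF j(1,2)] integrable_mult_right[OF ib0']]
       LINT_diff[OF j(1,2)] integral_mult_right_zero d0 ib0 by simp
    qed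
    also have "... = (LINT y|lC. f (t, y) * b0 y) + (LINT y|lC. h (t, y) * k y)"
     using Hk LINT_add[OF j(3,2)] by simp
    also have "... = (LINT y|lC. f (t, y) * b0 y + h (t, y) * k y)"
     by (rule LINT_add[OF j(1,3), symmetric])
    finally have "a t * (LINT y|lC. (f (t, y) - H (t, y) - c t) * b y) = a t * (LINT y|lC. f (t, y) * b0 y + h (t, y) * k y)"
     by simp
    then show ?case
     unfolding integral_mult_right_zero[symmetric] by (simp only: mult_ac distrib_left)
   qed
  qed
  also have "... = (LINT p|lM. f p * (a (fst p) * b0 (snd p)) + h p * (a (fst p) * k (snd p)))"
   using lTC.integral_fst'[OF i2] by (simp add: lM_pair)
  also have "... = 0" by (rule weak[OF a tk k(1) cb0])
  finally show "(LINT p:cyl|lborel. (f p - H p - c (fst p)) * (a (fst p) * b (snd p))) = 0"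
   by (simp add: integral_lM)
 qed
 then show "\<exists>c. AE p in lM. f p = c (fst p) + prim_c h p"
  by (intro exI[of _ c]) (auto simp: H_def elim!: eventually_mono)
qed

section \<open>Geometry of the faces\<close>

text \<open>The parameters are isothermal: the coordinate vectors are orthogonal with common squared
  length \<open>conf\<close>, which is thus at once the conformal factor of the metric and the area
  density.\<close>

definition conf :: "real => 3 => real => real" where
 "conf c i t = (Y_scale c i * cosh (t + Y_shift i))^2"

lemma conf_pos: "c > 0 ==> conf c i t > 0"
 using Y_scale_pos[of c i] cosh_real_pos[of "t + Y_shift i"] by (simp add: conf_def)

lemma inner_vector_3: "(vector [a, b, c] :: real^3) \<bullet> vector [a', b', c'] = a * a' + b * b' + c * c'"
 by (simp add: inner_vec_def sum_3)

lemma Y_sign_sq: "Y_sign i * Y_sign i = 1"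
 by (simp add: Y_sign_def)

lemma pd_inner:
 "pd 1 (Y_surface c i) p \<bullet> pd 1 (Y_surface c i) p = conf c i (fst p)"
 "pd 2 (Y_surface c i) p \<bullet> pd 2 (Y_surface c i) p = conf c i (fst p)"
 "pd 1 (Y_surface c i) p \<bullet> pd 2 (Y_surface c i) p = 0"
 "pd 2 (Y_surface c i) p \<bullet> pd 1 (Y_surface c i) p = 0"
proof -
 obtain t y where p: "p = (t, y)" by (cases p)
 let ?S = "sinh (t + Y_shift i)" and ?C = "cosh (t + Y_shift i)" and ?r = "Y_scale c i"
 have h: "?C * ?C = ?S * ?S + 1" using hyperbolic_pythagoras[of "t + Y_shift i"] by (simp add: power2_eq_square)
 have g: "cos y * cos y + sin y * sin y = 1" using sin_cos_squared_add[of y] by (simp add: power2_eq_square)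
 have e: "pd 1 (Y_surface c i) p \<bullet> pd 1 (Y_surface c i) p
   = ?r * ?r * (?S * ?S * (cos y * cos y + sin y * sin y) + Y_sign i * Y_sign i)"
  "pd 2 (Y_surface c i) p \<bullet> pd 2 (Y_surface c i) p
   = ?r * ?r * (?C * ?C * (cos y * cos y + sin y * sin y))"
  unfolding p pd_Y_surface inner_scaleR_left inner_scaleR_right inner_vector_3 by algebra+
 show "pd 1 (Y_surface c i) p \<bullet> pd 1 (Y_surface c i) p = conf c i (fst p)"
  unfolding e(1) g Y_sign_sq by (simp add: conf_def p power2_eq_square h[symmetric] mult_ac)
 show "pd 2 (Y_surface c i) p \<bullet> pd 2 (Y_surface c i) p = conf c i (fst p)"
  unfolding e(2) g by (simp add: conf_def p power2_eq_square mult_ac)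
 show 3: "pd 1 (Y_surface c i) p \<bullet> pd 2 (Y_surface c i) p = 0"
  unfolding p pd_Y_surface inner_scaleR_left inner_scaleR_right inner_vector_3 by algebra
 then show "pd 2 (Y_surface c i) p \<bullet> pd 1 (Y_surface c i) p = 0" by (simp add: inner_commute)
qed

lemma cross_Y:
 "cross3 (pd 1 (Y_surface c i) (t, y)) (pd 2 (Y_surface c i) (t, y)) = ((Y_scale c i)^2 * cosh (t + Y_shift i)) *\<^sub>R
   vector [- Y_sign i * cos y, - Y_sign i * sin y, sinh (t + Y_shift i)]"
proof -
 have g: "cos y * cos y + sin y * sin y = 1" using sin_cos_squared_add[of y] by (simp add: power2_eq_square)
 show ?thesis
  unfolding pd_Y_surface cross3_def
  by (simp add: vec_eq_iff forall_3 power2_eq_square algebra_simps) (use g in algebra)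
qed

lemma norm_normal_vector: "norm (vector [- (Y_sign i * cos y), - (Y_sign i * sin y), sinh s] :: real^3) = cosh s"
proof -
 have "(vector [- (Y_sign i * cos y), - (Y_sign i * sin y), sinh s] :: real^3) \<bullet> vector [- (Y_sign i * cos y), - (Y_sign i * sin y), sinh s]
   = (Y_sign i * Y_sign i) * (cos y * cos y + sin y * sin y) + sinh s * sinh s"
  unfolding inner_vector_3 by algebra
 also have "... = (cosh s)^2"
  using hyperbolic_pythagoras[of s] sin_cos_squared_add[of y] by (simp add: Y_sign_sq power2_eq_square)
 finally show ?thesis by (simp add: norm_eq_sqrt_inner)
qed

lemma norm_cross_Y: "c > 0 ==> norm (cross3 (pd 1 (Y_surface c i) p) (pd 2 (Y_surface c i) p)) = conf c i (fst p)"
 by (cases p) (simp add: cross_Y norm_normal_vector conf_def power2_eq_square)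

lemma pd_pd_Y:
 "pd 1 (pd 1 (Y_surface c i)) (t, y) = Y_scale c i *\<^sub>R vector [cosh (t + Y_shift i) * cos y, cosh (t + Y_shift i) * sin y, 0]"
 "pd 1 (pd 2 (Y_surface c i)) (t, y) = Y_scale c i *\<^sub>R vector [- sinh (t + Y_shift i) * sin y, sinh (t + Y_shift i) * cos y, 0]"
 "pd 2 (pd 1 (Y_surface c i)) (t, y) = Y_scale c i *\<^sub>R vector [- sinh (t + Y_shift i) * sin y, sinh (t + Y_shift i) * cos y, 0]"
 "pd 2 (pd 2 (Y_surface c i)) (t, y) = Y_scale c i *\<^sub>R vector [- cosh (t + Y_shift i) * cos y, - cosh (t + Y_shift i) * sin y, 0]"
proof -
 note r = vector_derivative_at has_vector_derivative_scaleR[OF DERIV_const, simplified] has_vector_derivative_vector_3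
 show "pd 1 (pd 1 (Y_surface c i)) (t, y) = Y_scale c i *\<^sub>R vector [cosh (t + Y_shift i) * cos y, cosh (t + Y_shift i) * sin y, 0]"
  unfolding pd_def[of 1 "pd 1 (Y_surface c i)"] pd_Y_surface fst_conv snd_conv
  by (simp, rule vector_derivative_at, rule has_vector_derivative_scaleR[OF DERIV_const, simplified], rule has_vector_derivative_vector_3)
    (auto intro!: derivative_eq_intros)
 show "pd 1 (pd 2 (Y_surface c i)) (t, y) = Y_scale c i *\<^sub>R vector [- sinh (t + Y_shift i) * sin y, sinh (t + Y_shift i) * cos y, 0]"
  unfolding pd_def[of 1 "pd 2 (Y_surface c i)"] pd_Y_surface fst_conv snd_conv
  by (simp, rule vector_derivative_at, rule has_vector_derivative_scaleR[OF DERIV_const, simplified], rule has_vector_derivative_vector_3)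
    (auto intro!: derivative_eq_intros)
 show "pd 2 (pd 1 (Y_surface c i)) (t, y) = Y_scale c i *\<^sub>R vector [- sinh (t + Y_shift i) * sin y, sinh (t + Y_shift i) * cos y, 0]"
  unfolding pd_def[of 2 "pd 1 (Y_surface c i)"] pd_Y_surface fst_conv snd_conv
  by (simp, rule vector_derivative_at, rule has_vector_derivative_scaleR[OF DERIV_const, simplified], rule has_vector_derivative_vector_3)
    (auto intro!: derivative_eq_intros)
 show "pd 2 (pd 2 (Y_surface c i)) (t, y) = Y_scale c i *\<^sub>R vector [- cosh (t + Y_shift i) * cos y, - cosh (t + Y_shift i) * sin y, 0]"
  unfolding pd_def[of 2 "pd 2 (Y_surface c i)"] pd_Y_surface fst_conv snd_conv
  by (simp, rule vector_derivative_at, rule has_vector_derivative_scaleR[OF DERIV_const, simplified], rule has_vector_derivative_vector_3)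
    (auto intro!: derivative_eq_intros)
qed

lemma matrix_inv_scalar:
 fixes A :: "real^2^2"
 assumes "e \<noteq> 0" "\<And>a b. A $ a $ b = (if a = b then e else 0)"
 shows "matrix_inv A $ a $ b = (if a = b then 1 / e else 0)"
proof -
 define B :: "real^2^2" where "B = (\<chi> a b. if a = b then 1 / e else 0)"
 have mult: "(A ** M) $ a $ b = e * M $ a $ b" "(M ** A) $ a $ b = e * M $ a $ b" for M a b
  unfolding matrix_matrix_mult_def by (simp_all add: assms(2) if_distrib[of "\<lambda>x. x * _"] if_distrib[of "\<lambda>x. _ * x"] cong: if_cong)
 have "A ** B = mat 1 \<and> B ** A = mat 1"
  using assms(1) by (simp add: vec_eq_iff mult B_def mat_def)
 then have "A ** matrix_inv A = mat 1"
  unfolding matrix_inv_def by (rule someI2) simp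
 then have "e * matrix_inv A $ a $ b = (mat 1 :: real^2^2) $ a $ b" by (simp flip: mult)
 then show ?thesis using assms(1) by (auto simp: mat_def field_simps split: if_splits)
qed

text \<open>In these parameters the second fundamental form of the catenoid is, up to sign, the
  constant matrix with diagonal \<open>- r\<close>, \<open>r\<close>, so
  \<open>|A|^2 = 2 r^2 / conf^2\<close>. Multiplication by the area density leaves
  \<open>2 sech^2\<close>, free of the scale.\<close>

lemma second_ff_norm_sq_Y:
 assumes c: "c > 0"
 shows "second_ff_norm_sq (Y_surface c i) p * conf c i (fst p) = 2 * (sech (fst p + Y_shift i))^2"
proof -
 obtain t y where p: "p = (t, y)" by (cases p)
 define s where "s = t + Y_shift i"
 define r where "r = Y_scale c i"
 have r: "r > 0" using Y_scale_pos[OF c] by (simp add: r_def)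
 have C: "cosh s > 0" by simp
 define e where "e = conf c i t"
 have e: "e = r^2 * (cosh s)^2" by (simp add: e_def conf_def r_def s_def power_mult_distrib)
 have e0: "e > 0" using conf_pos[OF c] by (simp add: e_def)
 have ff: "first_ff (Y_surface c i) p $ a $ b = (if a = b then e else 0)" for a b
  unfolding first_ff_def e_def using exhaust_2[of a] exhaust_2[of b] by (auto simp: pd_inner p)
 have g: "matrix_inv (first_ff (Y_surface c i) p) $ a $ b = (if a = b then 1 / e else 0)" for a b
  by (rule matrix_inv_scalar) (use e0 ff in auto)
 have n: "unit_normal (Y_surface c i) p = (1 / cosh s) *\<^sub>R vector [- Y_sign i * cos y, - Y_sign i * sin y, sinh s]"
 proof -
  have "unit_normal (Y_surface c i) p = sgn ((r^2 * cosh s) *\<^sub>R (vector [- Y_sign i * cos y, - Y_sign i * sin y, sinh s] :: real^3))"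
   by (simp add: unit_normal_def p cross_Y r_def s_def)
  also have "... = sgn (vector [- Y_sign i * cos y, - Y_sign i * sin y, sinh s] :: real^3)"
   using r C by (simp add: sgn_scaleR)
  finally show ?thesis by (simp add: sgn_div_norm norm_normal_vector inverse_eq_divide)
 qed
 note n' = n[unfolded p]
 have trig: "cos y * cos y + sin y * sin y = 1" using sin_cos_squared_add[of y] by (simp add: power2_eq_square)
 have h11: "second_ff (Y_surface c i) p $ 1 $ 1 = - r * Y_sign i"
 proof -
  have "second_ff (Y_surface c i) p $ 1 $ 1 = r * (1 / cosh s) * cosh s * (- Y_sign i) * (cos y * cos y + sin y * sin y)"
   unfolding second_ff_def vec_lambda_beta p n' pd_pd_Y inner_scaleR_left inner_scaleR_right inner_vector_3 r_def s_def
   by algebra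
  then show ?thesis unfolding trig using C by simp
 qed
 have h22: "second_ff (Y_surface c i) p $ 2 $ 2 = r * Y_sign i"
 proof -
  have "second_ff (Y_surface c i) p $ 2 $ 2 = r * (1 / cosh s) * cosh s * Y_sign i * (cos y * cos y + sin y * sin y)"
   unfolding second_ff_def vec_lambda_beta p n' pd_pd_Y inner_scaleR_left inner_scaleR_right inner_vector_3 r_def s_def
   by algebra
  then show ?thesis unfolding trig using C by simp
 qed
 have h12: "second_ff (Y_surface c i) p $ 1 $ 2 = 0" "second_ff (Y_surface c i) p $ 2 $ 1 = 0"
  unfolding second_ff_def vec_lambda_beta p n' pd_pd_Y inner_scaleR_left inner_scaleR_right inner_vector_3
  by algebra+
 have "second_ff_norm_sq (Y_surface c i) p = (1 / e) * (1 / e) * (r * r * (Y_sign i * Y_sign i)) * 2"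
  unfolding second_ff_norm_sq_def Let_def sum_2 g h11 h22 h12 by simp
 also have "... = 2 * r^2 / (e * e)" by (simp add: Y_sign_sq power2_eq_square)
 finally have "second_ff_norm_sq (Y_surface c i) p * e = 2 * r^2 / e" using e0 by simp
 also have "... = 2 * (sech s)^2" using r C by (simp add: e sech_def power_divide field_simps)
 finally show ?thesis by (simp add: e_def s_def p)
qed

lemma area_Y: "c > 0 ==> area (Y_surface c i) = density lM (\<lambda>p. ennreal (conf c i (fst p)))"
 by (simp add: area_def norm_cross_Y)

lemma conf_continuous: "continuous_on UNIV (conf c i)"
 unfolding conf_def[abs_def] by (intro continuous_intros)

lemma conf_measurable: "(\<lambda>p. conf c i (fst p)) \<in> borel_measurable lM"
 by (rule borel_measurable_lM_continuous[OF continuous_on_fst_snd(1)[OF conf_continuous]])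

lemma AE_area: "c > 0 ==> (AE p in area (Y_surface c i). P p) \<longleftrightarrow> (AE p in lM. P p)"
proof -
 assume c: "c > 0"
 show ?thesis unfolding area_Y[OF c]
  by (subst AE_density) (use conf_measurable[of c i] conf_pos[OF c] in auto)
qed

lemma measurable_area: "c > 0 ==> borel_measurable (area (Y_surface c i)) = borel_measurable lM"
 by (rule measurable_cong_sets) (simp_all add: area_Y)

lemma integrable_area:
 fixes f :: "real \<times> real => real"
 assumes "c > 0" "f \<in> borel_measurable lM"
 shows "integrable (area (Y_surface c i)) f \<longleftrightarrow> integrable lM (\<lambda>p. conf c i (fst p) * f p)"
 using integrable_density[OF assms(2) conf_measurable[of c i]] conf_pos[OF assms(1)]
 by (simp add: area_Y assms(1) less_imp_le)

lemma integral_area: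
 fixes f :: "real \<times> real => real"
 assumes "c > 0" "f \<in> borel_measurable lM"
 shows "(LINT p|area (Y_surface c i). f p) = (LINT p|lM. conf c i (fst p) * f p)"
 using integral_density[OF assms(2) conf_measurable[of c i]] conf_pos[OF assms(1)]
 by (simp add: area_Y assms(1) less_imp_le)

text \<open>The coordinate vectors are orthogonal of squared length \<open>conf\<close>, so for a
  tangent \<open>G\<close> the pairing with any \<open>H\<close> is read off from the coordinate
  components; the factor \<open>conf\<close> is supplied by the area density in every
  integral.\<close>

lemma tangent_inner:
 assumes c: "c > 0" and G: "G \<in> span {pd 1 (Y_surface c i) p, pd 2 (Y_surface c i) p}"
 shows "G \<bullet> H * conf c i (fst p) = (G \<bullet> pd 1 (Y_surface c i) p) * (H \<bullet> pd 1 (Y_surface c i) p)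
   + (G \<bullet> pd 2 (Y_surface c i) p) * (H \<bullet> pd 2 (Y_surface c i) p)"
proof -
 let ?X1 = "pd 1 (Y_surface c i) p" and ?X2 = "pd 2 (Y_surface c i) p"
 obtain a b where "G = a *\<^sub>R ?X1 + b *\<^sub>R ?X2"
  using G by (auto simp: span_insert span_empty) (metis add.commute diff_add_cancel)
 then show ?thesis
  by (simp add: inner_left_distrib pd_inner inner_commute[of ?X1 H] inner_commute[of ?X2 H] algebra_simps)
qed

section \<open>Weak gradients and traces in coordinates\<close>

lemma continuous_on_vector_3:
 fixes f g h :: "'a::topological_space => real"
 assumes "continuous_on S f" "continuous_on S g" "continuous_on S h"
 shows "continuous_on S (\<lambda>x. vector [f x, g x, h x] :: real^3)"
proof -
 have v: "(vector [a, b, c] :: real^3) = a *\<^sub>R axis 1 1 + b *\<^sub>R axis 2 1 + c *\<^sub>R axis 3 1" for a b c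
  by (simp add: vec_eq_iff forall_3 axis_def)
 show ?thesis unfolding v by (intro continuous_intros assms)
qed

lemma pd_continuous: "continuous_on UNIV (pd j (Y_surface c i))"
proof -
 have 1: "pd 1 (Y_surface c i) = (\<lambda>p. Y_scale c i *\<^sub>R
   vector [sinh (fst p + Y_shift i) * cos (snd p), sinh (fst p + Y_shift i) * sin (snd p), Y_sign i])"
  and 2: "pd 2 (Y_surface c i) = (\<lambda>p. Y_scale c i *\<^sub>R
   vector [- cosh (fst p + Y_shift i) * sin (snd p), cosh (fst p + Y_shift i) * cos (snd p), 0])"
  by (auto simp: fun_eq_iff pd_Y_surface)
 have "continuous_on UNIV (pd 1 (Y_surface c i))" "continuous_on UNIV (pd 2 (Y_surface c i))"
  unfolding 1 2 by (intro continuous_intros continuous_on_vector_3)+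
 then show ?thesis using exhaust_2[of j] by auto
qed

lemma surface_continuous: "continuous_on UNIV (Y_surface c i)"
 unfolding Y_surface_def split_beta' by (intro continuous_intros continuous_on_vector_3)

lemma borel_measurable_lM_cont: "continuous_on UNIV f ==> f \<in> borel_measurable lM"
 using borel_measurable_continuous_onI[of f] by (simp add: measurable_restrict_space1 measurable_lborel1)

lemma pd_measurable: "pd j (Y_surface c i) \<in> borel_measurable lM"
 by (rule borel_measurable_lM_cont[OF pd_continuous])

lemma set_integrable_box_cont:
 fixes w :: "real \<times> real => 'a::euclidean_space"
 assumes "continuous_on UNIV w"
 shows "set_integrable lborel ({a..b} \<times> {0..<2*pi}) w"
proof -
 have "set_integrable lborel (cbox (a, 0) (b, 2*pi)) w"
  unfolding set_integrable_def by (rule borel_integrable_compact) (auto intro: continuous_on_subset[OF assms])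
 then show ?thesis
  by (rule set_integrable_subset) (auto simp: cbox_Pair_eq intro!: borel_Times)
qed

lemma lM_integrable_cont:
 fixes w :: "real \<times> real => real"
 assumes "continuous_on UNIV w" "\<And>p. p \<in> cyl ==> fst p > R ==> w p = 0"
 shows "integrable lM w"
 using set_integrable_box_cont[OF assms(1), of 0 R] unfolding integrable_lM set_integrable_def
proof (rule L1_cong[THEN iffD1, rotated -1])
 fix p :: "real \<times> real"
 show "indicator ({0..R} \<times> {0..<2*pi}) p *\<^sub>R w p = indicator cyl p *\<^sub>R w p"
  by (cases "p \<in> cyl \<and> fst p > R"; cases p) (use assms(2)[of p] in \<open>auto simp: indicator_def cyl_def\<close>)
qed simp

lemma Ck1_slices:
 assumes "Ck 1 z"
 shows "((\<lambda>t. z (t, y)) has_real_derivative pd 1 z (t, y)) (at t)"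
  "((\<lambda>y. z (t, y)) has_real_derivative pd 2 z (t, y)) (at y)"
  "continuous_on UNIV (pd 1 z)" "continuous_on UNIV (pd 2 z)" "continuous_on UNIV z"
proof -
 have C: "z differentiable_on UNIV" "continuous_on UNIV (pd 1 z)" "continuous_on UNIV (pd 2 z)"
  using assms by auto
 show "continuous_on UNIV (pd 1 z)" "continuous_on UNIV (pd 2 z)" "continuous_on UNIV z"
  using C differentiable_imp_continuous_on by auto
 have d: "z differentiable at (t, y)" using C(1) by (simp add: differentiable_on_def)
 have "(\<lambda>t. z (t, y)) differentiable at t"
  using differentiable_chain_at[of "\<lambda>t. (t, y)" t z] d by (simp add: differentiable_Pair o_def)
 then show "((\<lambda>t. z (t, y)) has_real_derivative pd 1 z (t, y)) (at t)"
  by (simp add: pd_def has_real_derivative_iff_has_vector_derivative vector_derivative_works)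
 have "(\<lambda>y. z (t, y)) differentiable at y"
  using differentiable_chain_at[of "\<lambda>y. (t, y)" y z] d by (simp add: differentiable_Pair o_def)
 then show "((\<lambda>y. z (t, y)) has_real_derivative pd 2 z (t, y)) (at y)"
  by (simp add: pd_def has_real_derivative_iff_has_vector_derivative vector_derivative_works)
qed

lemma continuous_slices:
 assumes "continuous_on UNIV (w :: real \<times> real => real)"
 shows "continuous_on UNIV (\<lambda>t. w (t, y))" "continuous_on UNIV (\<lambda>y. w (t, y))"
 by (rule continuous_on_compose2[OF assms]; auto intro!: continuous_intros)+

text \<open>The integrand is the \<open>t\<close>-derivative of \<open>a z\<close> times
  \<open>k\<close>, so each line contributes only its value at the edge.\<close>

lemma Ck1_integral_t:
 assumes z: "Ck 1 z" and a: "\<And>t. (a has_real_derivative a' t) (at t)" "continuous_on UNIV a'"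
  and k: "continuous_on UNIV k" and supp: "\<And>t x. t > R ==> a t * z (t, x) = 0"
   "\<And>t x. t > R ==> a t * pd 1 z (t, x) + a' t * z (t, x) = 0"
 shows "(LINT p|lM. (a (fst p) * pd 1 z p + a' (fst p) * z p) * k (snd p)) = - a 0 * (LINT x|lC. z (0, x) * k x)"
proof -
 note zs = Ck1_slices[OF z]
 have ca: "continuous_on UNIV a" using a(1) by (meson DERIV_isCont continuous_at_imp_continuous_on)
 let ?w = "\<lambda>p. (a (fst p) * pd 1 z p + a' (fst p) * z p) * k (snd p)"
 have i: "integrable (lT \<Otimes>\<^sub>M lC) (case_prod (\<lambda>t x. ?w (t, x)))"
 proof -
  have "integrable lM ?w"
   by (rule lM_integrable_cont[of _ R])
     (use supp in \<open>auto intro!: continuous_on_mult continuous_on_add zs(3,5) continuous_on_fst_snd ca a(2) k\<close>)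
  then show ?thesis by (simp add: lM_pair split_beta')
 qed
 have "(LINT p|lM. ?w p) = (LINT x|lC. LINT t|lT. ?w (t, x))"
  using lTC.integral_snd[OF i] by (simp add: lM_pair split_beta')
 also have "... = (LINT x|lC. - a 0 * (z (0, x) * k x))"
 proof (rule LINT_cong[OF refl])
  fix x
  have y: "ac_on 0 R' (\<lambda>t. a t * z (t, x)) (\<lambda>t. a' t * z (t, x) + a t * pd 1 z (t, x))" for R'
   by (rule ac_on_mult; rule ac_on_C1)
     (use a(1) zs(1) in \<open>auto intro: continuous_on_subset[OF a(2)] continuous_on_subset[OF continuous_slices(1)[OF zs(3)]]\<close>)
  have "(LINT t|lT. a' t * z (t, x) + a t * pd 1 z (t, x)) = - (a 0 * z (0, x))"
  proof (rule half_line_FTC[OF y])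
   show "integrable lT (\<lambda>t. a t * z (t, x))"
    by (rule integrable_lT_set_support[OF set_integrable_continuous_Icc[OF ac_on_continuous[OF y]], of R]) (rule supp)
   show "integrable lT (\<lambda>t. a' t * z (t, x) + a t * pd 1 z (t, x))"
    by (rule integrable_lT_set_support[OF ac_on_integrable[OF y], of R]) (use supp in \<open>simp add: add.commute\<close>)
  qed
  then show "(LINT t|lT. ?w (t, x)) = - a 0 * (z (0, x) * k x)"
   by (simp add: add.commute)
 qed
 finally show ?thesis by simp
qed

lemma Ck1_integral_c:
 assumes z: "Ck 1 z" "periodic z" and b: "\<And>x. (b has_real_derivative b' x) (at x)" "continuous_on UNIV b'" "b (2*pi) = b 0"
  and k: "continuous_on UNIV k" and supp: "\<And>t x. t > R ==> z (t, x) = 0"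
 shows "(LINT p|lM. (b (snd p) * pd 2 z p + b' (snd p) * z p) * k (fst p)) = 0"
proof -
 note zs = Ck1_slices[OF z(1)]
 have cb: "continuous_on UNIV b" using b(1) by (meson DERIV_isCont continuous_at_imp_continuous_on)
 let ?w = "\<lambda>p. (b (snd p) * pd 2 z p + b' (snd p) * z p) * k (fst p)"
 have pz: "pd 2 z (t, x) = 0" if "t > R" for t x
  using zs(2)[of t x] supp[OF that] by (metis (no_types, lifting) DERIV_const DERIV_unique ext)
 have i: "integrable (lT \<Otimes>\<^sub>M lC) ?w"
 proof -
  have "integrable lM ?w"
   by (rule lM_integrable_cont[of _ R])
     (use supp pz in \<open>auto intro!: continuous_on_mult continuous_on_add zs(4,5) continuous_on_fst_snd cb b(2) k\<close>)
  then show ?thesis by (simp add: lM_pair)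
 qed
 have "(LINT p|lM. ?w p) = (LINT t|lT. LINT x|lC. ?w (t, x))"
  using lTC.integral_fst'[OF i] by (simp add: lM_pair)
 also have "... = (LINT t|lT. 0)"
 proof (rule LINT_cong[OF refl])
  fix t
  have y: "ac_on 0 (2*pi) (\<lambda>x. b x * z (t, x)) (\<lambda>x. b' x * z (t, x) + b x * pd 2 z (t, x))"
   by (rule ac_on_mult; rule ac_on_C1)
     (use b(1) zs(2) in \<open>auto intro: continuous_on_subset[OF b(2)] continuous_on_subset[OF continuous_slices(2)[OF zs(4)]]\<close>)
  have "z (t, 2*pi) = z (t, 0)" using z(2) unfolding periodic_def by (metis add_0)
  then have "(LINT x|lC. b' x * z (t, x) + b x * pd 2 z (t, x)) = 0"
   using ac_on_FTC[OF y] b(3) by (simp add: integral_lC)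
  then show "(LINT x|lC. ?w (t, x)) = 0" by (simp add: add.commute)
 qed
 finally show ?thesis by simp
qed

lemma weak_gradient_test:
 assumes "has_weak_gradient X f G" "test_t a" "test_c b"
  and d: "\<And>t. (a has_real_derivative a' t) (at t)" "\<And>y. (b has_real_derivative b' y) (at y)"
 shows "(LINT p|lM. f (X p) * (a' (fst p) * b (snd p))) = - (LINT p|lM. (G p \<bullet> pd 1 X p) * (a (fst p) * b (snd p)))"
  and "(LINT p|lM. f (X p) * (a (fst p) * b' (snd p))) = - (LINT p|lM. (G p \<bullet> pd 2 X p) * (a (fst p) * b (snd p)))"
proof -
 let ?z = "\<lambda>p. a (fst p) * b (snd p)"
 have "Ck 1 ?z" using assms(2,3) by (intro Ck_product) (auto simp: test_t_def test_c_def)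
 moreover have "periodic ?z" using assms(3) by (simp add: periodic_def test_c_def)
 moreover have "\<exists>a b. 0 < a \<and> (\<forall>t y. t \<notin> {a..b} \<longrightarrow> ?z (t, y) = 0)"
 proof -
  obtain l u where "0 < l" "\<forall>t. t \<notin> {l..u} \<longrightarrow> a t = 0" using assms(2) unfolding test_t_def by blast
  then show ?thesis by (intro exI[of _ l] exI[of _ u]) auto
 qed
 ultimately have "\<forall>i. (LINT p:cyl|lborel. f (X p) * pd i ?z p) = - (LINT p:cyl|lborel. (G p \<bullet> pd i X p) * ?z p)"
  using assms(1) unfolding has_weak_gradient_def by blast
 from this[rule_format, of 1] this[rule_format, of 2]
 show "(LINT p|lM. f (X p) * (a' (fst p) * b (snd p))) = - (LINT p|lM. (G p \<bullet> pd 1 X p) * (a (fst p) * b (snd p)))"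
  "(LINT p|lM. f (X p) * (a (fst p) * b' (snd p))) = - (LINT p|lM. (G p \<bullet> pd 2 X p) * (a (fst p) * b (snd p)))"
  unfolding pd_product[OF d] integral_lM by simp_all
qed

lemma set_integrable_inner_cont:
 fixes G :: "real \<times> real => real^3"
 assumes G: "set_integrable lborel ({a..b} \<times> {0..<2*pi}) G" and w: "continuous_on UNIV w"
 shows "set_integrable lborel ({a..b} \<times> {0..<2*pi}) (\<lambda>p. G p \<bullet> w p)"
proof -
 have "bounded (w ` cbox (a, 0) (b, 2*pi))"
  by (rule compact_imp_bounded[OF compact_continuous_image]) (auto intro: continuous_on_subset[OF w])
 then obtain B where B: "\<And>p. p \<in> cbox (a, 0) (b, 2*pi) ==> norm (w p) \<le> B" by (auto simp: bounded_iff)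
 have [measurable]: "w \<in> borel_measurable borel" by (rule borel_measurable_continuous_onI[OF w])
 have m: "(\<lambda>p. indicator ({a..b} \<times> {0..<2*pi}) p *\<^sub>R G p) \<in> borel_measurable borel"
  using borel_measurable_integrable[OF G[unfolded set_integrable_def]] by simp
 have "(\<lambda>p. (indicator ({a..b} \<times> {0..<2*pi}) p *\<^sub>R G p) \<bullet> w p) \<in> borel_measurable borel"
  using m by measurable
 moreover have eq: "(indicator ({a..b} \<times> {0..<2*pi}) p *\<^sub>R G p) \<bullet> w p = indicator ({a..b} \<times> {0..<2*pi}) p *\<^sub>R (G p \<bullet> w p)" for p
  by simp
 ultimately have meas: "set_borel_measurable lborel ({a..b} \<times> {0..<2*pi}) (\<lambda>p. G p \<bullet> w p)"
  unfolding set_borel_measurable_def eq by simp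
 have int: "set_integrable lborel ({a..b} \<times> {0..<2*pi}) (\<lambda>p. B *\<^sub>R G p)" using G by simp
 show ?thesis
 proof (rule set_integrable_bound[OF int meas])
  show "AE x in lborel. x \<in> {a..b} \<times> {0..<2*pi} \<longrightarrow> norm (G x \<bullet> w x) \<le> norm (B *\<^sub>R G x)"
  proof (intro AE_I2 impI)
   fix x :: "real \<times> real" assume x: "x \<in> {a..b} \<times> {0..<2*pi}"
   have "x \<in> cbox (a, 0) (b, 2*pi)" using x by (cases x) (auto simp: cbox_Pair_eq)
   then have "norm (w x) \<le> B" by (rule B)
   moreover have "norm (G x \<bullet> w x) \<le> norm (G x) * norm (w x)" by (simp add: Cauchy_Schwarz_ineq2)
   moreover have "norm (G x) * norm (w x) \<le> norm (G x) * \<bar>B\<bar>"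
    using \<open>norm (w x) \<le> B\<close> by (intro mult_left_mono) auto
   ultimately show "norm (G x \<bullet> w x) \<le> norm (B *\<^sub>R G x)" by (simp add: mult.commute)
  qed
 qed
qed

text \<open>\<open>weak_gradient\<close> is an arbitrary choice, so statements about it can hold
  only up to null sets; the fundamental lemma identifies the components of any two choices.\<close>

lemma weak_gradient_unique:
 assumes G: "has_weak_gradient (Y_surface c i) f G" "has_weak_gradient (Y_surface c i) f G'"
 shows "AE p in lM. G p \<bullet> pd j (Y_surface c i) p = G' p \<bullet> pd j (Y_surface c i) p"
proof -
 let ?X = "Y_surface c i"
 have si: "set_integrable lborel ({a..b} \<times> {0..<2*pi}) (\<lambda>p. G p \<bullet> pd j ?X p)"
  "set_integrable lborel ({a..b} \<times> {0..<2*pi}) (\<lambda>p. G' p \<bullet> pd j ?X p)" if "0 < a" for a b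
  using G that unfolding has_weak_gradient_def by (auto intro!: set_integrable_inner_cont pd_continuous)
 have "AE p in lM. G p \<bullet> pd j ?X p - G' p \<bullet> pd j ?X p = 0"
 proof (rule cyl_test_zero)
  show "set_integrable lborel ({a..b} \<times> {0..<2*pi}) (\<lambda>p. G p \<bullet> pd j ?X p - G' p \<bullet> pd j ?X p)" if "0 < a" for a b
   using si[OF that] by (rule set_integral_diff(1))
  fix a b assume a: "test_t a" and b: "test_c b"
  obtain a' where a': "\<And>t. (a has_real_derivative a' t) (at t)" 
   using a unfolding test_t_def by (metis C1k.simps(2))
  obtain b' where b': "\<And>t. (b has_real_derivative b' t) (at t)" 
   using b unfolding test_c_def by (metis C1k.simps(2))
  obtain l u where lu: "0 < l" "\<forall>t. t \<notin> {l..u} \<longrightarrow> a t = 0" using a unfolding test_t_def by blast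
  have cont: "continuous_on UNIV (\<lambda>p. a (fst p) * b (snd p))"
   by (intro continuous_on_mult continuous_on_fst_snd test_t_continuous[OF a] test_c_continuous[OF b])
  have int: "integrable lM (\<lambda>p. (H p \<bullet> pd j ?X p) * (a (fst p) * b (snd p)))"
   if H: "has_weak_gradient ?X f H" for H
  proof -
   have "set_integrable lborel ({l..u} \<times> {0..<2*pi}) H" using H lu unfolding has_weak_gradient_def by auto
   from set_integrable_inner_cont[OF this continuous_on_scaleR[OF cont pd_continuous[of j c i]]]
   have "set_integrable lborel ({l..u} \<times> {0..<2*pi}) (\<lambda>p. (H p \<bullet> pd j ?X p) * (a (fst p) * b (snd p)))"
    by (simp add: mult.commute)
   then show ?thesis unfolding integrable_lM set_integrable_def
    by (rule L1_cong[THEN iffD1, rotated -1])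
      (use lu in \<open>auto simp: indicator_def cyl_def\<close>)
  qed
  have "(LINT p|lM. (G p \<bullet> pd j ?X p) * (a (fst p) * b (snd p))) = (LINT p|lM. (G' p \<bullet> pd j ?X p) * (a (fst p) * b (snd p)))"
   using weak_gradient_test[OF G(1) a b a' b'] weak_gradient_test[OF G(2) a b a' b'] exhaust_2[of j] by auto
  then show "(LINT p:cyl|lborel. (G p \<bullet> pd j ?X p - G' p \<bullet> pd j ?X p) * (a (fst p) * b (snd p))) = 0"
   unfolding integral_lM[symmetric] left_diff_distrib LINT_diff[OF int[OF G(1)] int[OF G(2)]] by simp
 qed
 then show ?thesis by eventually_elim simp
qed

text \<open>The tangent vector whose inner products with the coordinate vectors are
  \<open>a' k\<close> and \<open>a k'\<close>; division by \<open>conf\<close> raises the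
  index.\<close>

definition product_gradient :: "real => 3 => (real => real) => (real => real) => (real => real) => (real => real) => real \<times> real => real^3" where
 "product_gradient c i a a' k k' p = ((a' (fst p) * k (snd p)) / conf c i (fst p)) *\<^sub>R pd 1 (Y_surface c i) p
   + ((a (fst p) * k' (snd p)) / conf c i (fst p)) *\<^sub>R pd 2 (Y_surface c i) p"

lemma product_gradient_inner:
 assumes "c > 0"
 shows "product_gradient c i a a' k k' p \<bullet> pd 1 (Y_surface c i) p = a' (fst p) * k (snd p)"
  "product_gradient c i a a' k k' p \<bullet> pd 2 (Y_surface c i) p = a (fst p) * k' (snd p)"
 using conf_pos[OF assms, of i "fst p"] by (simp_all add: product_gradient_def inner_left_distrib pd_inner)

lemma has_weak_gradient_product:
 assumes c: "c > 0" and a: "\<And>t. (a has_real_derivative a' t) (at t)" "continuous_on UNIV a'"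
  and k: "\<And>t. (k has_real_derivative k' t) (at t)" "continuous_on UNIV k'" "\<And>y. k (y + 2*pi) = k y"
  and f: "\<And>p. p \<in> cyl ==> f (Y_surface c i p) = a (fst p) * k (snd p)"
 shows "has_weak_gradient (Y_surface c i) f (product_gradient c i a a' k k')"
proof -
 let ?X = "Y_surface c i" and ?G = "product_gradient c i a a' k k'"
 have ca: "continuous_on UNIV a" and ck: "continuous_on UNIV k"
  using a(1) k(1) by (meson DERIV_isCont continuous_at_imp_continuous_on)+
 have cf: "continuous_on UNIV (\<lambda>p. a (fst p) * k (snd p))"
  by (intro continuous_on_mult continuous_on_fst_snd ca ck)
 have cG: "continuous_on UNIV ?G"
  unfolding product_gradient_def[abs_def]
  by (intro continuous_on_add continuous_on_scaleR continuous_on_divide continuous_on_mult continuous_on_fst_snd ca ck a(2) k(2) conf_continuous pd_continuous)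
    (use conf_pos[OF c, of i] in \<open>auto simp: less_le\<close>)
 show ?thesis unfolding has_weak_gradient_def measurable_area[OF c] AE_area[OF c]
 proof (intro conjI allI impI)
  show "(\<lambda>p. f (?X p)) \<in> borel_measurable lM"
   using borel_measurable_lM_cont[OF cf] by (rule measurable_cong[THEN iffD1, rotated]) (simp add: space_restrict_space f)
  show "?G \<in> borel_measurable lM" by (rule borel_measurable_lM_cont[OF cG])
  show "AE p in lM. ?G p \<in> span {pd 1 ?X p, pd 2 ?X p}"
   unfolding product_gradient_def by (intro AE_I2 span_add span_scale span_base) auto
  show "set_integrable lborel ({l..u} \<times> {0..<2 * pi}) (\<lambda>p. f (?X p))" if "0 < l" for l u
   using set_integrable_box_cont[OF cf, of l u]
   by (rule set_integrable_cong[THEN iffD1, rotated -1]) (use that f in \<open>auto simp: cyl_def\<close>)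
  show "set_integrable lborel ({l..u} \<times> {0..<2 * pi}) ?G" if "0 < l" for l u
   by (rule set_integrable_box_cont[OF cG])
 next
  fix z and j :: 2
  assume z: "Ck 1 z \<and> periodic z \<and> (\<exists>a b. 0 < a \<and> (\<forall>t y. t \<notin> {a..b} \<longrightarrow> z (t, y) = 0))"
  then obtain l u where lu: "0 < l" "\<And>t y. t \<notin> {l..u} ==> z (t, y) = 0" by blast
  have z1: "Ck 1 z" "periodic z" using z by auto
  note zs = Ck1_slices[OF z1(1)]
  have z0: "z (t, y) = 0" if "t > u" for t y using lu(2)[of t] that by auto
  have zt: "pd 1 z (t, y) = 0" if "t > u" for t y
  proof -
   have "\<forall>\<^sub>F x in nhds t. z (x, y) = 0"
    using eventually_nhds_in_open[of "{u<..}" t] that by (auto elim!: eventually_mono intro: z0)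
   then have "((\<lambda>t. z (t, y)) has_real_derivative 0) (at t)" by (subst DERIV_cong_ev[OF refl _ refl]) auto
   then show ?thesis using zs(1) DERIV_unique by blast
  qed
  have zc: "pd 2 z (t, y) = 0" if "t > u" for t y
   using zs(2)[of t y] z0[OF that] by (metis (no_types, lifting) DERIV_const DERIV_unique ext)
  have i1: "integrable lM (\<lambda>p. f (?X p) * pd j z p)" "integrable lM (\<lambda>p. (?G p \<bullet> pd j ?X p) * z p)"
  proof -
   have cpd: "continuous_on UNIV (pd j z)" using exhaust_2[of j] zs(3,4) by auto
   have zj: "pd j z p = 0" "z p = 0" if "fst p > u" for p
    using exhaust_2[of j] zt[OF that, of "snd p"] zc[OF that, of "snd p"] z0[OF that, of "snd p"] by auto
   have "integrable lM (\<lambda>p. (a (fst p) * k (snd p)) * pd j z p)"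
    by (rule lM_integrable_cont[of _ u], intro continuous_on_mult cf cpd) (simp add: zj)
   then show "integrable lM (\<lambda>p. f (?X p) * pd j z p)"
    by (rule L1_cong[THEN iffD1, rotated -1]) (auto simp: space_restrict_space f)
   show "integrable lM (\<lambda>p. (?G p \<bullet> pd j ?X p) * z p)"
    by (rule lM_integrable_cont[of _ u], intro continuous_on_mult continuous_on_inner cG pd_continuous zs(5))
      (simp add: zj)
  qed
  have "(LINT p|lM. f (?X p) * pd j z p + (?G p \<bullet> pd j ?X p) * z p) = 0"
  proof (cases "j = 1")
   case True
   have "(LINT p|lM. f (?X p) * pd j z p + (?G p \<bullet> pd j ?X p) * z p)
     = (LINT p|lM. (a (fst p) * pd 1 z p + a' (fst p) * z p) * k (snd p))"
    by (rule LINT_cong) (auto simp: True product_gradient_inner[OF c] space_restrict_space f algebra_simps)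
   also have "... = - a 0 * (LINT y|lC. z (0, y) * k y)"
    by (rule Ck1_integral_t[OF z1(1) a ck, of u]) (simp_all add: z0 zt)
   also have "... = 0" using lu by simp
   finally show ?thesis .
  next
   case False
   then have j: "j = 2" using exhaust_2[of j] by auto
   have "(LINT p|lM. f (?X p) * pd j z p + (?G p \<bullet> pd j ?X p) * z p)
     = (LINT p|lM. (k (snd p) * pd 2 z p + k' (snd p) * z p) * a (fst p))"
    by (rule LINT_cong) (auto simp: j product_gradient_inner[OF c] space_restrict_space f algebra_simps)
   also have "... = 0"
    by (rule Ck1_integral_c[OF z1 k(1,2) _ ca, of u]) (use k(3)[of 0] z0 in auto)
   finally show ?thesis .
  qed
  then show "(LINT p:cyl|lborel. f (?X p) * pd j z p) = - (LINT p:cyl|lborel. (?G p \<bullet> pd j ?X p) * z p)"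
   unfolding LINT_add[OF i1] by (simp add: integral_lM)
 qed
qed

text \<open>The elementary bound \<open>\<bar>u\<bar> \<le> e + u^2 / e\<close> plays the role of
  Cauchy-Schwarz; it works with extended nonnegative integrals, before integrability of
  \<open>u\<close> is known.\<close>

lemma L2_small:
 assumes "finite_measure M" and u: "u \<in> borel_measurable M" and e: "0 < e"
  and le: "(\<integral>\<^sup>+x. ennreal ((u x)^2) \<partial>M) \<le> ennreal (e^2)"
 shows "(\<integral>\<^sup>+x. ennreal \<bar>u x\<bar> \<partial>M) \<le> ennreal (e * (measure M (space M) + 1))"
proof -
 interpret finite_measure M by fact
 note [measurable] = u
 have "ennreal \<bar>u x\<bar> \<le> ennreal e + ennreal (1 / e) * ennreal ((u x)^2)" for x
 proof -
  have "\<bar>u x\<bar> \<le> e + (1 / e) * (u x)^2"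
  proof (cases "\<bar>u x\<bar> \<le> e")
   case False
   then have "e * \<bar>u x\<bar> \<le> \<bar>u x\<bar> * \<bar>u x\<bar>" by (intro mult_right_mono) auto
   also have "... = (u x)^2" by (simp add: power2_eq_square)
   finally have "\<bar>u x\<bar> \<le> (1 / e) * (u x)^2" using e by (simp add: field_simps)
   then show ?thesis using e by linarith
  qed (use e in \<open>simp add: add_increasing2\<close>)
  then have "ennreal \<bar>u x\<bar> \<le> ennreal (e + (1 / e) * (u x)^2)" by (rule ennreal_leI)
  then show ?thesis using e by (simp add: ennreal_plus[symmetric] ennreal_mult[symmetric] del: ennreal_plus)
 qed
 then have "(\<integral>\<^sup>+x. ennreal \<bar>u x\<bar> \<partial>M) \<le> (\<integral>\<^sup>+x. ennreal e + ennreal (1 / e) * ennreal ((u x)^2) \<partial>M)"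
  by (rule nn_integral_mono)
 also have "... = ennreal e * emeasure M (space M) + ennreal (1 / e) * (\<integral>\<^sup>+x. ennreal ((u x)^2) \<partial>M)"
  by (simp add: nn_integral_add nn_integral_cmult)
 also have "... \<le> ennreal e * emeasure M (space M) + ennreal (1 / e) * ennreal (e^2)"
  by (intro add_left_mono mult_left_mono le) simp
 also have "... = ennreal (e * (measure M (space M) + 1))"
  using e by (simp add: emeasure_eq_measure ennreal_mult[symmetric] ennreal_plus[symmetric] power2_eq_square distrib_left del: ennreal_plus)
 finally show ?thesis .
qed

lemma L2_tendsto_eventually_integrable:
 assumes M: "finite_measure M" and u: "\<And>n. u n \<in> borel_measurable M"
  and lim: "(\<lambda>n. \<integral>\<^sup>+x. ennreal ((u n x)^2) \<partial>M) \<longlonglongrightarrow> 0"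
 shows "\<forall>\<^sub>F n in sequentially. integrable M (u n) \<and> integrable M (\<lambda>x. (u n x)^2)"
proof -
 have "\<forall>\<^sub>F n in sequentially. (\<integral>\<^sup>+x. ennreal ((u n x)^2) \<partial>M) < 1"
  by (rule order_tendstoD(2)[OF lim]) simp
 then show ?thesis
 proof eventually_elim
  case (elim n)
  note [measurable] = u[of n]
  have "integrable M (\<lambda>x. (u n x)^2)"
   by (rule integrableI_bounded) (use elim in \<open>auto intro: less_trans\<close>)
  moreover have "(\<integral>\<^sup>+x. ennreal \<bar>u n x\<bar> \<partial>M) \<le> ennreal (1 * (measure M (space M) + 1))"
   by (rule L2_small[OF M]) (use elim in auto)
  then have "(\<integral>\<^sup>+x. ennreal (norm (u n x)) \<partial>M) < \<infinity>" using le_less_trans by fastforce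
  then have "integrable M (u n)" by (intro integrableI_bounded) auto
  ultimately show ?case by blast
 qed
qed

lemma L2_pairing_tendsto_zero:
 assumes M: "finite_measure M" and u: "\<And>n. u n \<in> borel_measurable M"
  and lim: "(\<lambda>n. \<integral>\<^sup>+x. ennreal ((u n x)^2) \<partial>M) \<longlonglongrightarrow> 0"
  and w: "w \<in> borel_measurable M" "\<And>x. x \<in> space M ==> \<bar>w x\<bar> \<le> C"
 shows "(\<lambda>n. LINT x|M. u n x * w x) \<longlonglongrightarrow> 0"
proof (rule LIMSEQ_I)
 fix r :: real assume r: "0 < r"
 define K where "K = (\<bar>C\<bar> + 1) * (measure M (space M) + 1)"
 have K: "K > 0" unfolding K_def by (intro mult_pos_pos) (auto intro: add_nonneg_pos)
 define e where "e = r / (2 * K)"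
 have e: "0 < e" using r K by (simp add: e_def)
 have "\<forall>\<^sub>F n in sequentially. (\<integral>\<^sup>+x. ennreal ((u n x)^2) \<partial>M) < ennreal (e^2)"
  by (rule order_tendstoD(2)[OF lim]) (use e in simp)
 then have "\<forall>\<^sub>F n in sequentially. norm ((LINT x|M. u n x * w x) - 0) < r"
 proof eventually_elim
  case (elim n)
  note [measurable] = u[of n] w(1)
  have "norm (LINT x|M. u n x * w x) \<le> e * K"
  proof (cases "integrable M (\<lambda>x. u n x * w x)")
   case True
   have "ennreal (norm (LINT x|M. u n x * w x)) \<le> (\<integral>\<^sup>+x. ennreal (norm (u n x * w x)) \<partial>M)"
    by (rule integral_norm_bound_ennreal[OF True])
   also have "... \<le> (\<integral>\<^sup>+x. ennreal (\<bar>C\<bar> + 1) * ennreal \<bar>u n x\<bar> \<partial>M)"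
   proof (rule nn_integral_mono)
    fix x assume x: "x \<in> space M"
    have "\<bar>u n x\<bar> * \<bar>w x\<bar> \<le> \<bar>u n x\<bar> * (\<bar>C\<bar> + 1)" using w(2)[OF x] by (intro mult_left_mono) auto
    then have "ennreal (norm (u n x * w x)) \<le> ennreal ((\<bar>C\<bar> + 1) * \<bar>u n x\<bar>)"
     by (intro ennreal_leI) (simp add: abs_mult mult.commute)
    then show "ennreal (norm (u n x * w x)) \<le> ennreal (\<bar>C\<bar> + 1) * ennreal \<bar>u n x\<bar>"
     by (simp add: ennreal_mult)
   qed
   also have "... = ennreal (\<bar>C\<bar> + 1) * (\<integral>\<^sup>+x. ennreal \<bar>u n x\<bar> \<partial>M)" by (rule nn_integral_cmult) simp
   also have "... \<le> ennreal (\<bar>C\<bar> + 1) * ennreal (e * (measure M (space M) + 1))"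
    by (intro mult_left_mono L2_small[OF M u e less_imp_le[OF elim]]) simp
   also have "... = ennreal (e * K)" using e by (simp add: ennreal_mult[symmetric] K_def mult_ac del: ennreal_plus)
   finally show ?thesis using e K by (simp add: ennreal_le_iff)
  qed (use e K in \<open>simp add: not_integrable_integral_eq\<close>)
  also have "e * K < r" using r K by (simp add: e_def)
  finally show ?case by simp
 qed
 then show "\<exists>no. \<forall>n\<ge>no. norm ((LINT x|M. u n x * w x) - 0) < r"
  by (simp add: eventually_sequentially)
qed

section \<open>Traces on the collar\<close>

abbreviation lK :: "(real \<times> real) measure" where "lK \<equiv> restrict_space lborel ({0..1} \<times> {0..<2*pi})"

lemma collar_borel [simp, measurable]: "{0..1::real} \<times> {0..<2*pi} \<in> sets borel"
 by (intro borel_Times) auto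

lemma finite_lK: "finite_measure lK"
proof (rule finite_measureI)
 have "bounded ({0..1::real} \<times> {0..<2*pi})" by (intro bounded_Times) auto
 then show "emeasure lK (space lK) \<noteq> \<infinity>"
  using emeasure_bounded_finite[of "{0..1::real} \<times> {0..<2*pi}"]
  by (simp add: space_restrict_space emeasure_restrict_space)
qed

lemma collar_indicator: "indicator ({0..1} \<times> {0..<2*pi}) p = (indicator cyl p * indicator {..1} (fst p) :: real)"
 by (cases p) (auto simp: indicator_def cyl_def)

lemma lK_lM:
 fixes u :: "real \<times> real => real"
 shows "integrable lK u \<longleftrightarrow> integrable lM (\<lambda>p. indicator {..1} (fst p) * u p)"
  "(LINT p|lK. u p) = (LINT p|lM. indicator {..1} (fst p) * u p)"
 by (simp_all add: integrable_restrict_space integral_restrict_space collar_indicator mult.assoc)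

lemma AE_lK: "(AE p in lM. P p) ==> (AE p in lK. P p)"
 by (simp add: AE_restrict_space_iff) (auto elim!: eventually_mono simp: cyl_def)

lemma measurable_lK: "f \<in> borel_measurable lM ==> f \<in> borel_measurable lK"
proof -
 assume f: "f \<in> borel_measurable lM"
 have "f \<in> borel_measurable (restrict_space lM ({0..1} \<times> {0..<2*pi}))" by (rule measurable_restrict_space1[OF f])
 moreover have "cyl \<inter> ({0..1} \<times> {0..<2*pi}) = {0..1} \<times> {0..<2*pi}" by (auto simp: cyl_def)
 ultimately show ?thesis by (simp add: restrict_restrict_space)
qed

abbreviation grad_comp :: "2 => face => (real^3 => real) => real \<times> real => real" where
 "grad_comp j X f \<equiv> (\<lambda>p. weak_gradient X f p \<bullet> pd j X p)"

lemma weak_gradient_works: "\<exists>G. has_weak_gradient X f G ==> has_weak_gradient X f (weak_gradient X f)"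
 using someI_ex[of "has_weak_gradient X f"] by (simp add: weak_gradient_def)

lemma edge_trace_works: "\<exists>\<tau>. has_trace X f \<tau> ==> has_trace X f (edge_trace X f)"
 using someI_ex[of "has_trace X f"] by (simp add: edge_trace_def)

lemma face_measurable:
 assumes c: "c > 0" and w: "\<exists>G. has_weak_gradient (Y_surface c i) f G"
 shows "(\<lambda>p. f (Y_surface c i p)) \<in> borel_measurable lM" "weak_gradient (Y_surface c i) f \<in> borel_measurable lM"
  "grad_comp j (Y_surface c i) f \<in> borel_measurable lM"
proof -
 show "(\<lambda>p. f (Y_surface c i p)) \<in> borel_measurable lM" and G: "weak_gradient (Y_surface c i) f \<in> borel_measurable lM"
  using weak_gradient_works[OF w] unfolding has_weak_gradient_def measurable_area[OF c] by auto
 then show "grad_comp j (Y_surface c i) f \<in> borel_measurable lM"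
  using pd_measurable[of j c i] by measurable
qed

lemma has_trace_approx:
 assumes "has_trace X f \<tau>"
 obtains gn where "\<And>n. Ck 1 (gn n)" "\<And>n. periodic (gn n)"
  "(\<lambda>n. \<integral>\<^sup>+p. ennreal ((gn n p - f (X p))^2) \<partial>lK) \<longlonglongrightarrow> 0"
  "(\<lambda>n. \<integral>\<^sup>+p. ennreal ((pd 1 (gn n) p - grad_comp 1 X f p)^2) \<partial>lK) \<longlonglongrightarrow> 0"
  "(\<lambda>n. \<integral>\<^sup>+y. ennreal ((gn n (0, y) - \<tau> y)^2) \<partial>lC) \<longlonglongrightarrow> 0"
proof -
 obtain gn where gn: "\<forall>n. Ck 1 (gn n) \<and> periodic (gn n)"
  "(\<lambda>n. \<integral>\<^sup>+p. ennreal ((gn n p - f (X p))^2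
        + (\<Sum>i\<in>UNIV. (pd i (gn n) p - weak_gradient X f p \<bullet> pd i X p)^2)) \<partial>lK) \<longlonglongrightarrow> 0"
  "(\<lambda>n. \<integral>\<^sup>+ y. ennreal ((gn n (0, y) - \<tau> y)^2) \<partial>lC) \<longlonglongrightarrow> 0"
  using assms unfolding has_trace_def by blast
 show ?thesis
 proof (rule that[of gn])
  show "(\<lambda>n. \<integral>\<^sup>+p. ennreal ((gn n p - f (X p))^2) \<partial>lK) \<longlonglongrightarrow> 0"
   by (rule tendsto_sandwich[OF _ _ tendsto_const gn(2)])
     (auto intro!: always_eventually nn_integral_mono ennreal_leI simp: sum_2)
  show "(\<lambda>n. \<integral>\<^sup>+p. ennreal ((pd 1 (gn n) p - grad_comp 1 X f p)^2) \<partial>lK) \<longlonglongrightarrow> 0"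
   by (rule tendsto_sandwich[OF _ _ tendsto_const gn(2)])
     (auto intro!: always_eventually nn_integral_mono ennreal_leI simp: sum_2)
 qed (use gn in auto)
qed

lemma integrable_lK_cont: "continuous_on UNIV (w :: real \<times> real => real) ==> integrable lK w"
 using set_integrable_box_cont[of w 0 1] by (simp add: integrable_restrict_space set_integrable_def)

lemma bounded_lK_cont:
 assumes "continuous_on UNIV (w :: real \<times> real => real)"
 obtains B where "\<And>p. p \<in> space lK ==> \<bar>w p\<bar> \<le> B"
proof -
 have "bounded (w ` cbox (0, 0) (1, 2*pi))"
  by (rule compact_imp_bounded[OF compact_continuous_image]) (auto intro: continuous_on_subset[OF assms])
 then obtain B where "\<And>p. p \<in> cbox (0, 0) (1, 2*pi) ==> \<bar>w p\<bar> \<le> B" by (auto simp: bounded_iff)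
 then show ?thesis by (intro that[of B]) (auto simp: space_restrict_space cbox_Pair_eq)
qed

lemma trace_square_integrable:
 assumes "has_trace X f \<tau>"
 shows "\<tau> \<in> borel_measurable lC" "integrable lC (\<lambda>y. (\<tau> y)^2)" "integrable lC \<tau>"
proof -
 show m: "\<tau> \<in> borel_measurable lC" using assms by (simp add: has_trace_def)
 obtain gn where gn': "\<And>n. Ck 1 (gn n)" "\<And>n. periodic (gn n)"
  "(\<lambda>n. \<integral>\<^sup>+p. ennreal ((gn n p - f (X p))^2) \<partial>lK) \<longlonglongrightarrow> 0"
  "(\<lambda>n. \<integral>\<^sup>+p. ennreal ((pd 1 (gn n) p - grad_comp 1 X f p)^2) \<partial>lK) \<longlonglongrightarrow> 0"
  "(\<lambda>n. \<integral>\<^sup>+y. ennreal ((gn n (0, y) - \<tau> y)^2) \<partial>lC) \<longlonglongrightarrow> 0"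
  by (rule has_trace_approx[OF assms]) (rule that, assumption+)
 note gn = gn'(1,5)
 have cg: "continuous_on UNIV (\<lambda>y. gn n (0, y))" for n by (rule continuous_slices[OF Ck1_slices(5)[OF gn(1)]])
 have mg: "(\<lambda>y. gn n (0, y)) \<in> borel_measurable lC" for n
  using borel_measurable_continuous_onI[OF cg[of n]] by (simp add: measurable_restrict_space1 measurable_lborel1)
 have "\<forall>\<^sub>F n in sequentially. integrable lC (\<lambda>y. gn n (0, y) - \<tau> y) \<and> integrable lC (\<lambda>y. (gn n (0, y) - \<tau> y)^2)"
  by (rule L2_tendsto_eventually_integrable[OF _ _ gn(2)]) (use m mg lC.finite_measure_axioms in auto)
 then obtain n where n: "integrable lC (\<lambda>y. gn n (0, y) - \<tau> y)" "integrable lC (\<lambda>y. (gn n (0, y) - \<tau> y)^2)"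
  by (auto simp: eventually_sequentially)
 have i1: "integrable lC (\<lambda>y. gn n (0, y))" and i2: "integrable lC (\<lambda>y. (gn n (0, y))^2)"
  unfolding integrable_lC by (intro set_integrable_continuous_Icc continuous_intros continuous_on_subset[OF cg]; simp)+
 show "integrable lC \<tau>" using L1_diff[OF i1 n(1)] by simp
 show "integrable lC (\<lambda>y. (\<tau> y)^2)"
 proof (rule L1_bound[OF L1_add[OF integrable_mult_right[of 2, OF i2] integrable_mult_right[of 2, OF n(2)]]])
  show "(\<lambda>y. (\<tau> y)^2) \<in> borel_measurable lC" using m by measurable
  show "AE x in lC. norm ((\<tau> x)^2) \<le> norm (2 * (gn n (0, x))^2 + 2 * (gn n (0, x) - \<tau> x)^2)"
  proof (rule AE_I2)
   fix x
   have "2 * (gn n (0, x))^2 + 2 * (gn n (0, x) - \<tau> x)^2 - (\<tau> x)\<^sup>2 = (2 * gn n (0, x) - \<tau> x)^2" by algebra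
   then show "norm ((\<tau> x)^2) \<le> norm (2 * (gn n (0, x))^2 + 2 * (gn n (0, x) - \<tau> x)^2)"
    by (smt (verit) real_norm_def zero_le_power2)
  qed
 qed
qed

text \<open>A weak gradient alone controls nothing at the edge. The approximants of the trace are
  continuous on the collar together with their derivatives, hence integrable there, and for suitable
  indices they differ from \<open>f\<close> and its \<open>t\<close>-derivative by integrable
  functions.\<close>

lemma face_lK:
 assumes c: "c > 0" and w: "\<exists>G. has_weak_gradient (Y_surface c i) f G" and tr: "has_trace (Y_surface c i) f \<tau>"
 shows "integrable lK (\<lambda>p. f (Y_surface c i p))" "integrable lK (grad_comp 1 (Y_surface c i) f)"
proof -
 let ?X = "Y_surface c i"
 obtain gn where gn': "\<And>n. Ck 1 (gn n)" "\<And>n. periodic (gn n)"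
  "(\<lambda>n. \<integral>\<^sup>+p. ennreal ((gn n p - f (?X p))^2) \<partial>lK) \<longlonglongrightarrow> 0"
  "(\<lambda>n. \<integral>\<^sup>+p. ennreal ((pd 1 (gn n) p - grad_comp 1 ?X f p)^2) \<partial>lK) \<longlonglongrightarrow> 0"
  "(\<lambda>n. \<integral>\<^sup>+y. ennreal ((gn n (0, y) - \<tau> y)^2) \<partial>lC) \<longlonglongrightarrow> 0"
  by (rule has_trace_approx[OF tr]) (rule that, assumption+)
 note gn = gn'(1,3,4)
 note cg = Ck1_slices(3,5)[OF gn(1)]
 note [measurable] = measurable_lK[OF face_measurable(1)[OF c w]] measurable_lK[OF face_measurable(3)[OF c w, of 1]]
  measurable_lK[OF borel_measurable_lM_cont[OF cg(1)]] measurable_lK[OF borel_measurable_lM_cont[OF cg(2)]]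
 have "\<forall>\<^sub>F n in sequentially. integrable lK (\<lambda>p. gn n p - f (?X p)) \<and> integrable lK (\<lambda>p. (gn n p - f (?X p))^2)"
  "\<forall>\<^sub>F n in sequentially. integrable lK (\<lambda>p. pd 1 (gn n) p - grad_comp 1 ?X f p) \<and> integrable lK (\<lambda>p. (pd 1 (gn n) p - grad_comp 1 ?X f p)^2)"
  by (rule L2_tendsto_eventually_integrable[OF finite_lK _ gn(2)], measurable)
    (rule L2_tendsto_eventually_integrable[OF finite_lK _ gn(3)], measurable)
 then obtain n m where n: "integrable lK (\<lambda>p. gn n p - f (?X p))" "integrable lK (\<lambda>p. pd 1 (gn m) p - grad_comp 1 ?X f p)"
  by (auto simp: eventually_sequentially)
 show "integrable lK (\<lambda>p. f (?X p))"
  using L1_diff[OF integrable_lK_cont[OF cg(2)[of n]] n(1)] by simp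
 show "integrable lK (grad_comp 1 ?X f)"
  using L1_diff[OF integrable_lK_cont[OF cg(1)[of m]] n(2)] by simp
qed

text \<open>For the \<open>C^1\<close> approximants this is integration by parts. All three terms
  pass to the limit under the convergences of \<open>has_trace\<close>, because the tests are
  bounded and supported inside the collar.\<close>

lemma trace_identity_collar:
 assumes c: "c > 0" and w: "\<exists>G. has_weak_gradient (Y_surface c i) f G" and tr: "has_trace (Y_surface c i) f \<tau>"
  and A: "\<And>t. (A has_real_derivative A' t) (at t)" "continuous_on UNIV A'" "\<And>t. t > 1/2 ==> A t = 0" "\<And>t. t > 1/2 ==> A' t = 0"
  and b: "continuous_on UNIV b"
 shows "(LINT p|lM. f (Y_surface c i p) * (A' (fst p) * b (snd p)) + grad_comp 1 (Y_surface c i) f p * (A (fst p) * b (snd p)))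
  = - A 0 * (LINT y|lC. \<tau> y * b y)"
proof -
 let ?X = "Y_surface c i"
 let ?f = "\<lambda>p. f (?X p)" and ?g = "grad_comp 1 ?X f"
 obtain gn where gn': "\<And>n. Ck 1 (gn n)" "\<And>n. periodic (gn n)"
  "(\<lambda>n. \<integral>\<^sup>+p. ennreal ((gn n p - f (?X p))^2) \<partial>lK) \<longlonglongrightarrow> 0"
  "(\<lambda>n. \<integral>\<^sup>+p. ennreal ((pd 1 (gn n) p - grad_comp 1 ?X f p)^2) \<partial>lK) \<longlonglongrightarrow> 0"
  "(\<lambda>n. \<integral>\<^sup>+y. ennreal ((gn n (0, y) - \<tau> y)^2) \<partial>lC) \<longlonglongrightarrow> 0"
  by (rule has_trace_approx[OF tr]) (rule that, assumption+)
 note gn = gn'(1,3,4,5)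
 note cg = Ck1_slices(3,5)[OF gn(1)]
 note fi = face_lK[OF c w tr]
 note \<tau>i = trace_square_integrable[OF tr]
 have cA: "continuous_on UNIV A" using A(1) by (meson DERIV_isCont continuous_at_imp_continuous_on)
 define W1 where "W1 p = A' (fst p) * b (snd p)" for p
 define W2 where "W2 p = A (fst p) * b (snd p)" for p
 have cW: "continuous_on UNIV W1" "continuous_on UNIV W2"
  unfolding W1_def W2_def by (intro continuous_on_mult continuous_on_fst_snd cA A(2) b)+
 obtain B1 where B1: "\<And>p. p \<in> space lK ==> \<bar>W1 p\<bar> \<le> B1" by (rule bounded_lK_cont[OF cW(1)]) (rule that, blast)
 obtain B2 where B2: "\<And>p. p \<in> space lK ==> \<bar>W2 p\<bar> \<le> B2" by (rule bounded_lK_cont[OF cW(2)]) (rule that, blast)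
 obtain B3 where B3: "\<And>y. y \<in> {0..2*pi} ==> \<bar>b y\<bar> \<le> B3" "B3 \<ge> 0" by (rule continuous_bound_circle[OF b]) (rule that, blast+)
 note [measurable] = measurable_lK[OF face_measurable(1)[OF c w]] measurable_lK[OF face_measurable(3)[OF c w, of 1]]
  measurable_lK[OF borel_measurable_lM_cont[OF cg(1)]] measurable_lK[OF borel_measurable_lM_cont[OF cg(2)]]
  measurable_lK[OF borel_measurable_lM_cont[OF cW(1)]] measurable_lK[OF borel_measurable_lM_cont[OF cW(2)]]
 have cg0: "continuous_on UNIV (\<lambda>y. gn n (0, y))" for n by (rule continuous_slices[OF cg(2)])
 have mC: "f \<in> borel_measurable lC" if "continuous_on UNIV f" for f :: "real => real"
  using borel_measurable_continuous_onI[OF that] by (simp add: measurable_restrict_space1 measurable_lborel1)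
 have int_prod: "integrable lK (\<lambda>p. u p * W p)" if ui: "integrable lK u" and Wc: "continuous_on UNIV W" for u W :: "real \<times> real => real"
 proof -
  obtain B where B: "\<And>p. p \<in> space lK ==> \<bar>W p\<bar> \<le> B" by (rule bounded_lK_cont[OF Wc]) (rule that, blast)
  note [measurable] = borel_measurable_integrable[OF ui] measurable_lK[OF borel_measurable_lM_cont[OF Wc]]
  show ?thesis
   by (rule L1_bound[OF integrable_mult_left[of B, OF ui]])
     (use B in \<open>auto simp: abs_mult intro!: AE_I2 mult_left_mono intro: order_trans[OF B abs_ge_self]\<close>)
 qed
 have l1: "(\<lambda>n. LINT p|lK. (gn n p - ?f p) * W1 p) \<longlonglongrightarrow> 0"
  by (rule L2_pairing_tendsto_zero[OF finite_lK _ gn(2) _ B1]) measurable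
 have l2: "(\<lambda>n. LINT p|lK. (pd 1 (gn n) p - ?g p) * W2 p) \<longlonglongrightarrow> 0"
  by (rule L2_pairing_tendsto_zero[OF finite_lK _ gn(3) _ B2]) measurable
 have l3: "(\<lambda>n. LINT y|lC. (gn n (0, y) - \<tau> y) * b y) \<longlonglongrightarrow> 0"
  by (rule L2_pairing_tendsto_zero[OF _ _ gn(4), where C=B3])
    (use mC[OF cg0] mC[OF b] \<tau>i(1) B3 lC.finite_measure_axioms in \<open>auto simp: space_restrict_space\<close>)
 have id: "(LINT p|lK. gn n p * W1 p) + (LINT p|lK. pd 1 (gn n) p * W2 p) = - A 0 * (LINT y|lC. gn n (0, y) * b y)" for n
 proof -
  have "(LINT p|lK. gn n p * W1 p) + (LINT p|lK. pd 1 (gn n) p * W2 p) = (LINT p|lK. gn n p * W1 p + pd 1 (gn n) p * W2 p)"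
   by (rule LINT_add[OF int_prod[OF integrable_lK_cont[OF cg(2)] cW(1)] int_prod[OF integrable_lK_cont[OF cg(1)] cW(2)], symmetric])
  also have "... = (LINT p|lM. (A (fst p) * pd 1 (gn n) p + A' (fst p) * gn n p) * b (snd p))"
   unfolding lK_lM
   by (rule LINT_cong) (use A(3,4) in \<open>auto simp: W1_def W2_def indicator_def algebra_simps\<close>)
  also have "... = - A 0 * (LINT y|lC. gn n (0, y) * b y)"
   by (rule Ck1_integral_t[OF gn(1) A(1,2) b, of "1/2"]) (simp_all add: A)
  finally show ?thesis .
 qed
 let ?L = "(LINT p|lK. ?f p * W1 p) + (LINT p|lK. ?g p * W2 p)"
 have "?L = - A 0 * (LINT y|lC. \<tau> y * b y)
   + (- A 0 * (LINT y|lC. (gn n (0, y) - \<tau> y) * b y) - (LINT p|lK. (gn n p - ?f p) * W1 p) - (LINT p|lK. (pd 1 (gn n) p - ?g p) * W2 p))" for n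
 proof -
  have i0: "integrable lC (\<lambda>y. gn n (0, y))" unfolding integrable_lC
   by (intro set_integrable_continuous_Icc continuous_on_subset[OF cg0]) simp
  have E1: "(LINT p|lK. (gn n p - ?f p) * W1 p) = (LINT p|lK. gn n p * W1 p) - (LINT p|lK. ?f p * W1 p)"
   unfolding left_diff_distrib
   by (rule LINT_diff) (rule int_prod[OF integrable_lK_cont[OF cg(2)] cW(1)] int_prod[OF fi(1) cW(1)])+
  have E2: "(LINT p|lK. (pd 1 (gn n) p - ?g p) * W2 p) = (LINT p|lK. pd 1 (gn n) p * W2 p) - (LINT p|lK. ?g p * W2 p)"
   unfolding left_diff_distrib
   by (rule LINT_diff) (rule int_prod[OF integrable_lK_cont[OF cg(1)] cW(2)] int_prod[OF fi(2) cW(2)])+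
  have E3: "(LINT y|lC. (gn n (0, y) - \<tau> y) * b y) = (LINT y|lC. gn n (0, y) * b y) - (LINT y|lC. \<tau> y * b y)"
   unfolding left_diff_distrib
   by (rule LINT_diff) (rule integrable_lC_mult_continuous[OF i0 b] integrable_lC_mult_continuous[OF \<tau>i(3) b])+
  show ?thesis unfolding E1 E2 E3 using id[of n] by algebra
 qed
 moreover have "(\<lambda>n. - A 0 * (LINT y|lC. \<tau> y * b y)
   + (- A 0 * (LINT y|lC. (gn n (0, y) - \<tau> y) * b y) - (LINT p|lK. (gn n p - ?f p) * W1 p) - (LINT p|lK. (pd 1 (gn n) p - ?g p) * W2 p)))
   \<longlonglongrightarrow> - A 0 * (LINT y|lC. \<tau> y * b y) + (- A 0 * 0 - 0 - 0)"
  by (intro tendsto_intros l1 l2 l3)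
 ultimately have "?L = - A 0 * (LINT y|lC. \<tau> y * b y)"
  using LIMSEQ_unique[OF tendsto_const[of ?L sequentially]] by simp
 moreover have "?L = (LINT p|lM. f (?X p) * (A' (fst p) * b (snd p)) + ?g p * (A (fst p) * b (snd p)))"
 proof -
  have "?L = (LINT p|lK. ?f p * W1 p + ?g p * W2 p)"
   by (rule LINT_add[OF int_prod[OF fi(1) cW(1)] int_prod[OF fi(2) cW(2)], symmetric])
  also have "... = (LINT p|lM. f (?X p) * (A' (fst p) * b (snd p)) + ?g p * (A (fst p) * b (snd p)))"
   unfolding lK_lM
   by (rule LINT_cong) (use A(3,4) in \<open>auto simp: W1_def W2_def indicator_def\<close>)
  finally show ?thesis .
 qed
 ultimately show ?thesis by simp
qed

lemma loc_int_of_square: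
 assumes m: "u \<in> borel_measurable lM" and i: "integrable lM (\<lambda>p. (u p)^2)"
 shows "loc_int u"
 unfolding loc_int_def
proof (intro conjI allI m)
 fix R
 have ii: "integrable lM (\<lambda>p. (indicator {..R} (fst p) :: real) * 1)"
  using integrable_lM_mult(1)[OF indicator_lT_integrable[of R], of "\<lambda>_. 1"] by simp
 show "integrable lM (\<lambda>p. indicator {..R} (fst p) * u p)"
 proof (rule L1_bound[OF L1_add[OF ii i]])
  show "(\<lambda>p. indicator {..R} (fst p) * u p) \<in> borel_measurable lM"
   using m indicator_fst_measurable by measurable
  have "\<bar>x\<bar> \<le> 1 + x^2" for x :: real
  proof -
   have "0 \<le> (\<bar>x\<bar> - 1/2)^2" by simp
   then show ?thesis by (simp add: power2_eq_square algebra_simps abs_mult_self_eq)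
  qed
  then show "AE p in lM. norm (indicator {..R} (fst p) * u p) \<le> norm (indicator {..R} (fst p) * 1 + (u p)^2)"
   by (auto intro!: AE_I2 simp: indicator_def)
 qed
qed

text \<open>The summary of a function of finite Dirichlet energy in coordinates: \<open>g\<close>
  and \<open>h\<close> are its partial derivatives, \<open>\<tau>\<close> its edge trace. The last
  three clauses say that it is, almost everywhere, an indefinite integral in \<open>t\<close>
  starting from the trace and a periodic indefinite integral in the angle. Square integrability is
  demanded of derivatives and trace only, since fields of the nullity problem need not be square
  integrable.\<close>

definition h1_data :: "(real \<times> real => real) => (real \<times> real => real) => (real \<times> real => real) => (real => real) => bool" where
 "h1_data f g h \<tau> \<longleftrightarrow> loc_int f
   \<and> g \<in> borel_measurable lM \<and> integrable lM (\<lambda>p. (g p)^2)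
   \<and> h \<in> borel_measurable lM \<and> integrable lM (\<lambda>p. (h p)^2)
   \<and> \<tau> \<in> borel_measurable lC \<and> integrable lC (\<lambda>y. (\<tau> y)^2)
   \<and> (AE p in lM. f p = \<tau> (snd p) + prim_t g p)
   \<and> (AE t in lT. (LINT y|lC. h (t, y)) = 0)
   \<and> (\<exists>k. AE p in lM. f p = k (fst p) + prim_c h p)"

lemma face_loc_int:
 assumes c: "c > 0" and w: "\<exists>G. has_weak_gradient (Y_surface c i) f G" and tr: "has_trace (Y_surface c i) f \<tau>"
 shows "loc_int (\<lambda>p. f (Y_surface c i p))"
 unfolding loc_int_def
proof (intro conjI allI face_measurable(1)[OF c w])
 fix R :: real
 have 1: "set_integrable lborel ({0..1} \<times> {0..<2*pi}) (\<lambda>p. f (Y_surface c i p))"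
  using face_lK(1)[OF c w tr] by (simp add: integrable_restrict_space set_integrable_def)
 have 2: "set_integrable lborel ({1..max 1 R} \<times> {0..<2*pi}) (\<lambda>p. f (Y_surface c i p))"
  using weak_gradient_works[OF w] unfolding has_weak_gradient_def by auto
 have "set_integrable lborel ({0..1} \<times> {0..<2*pi} \<union> {1..max 1 R} \<times> {0..<2*pi}) (\<lambda>p. f (Y_surface c i p))"
  by (rule set_integrable_Un[OF 1 2]) (auto intro!: borel_Times)
 then have "set_integrable lborel ({0..max 0 R} \<times> {0..<2*pi}) (\<lambda>p. f (Y_surface c i p))"
  by (rule set_integrable_subset) (auto intro!: borel_Times)
 then show "integrable lM (\<lambda>p. indicator {..R} (fst p) * f (Y_surface c i p))"
  unfolding integrable_lM set_integrable_def
 proof -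
  assume h: "integrable lborel (\<lambda>x. indicat_real ({0..max 0 R} \<times> {0..<2 * pi}) x *\<^sub>R f (Y_surface c i x))"
  have "(\<lambda>p :: real \<times> real. fst p) \<in> borel_measurable borel"
   by (rule borel_measurable_continuous_onI) (intro continuous_intros)
  then have m: "(\<lambda>p :: real \<times> real. indicator {..R} (fst p) :: real) \<in> borel_measurable borel" by measurable
  have "integrable lborel (\<lambda>x. indicator {..R} (fst x) * (indicat_real ({0..max 0 R} \<times> {0..<2 * pi}) x *\<^sub>R f (Y_surface c i x)))"
   by (rule L1_bound[OF h])
     (use m borel_measurable_integrable[OF h] in \<open>auto intro!: AE_I2 simp: indicator_def\<close>)
  then show "integrable lborel (\<lambda>x. indicat_real cyl x *\<^sub>R (indicat_real {..R} (fst x) * f (Y_surface c i x)))"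
   by (rule L1_cong[THEN iffD1, rotated -1]) (auto simp: indicator_def cyl_def)
 qed
qed

lemma derivative_zero_outside:
 assumes "\<And>t. (A has_real_derivative A' t) (at t)" "\<And>t. t > R ==> A t = 0" "t > R"
 shows "A' t = 0"
proof -
 have "\<forall>\<^sub>F x in nhds t. A x = 0"
  using eventually_nhds_in_open[of "{R<..}" t] assms(2,3) by (auto elim!: eventually_mono)
 then have "(A has_real_derivative 0) (at t)" by (subst DERIV_cong_ev[OF refl _ refl]) auto
 then show ?thesis using assms(1) DERIV_unique by blast
qed

lemma C1k_obtain_derivative:
 assumes "\<And>k. C1k k A"
 obtains A' where "\<And>t. (A has_real_derivative A' t) (at t)" "continuous_on UNIV A'"
 using assms[of 1] by auto

text \<open>A cutoff splits \<open>A\<close> into a part inside the collar, for which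
  \<open>trace_identity_collar\<close> gives the edge term, and a part vanishing near the edge,
  which is a genuine test function for the weak gradient.\<close>

lemma trace_identity:
 assumes c: "c > 0" and w: "\<exists>G. has_weak_gradient (Y_surface c i) f G" and tr: "has_trace (Y_surface c i) f \<tau>"
  and g: "loc_int (grad_comp 1 (Y_surface c i) f)"
  and A: "\<And>k. C1k k A" "\<And>t. (A has_real_derivative A' t) (at t)" "continuous_on UNIV A'" "\<And>t. t > R ==> A t = 0"
  and b: "test_c b"
 shows "(LINT p|lM. f (Y_surface c i p) * (A' (fst p) * b (snd p)) + grad_comp 1 (Y_surface c i) f p * (A (fst p) * b (snd p)))
  = - A 0 * (LINT y|lC. \<tau> y * b y)"
proof -
 let ?f = "\<lambda>p. f (Y_surface c i p)" and ?g = "grad_comp 1 (Y_surface c i) f"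
 note f = face_loc_int[OF c w tr]
 \<comment> \<open>The affine argument makes \<open>ct\<close> equal to 1 up to
   \<open>t = 1/4\<close> and 0 from \<open>t = 1/2\<close> on, well inside the collar
   \<open>0 \<le> t \<le> 1\<close>.\<close>
 define ct where "ct t = smooth_step ((-4) * t + 2)" for t
 have sct: "C1k k ct" for k unfolding ct_def[abs_def] by (rule C1k_step_affine)
 have ct1: "ct t = 1" if "t \<le> 1/4" for t unfolding ct_def by (rule step_1) (use that in simp)
 have ct0: "ct t = 0" if "t > 1/2" for t unfolding ct_def by (rule step_0) (use that in simp)
 define A1 where "A1 t = A t * ct t" for t
 define A2 where "A2 t = A t + (-1) * A1 t" for t
 have sA1: "C1k k A1" for k unfolding A1_def[abs_def] by (rule C1k_mult[OF A(1) sct])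
 have sA2: "C1k k A2" for k unfolding A2_def[abs_def] by (rule C1k_add[OF A(1) C1k_cmult[OF sA1]])
 obtain A1' where A1': "\<And>t. (A1 has_real_derivative A1' t) (at t)" "continuous_on UNIV A1'"
  using C1k_obtain_derivative[of A1] sA1 by blast
 obtain A2' where A2': "\<And>t. (A2 has_real_derivative A2' t) (at t)" "continuous_on UNIV A2'"
  using C1k_obtain_derivative[of A2] sA2 by blast
 have sum: "A t = A1 t + A2 t" "A' t = A1' t + A2' t" for t
 proof -
  show 1: "A t = A1 t + A2 t" for t by (simp add: A2_def)
  have "(A has_real_derivative A1' t + A2' t) (at t)"
   using DERIV_add[OF A1'(1) A2'(1)] by (simp add: 1[symmetric])
  then show "A' t = A1' t + A2' t" using A(2) DERIV_unique by blast
 qed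
 have z1: "A1 t = 0" if "t > 1/2" for t using ct0[OF that] by (simp add: A1_def)
 have z1': "A1' t = 0" if "t > 1/2" for t by (rule derivative_zero_outside[OF A1'(1) z1 that])
 have z2: "A2 t = 0" if "t > R" for t using A(4)[OF that] by (simp add: A1_def A2_def)
 have z2': "A2' t = 0" if "t > R" for t by (rule derivative_zero_outside[OF A2'(1) z2 that])
 have t2: "test_t A2" unfolding test_t_def
 proof (intro conjI allI exI)
  show "C1k k A2" for k by (rule sA2)
  show "(0::real) < 1/4" by simp
  show "t \<notin> {1/4..R} \<longrightarrow> A2 t = 0" for t
   using z2[of t] ct1[of t] by (auto simp: A2_def A1_def not_le)
 qed
 note cb = test_c_continuous[OF b]
 obtain b' where b': "\<And>t. (b has_real_derivative b' t) (at t)"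
  using b unfolding test_c_def by (metis C1k.simps(2))
 have cA1: "continuous_on UNIV A1" "continuous_on UNIV A2" by (rule C1k_continuous[OF sA1], rule C1k_continuous[OF sA2])
 have ints: "integrable lM (\<lambda>p. ?f p * (A1' (fst p) * b (snd p)))" "integrable lM (\<lambda>p. ?g p * (A1 (fst p) * b (snd p)))"
  "integrable lM (\<lambda>p. ?f p * (A2' (fst p) * b (snd p)))" "integrable lM (\<lambda>p. ?g p * (A2 (fst p) * b (snd p)))"
  by (rule loc_int_mult_integrable[OF f A1'(2) z1' cb], assumption, rule loc_int_mult_integrable[OF g cA1(1) z1 cb], assumption,
   rule loc_int_mult_integrable[OF f A2'(2) z2' cb], assumption, rule loc_int_mult_integrable[OF g cA1(2) z2 cb])
 have i1: "integrable lM (\<lambda>p. ?f p * (A1' (fst p) * b (snd p)) + ?g p * (A1 (fst p) * b (snd p)))"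
  and i2: "integrable lM (\<lambda>p. ?f p * (A2' (fst p) * b (snd p)) + ?g p * (A2 (fst p) * b (snd p)))"
  using L1_add[OF ints(1) ints(2)] L1_add[OF ints(3) ints(4)] by auto
 have "(LINT p|lM. ?f p * (A' (fst p) * b (snd p)) + ?g p * (A (fst p) * b (snd p)))
   = (LINT p|lM. (?f p * (A1' (fst p) * b (snd p)) + ?g p * (A1 (fst p) * b (snd p)))
      + (?f p * (A2' (fst p) * b (snd p)) + ?g p * (A2 (fst p) * b (snd p))))"
  by (rule LINT_cong) (simp_all add: sum algebra_simps)
 also have "... = (LINT p|lM. ?f p * (A1' (fst p) * b (snd p)) + ?g p * (A1 (fst p) * b (snd p)))
   + (LINT p|lM. ?f p * (A2' (fst p) * b (snd p)) + ?g p * (A2 (fst p) * b (snd p)))"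
  by (rule LINT_add[OF i1 i2])
 also have "(LINT p|lM. ?f p * (A1' (fst p) * b (snd p)) + ?g p * (A1 (fst p) * b (snd p))) = - A1 0 * (LINT y|lC. \<tau> y * b y)"
  by (rule trace_identity_collar[OF c w tr A1' z1 z1' cb])
 also have "A1 0 = A 0" using ct1[of 0] by (simp add: A1_def)
 also have "(LINT p|lM. ?f p * (A2' (fst p) * b (snd p)) + ?g p * (A2 (fst p) * b (snd p))) = 0"
  using weak_gradient_test(1)[OF weak_gradient_works[OF w] t2 b A2'(1) b']
   LINT_add[OF ints(3) ints(4)] by simp
 finally show ?thesis by simp
qed

text \<open>Conformal invariance of the Dirichlet integral in two dimensions: the area density
  cancels against the inverse metric and leaves the squared coordinate derivatives.\<close>

lemma gradient_L2_iff:
 assumes c: "c > 0" and w: "\<exists>G. has_weak_gradient (Y_surface c i) f G"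
 shows "gradient_L2 (Y_surface c i) f \<longleftrightarrow>
  integrable lM (\<lambda>p. (grad_comp 1 (Y_surface c i) f p)^2 + (grad_comp 2 (Y_surface c i) f p)^2)"
proof -
 let ?X = "Y_surface c i" and ?G = "weak_gradient (Y_surface c i) f"
 note [measurable] = face_measurable(2)[OF c w] face_measurable(3)[OF c w, of 1] face_measurable(3)[OF c w, of 2] conf_measurable[of c i]
 have sp: "AE p in lM. ?G p \<in> span {pd 1 ?X p, pd 2 ?X p}"
  using weak_gradient_works[OF w] unfolding has_weak_gradient_def AE_area[OF c] by blast
 have "gradient_L2 ?X f \<longleftrightarrow> integrable lM (\<lambda>p. conf c i (fst p) * (norm (?G p))^2)"
  unfolding gradient_L2_def by (rule integrable_area[OF c]) measurable
 also have "... \<longleftrightarrow> integrable lM (\<lambda>p. (grad_comp 1 ?X f p)^2 + (grad_comp 2 ?X f p)^2)"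
 proof (rule integrable_cong_AE)
  show "AE p in lM. conf c i (fst p) * (norm (?G p))^2 = (grad_comp 1 ?X f p)^2 + (grad_comp 2 ?X f p)^2"
   using sp
  proof eventually_elim
   case (elim p)
   show ?case using tangent_inner[OF c elim, of "?G p"] unfolding power2_norm_eq_inner by (simp add: power2_eq_square mult.commute)
  qed
 qed measurable
 finally show ?thesis .
qed

lemma face_h1_data:
 assumes c: "c > 0" and w: "\<exists>G. has_weak_gradient (Y_surface c i) f G" and tr: "\<exists>\<tau>. has_trace (Y_surface c i) f \<tau>"
  and L2: "gradient_L2 (Y_surface c i) f"
 shows "h1_data (\<lambda>p. f (Y_surface c i p)) (grad_comp 1 (Y_surface c i) f) (grad_comp 2 (Y_surface c i) f) (edge_trace (Y_surface c i) f)"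
proof -
 let ?X = "Y_surface c i"
 note tr' = edge_trace_works[OF tr]
 have sq: "integrable lM (\<lambda>p. (grad_comp j ?X f p)^2)" for j
 proof (rule L1_bound[OF L2[unfolded gradient_L2_iff[OF c w]]])
  show "(\<lambda>p. (grad_comp j ?X f p)^2) \<in> borel_measurable lM" using face_measurable(3)[OF c w, of j] by measurable
  show "AE p in lM. norm ((grad_comp j ?X f p)^2) \<le> norm ((grad_comp 1 ?X f p)^2 + (grad_comp 2 ?X f p)^2)"
   using exhaust_2[of j] by (auto intro!: AE_I2)
 qed
 have lg: "loc_int (grad_comp j ?X f)" for j by (rule loc_int_of_square[OF face_measurable(3)[OF c w] sq])
 note lf = face_loc_int[OF c w tr']
 have 1: "AE p in lM. f (?X p) = edge_trace ?X f (snd p) + prim_t (grad_comp 1 ?X f) p"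
 proof (rule weak_derivative_t[OF lf lg trace_square_integrable(3)[OF tr']])
  fix A A' R b
  assume h: "\<And>k. C1k k A" "\<And>t. (A has_real_derivative A' t) (at t)" "\<And>k. C1k k A'" "\<And>t. t > R ==> A t = 0" "test_c b"
  show "(LINT p|lM. f (?X p) * (A' (fst p) * b (snd p)) + grad_comp 1 ?X f p * (A (fst p) * b (snd p)))
    = - A 0 * (LINT y|lC. edge_trace ?X f y * b y)"
   by (rule trace_identity[OF c w tr' lg h(1,2) C1k_continuous[OF h(3)] h(4,5)])
 qed
 have 2: "(LINT p|lM. f (?X p) * (a (fst p) * b' (snd p)) + grad_comp 2 ?X f p * (a (fst p) * b (snd p))) = 0"
  if h: "test_t a" "test_c b" "\<And>y. (b has_real_derivative b' y) (at y)" "continuous_on UNIV b'" for a b b'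
 proof -
  obtain R where R: "R > 0" "\<And>t. t > R ==> a t = 0" using test_t_support[OF h(1)] by metis
  obtain a' where a': "\<And>t. (a has_real_derivative a' t) (at t)"
   using h(1) unfolding test_t_def by (metis C1k.simps(2))
  note i = loc_int_mult_integrable[OF lf test_t_continuous[OF h(1)] R(2) h(4)]
   loc_int_mult_integrable[OF lg[of 2] test_t_continuous[OF h(1)] R(2) test_c_continuous[OF h(2)]]
  show ?thesis
   using weak_gradient_test(2)[OF weak_gradient_works[OF w] h(1,2) a' h(3)]
    LINT_add[OF i(1) i(2)] by simp
 qed
 show ?thesis unfolding h1_data_def
  using lf face_measurable(3)[OF c w] sq trace_square_integrable(1,2)[OF tr'] 1
   weak_derivative_c[OF lf lg 2] by blast
qed

text \<open>The edge term of the trace identity with \<open>A 0 = 1\<close> depends on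
  \<open>f\<close> alone, so pairing with all tests on the circle identifies two traces almost
  everywhere.\<close>

lemma trace_unique:
 assumes c: "c > 0" and w: "\<exists>G. has_weak_gradient (Y_surface c i) f G"
  and tr: "has_trace (Y_surface c i) f \<tau>" "has_trace (Y_surface c i) f \<tau>'"
 shows "AE y in lC. \<tau> y = \<tau>' y"
proof -
 note i = trace_square_integrable(3)[OF tr(1)] trace_square_integrable(3)[OF tr(2)]
 define A where "A t = smooth_step ((-4) * t + 2)" for t
 have sA: "C1k k A" for k unfolding A_def[abs_def] by (rule C1k_step_affine)
 obtain A' where A': "\<And>t. (A has_real_derivative A' t) (at t)" "continuous_on UNIV A'"
  using C1k_obtain_derivative[of A] sA by blast
 have A0: "A 0 = 1" unfolding A_def by (rule step_1) simp
 have z: "A t = 0" if "t > 1/2" for t unfolding A_def by (rule step_0) (use that in simp)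
 have z': "A' t = 0" if "t > 1/2" for t by (rule derivative_zero_outside[OF A'(1) z that])
 have "AE y in lC. \<tau> y - \<tau>' y = 0"
 proof (rule circle_test_zero)
  show "integrable lC (\<lambda>y. \<tau> y - \<tau>' y)" using i by simp
  fix b assume b: "test_c b"
  note cb = test_c_continuous[OF b]
  have "(LINT y|lC. \<tau> y * b y) = (LINT y|lC. \<tau>' y * b y)"
   using trace_identity_collar[OF c w tr(1) A' z z' cb] trace_identity_collar[OF c w tr(2) A' z z' cb] A0 by simp
  then show "(LINT y|lC. (\<tau> y - \<tau>' y) * b y) = 0"
   unfolding left_diff_distrib
   by (simp add: LINT_diff[OF integrable_lC_mult_continuous[OF i(1) cb] integrable_lC_mult_continuous[OF i(2) cb]])
 qed
 then show ?thesis by eventually_elim simp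
qed

text \<open>For a smooth product the constant sequence approximates the trace. The almost-everywhere
  form of the conclusions is forced by the choices hidden in \<open>weak_gradient\<close> and
  \<open>edge_trace\<close>.\<close>

lemma product_face:
 assumes c: "c > 0" and sa: "\<And>k. C1k k a" and k: "test_c k"
  and d: "\<And>t. (a has_real_derivative a' t) (at t)" "continuous_on UNIV a'"
   "\<And>t. (k has_real_derivative k' t) (at t)" "continuous_on UNIV k'"
  and f: "\<And>p. p \<in> cyl ==> f (Y_surface c i p) = a (fst p) * k (snd p)"
 shows "\<exists>G. has_weak_gradient (Y_surface c i) f G"
  and "AE p in lM. grad_comp 1 (Y_surface c i) f p = a' (fst p) * k (snd p)"
  and "AE p in lM. grad_comp 2 (Y_surface c i) f p = a (fst p) * k' (snd p)"
  and "has_trace (Y_surface c i) f (\<lambda>y. a 0 * k y)"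
  and "AE y in lC. edge_trace (Y_surface c i) f y = a 0 * k y"
proof -
 let ?X = "Y_surface c i"
 have per: "\<And>y. k (y + 2*pi) = k y" using k by (simp add: test_c_def)
 have G: "has_weak_gradient ?X f (product_gradient c i a a' k k')"
  by (rule has_weak_gradient_product[OF c d per f])
 then show w: "\<exists>G. has_weak_gradient ?X f G" by blast
 have u: "AE p in lM. grad_comp j ?X f p = product_gradient c i a a' k k' p \<bullet> pd j ?X p" for j
  by (rule weak_gradient_unique[OF weak_gradient_works[OF w] G])
 show g1: "AE p in lM. grad_comp 1 ?X f p = a' (fst p) * k (snd p)"
  using u[of 1] by (simp add: product_gradient_inner[OF c])
 show g2: "AE p in lM. grad_comp 2 ?X f p = a (fst p) * k' (snd p)"
  using u[of 2] by (simp add: product_gradient_inner[OF c])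
 let ?z = "\<lambda>p. a (fst p) * k (snd p)"
 have ck: "continuous_on UNIV k" by (rule test_c_continuous[OF k])
 show tr: "has_trace ?X f (\<lambda>y. a 0 * k y)"
  unfolding has_trace_def
 proof (intro conjI exI[of _ "\<lambda>n. ?z"] allI)
  show "(\<lambda>y. a 0 * k y) \<in> borel_measurable lC"
   using borel_measurable_continuous_onI[OF ck] by (intro borel_measurable_times) (simp_all add: measurable_restrict_space1 measurable_lborel1)
  show "Ck 1 ?z" using sa k by (intro Ck_product) (auto simp: test_c_def)
  show "periodic ?z" using per by (simp add: periodic_def)
  have "(\<integral>\<^sup>+p. ennreal ((?z p - f (?X p))^2 + (\<Sum>i\<in>UNIV. (pd i ?z p - weak_gradient ?X f p \<bullet> pd i ?X p)^2)) \<partial>lK)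
    = (\<integral>\<^sup>+p. 0 \<partial>lK)"
  proof (rule nn_integral_cong_AE)
   show "AE p in lK. ennreal ((?z p - f (?X p))^2 + (\<Sum>i\<in>UNIV. (pd i ?z p - weak_gradient ?X f p \<bullet> pd i ?X p)^2)) = 0"
    using AE_lK[OF g1] AE_lK[OF g2] AE_space[of lK]
   proof eventually_elim
    case (elim p)
    then have "p \<in> cyl" by (auto simp: space_restrict_space cyl_def)
    then show ?case using elim by (simp add: sum_2 f pd_product[OF d(1,3)])
   qed
  qed
  then show "(\<lambda>n. \<integral>\<^sup>+p. ennreal ((?z p - f (?X p))^2 + (\<Sum>i\<in>UNIV. (pd i ?z p - weak_gradient ?X f p \<bullet> pd i ?X p)^2)) \<partial>lK) \<longlonglongrightarrow> 0"
   by simp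
 qed simp
 show "AE y in lC. edge_trace ?X f y = a 0 * k y"
  by (rule trace_unique[OF c w edge_trace_works tr]) (use tr in blast)
qed

text \<open>Three cancellations: conformal invariance removes \<open>conf\<close> from the gradient
  term; \<open>|A|^2\<close> times the area density is \<open>2 sech^2\<close>; and the curvature
  vector of the circle, inward of length \<open>1 / c\<close>, pairs with the conormal to
  \<open>- cos \<alpha> / c\<close>, whose denominator is undone by the arclength element. Hence the
  plus sign in front of the cosine.\<close>

lemma index_form_coordinates:
 assumes c: "c > 0"
  and w: "\<And>i. \<exists>G. has_weak_gradient (Y_surface c i) (\<phi> i) G" "\<And>i. \<exists>\<tau>. has_trace (Y_surface c i) (\<phi> i) \<tau>"
   "\<And>i. \<exists>G. has_weak_gradient (Y_surface c i) (\<psi> i) G" "\<And>i. \<exists>\<tau>. has_trace (Y_surface c i) (\<psi> i) \<tau>"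
 shows "index_form (Y_surface c) \<phi> \<psi> = (\<Sum>i\<in>UNIV.
   (LINT p|lM. grad_comp 1 (Y_surface c i) (\<phi> i) p * grad_comp 1 (Y_surface c i) (\<psi> i) p
    + grad_comp 2 (Y_surface c i) (\<phi> i) p * grad_comp 2 (Y_surface c i) (\<psi> i) p
    - 2 * (sech (fst p + Y_shift i))^2 * \<phi> i (Y_surface c i p) * \<psi> i (Y_surface c i p))
   + cos (Y_angle i) * (LINT y|lC. edge_trace (Y_surface c i) (\<phi> i) y * edge_trace (Y_surface c i) (\<psi> i) y))"
 unfolding index_form_def
proof (rule sum.cong[OF refl])
 fix i :: 3
 let ?X = "Y_surface c i"
 let ?G = "weak_gradient ?X (\<phi> i)" and ?H = "weak_gradient ?X (\<psi> i)"
 note m0 = face_measurable(2)[OF c w(1)] face_measurable(3)[OF c w(1), of 1] face_measurable(3)[OF c w(1), of 2] conf_measurable[of c i]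
   face_measurable(2)[OF c w(3)] face_measurable(3)[OF c w(3), of 1] face_measurable(3)[OF c w(3), of 2]
   face_measurable(1)[OF c w(1)] face_measurable(1)[OF c w(3)]
 have sff: "second_ff_norm_sq ?X p = 2 * (sech (fst p + Y_shift i))^2 / conf c i (fst p)" for p
  using second_ff_norm_sq_Y[OF c, of i p] conf_pos[OF c, of i "fst p"] by (simp add: field_simps)
 have cs: "continuous_on UNIV (\<lambda>t. sech (t + Y_shift i))" by (rule C1k_continuous[OF C1k_sech])
 have m1: "(\<lambda>p. sech (fst p + Y_shift i)) \<in> borel_measurable lM"
  by (rule borel_measurable_lM_cont[OF continuous_on_fst_snd(1)[OF cs]])
 have m2: "second_ff_norm_sq ?X \<in> borel_measurable lM" unfolding sff[abs_def]
  by (intro borel_measurable_divide borel_measurable_times borel_measurable_const borel_measurable_power m1 conf_measurable)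
 note meas = borel_measurable_times borel_measurable_diff borel_measurable_add borel_measurable_inner borel_measurable_const
  borel_measurable_power m0 m1 m2 pd_measurable
 have sp: "AE p in lM. ?G p \<in> span {pd 1 ?X p, pd 2 ?X p}"
  using weak_gradient_works[OF w(1)] unfolding has_weak_gradient_def AE_area[OF c] by blast
 have "(LINT p|area ?X. ?G p \<bullet> ?H p - second_ff_norm_sq ?X p * \<phi> i (?X p) * \<psi> i (?X p))
   = (LINT p|lM. conf c i (fst p) * (?G p \<bullet> ?H p - second_ff_norm_sq ?X p * \<phi> i (?X p) * \<psi> i (?X p)))"
  by (rule integral_area[OF c]) (intro meas)
 also have "... = (LINT p|lM. grad_comp 1 ?X (\<phi> i) p * grad_comp 1 ?X (\<psi> i) p
    + grad_comp 2 ?X (\<phi> i) p * grad_comp 2 ?X (\<psi> i) p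
    - 2 * (sech (fst p + Y_shift i))^2 * \<phi> i (?X p) * \<psi> i (?X p))"
 proof (rule integral_cong_AE)
  show "AE p in lM. conf c i (fst p) * (?G p \<bullet> ?H p - second_ff_norm_sq ?X p * \<phi> i (?X p) * \<psi> i (?X p))
   = grad_comp 1 ?X (\<phi> i) p * grad_comp 1 ?X (\<psi> i) p
    + grad_comp 2 ?X (\<phi> i) p * grad_comp 2 ?X (\<psi> i) p
    - 2 * (sech (fst p + Y_shift i))^2 * \<phi> i (?X p) * \<psi> i (?X p)"
   using sp
  proof eventually_elim
   case (elim p)
   have "conf c i (fst p) * (second_ff_norm_sq ?X p * \<phi> i (?X p) * \<psi> i (?X p))
     = 2 * (sech (fst p + Y_shift i))^2 * \<phi> i (?X p) * \<psi> i (?X p)"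
    using second_ff_norm_sq_Y[OF c, of i p] by (simp add: mult_ac)
   moreover have "conf c i (fst p) * (?G p \<bullet> ?H p) = grad_comp 1 ?X (\<phi> i) p * grad_comp 1 ?X (\<psi> i) p
    + grad_comp 2 ?X (\<phi> i) p * grad_comp 2 ?X (\<psi> i) p"
    using tangent_inner[OF c elim, of "?H p"] by (simp add: mult.commute)
   ultimately show ?case by (simp add: right_diff_distrib)
  qed
 qed (intro meas)+
 finally have bulk: "(LINT p|area ?X. ?G p \<bullet> ?H p - second_ff_norm_sq ?X p * \<phi> i (?X p) * \<psi> i (?X p))
  = (LINT p|lM. grad_comp 1 ?X (\<phi> i) p * grad_comp 1 ?X (\<psi> i) p
    + grad_comp 2 ?X (\<phi> i) p * grad_comp 2 ?X (\<psi> i) p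
    - 2 * (sech (fst p + Y_shift i))^2 * \<phi> i (?X p) * \<psi> i (?X p))" .
 have arc: "arclength (edge ?X) = density lC (\<lambda>y. ennreal c)"
  using c by (simp add: arclength_def edge_derivative norm_e_theta)
 have kap: "curvature_vector (edge ?X) y \<bullet> conormal ?X y = - (1 / c) * cos (Y_angle i)" for y
 proof -
  have "cos y * cos y + sin y * sin y = 1" using sin_cos_squared_add[of y] by (simp add: power2_eq_square)
  then show ?thesis
   by (simp add: curvature_vector_Y[OF c] conormal_Y[OF c] inner_add_right inner_vector_3)
 qed
 note [measurable] = trace_square_integrable(1)[OF edge_trace_works[OF w(2)]] trace_square_integrable(1)[OF edge_trace_works[OF w(4)]]
 have "(LINT y|arclength (edge ?X). (curvature_vector (edge ?X) y \<bullet> conormal ?X y) * edge_trace ?X (\<phi> i) y * edge_trace ?X (\<psi> i) y)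
   = (LINT y|lC. c * (- (1 / c) * cos (Y_angle i) * edge_trace ?X (\<phi> i) y * edge_trace ?X (\<psi> i) y))"
  unfolding arc kap using c by (subst integral_density) auto
 also have "... = (LINT y|lC. (- cos (Y_angle i)) * (edge_trace ?X (\<phi> i) y * edge_trace ?X (\<psi> i) y))"
  by (rule LINT_cong) (use c in auto)
 also have "... = - cos (Y_angle i) * (LINT y|lC. edge_trace ?X (\<phi> i) y * edge_trace ?X (\<psi> i) y)"
  by (rule integral_mult_right_zero)
 finally show "(LINT p|area ?X. ?G p \<bullet> ?H p - second_ff_norm_sq ?X p * \<phi> i (?X p) * \<psi> i (?X p))
   - (LINT y|arclength (edge ?X). (curvature_vector (edge ?X) y \<bullet> conormal ?X y) * edge_trace ?X (\<phi> i) y * edge_trace ?X (\<psi> i) y)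
   = (LINT p|lM. grad_comp 1 ?X (\<phi> i) p * grad_comp 1 ?X (\<psi> i) p
    + grad_comp 2 ?X (\<phi> i) p * grad_comp 2 ?X (\<psi> i) p
    - 2 * (sech (fst p + Y_shift i))^2 * \<phi> i (?X p) * \<psi> i (?X p))
   + cos (Y_angle i) * (LINT y|lC. edge_trace ?X (\<phi> i) y * edge_trace ?X (\<psi> i) y)"
  unfolding bulk by simp
qed

section \<open>The energy of mean-zero functions\<close>

lemma slice_measurable:
 assumes "f \<in> borel_measurable lM"
 shows "y \<in> space lC ==> (\<lambda>t. f (t, y)) \<in> borel_measurable lT"
  "t \<in> space lT ==> (\<lambda>y. f (t, y)) \<in> borel_measurable lC"
proof -
 have f: "f \<in> borel_measurable (lT \<Otimes>\<^sub>M lC)" using assms by (simp only: lM_pair)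
 show "y \<in> space lC ==> (\<lambda>t. f (t, y)) \<in> borel_measurable lT" by (rule measurable_Pair1[OF f])
 show "t \<in> space lT ==> (\<lambda>y. f (t, y)) \<in> borel_measurable lC" by (rule measurable_Pair2[OF f])
qed

lemma slice_integrable:
 assumes "integrable lM (u :: _ => real)"
 shows "AE t in lT. integrable lC (\<lambda>y. u (t, y))" "AE y in lC. integrable lT (\<lambda>t. u (t, y))"
  "integrable lT (\<lambda>t. LINT y|lC. u (t, y))" "(LINT p|lM. u p) = (LINT t|lT. LINT y|lC. u (t, y))"
  "integrable lC (\<lambda>y. LINT t|lT. u (t, y))" "(LINT p|lM. u p) = (LINT y|lC. LINT t|lT. u (t, y))"
proof -
 have i: "integrable (lT \<Otimes>\<^sub>M lC) (case_prod (\<lambda>t y. u (t, y)))" using assms by (simp add: lM_pair)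
 show "AE t in lT. integrable lC (\<lambda>y. u (t, y))" by (rule lTC.AE_integrable_fst[OF i])
 show "AE y in lC. integrable lT (\<lambda>t. u (t, y))" by (rule lTC.AE_integrable_snd[OF i])
 show "integrable lT (\<lambda>t. LINT y|lC. u (t, y))" by (rule lTC.integrable_fst[OF i])
 show "integrable lC (\<lambda>y. LINT t|lT. u (t, y))" by (rule lTC.integrable_snd[OF i])
 show "(LINT p|lM. u p) = (LINT t|lT. LINT y|lC. u (t, y))" using lTC.integral_fst[OF i] by (simp add: lM_pair)
 show "(LINT p|lM. u p) = (LINT y|lC. LINT t|lT. u (t, y))" using lTC.integral_snd[OF i] by (simp add: lM_pair)
qed

text \<open>The representative of \<open>f\<close> that is absolutely continuous in \<open>t\<close>
  on almost every line and takes the value \<open>\<tau>\<close> at the edge exactly.\<close>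

definition rep :: "(real => real) => (real \<times> real => real) => real \<times> real => real" where
 "rep \<tau> g p = \<tau> (snd p) + prim_t g p"

lemma rep_0: "rep \<tau> g (0, y) = \<tau> y"
 by (simp add: rep_def prim_t_def set_integral_Icc_self)

context
 fixes f g h \<tau> assumes d: "h1_data f g h \<tau>"
begin

lemma h1_facts:
 shows "loc_int f" "loc_int g" "loc_int h"
  "f \<in> borel_measurable lM" "g \<in> borel_measurable lM" "integrable lM (\<lambda>p. (g p)^2)" "h \<in> borel_measurable lM" "integrable lM (\<lambda>p. (h p)^2)"
  "\<tau> \<in> borel_measurable lC" "integrable lC (\<lambda>y. (\<tau> y)^2)" "AE p in lM. f p = rep \<tau> g p"
  "AE t in lT. (LINT y|lC. h (t, y)) = 0" "integrable lC \<tau>"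
proof -
 show g: "g \<in> borel_measurable lM" "integrable lM (\<lambda>p. (g p)^2)" and h: "h \<in> borel_measurable lM" "integrable lM (\<lambda>p. (h p)^2)"
  and f: "loc_int f" and t: "\<tau> \<in> borel_measurable lC" "integrable lC (\<lambda>y. (\<tau> y)^2)"
  and "AE t in lT. (LINT y|lC. h (t, y)) = 0" "AE p in lM. f p = rep \<tau> g p"
  using d unfolding h1_data_def rep_def by auto
 show "loc_int g" "loc_int h" by (rule loc_int_of_square[OF g], rule loc_int_of_square[OF h])
 show "f \<in> borel_measurable lM" using f by (rule loc_int_measurable)
 show "integrable lC \<tau>" by (rule lC.square_integrable_imp_integrable[OF t])
qed

lemma rep_measurable: "rep \<tau> g \<in> borel_measurable lM"
proof -
 have "(\<lambda>p. \<tau> (snd p)) \<in> borel_measurable lM"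
  using measurable_compose[OF measurable_snd[of lT lC] h1_facts(9)] by (simp only: lM_pair)
 then show ?thesis unfolding rep_def[abs_def] using prim_measurable(1)[OF h1_facts(5)] by measurable
qed

lemma h1_slice_t:
 "AE y in lC. (\<forall>R. ac_on 0 R (\<lambda>t. rep \<tau> g (t, y)) (\<lambda>t. g (t, y))) \<and> integrable lT (\<lambda>t. (g (t, y))^2)
   \<and> (\<lambda>t. rep \<tau> g (t, y)) \<in> borel_measurable lT \<and> (\<lambda>t. g (t, y)) \<in> borel_measurable lT
   \<and> (AE t in lT. f (t, y) = rep \<tau> g (t, y))"
 using loc_int_slice_t[OF h1_facts(2)] slice_integrable(2)[OF h1_facts(6)] AE_space AE_lM_slices(2)[OF h1_facts(11)]
proof eventually_elim
 case (elim y)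
 have "ac_on 0 R (\<lambda>t. rep \<tau> g (t, y)) (\<lambda>t. g (t, y))" for R
  by (rule ac_onI) (use elim(1) in \<open>auto simp: rep_def prim_t_def set_integral_Icc_self\<close>)
 then show ?case using elim slice_measurable(1)[OF rep_measurable] slice_measurable(1)[OF h1_facts(5)] by blast
qed

lemma h1_slice_c:
 "AE t in lT. \<exists>w. ac_on 0 (2*pi) w (\<lambda>y. h (t, y)) \<and> w 0 = w (2*pi) \<and> set_integrable lborel {0..2*pi} (\<lambda>y. (h (t, y))^2)
   \<and> (AE y in lC. f (t, y) = w y)"
proof -
 obtain k where k: "AE p in lM. f p = k (fst p) + prim_c h p" using d unfolding h1_data_def by blast
 show ?thesis
  using loc_int_slice_c[OF h1_facts(3)] slice_integrable(1)[OF h1_facts(8)] AE_lM_slices(1)[OF k] h1_facts(12)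
 proof eventually_elim
  case (elim t)
  let ?w = "\<lambda>y. k t + prim_c h (t, y)"
  have i: "set_integrable lborel {0..2*pi} (\<lambda>y. h (t, y))" using elim(1) by (simp add: integrable_lC)
  have "ac_on 0 (2*pi) ?w (\<lambda>y. h (t, y))"
   by (rule ac_onI[OF i]) (simp add: prim_c_def set_integral_Icc_self)
  moreover have "?w 0 = ?w (2*pi)"
   using elim(4) by (simp add: prim_c_def set_integral_Icc_self integral_lC)
  ultimately show ?case using elim(2,3) by (auto simp: integrable_lC intro!: exI[of _ ?w])
 qed
qed

text \<open>Wirtinger's inequality on almost every circle bounds the slices of \<open>f\<close> by
  those of \<open>h\<close>. For functions of mean zero, square integrability is thus a consequence
  of finite energy.\<close>

lemma h1_wirtinger:
 assumes mean: "AE t in lT. (LINT s|lC. f (t, s)) = 0"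
 shows "AE t in lT. integrable lC (\<lambda>s. (f (t, s))^2) \<and> (LINT s|lC. (f (t, s))^2) \<le> (LINT s|lC. (h (t, s))^2)"
  "integrable lM (\<lambda>p. (f p)^2)" "(LINT p|lM. (f p)^2) \<le> (LINT p|lM. (h p)^2)"
proof -
 show 1: "AE t in lT. integrable lC (\<lambda>s. (f (t, s))^2) \<and> (LINT s|lC. (f (t, s))^2) \<le> (LINT s|lC. (h (t, s))^2)"
  using h1_slice_c mean AE_space
 proof eventually_elim
  case (elim t)
  then obtain w where w: "ac_on 0 (2*pi) w (\<lambda>s. h (t, s))" "w 0 = w (2*pi)" "set_integrable lborel {0..2*pi} (\<lambda>s. (h (t, s))^2)"
   "AE s in lC. f (t, s) = w s" by blast
  have fm: "(\<lambda>s. f (t, s)) \<in> borel_measurable lC" using slice_measurable(2)[OF h1_facts(4)] elim by blast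
  have cw: "continuous_on {0..2*pi} w" by (rule ac_on_continuous[OF w(1)])
  have iw: "integrable lC w" "integrable lC (\<lambda>s. (w s)^2)"
   unfolding integrable_lC by (intro set_integrable_continuous_Icc continuous_intros cw)+
  have "(LINT s|lC. w s) = (LINT s|lC. f (t, s))"
   by (rule integral_cong_AE) (use w(4) fm iw(1) in \<open>auto elim!: eventually_mono\<close>)
  then have "(LINT s|lC. (w s)^2) \<le> (LINT s|lC. (h (t, s))^2)"
   using wirtinger[OF w(1,3,2)] elim(2) by (simp add: integral_lC)
  moreover have "(LINT s|lC. (f (t, s))^2) = (LINT s|lC. (w s)^2)"
   by (rule integral_cong_AE) (use w(4) fm iw(1) in \<open>auto elim!: eventually_mono\<close>)
  moreover have "integrable lC (\<lambda>s. (f (t, s))^2)"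
   by (rule integrable_cong_AE_imp[OF iw(2)]) (use w(4) fm in \<open>auto elim!: eventually_mono\<close>)
  ultimately show ?case by simp
 qed
 have m: "(\<lambda>p. (f p)^2) \<in> borel_measurable (lT \<Otimes>\<^sub>M lC)"
  using h1_facts(4) unfolding lM_pair by measurable
 have "integrable (lT \<Otimes>\<^sub>M lC) (\<lambda>p. (f p)^2)"
 proof (rule lTC.Fubini_integrable[OF m])
  show "AE x in lT. integrable lC (\<lambda>y. (f (x, y))^2)" using 1 by eventually_elim blast
  show "integrable lT (\<lambda>x. LINT y|lC. norm ((f (x, y))^2))"
  proof (rule L1_bound[OF slice_integrable(3)[OF h1_facts(8)]])
   show "(\<lambda>x. LINT y|lC. norm ((f (x, y))^2)) \<in> borel_measurable lT"
    by (intro lC.borel_measurable_lebesgue_integral) (use m in simp)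
   show "AE x in lT. norm (LINT y|lC. norm ((f (x, y))^2)) \<le> norm (LINT s|lC. (h (x, s))^2)"
    using 1 by eventually_elim simp
  qed
 qed
 then show i: "integrable lM (\<lambda>p. (f p)^2)" by (simp only: lM_pair)
 show "(LINT p|lM. (f p)^2) \<le> (LINT p|lM. (h p)^2)"
  unfolding slice_integrable(4)[OF i] slice_integrable(4)[OF h1_facts(8)]
  by (rule integral_mono_AE[OF slice_integrable(3)[OF i] slice_integrable(3)[OF h1_facts(8)]]) (use 1 in \<open>auto elim!: eventually_mono\<close>)
qed

end

lemma tanh_sech: "(tanh x)^2 = 1 - (sech x)\<^sup>2" for x :: real
proof -
 have "(sinh x)^2 = (cosh x)^2 - 1" by (simp add: cosh_square_eq)
 moreover have "cosh x \<noteq> 0" using cosh_real_pos[of x] by linarith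
 ultimately show ?thesis by (simp add: tanh_def sech_def power_divide diff_divide_distrib)
qed

lemma sech_bounds: "0 < sech x" "sech x \<le> 1"
 using cosh_real_ge_1[of x] by (auto simp: sech_def)

lemma tanh_derivative: "((\<lambda>t. tanh (t + T)) has_real_derivative (sech (t + T))^2) (at t)"
proof -
 have "cosh (t + T) \<noteq> 0" using cosh_real_pos[of "t + T"] by linarith
 then have "((\<lambda>t. tanh (t + T)) has_real_derivative 1 - (tanh (t + T))\<^sup>2) (at t)"
  by (auto intro!: derivative_eq_intros)
 then show ?thesis by (simp add: tanh_sech)
qed

lemma sech_derivative: "((\<lambda>t. sech (t + T)) has_real_derivative - sech (t + T) * tanh (t + T)) (at t)"
proof -
 have "cosh (t + T) \<noteq> 0" using cosh_real_pos[of "t + T"] by linarith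
 then show ?thesis unfolding sech_def
  by (auto intro!: derivative_eq_intros simp: tanh_def power2_eq_square)
qed

lemma sech_tanh_continuous: "continuous_on UNIV (\<lambda>t. sech (t + T))" "continuous_on UNIV (\<lambda>t. tanh (t + T) :: real)"
 by (rule C1k_continuous[OF C1k_sech], rule C1k_continuous[OF C1k_tanh])

lemma sech_tanh_measurable: "(\<lambda>p. sech (fst p + T)) \<in> borel_measurable lM" "(\<lambda>p. tanh (fst p + T) :: real) \<in> borel_measurable lM"
 by (rule borel_measurable_lM_cont, rule continuous_on_fst_snd, rule sech_tanh_continuous)+

lemma integrable_mult_bounded:
 assumes "integrable M (u :: _ => real)" "w \<in> borel_measurable M" "\<And>x. \<bar>w x\<bar> \<le> B"
 shows "integrable M (\<lambda>x. w x * u x)"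
proof -
 note [measurable] = assms(2) borel_measurable_integrable[OF assms(1)]
 have "\<bar>w x * u x\<bar> \<le> \<bar>B * u x\<bar>" for x
  using assms(3)[of x] by (auto simp: abs_mult intro!: mult_right_mono intro: order_trans[OF _ abs_ge_self])
 then show ?thesis by (intro L1_bound[OF integrable_mult_right[of B, OF assms(1)]]) auto
qed

text \<open>On mean-zero functions the substitution \<open>f = sech * w\<close> turns the index form into a sum of squares
 plus the Wirtinger deficit.\<close>

lemma mean_zero_identity:
 assumes d: "h1_data f g h \<tau>" and mean: "AE t in lT. (LINT y|lC. f (t, y)) = 0"
 shows "integrable lM (\<lambda>p. (g p + tanh (fst p + T) * f p)^2)"
  "(LINT p|lM. (g p)^2) + (LINT p|lM. (h p)^2) - 2 * (LINT p|lM. (sech (fst p + T))^2 * (f p)^2) - tanh T * (LINT y|lC. (\<tau> y)^2)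
   = (LINT p|lM. (g p + tanh (fst p + T) * f p)^2) + ((LINT p|lM. (h p)^2) - (LINT p|lM. (f p)^2))"
proof -
 note F = h1_facts[OF d] and f2 = h1_wirtinger(2)[OF d mean]
 note [measurable] = F(4) F(5) sech_tanh_measurable[of T]
 have tb: "\<bar>tanh (x::real)\<bar> \<le> 1" for x using tanh_real_bounds[of x] by (auto simp: abs_le_iff)
 have i1: "integrable lM (\<lambda>p. (sech (fst p + T))^2 * (f p)^2)"
  by (rule integrable_mult_bounded[OF f2, where B=1]) (use sech_bounds in \<open>auto simp: power_le_one less_imp_le\<close>)
 show i2: "integrable lM (\<lambda>p. (g p + tanh (fst p + T) * f p)^2)"
 proof (rule L1_bound[OF L1_add[OF integrable_mult_right[of 2, OF F(6)] integrable_mult_right[of 2, OF f2]]])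
  show "AE p in lM. norm ((g p + tanh (fst p + T) * f p)^2) \<le> norm (2 * (g p)^2 + 2 * (f p)^2)"
  proof (rule AE_I2)
   fix p :: "real \<times> real"
   have "(tanh (fst p + T) * f p)^2 \<le> 1 * (f p)^2" unfolding power_mult_distrib
    by (rule mult_right_mono) (use tb[of "fst p + T"] in \<open>auto simp: abs_square_le_1\<close>)
   moreover have "2 * (g p)^2 + 2 * (tanh (fst p + T) * f p)^2 - (g p + tanh (fst p + T) * f p)\<^sup>2 = (g p - tanh (fst p + T) * f p)^2"
    by algebra
   ultimately show "norm ((g p + tanh (fst p + T) * f p)^2) \<le> norm (2 * (g p)^2 + 2 * (f p)^2)"
    by (smt (verit) real_norm_def zero_le_power2)
  qed
 qed measurable
 \<comment> \<open>\<open>1 - 2 sech^2\<close> is \<open>v' + v^2\<close> for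
   \<open>v = - tanh\<close>. The surplus \<open>1\<close> contributes the integral of
   \<open>f^2\<close> that reappears inside the Wirtinger deficit.\<close>
 let ?W = "\<lambda>p. (1 - 2 * (sech (fst p + T))^2) * (f p)^2"
 have eW: "?W = (\<lambda>p. (f p)^2 - 2 * ((sech (fst p + T))^2 * (f p)^2))" by (auto simp: algebra_simps)
 have iW: "integrable lM ?W" unfolding eW by (intro L1_diff f2 integrable_mult_right i1)
 have "(LINT p|lM. (g p)^2) + (LINT p|lM. ?W p) = (LINT y|lC. (LINT t|lT. (g (t, y))^2) + (LINT t|lT. ?W (t, y)))"
  unfolding slice_integrable(6)[OF F(6)] slice_integrable(6)[OF iW]
  by (rule LINT_add[OF slice_integrable(5)[OF F(6)] slice_integrable(5)[OF iW], symmetric])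
 also have "... = (LINT y|lC. (LINT t|lT. (g (t, y) + tanh (fst (t, y) + T) * f (t, y))^2) + tanh T * (\<tau> y)^2)"
 proof (rule integral_cong_AE)
  show "(\<lambda>y. (LINT t|lT. (g (t, y))^2) + (LINT t|lT. ?W (t, y))) \<in> borel_measurable lC"
   using slice_integrable(5)[OF F(6)] slice_integrable(5)[OF iW] by (intro borel_measurable_add borel_measurable_integrable)
  show "(\<lambda>y. (LINT t|lT. (g (t, y) + tanh (fst (t, y) + T) * f (t, y))^2) + tanh T * (\<tau> y)^2) \<in> borel_measurable lC"
   using slice_integrable(5)[OF i2] F(10) by (intro borel_measurable_add borel_measurable_integrable borel_measurable_times borel_measurable_const) auto
  show "AE y in lC. (LINT t|lT. (g (t, y))^2) + (LINT t|lT. ?W (t, y))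
    = (LINT t|lT. (g (t, y) + tanh (fst (t, y) + T) * f (t, y))^2) + tanh T * (\<tau> y)^2"
   using h1_slice_t[OF d] slice_integrable(2)[OF f2] AE_space
  proof eventually_elim
   case (elim y)
   let ?u = "\<lambda>t. rep \<tau> g (t, y)" and ?g = "\<lambda>t. g (t, y)"
   have ac: "\<And>R. ac_on 0 R ?u ?g" and g2: "integrable lT (\<lambda>t. (?g t)^2)" and um: "?u \<in> borel_measurable lT" and gm: "?g \<in> borel_measurable lT"
    and fu: "AE t in lT. f (t, y) = ?u t" using elim by auto
   have fm: "(\<lambda>t. f (t, y)) \<in> borel_measurable lT" using slice_measurable(1)[OF F(4)] elim by blast
   have u2: "integrable lT (\<lambda>t. (?u t)^2)"
    by (rule integrable_cong_AE_imp[OF elim(2)]) (use fu um in \<open>auto elim!: eventually_mono\<close>)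
   have mm: "(\<lambda>t. tanh (t + T)) \<in> borel_measurable lT" "(\<lambda>t. sech (t + T)) \<in> borel_measurable lT"
    using borel_measurable_continuous_onI[OF sech_tanh_continuous(2)] borel_measurable_continuous_onI[OF sech_tanh_continuous(1)]
    by (simp_all add: measurable_restrict_space1 measurable_lborel1)
   note r = riccati_half_line[of ?u ?g "\<lambda>t. - tanh (t + T)" "\<lambda>t. - (sech (t + T))\<^sup>2" 1, OF ac um gm u2 g2]
   have R: "(LINT t|lT. (?g t)^2) + (LINT t|lT. (- (sech (t + T))\<^sup>2 + (- tanh (t + T))^2) * (?u t)^2)
    = (LINT t|lT. (?g t - - tanh (t + T) * ?u t)^2) - - tanh (0 + T) * (?u 0)^2"
    by (rule r(3)) (use tb sech_bounds in \<open>auto intro!: derivative_eq_intros tanh_derivative continuous_intros sech_tanh_continuous simp: power_le_one less_imp_le tanh_sech\<close>)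
   have "(LINT t|lT. ?W (t, y)) = (LINT t|lT. (- (sech (t + T))\<^sup>2 + (- tanh (t + T))^2) * (?u t)^2)"
    by (rule integral_cong_AE) (use fu um fm mm in \<open>auto elim!: eventually_mono simp: tanh_sech\<close>)
   moreover have "(LINT t|lT. (g (t, y) + tanh (fst (t, y) + T) * f (t, y))^2) = (LINT t|lT. (?g t - - tanh (t + T) * ?u t)^2)"
    by (rule integral_cong_AE) (use fu um fm gm mm in \<open>auto elim!: eventually_mono\<close>)
   ultimately show ?case using R by (simp add: rep_0)
  qed
 qed
 also have "... = (LINT p|lM. (g p + tanh (fst p + T) * f p)^2) + tanh T * (LINT y|lC. (\<tau> y)^2)"
  unfolding slice_integrable(6)[OF i2]
  by (subst LINT_add) (use slice_integrable(5)[OF i2] F(10) in auto)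
 finally have "(LINT p|lM. (g p)^2) + (LINT p|lM. ?W p)
   = (LINT p|lM. (g p + tanh (fst p + T) * f p)^2) + tanh T * (LINT y|lC. (\<tau> y)^2)" .
 moreover have "(LINT p|lM. ?W p) = (LINT p|lM. (f p)^2) - 2 * (LINT p|lM. (sech (fst p + T))^2 * (f p)^2)"
  unfolding eW by (subst LINT_diff[OF f2 integrable_mult_right[OF i1]]) simp
 ultimately show "(LINT p|lM. (g p)^2) + (LINT p|lM. (h p)^2) - 2 * (LINT p|lM. (sech (fst p + T))^2 * (f p)^2) - tanh T * (LINT y|lC. (\<tau> y)^2)
   = (LINT p|lM. (g p + tanh (fst p + T) * f p)^2) + ((LINT p|lM. (h p)^2) - (LINT p|lM. (f p)^2))"
  by linarith
qed

section \<open>The radial part\<close>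

lemma set_integrable_of_lT: "integrable lT (f :: real => real) ==> 0 \<le> a ==> set_integrable lborel {a..b} f"
 unfolding integrable_lT by (erule set_integrable_subset) auto

text \<open>Cauchy-Schwarz bounds the squared increment of \<open>u\<close> over
  \<open>[0, t]\<close> by \<open>t\<close> times the energy; it is obtained here from the
  nonnegative variance of \<open>g\<close> about its mean \<open>m\<close> on the interval.\<close>

lemma ac_growth:
 assumes ac: "\<And>R. ac_on 0 R u g" and g2: "integrable lT (\<lambda>t. (g t)^2)" and t: "t \<ge> 0"
 shows "(u t)^2 \<le> 2 * (u 0)^2 + 2 * t * (LINT t|lT. (g t)^2)"
proof -
 define m where "m = (LINT s:{0..t}|lborel. g s) / t"
 define K where "K = (LINT t|lT. (g t)^2)"
 have K: "(LINT s:{0..t}|lborel. (g s)^2) \<le> K"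
 proof -
  have "set_integrable lborel {0..} (\<lambda>t. (g t)^2)" using g2 by (simp add: integrable_lT)
  then show ?thesis unfolding K_def integral_lT set_lebesgue_integral_def
   by (intro integral_mono_AE) (use set_integrable_of_lT[OF g2, of 0 t] in \<open>auto simp: set_integrable_def indicator_def intro!: AE_I2\<close>)
 qed
 have ut: "u t = u 0 + (LINT s:{0..t}|lborel. g s)" by (rule ac_onD[OF ac t order_refl])
 have "(LINT s:{0..t}|lborel. g s)^2 \<le> t * K"
 proof (cases "t = 0")
  case True then show ?thesis by (simp add: set_integral_Icc_self)
 next
  case False
  then have t0: "t > 0" using t by simp
  have i: "set_integrable lborel {0..t} g" by (rule ac_on_integrable[OF ac])
  have i2: "set_integrable lborel {0..t} (\<lambda>s. (g s)^2)" by (rule set_integrable_of_lT[OF g2]) simp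
  have i3: "set_integrable lborel {0..t} (\<lambda>s. m^2)" by (rule set_integrable_continuous_Icc) simp
  have i4: "set_integrable lborel {0..t} (\<lambda>s. (2 * m) * g s)" using i by simp
  have e: "(g s - m)^2 = ((g s)^2 - (2 * m) * g s) + m^2" for s by algebra
  have "0 \<le> (LINT s:{0..t}|lborel. (g s - m)^2)"
   unfolding set_lebesgue_integral_def by (rule integral_nonneg_AE) (auto intro!: AE_I2)
  also have "... = (LINT s:{0..t}|lborel. (g s)^2) - 2 * m * (LINT s:{0..t}|lborel. g s) + m^2 * t"
   unfolding e set_integral_add(2)[OF set_integral_diff(1)[OF i2 i4] i3] set_integral_diff(2)[OF i2 i4] set_integral_mult_right
   using t0 by (simp add: set_integral_const)
  also have "(LINT s:{0..t}|lborel. g s) = m * t" using t0 by (simp add: m_def)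
  finally have "m^2 * t \<le> K" using K by (simp add: power2_eq_square)
  then have "t * (m^2 * t) \<le> t * K" using t0 by (intro mult_left_mono) auto
  then show ?thesis using t0 by (simp add: m_def power2_eq_square)
 qed
 moreover have "2 * (u 0)^2 + 2 * (LINT s:{0..t}|lborel. g s)^2 - (u t)\<^sup>2 = (u 0 - (LINT s:{0..t}|lborel. g s))^2"
  unfolding ut by algebra
 ultimately show ?thesis unfolding K_def[symmetric]
  using zero_le_power2[of "u 0 - (LINT s:{0..t}|lborel. g s)"] by linarith
qed

lemma integrable_exp_lT: "integrable lT (\<lambda>t. exp (- t))"
proof -
 have "((\<lambda>x::real. exp (- x)) \<longlongrightarrow> 0) at_top"
  by (rule filterlim_compose[OF exp_at_bot filterlim_uminus_at_bot_at_top])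
 then have lim: "((\<lambda>x::real. - exp (- x)) \<longlongrightarrow> 0) at_top" using tendsto_minus[of "\<lambda>x. exp (- x)" 0] by simp
 have "(\<integral>\<^sup>+x. ennreal (exp (- x)) * indicator {0..} x \<partial>lborel) = ennreal (0 - (- exp (- 0)))"
 proof (rule nn_integral_FTC_atLeast[OF _ _ _ lim])
  show "((\<lambda>x. - exp (- x)) has_real_derivative exp (- x)) (at x)" for x :: real
   by (auto intro!: derivative_eq_intros)
 qed auto
 moreover have "(\<integral>\<^sup>+x. ennreal (norm (indicator {0..} x *\<^sub>R exp (- x :: real))) \<partial>lborel)
   = (\<integral>\<^sup>+x. ennreal (exp (- x)) * indicator {0..} x \<partial>lborel)"
  by (rule nn_integral_cong) (auto simp: indicator_def)
 ultimately have "(\<integral>\<^sup>+x. ennreal (norm (indicator {0..} x *\<^sub>R exp (- x :: real))) \<partial>lborel) < \<infinity>"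
  by simp
 then show ?thesis unfolding integrable_lT set_integrable_def
  by (intro integrableI_bounded) auto
qed

text \<open>From \<open>sech s \<le> 2 exp (- s)\<close>, squared, and
  \<open>1 + t \<le> exp t\<close>: one of the two factors \<open>exp (- t)\<close> pays for the
  growth.\<close>

lemma sech_sq_exp_bound: "t \<ge> 0 ==> (1 + t) * (sech (t + T))^2 \<le> 4 * exp (2 * \<bar>T\<bar>) * exp (- t)"
proof -
 assume t: "t \<ge> 0"
 have "exp (t + T) \<le> 2 * cosh (t + T)" by (simp add: cosh_def)
 then have "exp (t + T) * sech (t + T) \<le> 2" using cosh_real_pos[of "t + T"] by (simp add: sech_def field_simps)
 then have 1: "exp (- (t + T)) * (exp (t + T) * sech (t + T)) \<le> exp (- (t + T)) * 2" by (rule mult_left_mono) simp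
 have 2: "exp (- (t + T)) * exp (t + T) = 1" by (simp add: mult_exp_exp)
 have s: "sech (t + T) \<le> 2 * exp (- (t + T))"
  using 1 unfolding mult.assoc[symmetric] 2 by simp
 have "(sech (t + T))^2 \<le> (2 * exp (- (t + T)))^2"
  by (rule power_mono[OF s]) (use sech_bounds(1)[of "t + T"] in simp)
 also have "... = 4 * exp (- 2 * T) * (exp (- t) * exp (- t))"
 proof -
  have "(exp (- (t + T)))^2 = exp (- 2 * T) * (exp (- t) * exp (- t))"
   unfolding exp_double[symmetric] mult_exp_exp by (rule arg_cong[of _ _ exp]) simp
  then show ?thesis by (simp only: power_mult_distrib) simp
 qed
 also have "... \<le> 4 * exp (2 * \<bar>T\<bar>) * (exp (- t) * exp (- t))"
  by (intro mult_right_mono mult_left_mono) auto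
 finally have "(1 + t) * (sech (t + T))^2 \<le> exp t * (4 * exp (2 * \<bar>T\<bar>) * (exp (- t) * exp (- t)))"
  using t exp_ge_add_one_self[of t] by (intro mult_mono) auto
 also have "... = 4 * exp (2 * \<bar>T\<bar>) * exp (- t) * (exp t * exp (- t))" by (simp only: mult_ac)
 finally show ?thesis by (simp add: mult_exp_exp)
qed

lemma integrable_sech_sq_growth:
 assumes m: "u \<in> borel_measurable lT" and le: "\<And>t. t \<ge> 0 ==> (u t)^2 \<le> C * (1 + t)" "C \<ge> 0"
 shows "integrable lT (\<lambda>t. (sech (t + T))^2 * (u t)^2)"
proof (rule L1_bound[OF integrable_mult_right[of "C * (4 * exp (2 * \<bar>T\<bar>))", OF integrable_exp_lT]])
 have "(\<lambda>t. sech (t + T)) \<in> borel_measurable lT"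
  using borel_measurable_continuous_onI[OF sech_tanh_continuous(1)] by (simp add: measurable_restrict_space1 measurable_lborel1)
 then show "(\<lambda>t. (sech (t + T))^2 * (u t)^2) \<in> borel_measurable lT" using m by measurable
 show "AE t in lT. norm ((sech (t + T))^2 * (u t)^2) \<le> norm (C * (4 * exp (2 * \<bar>T\<bar>)) * exp (- t))"
 proof (rule AE_I2)
  fix t assume "t \<in> space lT"
  then have t: "t \<ge> 0" by (simp add: space_restrict_space)
  have "(sech (t + T))^2 * (u t)^2 \<le> (sech (t + T))^2 * (C * (1 + t))" by (rule mult_left_mono[OF le(1)[OF t]]) simp
  also have "... = C * ((1 + t) * (sech (t + T))^2)" by (simp only: mult_ac)
  also have "... \<le> C * (4 * exp (2 * \<bar>T\<bar>) * exp (- t))" by (rule mult_left_mono[OF sech_sq_exp_bound[OF t] le(2)])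
  finally show "norm ((sech (t + T))^2 * (u t)^2) \<le> norm (C * (4 * exp (2 * \<bar>T\<bar>)) * exp (- t))"
   by (simp add: mult.assoc le(2))
 qed
qed

definition circ_mean :: "(real \<times> real => real) => real => real" where
 "circ_mean g t = (LINT y|lC. g (t, y)) / (2 * pi)"

definition trace_mean :: "(real => real) => real" where
 "trace_mean \<tau> = (LINT y|lC. \<tau> y) / (2 * pi)"

text \<open>Built from the trace and the derivative rather than from \<open>f\<close>, so that it is
  absolutely continuous and meaningful for every \<open>t \<ge> 0\<close>; almost everywhere it is
  the circle mean of \<open>f\<close>.\<close>

definition radial :: "(real => real) => (real \<times> real => real) => real => real" where
 "radial \<tau> g t = trace_mean \<tau> + (LINT s:{0..t}|lborel. circ_mean g s)"

lemma radial_0: "radial \<tau> g 0 = trace_mean \<tau>"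
 by (simp add: radial_def set_integral_Icc_self)

lemma variance_identity:
 assumes "integrable lC (\<lambda>y. (x y)^2)" "x \<in> borel_measurable lC" "(LINT y|lC. x y) = 2 * pi * m"
 shows "integrable lC (\<lambda>y. (x y - m)^2)" "(LINT y|lC. (x y - m)^2) = (LINT y|lC. (x y)^2) - 2 * pi * m^2"
proof -
 have ix: "integrable lC x" by (rule lC.square_integrable_imp_integrable[OF assms(2,1)])
 have e: "(x y - m)^2 = ((x y)^2 - (2 * m) * x y) + m^2" for y by algebra
 have i: "integrable lC (\<lambda>y. (2 * m) * x y)" "integrable lC (\<lambda>y. m^2)" using ix by auto
 show "integrable lC (\<lambda>y. (x y - m)^2)" unfolding e
  by (intro L1_add L1_diff assms(1) i)
 have "(LINT y|lC. m^2) = 2 * pi * m^2" using measure_lC by simp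
 then show "(LINT y|lC. (x y - m)^2) = (LINT y|lC. (x y)^2) - 2 * pi * m^2"
  unfolding e LINT_add[OF L1_diff[OF assms(1) i(1)] i(2)]
   LINT_diff[OF assms(1) i(1)] integral_mult_right_zero assms(3)
  by (simp add: power2_eq_square)
qed

lemma LINT_nonneg_sq: "0 \<le> (LINT x|M. ((f x)^2 :: real))"
 by (rule integral_nonneg_AE) auto

context
 fixes f g h \<tau> assumes d: "h1_data f g h \<tau>"
begin

lemma circ_mean_facts:
 "circ_mean g \<in> borel_measurable lT"
 "AE t in lT. 2 * pi * (circ_mean g t)^2 \<le> (LINT y|lC. (g (t, y))^2)"
 "integrable lT (\<lambda>t. (circ_mean g t)^2)"
 "ac_on 0 R (radial \<tau> g) (circ_mean g)"
proof -
 note F = h1_facts[OF d]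
 have gm: "g \<in> borel_measurable (lT \<Otimes>\<^sub>M lC)" using F(5) by (simp only: lM_pair)
 show m: "circ_mean g \<in> borel_measurable lT" unfolding circ_mean_def[abs_def]
  by (intro borel_measurable_divide borel_measurable_const lC.borel_measurable_lebesgue_integral) (use gm in simp)
 show le: "AE t in lT. 2 * pi * (circ_mean g t)^2 \<le> (LINT y|lC. (g (t, y))^2)"
  using slice_integrable(1)[OF F(6)] AE_space
 proof eventually_elim
  case (elim t)
  have "(LINT y|lC. (g (t, y) - circ_mean g t)^2) = (LINT y|lC. (g (t, y))^2) - 2 * pi * (circ_mean g t)^2"
   by (rule variance_identity(2)[OF elim(1)]) (use slice_measurable(2)[OF F(5) elim(2)] in \<open>simp_all add: circ_mean_def\<close>)
  with LINT_nonneg_sq[of lC "\<lambda>y. g (t, y) - circ_mean g t"] show ?case by linarith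
 qed
 show i2: "integrable lT (\<lambda>t. (circ_mean g t)^2)"
 proof (rule L1_bound[OF slice_integrable(3)[OF F(6)]])
  show "(\<lambda>t. (circ_mean g t)^2) \<in> borel_measurable lT" using m by measurable
  show "AE t in lT. norm ((circ_mean g t)^2) \<le> norm (LINT y|lC. (g (t, y))^2)"
   using le
  proof eventually_elim
   case (elim t)
   have "1 * (circ_mean g t)^2 \<le> 2 * pi * (circ_mean g t)^2"
    by (rule mult_right_mono) (use pi_gt3 in auto)
   with elim show ?case by (simp add: LINT_nonneg_sq)
  qed
 qed
 have "set_integrable lborel {0..R} (circ_mean g)" for R
 proof (rule set_integrable_bound)
  have "set_integrable lborel {0..R} (\<lambda>t. (circ_mean g t)^2)" by (rule set_integrable_of_lT[OF i2]) simp
  moreover have "set_integrable lborel {0..R} (\<lambda>t. 1 :: real)" by (rule set_integrable_continuous_Icc) simp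
  ultimately show "set_integrable lborel {0..R} (\<lambda>t. 1 + (circ_mean g t)^2)" by (intro set_integral_add(1))
  show "set_borel_measurable lborel {0..R} (circ_mean g)"
  proof -
   have "(\<lambda>t. circ_mean g t * indicator {0..} t) \<in> borel_measurable lborel"
    using m by (subst (asm) borel_measurable_restrict_space_iff) (auto simp: mult.commute)
   then have "(\<lambda>t. indicator {0..R} t * (circ_mean g t * indicator {0..} t)) \<in> borel_measurable lborel" by measurable
   moreover have "(\<lambda>t. indicator {0..R} t * (circ_mean g t * indicator {0..} t)) = (\<lambda>t. indicator {0..R} t *\<^sub>R circ_mean g t)"
    by (auto simp: indicator_def)
   ultimately show ?thesis by (simp add: set_borel_measurable_def)
  qed
  have "\<bar>x\<bar> \<le> 1 + x^2" for x :: real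
  proof -
   have "0 \<le> (\<bar>x\<bar> - 1/2)^2" by simp
   then show ?thesis by (simp add: power2_eq_square algebra_simps abs_mult_self_eq)
  qed
  then show "AE x in lborel. x \<in> {0..R} \<longrightarrow> norm (circ_mean g x) \<le> norm (1 + (circ_mean g x)^2)"
   by (auto intro!: AE_I2)
 qed
 then show "ac_on 0 R (radial \<tau> g) (circ_mean g)"
  by (intro ac_onI) (auto simp: radial_def set_integral_Icc_self)
qed

lemma integral_rep: "t \<ge> 0 ==> integrable lC (\<lambda>y. rep \<tau> g (t, y)) \<and> (LINT y|lC. rep \<tau> g (t, y)) = 2 * pi * radial \<tau> g t"
proof -
 assume t: "t \<ge> 0"
 note F = h1_facts[OF d]
 have i: "integrable lM (\<lambda>p. indicator {..t} (fst p) * g p)" by (rule loc_int_integrable[OF F(2)])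
 have eq: "prim_t g (t, y) = (LINT s|lT. indicator {..t} (fst (s, y)) * g (s, y))" for y
  unfolding prim_t_alt by (simp add: indicator_def)
 have ip: "integrable lC (\<lambda>y. prim_t g (t, y))" unfolding eq by (rule slice_integrable(5)[OF i])
 have "(LINT y|lC. prim_t g (t, y)) = (LINT s|lT. LINT y|lC. indicator {..t} (fst (s, y)) * g (s, y))"
  unfolding eq slice_integrable(6)[OF i, symmetric] slice_integrable(4)[OF i] ..
 also have "... = (LINT s|lT. indicator {..t} s * (LINT y|lC. g (s, y)))" by simp
 also have "... = 2 * pi * (LINT s:{0..t}|lborel. circ_mean g s)"
  unfolding integral_lT set_lebesgue_integral_def circ_mean_def integral_mult_right_zero[symmetric]
  by (rule LINT_cong) (auto simp: indicator_def)
 finally show ?thesis using ip F(13)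
  by (simp add: rep_def radial_def trace_mean_def distrib_left)
qed

lemma radial_measurable: "radial \<tau> g \<in> borel_measurable lT"
proof -
 have "rep \<tau> g \<in> borel_measurable (lT \<Otimes>\<^sub>M lC)" using rep_measurable[OF d] by (simp only: lM_pair)
 then have "(\<lambda>t. (LINT y|lC. rep \<tau> g (t, y)) / (2 * pi)) \<in> borel_measurable lT"
  by (intro borel_measurable_divide borel_measurable_const lC.borel_measurable_lebesgue_integral) simp
 then show ?thesis
  by (rule measurable_cong[THEN iffD1, rotated]) (simp add: integral_rep space_restrict_space)
qed

lemma mean_f: "AE t in lT. integrable lC (\<lambda>y. f (t, y)) \<and> (LINT y|lC. f (t, y)) = 2 * pi * radial \<tau> g t"
 using AE_lM_slices(1)[OF h1_facts(11)[OF d]] loc_int_slice_c[OF h1_facts(1)[OF d]] AE_space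
proof eventually_elim
 case (elim t)
 have "(LINT y|lC. f (t, y)) = (LINT y|lC. rep \<tau> g (t, y))"
  by (rule integral_cong_AE)
    (use elim slice_measurable(2)[OF h1_facts(4)[OF d]] slice_measurable(2)[OF rep_measurable[OF d]] in auto)
 then show ?case using integral_rep[of t] elim by (simp add: space_restrict_space)
qed

lemma radial_growth: "t \<ge> 0 ==> (radial \<tau> g t)^2 \<le> (2 * (trace_mean \<tau>)^2 + 2 * (LINT t|lT. (circ_mean g t)^2)) * (1 + t)"
proof -
 assume t: "t \<ge> 0"
 have "(radial \<tau> g t)^2 \<le> 2 * (trace_mean \<tau>)^2 + 2 * t * (LINT t|lT. (circ_mean g t)^2)"
  using ac_growth[OF circ_mean_facts(4,3) t] by (simp add: radial_0)
 also have "... \<le> (2 * (trace_mean \<tau>)^2 + 2 * (LINT t|lT. (circ_mean g t)^2)) * (1 + t)"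
  using t by (simp add: algebra_simps LINT_nonneg_sq)
 finally show ?thesis .
qed

lemma radial_sech_integrable: "integrable lT (\<lambda>t. (sech (t + T))^2 * (radial \<tau> g t)^2)"
 by (rule integrable_sech_sq_growth[OF radial_measurable radial_growth]) (auto intro!: add_nonneg_nonneg LINT_nonneg_sq)

text \<open>The subtracted part depends on \<open>t\<close> only, so \<open>h\<close> stays the same
  and the circle primitive changes only in its free function of \<open>t\<close>.\<close>

lemma h1_data_mean_zero:
 "h1_data (\<lambda>p. f p - radial \<tau> g (fst p)) (\<lambda>p. g p - circ_mean g (fst p)) h (\<lambda>y. \<tau> y - trace_mean \<tau>)"
 "AE t in lT. (LINT y|lC. f (t, y) - radial \<tau> g t) = 0"
proof -
 note F = h1_facts[OF d] and C = circ_mean_facts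
 have mfst: "(\<lambda>p. u (fst p)) \<in> borel_measurable lM" if "u \<in> borel_measurable lT" for u :: "real => real"
  using measurable_compose[OF measurable_fst[of lT lC] that] by (simp only: lM_pair)
 have lr: "loc_int (\<lambda>p. radial \<tau> g (fst p))"
 proof (rule loc_int_bound[where A="\<lambda>R t. indicator {..R} t * \<bar>radial \<tau> g t\<bar>" and B="\<lambda>R y. 1"])
  show "integrable lT (\<lambda>t. indicator {..R} t * \<bar>radial \<tau> g t\<bar>)" for R
  proof (rule integrable_lT_set_support)
   have "set_integrable lborel {0..R} (\<lambda>t. \<bar>radial \<tau> g t\<bar>)"
    by (intro set_integrable_continuous_Icc continuous_intros ac_on_continuous[OF C(4)])
   then show "set_integrable lborel {0..R} (\<lambda>t. indicator {..R} t * \<bar>radial \<tau> g t\<bar>)"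
    by (rule set_integrable_cong[THEN iffD1, rotated -1]) auto
  qed auto
 qed (use mfst[OF radial_measurable] in auto)
 have ig: "integrable lM (\<lambda>p. (circ_mean g (fst p))^2)"
  using integrable_lM_mult(1)[OF C(3), of "\<lambda>_. 1"] by simp
 have g2: "integrable lM (\<lambda>p. (g p - circ_mean g (fst p))^2)"
 proof (rule L1_bound[OF L1_add[OF integrable_mult_right[of 2, OF F(6)] integrable_mult_right[of 2, OF ig]]])
  show "(\<lambda>p. (g p - circ_mean g (fst p))^2) \<in> borel_measurable lM"
   using F(5) mfst[OF C(1)] by measurable
  show "AE p in lM. norm ((g p - circ_mean g (fst p))^2) \<le> norm (2 * (g p)^2 + 2 * (circ_mean g (fst p))^2)"
  proof (rule AE_I2)
   fix p :: "real \<times> real"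
   have "2 * (g p)^2 + 2 * (circ_mean g (fst p))^2 - (g p - circ_mean g (fst p))\<^sup>2 = (g p + circ_mean g (fst p))^2" by algebra
   then show "norm ((g p - circ_mean g (fst p))^2) \<le> norm (2 * (g p)^2 + 2 * (circ_mean g (fst p))^2)"
    by (smt (verit) real_norm_def zero_le_power2)
  qed
 qed
 have t2: "integrable lC (\<lambda>y. (\<tau> y - trace_mean \<tau>)^2)"
  by (rule variance_identity(1)[OF F(10,9)]) (simp add: trace_mean_def)
 have rep': "AE p in lM. f p - radial \<tau> g (fst p) = \<tau> (snd p) - trace_mean \<tau> + prim_t (\<lambda>p. g p - circ_mean g (fst p)) p"
  using F(11) AE_lM_snd[OF loc_int_slice_t[OF F(2)]]
 proof eventually_elim
  case (elim p)
  have "prim_t (\<lambda>p. g p - circ_mean g (fst p)) p = prim_t g p - (LINT s:{0..fst p}|lborel. circ_mean g s)"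
   unfolding prim_t_def fst_conv by (rule set_integral_diff(2)) (use elim(2) ac_on_integrable[OF C(4)] in auto)
  then show ?case using elim(1) by (simp add: rep_def radial_def)
 qed
 obtain k where k: "AE p in lM. f p = k (fst p) + prim_c h p" using d unfolding h1_data_def by blast
 have "AE p in lM. f p - radial \<tau> g (fst p) = (k (fst p) - radial \<tau> g (fst p)) + prim_c h p"
  using k by eventually_elim simp
 then have ck: "\<exists>k. AE p in lM. f p - radial \<tau> g (fst p) = k (fst p) + prim_c h p"
  by (intro exI[of _ "\<lambda>t. k t - radial \<tau> g t"])
 show "h1_data (\<lambda>p. f p - radial \<tau> g (fst p)) (\<lambda>p. g p - circ_mean g (fst p)) h (\<lambda>y. \<tau> y - trace_mean \<tau>)"
  unfolding h1_data_def
  by (intro conjI loc_int_diff F(1) lr g2 F(7,8,12) t2 rep' ck borel_measurable_diff F(5,9) mfst C(1) borel_measurable_const)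
 show "AE t in lT. (LINT y|lC. f (t, y) - radial \<tau> g t) = 0"
  using mean_f by eventually_elim (use measure_lC in simp)
qed

text \<open>The fluctuation is square integrable by Wirtinger and the radial part grows slowly, so
  the potential term of the index form converges for every function of finite Dirichlet
  energy.\<close>

lemma sech_sq_integrable: "integrable lM (\<lambda>p. (sech (fst p + T))^2 * (f p)^2)"
proof -
 have f0: "integrable lM (\<lambda>p. (f p - radial \<tau> g (fst p))^2)"
  by (rule h1_wirtinger(2)[OF h1_data_mean_zero(1)]) (use h1_data_mean_zero(2) in simp)
 have r: "integrable lM (\<lambda>p. (sech (fst p + T))^2 * (radial \<tau> g (fst p))^2)"
  using integrable_lM_mult(1)[OF radial_sech_integrable, of "\<lambda>_. 1" T] by simp
 show ?thesis
 proof (rule L1_bound[OF L1_add[OF integrable_mult_right[of 2, OF f0] integrable_mult_right[of 2, OF r]]])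
  show "(\<lambda>p. (sech (fst p + T))^2 * (f p)^2) \<in> borel_measurable lM"
   using h1_facts(4)[OF d] sech_tanh_measurable(1)[of T] by measurable
  show "AE p in lM. norm ((sech (fst p + T))^2 * (f p)^2)
    \<le> norm (2 * (f p - radial \<tau> g (fst p))^2 + 2 * ((sech (fst p + T))^2 * (radial \<tau> g (fst p))^2))"
  proof (rule AE_I2)
   fix p :: "real \<times> real"
   define S where "S = (sech (fst p + T))^2"
   have S: "0 \<le> S" "S \<le> 1" using sech_bounds[of "fst p + T"] by (auto simp: S_def power_le_one)
   have "2 * (f p - radial \<tau> g (fst p))^2 + 2 * (radial \<tau> g (fst p))^2 - (f p)\<^sup>2 = (f p - 2 * radial \<tau> g (fst p))^2" by algebra
   then have "(f p)^2 \<le> 2 * (f p - radial \<tau> g (fst p))^2 + 2 * (radial \<tau> g (fst p))^2" by (smt (verit) zero_le_power2)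
   then have "S * (f p)^2 \<le> S * (2 * (f p - radial \<tau> g (fst p))^2 + 2 * (radial \<tau> g (fst p))^2)" using S by (intro mult_left_mono) auto
   also have "... \<le> 2 * (f p - radial \<tau> g (fst p))^2 + 2 * (S * (radial \<tau> g (fst p))^2)"
    using mult_right_mono[OF S(2), of "2 * (f p - radial \<tau> g (fst p))^2"] by (simp add: distrib_left)
   finally show "norm ((sech (fst p + T))^2 * (f p)^2)
    \<le> norm (2 * (f p - radial \<tau> g (fst p))^2 + 2 * ((sech (fst p + T))^2 * (radial \<tau> g (fst p))^2))"
    using S by (simp add: S_def[symmetric])
  qed
 qed
qed

end

section \<open>Splitting the circle mean off the energy\<close>

definition energy :: "real => (real \<times> real => real) => (real \<times> real => real) => (real \<times> real => real) => (real => real) => real" where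
 "energy T f g h \<tau> = (LINT p|lM. (g p)^2) + (LINT p|lM. (h p)^2)
   - 2 * (LINT p|lM. (sech (fst p + T))^2 * (f p)^2) - tanh T * (LINT y|lC. (\<tau> y)^2)"

definition radial_energy :: "real => (real => real) => (real => real) => real" where
 "radial_energy T u g = (LINT t|lT. (g t)^2) - 2 * (LINT t|lT. (sech (t + T))^2 * (u t)^2) - tanh T * (u 0)^2"

text \<open>Circle mean and fluctuation are orthogonal in each term, so the energy is exactly
  \<open>2 pi\<close> times the radial energy plus the energy of the fluctuation. The latter is a
  sum of a square and a Wirtinger deficit.\<close>

lemma energy_ge_radial:
 assumes d: "h1_data f g h \<tau>"
 shows "2 * pi * radial_energy T (radial \<tau> g) (circ_mean g) \<le> energy T f g h \<tau>"
proof -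
 note F = h1_facts[OF d] and d0 = h1_data_mean_zero[OF d] and C = circ_mean_facts[OF d]
 note F0 = h1_facts[OF d0(1)]
 let ?f = "\<lambda>p. f p - radial \<tau> g (fst p)" and ?g = "\<lambda>p. g p - circ_mean g (fst p)"
 have mean: "AE t in lT. (LINT y|lC. ?f (t, y)) = 0" using d0(2) by simp
 have E0: "0 \<le> energy T ?f ?g h (\<lambda>y. \<tau> y - trace_mean \<tau>)"
  unfolding energy_def mean_zero_identity(2)[OF d0(1) mean]
  using h1_wirtinger(3)[OF d0(1) mean] LINT_nonneg_sq[of lM "\<lambda>p. ?g p + tanh (fst p + T) * ?f p"] by linarith
 have E1: "(LINT p|lM. (?g p)^2) = (LINT p|lM. (g p)^2) - 2 * pi * (LINT t|lT. (circ_mean g t)^2)"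
 proof -
  have "(LINT p|lM. (?g p)^2) = (LINT t|lT. LINT y|lC. (g (t, y) - circ_mean g t)^2)"
   using slice_integrable(4)[OF F0(6)] by simp
  also have "... = (LINT t|lT. (LINT y|lC. (g (t, y))^2) - 2 * pi * (circ_mean g t)^2)"
  proof (rule integral_cong_AE)
   show "(\<lambda>t. LINT y|lC. (g (t, y) - circ_mean g t)^2) \<in> borel_measurable lT"
    using borel_measurable_integrable[OF slice_integrable(3)[OF F0(6)]] by simp
   show "(\<lambda>t. (LINT y|lC. (g (t, y))^2) - 2 * pi * (circ_mean g t)^2) \<in> borel_measurable lT"
    using borel_measurable_integrable[OF slice_integrable(3)[OF F(6)]] C(1) by (intro borel_measurable_diff borel_measurable_times borel_measurable_power) auto
   show "AE t in lT. (LINT y|lC. (g (t, y) - circ_mean g t)^2) = (LINT y|lC. (g (t, y))^2) - 2 * pi * (circ_mean g t)^2"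
    using slice_integrable(1)[OF F(6)] AE_space
    by eventually_elim (rule variance_identity(2), use slice_measurable(2)[OF F(5)] in \<open>auto simp: circ_mean_def\<close>)
  qed
  also have "... = (LINT p|lM. (g p)^2) - 2 * pi * (LINT t|lT. (circ_mean g t)^2)"
   unfolding slice_integrable(4)[OF F(6)]
   by (subst LINT_diff[OF slice_integrable(3)[OF F(6)] integrable_mult_right[OF C(3)]]) simp
  finally show ?thesis .
 qed
 have E2: "(LINT p|lM. (sech (fst p + T))^2 * (?f p)^2) = (LINT p|lM. (sech (fst p + T))^2 * (f p)^2)
    - 2 * pi * (LINT t|lT. (sech (t + T))^2 * (radial \<tau> g t)^2)"
 proof -
  note i0 = sech_sq_integrable[OF d0(1), of T] and i1 = sech_sq_integrable[OF d, of T] and i2 = radial_sech_integrable[OF d, of T]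
  have "(LINT p|lM. (sech (fst p + T))^2 * (?f p)^2) = (LINT t|lT. LINT y|lC. (sech (t + T))^2 * (f (t, y) - radial \<tau> g t)^2)"
   using slice_integrable(4)[OF i0] by simp
  also have "... = (LINT t|lT. (LINT y|lC. (sech (fst (t, y) + T))^2 * (f (t, y))^2) - 2 * pi * ((sech (t + T))^2 * (radial \<tau> g t)^2))"
  proof (rule integral_cong_AE)
   show "(\<lambda>t. LINT y|lC. (sech (t + T))^2 * (f (t, y) - radial \<tau> g t)^2) \<in> borel_measurable lT"
    using borel_measurable_integrable[OF slice_integrable(3)[OF i0]] by simp
   show "(\<lambda>t. (LINT y|lC. (sech (fst (t, y) + T))^2 * (f (t, y))^2) - 2 * pi * ((sech (t + T))^2 * (radial \<tau> g t)^2)) \<in> borel_measurable lT"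
    using borel_measurable_integrable[OF slice_integrable(3)[OF i1]] borel_measurable_integrable[OF i2]
    by (intro borel_measurable_diff borel_measurable_times[OF borel_measurable_const]) auto
   show "AE t in lT. (LINT y|lC. (sech (t + T))^2 * (f (t, y) - radial \<tau> g t)^2)
    = (LINT y|lC. (sech (fst (t, y) + T))^2 * (f (t, y))^2) - 2 * pi * ((sech (t + T))^2 * (radial \<tau> g t)^2)"
    using slice_integrable(1)[OF i1] AE_space mean_f[OF d]
   proof eventually_elim
    case (elim t)
    have "integrable lC (\<lambda>y. (1 / (sech (t + T))^2) * ((sech (t + T))^2 * (f (t, y))^2))"
     using elim(1) by (intro integrable_mult_right) simp
    then have i: "integrable lC (\<lambda>y. (f (t, y))^2)" using sech_bounds(1)[of "t + T"] by simp
    have "(LINT y|lC. (f (t, y) - radial \<tau> g t)^2) = (LINT y|lC. (f (t, y))^2) - 2 * pi * (radial \<tau> g t)^2"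
     by (rule variance_identity(2)[OF i]) (use slice_measurable(2)[OF F(4) elim(2)] elim(3) in auto)
    then show ?case by (simp add: right_diff_distrib)
   qed
  qed
  also have "... = (LINT p|lM. (sech (fst p + T))^2 * (f p)^2) - 2 * pi * (LINT t|lT. (sech (t + T))^2 * (radial \<tau> g t)^2)"
   unfolding slice_integrable(4)[OF i1]
   by (subst LINT_diff[OF slice_integrable(3)[OF i1] integrable_mult_right[OF i2]]) simp
  finally show ?thesis .
 qed
 have E3: "(LINT y|lC. (\<tau> y - trace_mean \<tau>)^2) = (LINT y|lC. (\<tau> y)^2) - 2 * pi * (trace_mean \<tau>)^2"
  by (rule variance_identity(2)[OF F(10,9)]) (simp add: trace_mean_def)
 have "energy T ?f ?g h (\<lambda>y. \<tau> y - trace_mean \<tau>)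
   = energy T f g h \<tau> - 2 * pi * radial_energy T (radial \<tau> g) (circ_mean g)"
  unfolding energy_def radial_energy_def radial_0 E1 E2 E3 by algebra
 then show ?thesis using E0 by linarith
qed

text \<open>The logarithmic derivative \<open>v = w1 / w\<close> of a positive solution of the
  radial Jacobi equation satisfies \<open>v' + v^2 = - 2 sech^2\<close>, so the Riccati inequality
  applies with it.\<close>

lemma radial_interval_inequality:
 assumes ab: "a \<le> b" and u: "ac_on a b u g" and g2: "set_integrable lborel {a..b} (\<lambda>t. (g t)^2)"
  and w: "\<And>t. (w has_real_derivative w1 t) (at t)" "\<And>t. (w1 has_real_derivative - 2 * (sech (t + T))^2 * w t) (at t)"
  and pos: "\<And>t. t \<in> {a..b} ==> w t > 0"
 shows "w1 b / w b * (u b)^2 - w1 a / w a * (u a)^2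
   \<le> (LINT t:{a..b}|lborel. (g t)^2) - 2 * (LINT t:{a..b}|lborel. (sech (t + T))^2 * (u t)^2)"
proof -
 define v' where "v' t = - 2 * (sech (t + T))^2 - (w1 t / w t)\<^sup>2" for t
 have d: "((\<lambda>t. w1 t / w t) has_real_derivative v' t) (at t)" if "t \<in> {a..b}" for t
  using pos[OF that] unfolding v'_def
  by (auto intro!: derivative_eq_intros w simp: power2_eq_square field_simps)
 have cw: "continuous_on {a..b} w" "continuous_on {a..b} w1"
  using w by (meson DERIV_isCont continuous_at_imp_continuous_on)+
 have c: "continuous_on {a..b} v'"
  unfolding v'_def using pos
  by (intro continuous_intros cw continuous_on_subset[OF sech_tanh_continuous(1)]) (auto simp: less_le)
 have "w1 b / w b * (u b)^2 - w1 a / w a * (u a)^2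
   \<le> (LINT t:{a..b}|lborel. (g t)^2) + (LINT t:{a..b}|lborel. (v' t + (w1 t / w t)^2) * (u t)^2)"
  by (rule riccati_inequality[OF ab u g2 d c])
 also have "(\<lambda>t. (v' t + (w1 t / w t)^2) * (u t)^2) = (\<lambda>t. - 2 * ((sech (t + T))^2 * (u t)^2))"
  by (rule ext) (simp add: v'_def mult.assoc)
 finally show ?thesis unfolding set_integral_mult_right by simp
qed

text \<open>\<open>jac_p\<close> and \<open>jac_q\<close> span the solutions of
  \<open>w'' + 2 sech^2 w = 0\<close>. Up to constant factors they are the normal components of the
  vertical translation and of the dilation about the centre of the catenoid; \<open>jac_p'\<close>
  and \<open>jac_q'\<close> are their derivatives.\<close>

definition jac_p :: "real => real => real" where "jac_p T t = tanh (t + T)"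
definition jac_q :: "real => real => real" where "jac_q T t = 1 - (t + T) * tanh (t + T)"
definition jac_p' :: "real => real => real" where "jac_p' T t = (sech (t + T))^2"
definition jac_q' :: "real => real => real" where "jac_q' T t = - tanh (t + T) - (t + T) * (sech (t + T))^2"

lemma jac_derivatives:
 "(jac_p T has_real_derivative jac_p' T t) (at t)" "(jac_p' T has_real_derivative - 2 * (sech (t + T))^2 * jac_p T t) (at t)"
 "(jac_q T has_real_derivative jac_q' T t) (at t)" "(jac_q' T has_real_derivative - 2 * (sech (t + T))^2 * jac_q T t) (at t)"
proof -
 note D = tanh_derivative[of T t] sech_derivative[of T t]
 show "(jac_p T has_real_derivative jac_p' T t) (at t)" unfolding jac_p_def[abs_def] jac_p'_def by (rule D(1))
 have s2: "((\<lambda>t. (sech (t + T))^2) has_real_derivative - 2 * (sech (t + T))^2 * tanh (t + T)) (at t)"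
  using DERIV_power[OF D(2), of 2] by (simp add: power2_eq_square mult_ac)
 then show "(jac_p' T has_real_derivative - 2 * (sech (t + T))^2 * jac_p T t) (at t)" unfolding jac_p_def jac_p'_def[abs_def] .
 have id: "((\<lambda>t. t + T) has_real_derivative 1) (at t)" by (auto intro!: derivative_eq_intros)
 show "(jac_q T has_real_derivative jac_q' T t) (at t)" unfolding jac_q_def[abs_def] jac_q'_def
  using DERIV_diff[OF DERIV_const[of 1] DERIV_mult[OF id D(1)]] by (simp add: mult.commute)
 show "(jac_q' T has_real_derivative - 2 * (sech (t + T))^2 * jac_q T t) (at t)" unfolding jac_q_def jac_q'_def[abs_def]
  using DERIV_diff[OF DERIV_minus[OF D(1)] DERIV_mult[OF id s2]] by (rule DERIV_cong) (simp add: algebra_simps)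
qed

lemma jac_combination:
 "((\<lambda>t. x * jac_p T t + y * jac_q T t) has_real_derivative x * jac_p' T t + y * jac_q' T t) (at t)"
 "((\<lambda>t. x * jac_p' T t + y * jac_q' T t) has_real_derivative - 2 * (sech (t + T))^2 * (x * jac_p T t + y * jac_q T t)) (at t)"
 using DERIV_add[OF DERIV_cmult[OF jac_derivatives(1), of x] DERIV_cmult[OF jac_derivatives(3), of y]]
  DERIV_add[OF DERIV_cmult[OF jac_derivatives(2), of x] DERIV_cmult[OF jac_derivatives(4), of y]]
 by (auto elim!: DERIV_cong simp: algebra_simps)

text \<open>The Jacobi field \<open>tanh\<close> vanishes at \<open>s = 0\<close>; adding a small multiple of the second Jacobi field
 makes it positive on a compact interval.\<close>

lemma dirichlet_interval:
 assumes ac: "\<And>R. ac_on 0 R u g" and g2: "integrable lT (\<lambda>t. (g t)^2)"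
  and T: "T \<le> 0" "- T < S" and z: "u (- T) = 0" "u S = 0"
 shows "0 \<le> (LINT t:{- T..S}|lborel. (g t)^2) - 2 * (LINT t:{- T..S}|lborel. (sech (t + T))^2 * (u t)^2)"
proof -
 \<comment> \<open>With this value \<open>1 - \<epsilon> s\<close> is nonnegative up to the end
   \<open>s = S + T\<close>, so \<open>tanh s (1 - \<epsilon> s) + \<epsilon>\<close> is positive on
   the whole interval, \<open>s = 0\<close> included.\<close>
 define \<epsilon> where "\<epsilon> = 1 / (S + T)"
 have \<epsilon>: "\<epsilon> > 0" using T by (simp add: \<epsilon>_def)
 have pos: "1 * jac_p T t + \<epsilon> * jac_q T t > 0" if "t \<in> {- T..S}" for t
 proof -
  have s: "0 \<le> t + T" "\<epsilon> * (t + T) \<le> 1" using that T by (auto simp: \<epsilon>_def)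
  have "tanh (t + T) \<ge> 0" using s by simp
  then have "0 \<le> tanh (t + T) * (1 - \<epsilon> * (t + T))" using s by simp
  then show ?thesis using \<epsilon> unfolding jac_p_def jac_q_def by (simp add: algebra_simps)
 qed
 have u: "ac_on (- T) S u g" by (rule ac_on_subinterval[OF ac]) (use T in auto)
 have "set_integrable lborel {- T..S} (\<lambda>t. (g t)^2)" by (rule set_integrable_of_lT[OF g2]) (use T in auto)
 from radial_interval_inequality[OF _ u this jac_combination pos] T z show ?thesis by simp
qed

text \<open>To the left of \<open>s = 0\<close> the comparison function is \<open>- tanh s\<close>
  plus a small multiple of the second solution. The edge value is free here, so the multiple has to
  tend to zero in order to reach the sharp coefficient, the logarithmic derivative
  \<open>sech^2 T / tanh T\<close> of \<open>tanh\<close> at the edge.\<close>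

lemma dirichlet_left_interval:
 assumes ac: "\<And>R. ac_on 0 R u g" and g2: "integrable lT (\<lambda>t. (g t)^2)"
  and T: "T < 0" and z: "u (- T) = 0"
 shows "- ((sech T)^2 / tanh T) * (u 0)^2 \<le> (LINT t:{0..- T}|lborel. (g t)^2) - 2 * (LINT t:{0..- T}|lborel. (sech (t + T))^2 * (u t)^2)"
  (is "_ \<le> ?I")
proof -
 have tT: "tanh T < 0" using T by simp
 let ?k = "\<lambda>\<epsilon>. - ((- 1 * jac_p' T 0 + \<epsilon> * jac_q' T 0) / (- 1 * jac_p T 0 + \<epsilon> * jac_q T 0)) * (u 0)^2"
 have le: "?k \<epsilon> \<le> ?I" if \<epsilon>: "0 < \<epsilon>" "\<epsilon> < 1 / (- T)" for \<epsilon>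
 proof -
  have pos: "- 1 * jac_p T t + \<epsilon> * jac_q T t > 0" if "t \<in> {0..- T}" for t
  proof -
   have s: "t + T \<le> 0" using that by auto
   have "\<epsilon> * (- (t + T)) \<le> \<epsilon> * (- T)" using that \<epsilon> by (intro mult_left_mono) auto
   also have "... \<le> 1" using \<epsilon> T by (simp add: field_simps)
   finally have "0 \<le> 1 + \<epsilon> * (t + T)" unfolding mult_minus_right by linarith
   then have "0 \<le> - tanh (t + T) * (1 + \<epsilon> * (t + T))" using s by (intro mult_nonneg_nonneg) auto
   then show ?thesis using \<epsilon> unfolding jac_p_def jac_q_def by (simp add: algebra_simps)
  qed
  have g2': "set_integrable lborel {0..- T} (\<lambda>t. (g t)^2)" by (rule set_integrable_of_lT[OF g2]) simp
  from radial_interval_inequality[OF _ ac g2' jac_combination pos] T z show ?thesis by simp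
 qed
 have "(?k \<longlongrightarrow> - ((- 1 * jac_p' T 0 + 0 * jac_q' T 0) / (- 1 * jac_p T 0 + 0 * jac_q T 0)) * (u 0)^2) (at_right 0)"
  using tT by (intro tendsto_intros) (auto simp: jac_p_def)
 moreover have "\<forall>\<^sub>F \<epsilon> in at_right 0. ?k \<epsilon> \<le> ?I"
  unfolding eventually_at_right_field using le T by (intro exI[of _ "1 / (- T)"]) auto
 ultimately have "- ((- 1 * jac_p' T 0 + 0 * jac_q' T 0) / (- 1 * jac_p T 0 + 0 * jac_q T 0)) * (u 0)^2 \<le> ?I"
  by (intro tendsto_upperbound) auto
 then show ?thesis by (simp add: jac_p_def jac_p'_def)
qed

text \<open>Beyond \<open>S\<close> the function vanishes, so truncation leaves the potential term
  unchanged and can only lower the gradient term.\<close>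

lemma radial_energy_lower:
 assumes ac: "\<And>R. ac_on 0 R u g" and um: "u \<in> borel_measurable lT" and g2: "integrable lT (\<lambda>t. (g t)^2)"
  and su: "integrable lT (\<lambda>t. (sech (t + T))^2 * (u t)^2)" and S: "S \<ge> 0" "\<And>t. t \<ge> S ==> u t = 0"
 shows "(LINT t:{0..S}|lborel. (g t)^2) - 2 * (LINT t:{0..S}|lborel. (sech (t + T))^2 * (u t)^2) - tanh T * (u 0)^2 \<le> radial_energy T u g"
proof -
 have "(LINT t:{0..S}|lborel. (g t)^2) \<le> (LINT t|lT. (g t)^2)"
 proof -
  have "set_integrable lborel {0..} (\<lambda>t. (g t)^2)" using g2 by (simp add: integrable_lT)
  then show ?thesis unfolding integral_lT set_lebesgue_integral_def
   by (intro integral_mono_AE) (use set_integrable_of_lT[OF g2, of 0 S] in \<open>auto simp: set_integrable_def indicator_def intro!: AE_I2\<close>)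
 qed
 moreover have "(LINT t:{0..S}|lborel. (sech (t + T))^2 * (u t)^2) = (LINT t|lT. (sech (t + T))^2 * (u t)^2)"
  unfolding integral_lT set_lebesgue_integral_def
  by (rule LINT_cong) (use S in \<open>auto simp: indicator_def\<close>)
 ultimately show ?thesis unfolding radial_energy_def by simp
qed

text \<open>Comparison with \<open>tanh s\<close> leaves the edge coefficient
  \<open>- sech^2 T / tanh T - tanh T = - 1 / tanh T\<close>. For \<open>T > 0\<close> the
  comparison function is positive throughout; for \<open>T = 0\<close> and \<open>T < 0\<close> its
  zero lies on the edge or inside, where the function is required to vanish.\<close>

lemma radial_energy_faces:
 assumes ac: "\<And>R. ac_on 0 R u g" and um: "u \<in> borel_measurable lT" and g2: "integrable lT (\<lambda>t. (g t)^2)"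
  and su: "integrable lT (\<lambda>t. (sech (t + T))^2 * (u t)^2)" and S: "\<And>t. t \<ge> S ==> u t = 0"
 shows "T > 0 ==> - (1 / tanh T) * (u 0)^2 \<le> radial_energy T u g"
  and "T = 0 ==> u 0 = 0 ==> 0 \<le> radial_energy T u g"
  and "T < 0 ==> u (- T) = 0 ==> - (1 / tanh T) * (u 0)^2 \<le> radial_energy T u g"
proof -
 define S' where "S' = max (max S 1) (1 - T)"
 have S': "S' > 0" "S' > - T" "\<And>t. t \<ge> S' ==> u t = 0" using S by (auto simp: S'_def)
 note low = radial_energy_lower[OF ac um g2 su less_imp_le[OF S'(1)] S'(3)]
 have g2': "set_integrable lborel {0..S'} (\<lambda>t. (g t)^2)" by (rule set_integrable_of_lT[OF g2]) simp
 have su': "set_integrable lborel {0..S'} (\<lambda>t. (sech (t + T))^2 * (u t)^2)" by (rule set_integrable_of_lT[OF su]) simp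
 have th: "(sech T)^2 / tanh T + tanh T = 1 / tanh T" if "tanh T \<noteq> 0"
  using that tanh_sech[of T] by (simp add: field_simps power2_eq_square)
 have comb: "- ((sech T)^2 / tanh T) * x - tanh T * x = - (1 / tanh T) * x" if "tanh T \<noteq> 0" for x
  unfolding th[OF that, symmetric] by (simp add: algebra_simps)
 show "- (1 / tanh T) * (u 0)^2 \<le> radial_energy T u g" if T: "T > 0"
 proof -
  have "tanh T > 0" using T by simp
  have pos: "1 * jac_p T t + 0 * jac_q T t > 0" if "t \<in> {0..S'}" for t
   using that T by (simp add: jac_p_def)
  from radial_interval_inequality[OF less_imp_le[OF S'(1)] ac g2' jac_combination pos] S'(3)[of S']
  have "- ((sech T)^2 / tanh T) * (u 0)^2 \<le> (LINT t:{0..S'}|lborel. (g t)^2) - 2 * (LINT t:{0..S'}|lborel. (sech (t + T))^2 * (u t)^2)"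
   by (simp add: jac_p_def jac_p'_def)
  with low comb[of "(u 0)^2"] \<open>tanh T > 0\<close> show ?thesis by linarith
 qed
 show "0 \<le> radial_energy T u g" if T: "T = 0" "u 0 = 0"
  using dirichlet_interval[OF ac g2, of T S'] S' T low by simp
 show "- (1 / tanh T) * (u 0)^2 \<le> radial_energy T u g" if T: "T < 0" "u (- T) = 0"
 proof -
  have "tanh T < 0" using T by simp
  have "(LINT t:{0..S'}|lborel. (g t)^2) = (LINT t:{0..- T}|lborel. (g t)^2) + (LINT t:{- T..S'}|lborel. (g t)^2)"
   "(LINT t:{0..S'}|lborel. (sech (t + T))^2 * (u t)^2) = (LINT t:{0..- T}|lborel. (sech (t + T))^2 * (u t)^2) + (LINT t:{- T..S'}|lborel. (sech (t + T))^2 * (u t)^2)"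
   using set_integral_Icc_split[OF g2', of "- T"] set_integral_Icc_split[OF su', of "- T"] T S' by auto
  with dirichlet_interval[OF ac g2 less_imp_le[OF T(1)] S'(2) T(2) S'(3)[OF order_refl]]
   dirichlet_left_interval[OF ac g2 T] low comb[of "(u 0)^2"] \<open>tanh T < 0\<close>
  show ?thesis by linarith
 qed
qed

section \<open>The bilinear energy form\<close>

lemma L2_product_integrable:
 fixes u v :: "'a => real"
 assumes [measurable]: "u \<in> borel_measurable M" "v \<in> borel_measurable M"
  and i: "integrable M (\<lambda>x. (u x)^2)" "integrable M (\<lambda>x. (v x)^2)"
 shows "integrable M (\<lambda>x. u x * v x)"
proof (rule L1_bound[OF L1_add[OF i]])
 have "\<bar>a * b\<bar> \<le> a^2 + b^2" for a b :: real
 proof -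
  have "0 \<le> (\<bar>a\<bar> - \<bar>b\<bar>)^2" "0 \<le> \<bar>a\<bar> * \<bar>b\<bar>" by simp_all
  then show ?thesis unfolding power2_diff abs_mult power2_abs by linarith
 qed
 then show "AE x in M. norm (u x * v x) \<le> norm ((u x)^2 + (v x)^2)" by simp
qed measurable

lemma L2_add_integrable:
 fixes u v :: "'a => real"
 assumes m: "u \<in> borel_measurable M" "v \<in> borel_measurable M"
  and i: "integrable M (\<lambda>x. (u x)^2)" "integrable M (\<lambda>x. (v x)^2)"
 shows "integrable M (\<lambda>x. (u x + r * v x)^2)"
proof -
 have e: "(u x + r * v x)^2 = (u x)^2 + (2 * r) * (u x * v x) + r^2 * (v x)^2" for x by algebra
 show ?thesis unfolding e
  by (intro L1_add integrable_mult_right i L2_product_integrable m)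
qed

lemma prim_linear:
 assumes "loc_int g" "loc_int g'"
 shows "AE p in lM. prim_t (\<lambda>p. g p + r * g' p) p = prim_t g p + r * prim_t g' p"
  and "AE p in lM. prim_c (\<lambda>p. g p + r * g' p) p = prim_c g p + r * prim_c g' p"
proof -
 show "AE p in lM. prim_t (\<lambda>p. g p + r * g' p) p = prim_t g p + r * prim_t g' p"
  using AE_lM_snd[OF loc_int_slice_t[OF assms(1)]] AE_lM_snd[OF loc_int_slice_t[OF assms(2)]]
  by eventually_elim (simp add: prim_t_def set_integral_add(2))
 have si: "set_integrable lborel {0..x} w" if "integrable lC w" "x \<le> 2 * pi" for w :: "real => real" and x
  by (rule set_integrable_subset[OF that(1)[unfolded integrable_lC]]) (use that in auto)
 show "AE p in lM. prim_c (\<lambda>p. g p + r * g' p) p = prim_c g p + r * prim_c g' p"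
  using AE_lM_fst[OF loc_int_slice_c[OF assms(1)]] AE_lM_fst[OF loc_int_slice_c[OF assms(2)]] AE_space
 proof eventually_elim
  case (elim p)
  have x: "snd p \<le> 2 * pi" using elim(3) by (auto simp: space_restrict_space cyl_def)
  show ?case using si[OF elim(1) x] si[OF elim(2) x] by (simp add: prim_c_def set_integral_add(2))
 qed
qed

lemma h1_data_linear:
 assumes d: "h1_data f g h \<tau>" and d': "h1_data f' g' h' \<tau>'"
 shows "h1_data (\<lambda>p. f p + r * f' p) (\<lambda>p. g p + r * g' p) (\<lambda>p. h p + r * h' p) (\<lambda>y. \<tau> y + r * \<tau>' y)"
proof -
 note F = h1_facts[OF d] and F' = h1_facts[OF d']
 obtain k where k: "AE p in lM. f p = k (fst p) + prim_c h p" using d unfolding h1_data_def by blast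
 obtain k' where k': "AE p in lM. f' p = k' (fst p) + prim_c h' p" using d' unfolding h1_data_def by blast
 have "loc_int (\<lambda>p. r * f' p)" using F'(1) unfolding loc_int_def by (auto simp: mult.left_commute)
 then have 1: "loc_int (\<lambda>p. f p + r * f' p)" by (rule loc_int_add[OF F(1)])
 have 2: "AE p in lM. f p + r * f' p = \<tau> (snd p) + r * \<tau>' (snd p) + prim_t (\<lambda>p. g p + r * g' p) p"
  using F(11) F'(11) prim_linear(1)[OF F(2) F'(2), of r]
  by eventually_elim (simp add: rep_def distrib_left)
 have 3: "AE t in lT. (LINT y|lC. h (t, y) + r * h' (t, y)) = 0"
  using F(12) F'(12) loc_int_slice_c[OF F(3)] loc_int_slice_c[OF F'(3)]
  by eventually_elim simp
 have 4: "AE p in lM. f p + r * f' p = (k (fst p) + r * k' (fst p)) + prim_c (\<lambda>p. h p + r * h' p) p"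
  using k k' prim_linear(2)[OF F(3) F'(3), of r]
  by eventually_elim (simp add: distrib_left)
 have m: "(\<lambda>p. g p + r * g' p) \<in> borel_measurable lM" "(\<lambda>p. h p + r * h' p) \<in> borel_measurable lM"
  "(\<lambda>y. \<tau> y + r * \<tau>' y) \<in> borel_measurable lC"
  using F F' by (auto intro!: borel_measurable_add borel_measurable_times)
 show ?thesis unfolding h1_data_def
  by (intro conjI 1 2 3 m exI[of _ "\<lambda>t. k t + r * k' t"] 4 L2_add_integrable F F')
qed

definition energy_form :: "real => (real \<times> real => real) => (real \<times> real => real) => (real \<times> real => real) => (real => real) =>
  (real \<times> real => real) => (real \<times> real => real) => (real \<times> real => real) => (real => real) => real" where
 "energy_form T f g h \<tau> f' g' h' \<tau>' =
   (LINT p|lM. g p * g' p + h p * h' p - 2 * (sech (fst p + T))^2 * f p * f' p) - tanh T * (LINT y|lC. \<tau> y * \<tau>' y)"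

lemma sech_product_integrable:
 assumes d: "h1_data f g h \<tau>" and d': "h1_data f' g' h' \<tau>'"
 shows "integrable lM (\<lambda>p. (sech (fst p + T))^2 * f p * f' p)"
proof -
 have "integrable lM (\<lambda>p. (sech (fst p + T) * f p) * (sech (fst p + T) * f' p))"
  using sech_sq_integrable[OF d, of T] sech_sq_integrable[OF d', of T] h1_facts(4)[OF d] h1_facts(4)[OF d'] sech_tanh_measurable(1)[of T]
  by (intro L2_product_integrable borel_measurable_times) (auto simp: power_mult_distrib)
 then show ?thesis by (simp add: power2_eq_square mult_ac)
qed

lemma energy_form_integrable:
 assumes d: "h1_data f g h \<tau>" and d': "h1_data f' g' h' \<tau>'"
 shows "integrable lM (\<lambda>p. g p * g' p)" "integrable lM (\<lambda>p. h p * h' p)"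
  "integrable lM (\<lambda>p. 2 * (sech (fst p + T))^2 * f p * f' p)"
  "integrable lM (\<lambda>p. g p * g' p + h p * h' p - 2 * (sech (fst p + T))^2 * f p * f' p)"
  "integrable lC (\<lambda>y. \<tau> y * \<tau>' y)"
proof -
 note F = h1_facts[OF d] and F' = h1_facts[OF d']
 show 1: "integrable lM (\<lambda>p. g p * g' p)" "integrable lM (\<lambda>p. h p * h' p)" "integrable lC (\<lambda>y. \<tau> y * \<tau>' y)"
  by (intro L2_product_integrable F F')+
 show 2: "integrable lM (\<lambda>p. 2 * (sech (fst p + T))^2 * f p * f' p)"
  using integrable_mult_right[OF sech_product_integrable[OF d d', of T], of 2] by (simp add: mult_ac)
 show "integrable lM (\<lambda>p. g p * g' p + h p * h' p - 2 * (sech (fst p + T))^2 * f p * f' p)"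
  by (intro L1_add L1_diff 1 2)
qed

lemma energy_form_split:
 assumes d: "h1_data f g h \<tau>" and d': "h1_data f' g' h' \<tau>'"
 shows "energy_form T f g h \<tau> f' g' h' \<tau>' = (LINT p|lM. g p * g' p) + (LINT p|lM. h p * h' p)
   - (LINT p|lM. 2 * (sech (fst p + T))^2 * f p * f' p) - tanh T * (LINT y|lC. \<tau> y * \<tau>' y)"
 unfolding energy_form_def
  LINT_diff[OF L1_add[OF energy_form_integrable(1,2)[OF d d']] energy_form_integrable(3)[OF d d']]
  LINT_add[OF energy_form_integrable(1,2)[OF d d']] ..

lemma energy_form_same:
 assumes d: "h1_data f g h \<tau>"
 shows "energy_form T f g h \<tau> f g h \<tau> = energy T f g h \<tau>"
proof -
 have "(LINT p|lM. 2 * (sech (fst p + T))^2 * f p * f p) = 2 * (LINT p|lM. (sech (fst p + T))^2 * (f p)^2)"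
  by (subst integral_mult_right_zero[symmetric]) (simp add: power2_eq_square mult_ac)
 then show ?thesis unfolding energy_form_split[OF d d] energy_def by (simp add: power2_eq_square)
qed

lemma energy_form_commute: "energy_form T f g h \<tau> f' g' h' \<tau>' = energy_form T f' g' h' \<tau>' f g h \<tau>"
 unfolding energy_form_def by (simp add: mult_ac)

lemma energy_form_linear:
 assumes d: "h1_data f g h \<tau>" and d1: "h1_data f1 g1 h1 \<tau>1" and d2: "h1_data f2 g2 h2 \<tau>2"
 shows "energy_form T f g h \<tau> (\<lambda>p. f1 p + r * f2 p) (\<lambda>p. g1 p + r * g2 p) (\<lambda>p. h1 p + r * h2 p) (\<lambda>y. \<tau>1 y + r * \<tau>2 y)
  = energy_form T f g h \<tau> f1 g1 h1 \<tau>1 + r * energy_form T f g h \<tau> f2 g2 h2 \<tau>2"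
proof -
 note I1 = energy_form_integrable(4)[OF d d1, of T] energy_form_integrable(5)[OF d d1] and I2 = energy_form_integrable(4)[OF d d2, of T] energy_form_integrable(5)[OF d d2]
 define A where "A p = g p * g1 p + h p * h1 p - 2 * (sech (fst p + T))^2 * f p * f1 p" for p
 define B where "B p = g p * g2 p + h p * h2 p - 2 * (sech (fst p + T))^2 * f p * f2 p" for p
 have i: "integrable lM A" "integrable lM B" using I1(1) I2(1) by (simp_all add: A_def[abs_def] B_def[abs_def])
 have e: "(\<lambda>p. g p * (g1 p + r * g2 p) + h p * (h1 p + r * h2 p) - 2 * (sech (fst p + T))^2 * f p * (f1 p + r * f2 p))
  = (\<lambda>p. A p + r * B p)"
 proof
  fix p show "g p * (g1 p + r * g2 p) + h p * (h1 p + r * h2 p) - 2 * (sech (fst p + T))^2 * f p * (f1 p + r * f2 p) = A p + r * B p"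
   unfolding A_def B_def by algebra
 qed
 have e': "\<tau> y * (\<tau>1 y + r * \<tau>2 y) = \<tau> y * \<tau>1 y + r * (\<tau> y * \<tau>2 y)" for y by algebra
 have s: "(LINT p|lM. A p + r * B p) = (LINT p|lM. A p) + r * (LINT p|lM. B p)" using i by simp
 have s': "(LINT y|lC. \<tau> y * (\<tau>1 y + r * \<tau>2 y)) = (LINT y|lC. \<tau> y * \<tau>1 y) + r * (LINT y|lC. \<tau> y * \<tau>2 y)"
  unfolding e' using I1(2) I2(2) by simp
 show ?thesis unfolding energy_form_def e s s' A_def[symmetric] B_def[symmetric] by algebra
qed

lemma energy_linear:
 assumes d: "h1_data f g h \<tau>" and d': "h1_data f' g' h' \<tau>'"
 shows "energy T (\<lambda>p. f p + r * f' p) (\<lambda>p. g p + r * g' p) (\<lambda>p. h p + r * h' p) (\<lambda>y. \<tau> y + r * \<tau>' y)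
  = energy T f g h \<tau> + 2 * r * energy_form T f g h \<tau> f' g' h' \<tau>' + r^2 * energy T f' g' h' \<tau>'"
proof -
 note D = h1_data_linear[OF d d', of r]
 show ?thesis
  unfolding energy_form_same[OF D, symmetric] energy_form_linear[OF D d d']
   energy_form_commute[of T "\<lambda>p. f p + r * f' p"] energy_form_linear[OF d d d'] energy_form_linear[OF d' d d']
   energy_form_same[OF d] energy_form_same[OF d'] energy_form_commute[of T f' g' h' \<tau>' f g h \<tau>]
  by algebra
qed

lemma energy_form_cong:
 assumes d: "h1_data f g h \<tau>" and d': "h1_data f' g' h' \<tau>'"
  and m: "f1 \<in> borel_measurable lM" "g1 \<in> borel_measurable lM" "h1 \<in> borel_measurable lM" "\<tau>1 \<in> borel_measurable lC"
  and e: "AE p in lM. f' p = f1 p" "AE p in lM. g' p = g1 p" "AE p in lM. h' p = h1 p" "AE y in lC. \<tau>' y = \<tau>1 y"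
 shows "energy_form T f g h \<tau> f' g' h' \<tau>' = energy_form T f g h \<tau> f1 g1 h1 \<tau>1"
proof -
 note F = h1_facts[OF d] and F' = h1_facts[OF d']
 note [measurable] = F(4,5,7,9) F'(4,5,7,9) m sech_tanh_measurable(1)[of T]
 have 1: "(LINT p|lM. g p * g' p + h p * h' p - 2 * (sech (fst p + T))^2 * f p * f' p)
   = (LINT p|lM. g p * g1 p + h p * h1 p - 2 * (sech (fst p + T))^2 * f p * f1 p)"
 proof (rule integral_cong_AE)
  show "AE p in lM. g p * g' p + h p * h' p - 2 * (sech (fst p + T))^2 * f p * f' p
   = g p * g1 p + h p * h1 p - 2 * (sech (fst p + T))^2 * f p * f1 p"
   using e(1-3) by eventually_elim simp
 qed measurable
 have 2: "(LINT y|lC. \<tau> y * \<tau>' y) = (LINT y|lC. \<tau> y * \<tau>1 y)"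
 proof (rule integral_cong_AE)
  show "AE y in lC. \<tau> y * \<tau>' y = \<tau> y * \<tau>1 y" using e(4) by eventually_elim simp
 qed measurable
 show ?thesis unfolding energy_form_def 1 2 ..
qed

lemma continuous_AE_zero:
 fixes w :: "real => real"
 assumes c: "\<And>R. continuous_on {0..R} w" and e: "AE t in lT. w t = 0" and t: "t \<ge> 0"
 shows "w t = 0"
proof -
 have c2: "continuous_on {0..t+1} (\<lambda>t. (w t)^2)" by (intro continuous_intros c)
 have "AE t in lborel. t \<in> {0..} \<longrightarrow> w t = 0"
  using e by (simp add: AE_restrict_space_iff)
 then have "(LINT t:{0..t+1}|lborel. (w t)^2) = (LINT t:{0..t+1}|lborel. 0)"
  unfolding set_lebesgue_integral_def
  by (intro integral_cong_AE) (use borel_measurable_integrable[OF set_integrable_continuous_Icc[OF c2, unfolded set_integrable_def]] in \<open>auto simp: indicator_def\<close>)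
 then have "(LINT t:{0..t+1}|lborel. (w t)^2) = 0" by (simp add: set_lebesgue_integral_def)
 from continuous_nonneg_integral_zero[OF c2 _ this, of t] t show ?thesis by simp
qed

text \<open>The relation between the functions is assumed only almost everywhere, because weak
  gradient and trace of a combination are fresh choices. Circle means agree almost everywhere and
  continuity extends this to every \<open>t \<ge> 0\<close>, which makes point values of the radial
  part linear functionals.\<close>

lemma radial_linear:
 assumes d: "h1_data f g h \<tau>" and d': "h1_data f' g' h' \<tau>'" and d1: "h1_data f1 g1 h1 \<tau>1"
  and e: "AE p in lM. f1 p = f p + r * f' p" and t: "t \<ge> 0"
 shows "radial \<tau>1 g1 t = radial \<tau> g t + r * radial \<tau>' g' t"
proof -
 have L: "AE t in lT. radial \<tau>1 g1 t - (radial \<tau> g t + r * radial \<tau>' g' t) = 0"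
  using mean_f[OF d] mean_f[OF d'] mean_f[OF d1] AE_lM_slices(1)[OF e]
 proof eventually_elim
  case (elim t)
  have "(LINT y|lC. f1 (t, y)) = (LINT y|lC. f (t, y) + r * f' (t, y))"
   by (rule integral_cong_AE) (use elim in \<open>auto dest: borel_measurable_integrable intro!: borel_measurable_add borel_measurable_times\<close>)
  then have "2 * pi * (radial \<tau>1 g1 t - (radial \<tau> g t + r * radial \<tau>' g' t)) = 0" using elim by (simp add: algebra_simps)
  then show ?case by simp
 qed
 have "radial \<tau>1 g1 t - (radial \<tau> g t + r * radial \<tau>' g' t) = 0"
  by (rule continuous_AE_zero[OF _ L t])
    (intro continuous_intros ac_on_continuous[OF circ_mean_facts(4)[OF d]] ac_on_continuous[OF circ_mean_facts(4)[OF d']] ac_on_continuous[OF circ_mean_facts(4)[OF d1]])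
 then show ?thesis by simp
qed

text \<open>Du Bois-Reymond's lemma on the half-line for tests vanishing at the edge. It is reduced
  to \<open>weak_derivative_t\<close> with zero derivative and constant trace.\<close>

lemma constant_of_weak_derivative_zero:
 assumes W: "loc_int (\<lambda>p. W (fst p))"
  and z: "\<And>Z Z' R. (\<And>k. C1k k Z) ==> (\<And>t. (Z has_real_derivative Z' t) (at t)) ==> continuous_on UNIV Z' ==> Z 0 = 0 ==>
    (\<And>t. t > R ==> Z t = 0) ==> (\<And>t. t > R ==> Z' t = 0) ==> (LINT t|lT. W t * Z' t) = 0"
 obtains m where "AE t in lT. W t = m"
proof -
 define \<eta> where "\<eta> t = smooth_step ((-1) * t + 1)" for t
 have s\<eta>: "C1k k \<eta>" for k unfolding \<eta>_def[abs_def] by (rule C1k_step_affine)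
 obtain \<eta>' where \<eta>': "\<And>t. (\<eta> has_real_derivative \<eta>' t) (at t)" "continuous_on UNIV \<eta>'"
  using C1k_obtain_derivative[of \<eta>] s\<eta> by blast
 have \<eta>0: "\<eta> 0 = 1" unfolding \<eta>_def by (rule step_1) simp
 have \<eta>z: "\<eta> t = 0" if "t > 1" for t unfolding \<eta>_def by (rule step_0) (use that in simp)
 have \<eta>z': "\<eta>' t = 0" if "t > 1" for t by (rule derivative_zero_outside[OF \<eta>'(1) \<eta>z that])
 have I: "integrable lT (\<lambda>t. W t * A t)" if A: "continuous_on UNIV A" "\<And>t. t > R ==> A t = 0" for A R
 proof -
  have "integrable lM (\<lambda>p. W (fst p) * (A (fst p) * 1))" by (rule loc_int_mult_integrable[OF W A]) auto
  from integrable_mult_right[OF slice_integrable(3)[OF this], of "1 / (2 * pi)"]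
  have "integrable lT (\<lambda>t. 1 / (2 * pi) * (LINT y|lC. W (fst (t, y)) * (A (fst (t, y)) * 1)))" .
  moreover have "1 / (2 * pi) * (LINT y|lC. W (fst (t, y)) * (A (fst (t, y)) * 1)) = W t * A t" for t
   using measure_lC by simp
  ultimately show ?thesis by (simp only:)
 qed
 define m where "m = (LINT t|lT. W t * \<eta>' t)"
 have "AE p in lM. W (fst p) = (\<lambda>y. - m) (snd p) + prim_t (\<lambda>p. 0) p"
 proof (rule weak_derivative_t[OF W])
  show "loc_int (\<lambda>p. 0)" by (simp add: loc_int_def)
  show "integrable lC (\<lambda>y. - m)" by simp
  fix A A' :: "real => real" and R :: real and b
  assume A: "\<And>k. C1k k A" "\<And>t. (A has_real_derivative A' t) (at t)" "\<And>k. C1k k A'" "\<And>t. t > R ==> A t = 0"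
   and b: "test_c b"
  have A'z: "A' t = 0" if "t > R" for t by (rule derivative_zero_outside[OF A(2) A(4) that])
  have cA': "continuous_on UNIV A'" by (rule C1k_continuous[OF A(3)])
  have cb: "continuous_on UNIV b" using b C1k_continuous unfolding test_c_def by blast
  have ib: "integrable lC b" using integrable_lC_mult_continuous[OF _ cb, of "\<lambda>_. 1"] by simp
  \<comment> \<open>Subtracting \<open>A 0\<close> times a fixed cutoff makes a general test vanish
    at the edge; the correction identifies the constant value as \<open>- m\<close>.\<close>
  have "(LINT t|lT. W t * (A' t + - A 0 * \<eta>' t)) = 0"
  proof (rule z[where Z = "\<lambda>t. A t + - A 0 * \<eta> t" and R = "max R 1"])
   show "C1k k (\<lambda>t. A t + - A 0 * \<eta> t)" for k by (rule C1k_add[OF A(1) C1k_cmult[OF s\<eta>]])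
   show "((\<lambda>t. A t + - A 0 * \<eta> t) has_real_derivative A' t + - A 0 * \<eta>' t) (at t)" for t
    by (rule DERIV_add[OF A(2) DERIV_cmult[OF \<eta>'(1)]])
   show "continuous_on UNIV (\<lambda>t. A' t + - A 0 * \<eta>' t)" by (intro continuous_intros cA' \<eta>'(2))
  qed (use \<eta>0 \<eta>z \<eta>z' A(4) A'z in auto)
  then have "(LINT t|lT. W t * A' t) + - A 0 * m = 0"
   using I[OF cA' A'z] I[OF \<eta>'(2) \<eta>z'] by (simp add: distrib_left right_diff_distrib mult.left_commute m_def)
  moreover have "(LINT p|lM. (W (fst p) * A' (fst p)) * b (snd p)) = (LINT t|lT. W t * A' t) * (LINT y|lC. b y)"
   by (rule integrable_lM_mult(2)[OF I[OF cA' A'z] ib])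
  ultimately show "(LINT p|lM. W (fst p) * (A' (fst p) * b (snd p)) + 0 * (A (fst p) * b (snd p))) = - A 0 * (LINT y|lC. - m * b y)"
   by (simp add: mult.assoc)
 qed
 then have "AE p in lM. W (fst p) = - m" by (simp add: prim_t_def)
 from that[OF AE_lM_fstD[OF this]] show thesis .
qed

section \<open>Product functions on the faces\<close>

text \<open>Coefficients of the modes 1, cosine and sine, the angular modes that occur in the null
  space, collected in a vector so that linear combinations of them are available.\<close>

definition fourier :: "real^3 => real => real" where
 "fourier v y = v $ 1 + v $ 2 * cos y + v $ 3 * sin y"

definition fourier' :: "real^3 => real => real" where
 "fourier' v y = - v $ 2 * sin y + v $ 3 * cos y"

lemma fourier_derivative: "(fourier v has_real_derivative fourier' v y) (at y)"
 unfolding fourier_def[abs_def] fourier'_def by (auto intro!: derivative_eq_intros)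

lemma fourier'_continuous: "continuous_on UNIV (fourier' v)" "continuous_on UNIV (fourier v)"
 unfolding fourier'_def[abs_def] fourier_def[abs_def] by (intro continuous_intros)+

lemma fourier_test_c: "test_c (fourier v)"
proof -
 have "C1k k (fourier v)" for k
  unfolding fourier_def[abs_def] using C1k_sin_cos[of k] by (intro C1k_add[OF C1k_add[OF C1k_const C1k_cmult] C1k_cmult]) auto
 then show ?thesis by (auto simp: test_c_def fourier_def)
qed

lemma fourier_square_integrable: "integrable lC (\<lambda>y. (fourier v y)^2)" "integrable lC (\<lambda>y. (fourier' v y)^2)"
 using integrable_lC_mult_continuous[of "\<lambda>_. 1", OF _ continuous_on_power[OF fourier'_continuous(1), of v 2]]
  integrable_lC_mult_continuous[of "\<lambda>_. 1", OF _ continuous_on_power[OF fourier'_continuous(2), of v 2]] by auto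

text \<open>On the face, \<open>prodf c i a v\<close> is \<open>a t * fourier v \<theta>\<close>: the parameter \<open>t\<close> is recovered from the height.\<close>

definition prodf :: "real => 3 => (real => real) => real^3 => real^3 => real" where
 "prodf c i a v x = (let t = Y_sign i * x $ 3 / Y_scale c i in
   a t * (v $ 1 + (v $ 2 * x $ 1 + v $ 3 * x $ 2) / (Y_scale c i * cosh (t + Y_shift i))))"

lemma Y_surface_components:
 "Y_surface c i (t, y) $ 1 = Y_scale c i * (cosh (t + Y_shift i) * cos y)"
 "Y_surface c i (t, y) $ 2 = Y_scale c i * (cosh (t + Y_shift i) * sin y)"
 "Y_surface c i (t, y) $ 3 = Y_scale c i * (Y_sign i * t)"
 by (simp_all add: Y_surface_def)

lemma Y_surface_norm: "(norm (Y_surface c i (t, y)))^2 = conf c i t + (Y_scale c i * t)^2"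
proof -
 have "(norm (Y_surface c i (t, y)))^2 = (Y_scale c i * cosh (t + Y_shift i))^2 * ((sin y)^2 + (cos y)^2) + (Y_scale c i * t)^2 * (Y_sign i * Y_sign i)"
  unfolding power2_norm_eq_inner inner_vec_def sum_3 Y_surface_components inner_real_def by algebra
 then show ?thesis by (simp only: sin_cos_squared_add Y_sign_sq conf_def mult_1_right)
qed

lemma prodf_Y: "c > 0 ==> prodf c i a v (Y_surface c i (t, y)) = a t * fourier v y"
proof -
 assume c: "c > 0"
 note r = Y_scale_pos[OF c, of i]
 have t: "Y_sign i * (Y_scale c i * (Y_sign i * t)) / Y_scale c i = t"
  using r Y_sign_sq[of i] by (simp add: field_simps)
 have "cosh (t + Y_shift i) > 0" by (rule cosh_real_pos)
 then show ?thesis unfolding prodf_def Y_surface_components t Let_def fourier_def using r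
  by (simp add: field_simps)
qed

lemma prodf_Y': "c > 0 ==> prodf c i a v (Y_surface c i p) = a (fst p) * fourier v (snd p)"
 by (cases p) (simp add: prodf_Y)

definition smooth :: "(real => real) => bool" where "smooth a \<longleftrightarrow> (\<forall>k. C1k k a)"

lemma integrable_inverse_square: "integrable lT (\<lambda>t. 1 / (1 + t)^2)"
proof -
 have lim: "((\<lambda>x::real. - 1 / (1 + x)) \<longlongrightarrow> 0) at_top"
  by (intro tendsto_divide_0[OF tendsto_const] filterlim_at_top_imp_at_infinity filterlim_tendsto_add_at_top[OF tendsto_const] filterlim_ident)
 have "(\<integral>\<^sup>+x. ennreal (1 / (1 + x)^2) * indicator {0..} x \<partial>lborel) = ennreal (0 - (- 1 / (1 + 0)))"
 proof (rule nn_integral_FTC_atLeast[OF _ _ _ lim])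
  show "((\<lambda>x. - 1 / (1 + x)) has_real_derivative 1 / (1 + x)^2) (at x)" if "0 \<le> x" for x :: real
   using that by (auto intro!: derivative_eq_intros simp: power2_eq_square)
 qed auto
 moreover have "(\<integral>\<^sup>+x. ennreal (norm (indicator {0..} x *\<^sub>R (1 / (1 + x :: real)^2))) \<partial>lborel)
   = (\<integral>\<^sup>+x. ennreal (1 / (1 + x)^2) * indicator {0..} x \<partial>lborel)"
  by (rule nn_integral_cong) (auto simp: indicator_def)
 ultimately have "(\<integral>\<^sup>+x. ennreal (norm (indicator {0..} x *\<^sub>R (1 / (1 + x :: real)^2))) \<partial>lborel) < \<infinity>"
  by simp
 then show ?thesis unfolding integrable_lT set_integrable_def by (intro integrableI_bounded) auto
qed

lemma smooth_obtain:
 assumes "smooth a" obtains a' where "\<And>t. (a has_real_derivative a' t) (at t)" "continuous_on UNIV a'"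
 using C1k_obtain_derivative[of a] assms unfolding smooth_def by blast

lemma smooth_continuous: "smooth a ==> continuous_on UNIV a"
 using C1k_continuous unfolding smooth_def by blast

lemma integrable_lT_compact:
 assumes "continuous_on UNIV (w :: real => real)" "\<And>t. t > R ==> w t = 0"
 shows "integrable lT w"
 by (rule integrable_lT_set_support[OF set_integrable_continuous_Icc[OF continuous_on_subset[OF assms(1)]]]) (use assms(2) in auto)

definition prod_triple :: "real => (3 => real => real) => (3 => real^3) => triple" where
 "prod_triple c a v = (\<lambda>i. prodf c i (a i) (v i))"

context
 fixes c :: real assumes c: "c > 0"
begin

lemma prodf_facts:
 assumes a: "smooth a" "\<And>t. (a has_real_derivative a' t) (at t)" "continuous_on UNIV a'"
 shows "\<exists>G. has_weak_gradient (Y_surface c i) (prodf c i a v) G"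
  and "AE p in lM. grad_comp 1 (Y_surface c i) (prodf c i a v) p = a' (fst p) * fourier v (snd p)"
  and "AE p in lM. grad_comp 2 (Y_surface c i) (prodf c i a v) p = a (fst p) * fourier' v (snd p)"
  and "has_trace (Y_surface c i) (prodf c i a v) (\<lambda>y. a 0 * fourier v y)"
  and "AE y in lC. edge_trace (Y_surface c i) (prodf c i a v) y = a 0 * fourier v y"
proof -
 have sa: "C1k k a" for k using a(1) by (simp add: smooth_def)
 note P = product_face[where f = "prodf c i a v" and i = i, OF c sa fourier_test_c[of v] a(2,3) fourier_derivative fourier'_continuous(1) prodf_Y'[OF c]]
 show "\<exists>G. has_weak_gradient (Y_surface c i) (prodf c i a v) G"
  and "AE p in lM. grad_comp 1 (Y_surface c i) (prodf c i a v) p = a' (fst p) * fourier v (snd p)"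
  and "AE p in lM. grad_comp 2 (Y_surface c i) (prodf c i a v) p = a (fst p) * fourier' v (snd p)"
  and "has_trace (Y_surface c i) (prodf c i a v) (\<lambda>y. a 0 * fourier v y)"
  and "AE y in lC. edge_trace (Y_surface c i) (prodf c i a v) y = a 0 * fourier v y" by (rule P)+
qed

lemma prodf_gradient_L2:
 assumes a: "smooth a" "\<And>t. (a has_real_derivative a' t) (at t)" "continuous_on UNIV a'"
  and i: "integrable lT (\<lambda>t. (a' t)^2)" "v $ 2 = 0 \<and> v $ 3 = 0 \<or> integrable lT (\<lambda>t. (a t)^2)"
 shows "gradient_L2 (Y_surface c i) (prodf c i a v)"
proof -
 note P = prodf_facts[OF a, of i v]
 note [measurable] = face_measurable(3)[OF c P(1)]
 have ca: "continuous_on UNIV a" using a(1) C1k_continuous unfolding smooth_def by blast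
 have m: "(\<lambda>p. w (fst p) * k (snd p)) \<in> borel_measurable lM" if "continuous_on UNIV w" "continuous_on UNIV k" for w k :: "real => real"
  by (intro borel_measurable_times borel_measurable_lM_cont continuous_on_fst_snd that)
 have 1: "integrable lM (\<lambda>p. (a' (fst p))^2 * (fourier v (snd p))^2)"
  by (rule integrable_lM_mult(1)[OF i(1) fourier_square_integrable(1)])
 have 2: "integrable lM (\<lambda>p. (a (fst p))^2 * (fourier' v (snd p))^2)"
 proof (cases "v $ 2 = 0 \<and> v $ 3 = 0")
  case True then show ?thesis by (simp add: fourier'_def)
 next
  case False then show ?thesis using i(2) by (intro integrable_lM_mult(1)[OF _ fourier_square_integrable(2)]) blast
 qed
 have "integrable lM (\<lambda>p. (a' (fst p) * fourier v (snd p))^2 + (a (fst p) * fourier' v (snd p))^2)"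
  using L1_add[OF 1 2] by (simp add: power_mult_distrib)
 then show ?thesis unfolding gradient_L2_iff[OF c P(1)]
 proof (rule integrable_cong_AE[THEN iffD1, rotated -1])
  show "AE p in lM. (a' (fst p) * fourier v (snd p))^2 + (a (fst p) * fourier' v (snd p))^2
   = (grad_comp 1 (Y_surface c i) (prodf c i a v) p)^2 + (grad_comp 2 (Y_surface c i) (prodf c i a v) p)^2"
   using P(2,3) by eventually_elim simp
  show "(\<lambda>p. (a' (fst p) * fourier v (snd p))^2 + (a (fst p) * fourier' v (snd p))^2) \<in> borel_measurable lM"
   using m[OF a(3) fourier'_continuous(2)] m[OF ca fourier'_continuous(1)] by (intro borel_measurable_add borel_measurable_power) 
 qed measurable
qed

lemma prodf_smooth_cpt:
 assumes a: "smooth a" "\<And>t. t > R ==> a t = 0"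
 shows "smooth_on_face (Y_surface c i) (prodf c i a v)" "cpt_supp (Y_surface c i) (prodf c i a v)"
proof -
 have "Ck k (\<lambda>p. a (fst p) * fourier v (snd p))" for k
  using a(1) fourier_test_c[of v] by (intro Ck_product) (auto simp: smooth_def test_c_def)
 then show "smooth_on_face (Y_surface c i) (prodf c i a v)"
  unfolding smooth_on_face_def by (intro exI[of _ "\<lambda>p. a (fst p) * fourier v (snd p)"]) (simp add: prodf_Y[OF c])
 let ?K = "Y_surface c i ` ({0..R} \<times> {0..2*pi})"
 have "compact ?K"
  by (intro compact_continuous_image compact_Times continuous_on_subset[OF surface_continuous]) auto
 moreover have "?K \<subseteq> face_set (Y_surface c i)" unfolding face_set_def by (intro image_mono) auto
 moreover have "AE p in area (Y_surface c i). Y_surface c i p \<notin> ?K \<longrightarrow> prodf c i a v (Y_surface c i p) = 0"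
  unfolding AE_area[OF c]
 proof (rule AE_I2, rule impI)
  fix p assume p: "p \<in> space lM" "Y_surface c i p \<notin> ?K"
  then have "p \<notin> {0..R} \<times> {0..2*pi}" by blast
  then have "fst p > R" using p(1) by (cases p) (auto simp: space_restrict_space cyl_def)
  then show "prodf c i a v (Y_surface c i p) = 0" using a(2) by (simp add: prodf_Y'[OF c])
 qed
 ultimately show "cpt_supp (Y_surface c i) (prodf c i a v)" unfolding cpt_supp_def by blast
qed

text \<open>\<open>conf\<close> is at most the squared distance from the origin, and this distance
  grows exponentially in \<open>t\<close>, so the squared logarithm in the weight contributes
  \<open>1 / (1 + t)^2\<close>. In the parameter \<open>t\<close> the weight is therefore
  integrable.\<close>

lemma Lstar_weight_bound:
 obtains C where "C \<ge> 0" "\<And>t y. t \<ge> 0 ==> conf c i t * Lstar_weight (Y_surface c i (t, y)) \<le> C * (1 / (1 + t)^2)"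
proof -
 define r where "r = Y_scale c i"
 have r: "r > 0" unfolding r_def by (rule Y_scale_pos[OF c])
 define b where "b = ln (r / 2) + Y_shift i"
 \<comment> \<open>\<open>b + t \<le> L\<close> and \<open>1/2 \<le> L\<close> give \<open>1 + t
   \<le> L + \<bar>b\<bar> + 1 \<le> (2 \<bar>b\<bar> + 3) L\<close>.\<close>
 define K where "K = 2 * \<bar>b\<bar> + 3"
 have K: "K > 0" unfolding K_def by simp
 have "conf c i t * Lstar_weight (Y_surface c i (t, y)) \<le> K^2 * (1 / (1 + t)^2)" if t: "t \<ge> 0" for t y
 proof -
  define N where "N = norm (Y_surface c i (t, y))"
  define L where "L = ln (2 + N)"
  have N0: "N \<ge> 0" unfolding N_def by simp
  have "(r * cosh (t + Y_shift i))^2 \<le> N^2" unfolding N_def Y_surface_norm conf_def r_def by simp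
  then have N1: "r * cosh (t + Y_shift i) \<le> N" by (rule power2_le_imp_le) (rule N0)
  have "exp (b + t) = r * (exp (t + Y_shift i) / 2)" using r by (simp add: b_def exp_add)
  also have "... \<le> r * cosh (t + Y_shift i)" using r by (intro mult_left_mono) (auto simp: cosh_def)
  finally have "exp (b + t) \<le> 2 + N" using N1 by linarith
  then have L1: "b + t \<le> L" unfolding L_def using N0 by (subst ln_ge_iff) auto
  have "1 / 2 \<le> ln (2::real)" using ln2_ge_two_thirds by linarith
  also have "... \<le> L" unfolding L_def using N0 by simp
  finally have L2: "1 / 2 \<le> L" .
  have "(2 * \<bar>b\<bar> + 2) * (1 / 2) \<le> (2 * \<bar>b\<bar> + 2) * L" using L2 by (intro mult_left_mono) auto
  then have KL: "1 + t \<le> K * L" using L1 unfolding K_def by (simp add: algebra_simps)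
  have "conf c i t \<le> N^2" unfolding N_def Y_surface_norm by simp
  also have "... \<le> 1 + N^2" by simp
  finally have cN: "conf c i t / (1 + N^2) \<le> 1" by (simp add: divide_le_eq_1 add_pos_nonneg)
  have "conf c i t * Lstar_weight (Y_surface c i (t, y)) = conf c i t / (1 + N^2) * (1 / L^2)"
   by (simp add: Lstar_weight_def N_def L_def)
  also have "... \<le> 1 * (1 / L^2)" by (rule mult_right_mono[OF cN]) simp
  also have "... \<le> K^2 * (1 / (1 + t)^2)"
  proof -
   have "(1 + t)^2 \<le> (K * L)^2" by (rule power_mono[OF KL]) (use t in simp)
   moreover have "L > 0" using L2 by linarith
   ultimately show ?thesis using t by (simp add: field_simps power_mult_distrib)
  qed
  finally show ?thesis .
 qed
 from that[OF zero_le_power2 this] show thesis .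
qed

text \<open>Truncation at height \<open>n\<close> approximates in the weighted norm, its error being
  dominated by an integrable multiple of \<open>1 / (1 + t)^2\<close>. In particular profiles that
  do not decay, such as \<open>tanh\<close>, are covered.\<close>

lemma prodf_Lstar:
 assumes a: "smooth a" and B: "\<And>t. t \<ge> 0 ==> \<bar>a t\<bar> \<le> B"
 shows "Lstar (Y_surface c i) (prodf c i a v)"
proof -
 let ?X = "Y_surface c i"
 define \<eta> where "\<eta> n t = smooth_step ((-1) * t + (1 + real n))" for n :: nat and t
 have s\<eta>: "smooth (\<lambda>t. a t * \<eta> n t)" for n
  unfolding smooth_def \<eta>_def by (intro allI C1k_mult C1k_step_affine) (use a in \<open>simp add: smooth_def\<close>)
 have ca: "continuous_on UNIV a" using a C1k_continuous unfolding smooth_def by blast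
 have ca\<eta>: "continuous_on UNIV (\<lambda>t. a t * \<eta> n t)" for n using s\<eta> C1k_continuous unfolding smooth_def by blast
 have \<eta>z: "\<eta> n t = 0" if "t > 1 + real n" for n t unfolding \<eta>_def by (rule step_0) (use that in simp)
 have \<eta>1: "\<eta> n t = 1" if "t \<le> real n" for n t unfolding \<eta>_def by (rule step_1) (use that in simp)
 have \<eta>b: "(1 - \<eta> n t)^2 \<le> 1" for n t
  using step_bounds[of "(-1) * t + (1 + real n)"] unfolding \<eta>_def by (intro power_le_one) auto
 have m: "(\<lambda>p. w (fst p) * fourier v (snd p)) \<in> borel_measurable lM" if "continuous_on UNIV w" for w :: "real => real"
  by (intro borel_measurable_times borel_measurable_lM_cont continuous_on_fst_snd that fourier'_continuous(2))
 obtain C where C: "C \<ge> 0" "\<And>t y. t \<ge> 0 ==> conf c i t * Lstar_weight (?X (t, y)) \<le> C * (1 / (1 + t)^2)"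
  using Lstar_weight_bound by blast
 have X: "?X \<in> borel_measurable lM" by (rule borel_measurable_lM_cont[OF surface_continuous])
 have wt: "(\<lambda>p. Lstar_weight (?X p)) \<in> borel_measurable lM"
  unfolding Lstar_weight_def using X by measurable
 have w0: "Lstar_weight x \<ge> 0" for x unfolding Lstar_weight_def by simp
 let ?g = "\<lambda>n. prodf c i (\<lambda>t. a t * \<eta> n t) v"
 define F where "F n p = (prodf c i a v (?X p) - ?g n (?X p))^2 * Lstar_weight (?X p)" for n p
 define G where "G p = B^2 * C * (1 / (1 + fst p)^2) * (fourier v (snd p))^2" for p :: "real \<times> real"
 have Fe: "F n p = (a (fst p))^2 * (1 - \<eta> n (fst p))^2 * (fourier v (snd p))^2 * Lstar_weight (?X p)" for n p
  unfolding F_def prodf_Y'[OF c] by algebra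
 have Fm: "F n \<in> borel_measurable lM" for n
  unfolding F_def[abs_def] prodf_Y'[OF c]
  by (intro borel_measurable_times borel_measurable_power borel_measurable_diff wt m ca ca\<eta>)
 have Gi: "integrable lM G" unfolding G_def
  by (rule integrable_lM_mult(1)[OF integrable_mult_right[OF integrable_inverse_square] fourier_square_integrable(1)])
 have "(\<lambda>n. \<integral>\<^sup>+p. ennreal (conf c i (fst p) * F n p) \<partial>lM) \<longlonglongrightarrow> (\<integral>\<^sup>+p. 0 \<partial>lM)"
 proof (rule nn_integral_dominated_convergence[where w = "\<lambda>p. ennreal (G p)"])
  show "(\<lambda>p. ennreal (conf c i (fst p) * F n p)) \<in> borel_measurable lM" for n
   using Fm conf_measurable[of c i] by measurable
  show "(\<lambda>p. ennreal (G p)) \<in> borel_measurable lM" using borel_measurable_integrable[OF Gi] by measurable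
  show "(\<integral>\<^sup>+p. ennreal (G p) \<partial>lM) < \<infinity>"
  proof -
   have "(\<integral>\<^sup>+p. ennreal (norm (G p)) \<partial>lM) < \<infinity>" using Gi unfolding integrable_iff_bounded by blast
   moreover have "norm (G p) = G p" for p unfolding G_def using C(1) by simp
   ultimately show ?thesis by simp
  qed
  show "AE p in lM. ennreal (conf c i (fst p) * F n p) \<le> ennreal (G p)" for n
  proof (rule AE_I2, rule ennreal_leI)
   fix p assume "p \<in> space lM"
   then have t: "fst p \<ge> 0" by (auto simp: space_restrict_space cyl_def)
   have "conf c i (fst p) * F n p = ((a (fst p))^2 * (1 - \<eta> n (fst p))^2) * ((conf c i (fst p) * Lstar_weight (?X p)) * (fourier v (snd p))^2)"
    unfolding Fe by algebra
   also have "... \<le> (B^2 * 1) * ((C * (1 / (1 + fst p)^2)) * (fourier v (snd p))^2)"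
   proof (rule mult_mono)
    have "(a (fst p))^2 \<le> B^2" using B[OF t] by (metis abs_ge_zero power2_abs power_mono)
    then show "(a (fst p))^2 * (1 - \<eta> n (fst p))^2 \<le> B^2 * 1" by (rule mult_mono[OF _ \<eta>b]) auto
    show "conf c i (fst p) * Lstar_weight (?X p) * (fourier v (snd p))^2 \<le> C * (1 / (1 + fst p)^2) * (fourier v (snd p))^2"
     using C(2)[OF t, of "snd p"] by (intro mult_right_mono) auto
    show "0 \<le> conf c i (fst p) * Lstar_weight (?X p) * (fourier v (snd p))^2"
     by (intro mult_nonneg_nonneg w0 less_imp_le[OF conf_pos[OF c]]) simp
   qed simp
   finally show "conf c i (fst p) * F n p \<le> G p" unfolding G_def by (simp add: mult_ac)
  qed
  have "(\<lambda>n. ennreal (conf c i (fst p) * F n p)) \<longlonglongrightarrow> 0" for p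
  proof -
   obtain N :: nat where "fst p \<le> real N" using real_arch_simple by blast
   then have "ennreal (conf c i (fst p) * F n p) = 0" if "n \<ge> N" for n
    using \<eta>1[of "fst p" n] that unfolding Fe by simp
   then show "(\<lambda>n. ennreal (conf c i (fst p) * F n p)) \<longlonglongrightarrow> 0"
    by (intro tendsto_eventually eventually_sequentiallyI)
  qed
  then show "AE p in lM. (\<lambda>n. ennreal (conf c i (fst p) * F n p)) \<longlonglongrightarrow> 0" by simp
 qed auto
 moreover have "(\<integral>\<^sup>+p. ennreal (F n p) \<partial>area ?X) = (\<integral>\<^sup>+p. ennreal (conf c i (fst p) * F n p) \<partial>lM)" for n
  unfolding area_Y[OF c] using conf_measurable[of c i] Fm[of n] conf_pos[OF c, of i]
  by (subst nn_integral_density) (auto simp: ennreal_mult' less_imp_le)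
 ultimately have lim: "(\<lambda>n. \<integral>\<^sup>+p. ennreal (F n p) \<partial>area ?X) \<longlonglongrightarrow> 0" by simp
 have "smooth_on_face ?X (?g n) \<and> cpt_supp ?X (?g n)" for n
  using prodf_smooth_cpt[OF s\<eta>[of n], of "1 + real n"] \<eta>z by simp
 then show ?thesis unfolding Lstar_def measurable_area[OF c]
  using lim[unfolded F_def] m[OF ca] by (auto simp: prodf_Y'[OF c] intro!: exI[of _ ?g])
qed

lemma prod_triple_admissible:
 assumes a: "\<And>i. smooth (a i)" and z: "\<And>y. (\<Sum>i\<in>UNIV. a i 0 * fourier (v i) y) = 0"
 shows "admissible (Y_surface c) (prod_triple c a v)"
 unfolding admissible_def
proof (intro conjI allI)
 fix i
 obtain a' where a': "\<And>t. (a i has_real_derivative a' t) (at t)" "continuous_on UNIV a'" using smooth_obtain[OF a] by blast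
 show "\<exists>G. has_weak_gradient (Y_surface c i) (prod_triple c a v i) G" "\<exists>\<tau>. has_trace (Y_surface c i) (prod_triple c a v i) \<tau>"
  using prodf_facts[OF a a', of i "v i"] unfolding prod_triple_def by blast+
next
 have "AE y in lC. edge_trace (Y_surface c i) (prodf c i (a i) (v i)) y = a i 0 * fourier (v i) y" for i
 proof -
  obtain a' where a': "\<And>t. (a i has_real_derivative a' t) (at t)" "continuous_on UNIV a'" using smooth_obtain[OF a] by blast
  show ?thesis by (rule prodf_facts(5)[OF a a'])
 qed
 then have "AE y in lC. \<forall>i\<in>UNIV. edge_trace (Y_surface c i) (prodf c i (a i) (v i)) y = a i 0 * fourier (v i) y"
  by (intro AE_finite_allI) auto
 then show "AE y in lC. (\<Sum>i\<in>UNIV. edge_trace (Y_surface c i) (prod_triple c a v i) y) = 0"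
  by eventually_elim (simp add: prod_triple_def z)
qed

text \<open>The disjunction on the profile reflects that exactly the angular modes contribute
  \<open>a^2\<close> to the Dirichlet energy.\<close>

lemma prod_triple_D:
 assumes a: "\<And>i. smooth (a i)" "\<And>i t. (a i has_real_derivative a' i t) (at t)" "\<And>i. continuous_on UNIV (a' i)"
  and z: "\<And>y. (\<Sum>i\<in>UNIV. a i 0 * fourier (v i) y) = 0" and B: "\<And>i t. t \<ge> 0 ==> \<bar>a i t\<bar> \<le> B i"
  and i: "\<And>i. integrable lT (\<lambda>t. (a' i t)^2)" "\<And>i. v i $ 2 = 0 \<and> v i $ 3 = 0 \<or> integrable lT (\<lambda>t. (a i t)^2)"
 shows "prod_triple c a v \<in> D_space (Y_surface c)"
 unfolding D_space_def using prod_triple_admissible[OF a(1) z] prodf_Lstar[OF a(1) B] prodf_gradient_L2[OF a i]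
 by (simp add: prod_triple_def)

lemma prod_triple_compact:
 assumes a: "\<And>i. smooth (a i)" "\<And>i t. t > R ==> a i t = 0" and z: "\<And>y. (\<Sum>i\<in>UNIV. a i 0 * fourier (v i) y) = 0"
 shows "prod_triple c a v \<in> D_space (Y_surface c)" "prod_triple c a v \<in> cpt_variations (Y_surface c)"
proof -
 have "\<exists>a'. (\<forall>t. (a i has_real_derivative a' t) (at t)) \<and> continuous_on UNIV a'" for i
  using smooth_obtain[OF a(1)] by metis
 then obtain a' where a': "\<And>i t. (a i has_real_derivative a' i t) (at t)" "\<And>i. continuous_on UNIV (a' i)" by metis
 have z': "a' i t = 0" if "t > R" for i t by (rule derivative_zero_outside[OF a'(1) a(2) that])
 have ca: "continuous_on UNIV (a i)" for i by (rule smooth_continuous[OF a(1)])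
 have "bounded (a i ` {0..R})" for i
  by (rule compact_imp_bounded[OF compact_continuous_image]) (auto intro: continuous_on_subset[OF ca])
 then have "\<forall>i. \<exists>B. \<forall>t\<in>{0..R}. \<bar>a i t\<bar> \<le> B" by (simp add: bounded_iff)
 from choice[OF this] obtain B where B: "\<And>i t. t \<in> {0..R} ==> \<bar>a i t\<bar> \<le> B i" by blast
 have B': "\<bar>a i t\<bar> \<le> max 0 (B i)" if "t \<ge> 0" for i t using B[of t i] a(2)[of t i] that by (cases "t \<le> R") auto
 have i: "integrable lT (\<lambda>t. (a' i t)^2)" "integrable lT (\<lambda>t. (a i t)^2)" for i
  by (rule integrable_lT_compact[of _ R]; use z' a(2) in \<open>auto intro!: continuous_intros ca a'(2)\<close>)+
 show "prod_triple c a v \<in> D_space (Y_surface c)"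
  by (rule prod_triple_D[OF a(1) a' z B' i(1)]) (use i(2) in auto)
 have "W12 (Y_surface c i) (prodf c i (a i) (v i))" for i
  unfolding W12_def
 proof (intro conjI prodf_facts(1)[OF a(1) a'] prodf_gradient_L2[OF a(1) a' i(1)] disjI2 i(2))
  have "integrable lT (\<lambda>t. conf c i t * (a i t)^2)"
   by (rule integrable_lT_compact[of _ R]; use a(2) in \<open>auto intro!: continuous_intros ca conf_continuous\<close>)
  from integrable_lM_mult(1)[OF this fourier_square_integrable(1)[of "v i"]]
  show "integrable (area (Y_surface c i)) (\<lambda>p. (prodf c i (a i) (v i) (Y_surface c i p))^2)"
   unfolding prodf_Y'[OF c]
   by (subst integrable_area[OF c])
     (auto simp: power_mult_distrib mult.assoc intro!: borel_measurable_lM_cont continuous_intros continuous_on_fst_snd ca fourier'_continuous(2))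
 qed
 then show "prod_triple c a v \<in> cpt_variations (Y_surface c)"
  unfolding cpt_variations_def using prod_triple_admissible[OF a(1) z] prodf_smooth_cpt(2)[OF a]
  by (auto simp: prod_triple_def)
qed

end

section \<open>The Morse index\<close>

text \<open>Gaussian elimination: a pivot \<open>p\<close> disposes of the last equation and the
  induction hypothesis solves the reduced system. Working with coefficients fits
  \<open>lin_indep\<close>, which is a notion modulo null triples.\<close>

lemma linear_dependence:
 fixes w :: "'a => nat => real"
 assumes "finite J" "card J > n"
 shows "\<exists>a. (\<exists>j\<in>J. a j \<noteq> 0) \<and> (\<forall>k<n. (\<Sum>j\<in>J. a j * w j k) = 0)"
 using assms
proof (induction n arbitrary: J w)
 case 0
 then obtain j where "j \<in> J" by (metis card_gt_0_iff ex_in_conv)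
 then show ?case by (intro exI[of _ "\<lambda>_. 1"]) auto
next
 case (Suc n)
 show ?case
 proof (cases "\<forall>j\<in>J. w j n = 0")
  case True
  obtain a where a: "\<exists>j\<in>J. a j \<noteq> 0" "\<forall>k<n. (\<Sum>j\<in>J. a j * w j k) = 0"
   using Suc.IH[of J w] Suc.prems by auto
  have "(\<Sum>j\<in>J. a j * w j k) = 0" if "k < Suc n" for k
   using a(2) True that by (cases "k = n") auto
  then show ?thesis using a(1) by blast
 next
  case False
  then obtain p where p: "p \<in> J" "w p n \<noteq> 0" by blast
  have card: "finite (J - {p})" "card (J - {p}) > n" using Suc.prems p by auto
  obtain a where a: "\<exists>j\<in>J - {p}. a j \<noteq> 0"
   "\<forall>k<n. (\<Sum>j\<in>J - {p}. a j * (w j k - w j n / w p n * w p k)) = 0"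
   using Suc.IH[OF card, of "\<lambda>j k. w j k - w j n / w p n * w p k"] by blast
  define s where "s = - (\<Sum>j\<in>J - {p}. a j * w j n) / w p n"
  have sum: "(\<Sum>j\<in>J. (a(p := s)) j * w j k) = s * w p k + (\<Sum>j\<in>J - {p}. a j * w j k)" for k
   unfolding sum.remove[OF Suc.prems(1) p(1)] by simp
  have "(\<Sum>j\<in>J. (a(p := s)) j * w j k) = 0" if k: "k < Suc n" for k
  proof (cases "k = n")
   case True show ?thesis unfolding sum using p(2) by (simp add: True s_def)
  next
   case False
   then have "0 = (\<Sum>j\<in>J - {p}. a j * (w j k - w j n / w p n * w p k))" using a(2) k by simp
   also have "... = (\<Sum>j\<in>J - {p}. a j * w j k) - (\<Sum>j\<in>J - {p}. a j * w j n * (w p k / w p n))"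
    by (simp add: right_diff_distrib sum_subtractf mult_ac)
   also have "... = (\<Sum>j\<in>J - {p}. a j * w j k) - (\<Sum>j\<in>J - {p}. a j * w j n) * (w p k / w p n)"
    unfolding sum_distrib_right ..
   finally show ?thesis unfolding sum by (simp add: s_def)
  qed
  moreover have "\<exists>j\<in>J. (a(p := s)) j \<noteq> 0" using a(1) by auto
  ultimately show ?thesis by blast
 qed
qed

lemma lin_comb_Suc: "lin_comb (Suc n) a b = (\<lambda>i x. lin_comb n a b i x + a n * b n i x)"
 by (simp add: lin_comb_def)

lemma lin_comb_mem: "linear_subspace V ==> (\<And>j. j < n ==> b j \<in> V) ==> lin_comb n a b \<in> V"
proof (induction n)
 case 0 then show ?case by (simp add: lin_comb_def linear_subspace_def)
next
 case (Suc n)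
 then have "lin_comb n a b \<in> V" "(\<lambda>i x. a n * b n i x) \<in> V" by (auto simp: linear_subspace_def)
 moreover have "(\<lambda>i x. \<phi> i x + \<psi> i x) \<in> V" if "\<phi> \<in> V" "\<psi> \<in> V" for \<phi> \<psi>
  using Suc.prems(1) that by (simp add: linear_subspace_def)
 ultimately show ?case unfolding lin_comb_Suc by metis
qed

text \<open>The common setting of index and nullity: both \<open>cpt_variations\<close> and
  \<open>D_space\<close> lie in it, and it supplies \<open>h1_data\<close> on each face.\<close>

definition finite_energy :: "(3 => face) => triple => bool" where
 "finite_energy Y \<phi> \<longleftrightarrow> admissible Y \<phi> \<and> (\<forall>i. gradient_L2 (Y i) (\<phi> i))"

lemma finite_energyI: "\<phi> \<in> cpt_variations Y ==> finite_energy Y \<phi>" "\<phi> \<in> D_space Y ==> finite_energy Y \<phi>"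
 by (auto simp: finite_energy_def cpt_variations_def D_space_def W12_def)

abbreviation face_radial :: "real => triple => 3 => real => real" where
 "face_radial c \<phi> i \<equiv> radial (edge_trace (Y_surface c i) (\<phi> i)) (grad_comp 1 (Y_surface c i) (\<phi> i))"

abbreviation face_energy :: "real => triple => 3 => real" where
 "face_energy c \<phi> i \<equiv> energy (Y_shift i) (\<lambda>p. \<phi> i (Y_surface c i p)) (grad_comp 1 (Y_surface c i) (\<phi> i))
   (grad_comp 2 (Y_surface c i) (\<phi> i)) (edge_trace (Y_surface c i) (\<phi> i))"

lemma tanh_Y_shift_values: "tanh (Y_shift 1) = - (sqrt 3 / 2)" "tanh (Y_shift 2) = sqrt 3 / 2" "tanh (Y_shift 3) = 0"
 by (simp_all add: tanh_Y_shift Y_cos)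

lemma Y_shift_signs: "Y_shift 1 < 0" "Y_shift 2 > 0" "Y_shift 3 = 0"
proof -
 have "tanh (Y_shift 1) < 0" "tanh (Y_shift 2) > 0" "tanh (Y_shift 3) = 0" by (simp_all add: tanh_Y_shift_values)
 then show "Y_shift 1 < 0" "Y_shift 2 > 0" "Y_shift 3 = 0" by simp_all
qed

context
 fixes c :: real assumes c: "c > 0"
begin

lemma finite_energy_data:
 assumes "finite_energy (Y_surface c) \<phi>"
 shows "h1_data (\<lambda>p. \<phi> i (Y_surface c i p)) (grad_comp 1 (Y_surface c i) (\<phi> i)) (grad_comp 2 (Y_surface c i) (\<phi> i)) (edge_trace (Y_surface c i) (\<phi> i))"
 by (rule face_h1_data[OF c]) (use assms in \<open>auto simp: finite_energy_def admissible_def\<close>)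

lemma index_form_energy_form:
 assumes "finite_energy (Y_surface c) \<phi>" "finite_energy (Y_surface c) \<psi>"
 shows "index_form (Y_surface c) \<phi> \<psi> = (\<Sum>i\<in>UNIV. energy_form (Y_shift i)
   (\<lambda>p. \<phi> i (Y_surface c i p)) (grad_comp 1 (Y_surface c i) (\<phi> i)) (grad_comp 2 (Y_surface c i) (\<phi> i)) (edge_trace (Y_surface c i) (\<phi> i))
   (\<lambda>p. \<psi> i (Y_surface c i p)) (grad_comp 1 (Y_surface c i) (\<psi> i)) (grad_comp 2 (Y_surface c i) (\<psi> i)) (edge_trace (Y_surface c i) (\<psi> i)))"
proof -
 have t: "cos (Y_angle i) = - tanh (Y_shift i)" for i by (simp add: tanh_Y_shift)
 show ?thesis
  by (subst index_form_coordinates[OF c]) (use assms in \<open>auto simp: finite_energy_def admissible_def energy_form_def t\<close>)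
qed

lemma index_form_energy:
 assumes "finite_energy (Y_surface c) \<phi>"
 shows "index_form (Y_surface c) \<phi> \<phi> = (\<Sum>i\<in>UNIV. face_energy c \<phi> i)"
 unfolding index_form_energy_form[OF assms assms] energy_form_same[OF finite_energy_data[OF assms]] ..

text \<open>The absolute height of a point is proportional to \<open>t\<close>, so a compact support
  bounds \<open>t\<close>; beyond that bound the radial part vanishes, first almost everywhere and
  then everywhere by continuity.\<close>

lemma compact_radial_zero:
 assumes \<phi>: "\<phi> \<in> cpt_variations (Y_surface c)"
 obtains S where "\<And>t. t \<ge> S ==> face_radial c \<phi> i t = 0"
proof -
 let ?X = "Y_surface c i"
 note d = finite_energy_data[OF finite_energyI(1)[OF \<phi>], of i]
 have r: "Y_scale c i > 0" by (rule Y_scale_pos[OF c])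
 obtain K where K: "compact K" "AE p in lM. ?X p \<notin> K \<longrightarrow> \<phi> i (?X p) = 0"
  using \<phi> unfolding cpt_variations_def cpt_supp_def AE_area[OF c] by blast
 obtain B where B: "\<And>x. x \<in> K ==> norm x \<le> B" using compact_imp_bounded[OF K(1)] by (auto simp: bounded_iff)
 define R where "R = max 0 (B / Y_scale c i)"
 have out: "?X p \<notin> K" if "fst p > R" for p
 proof
  assume "?X p \<in> K"
  then have "\<bar>?X p $ 3\<bar> \<le> B" using B component_le_norm_cart order_trans by blast
  moreover have "\<bar>?X p $ 3\<bar> = Y_scale c i * fst p"
   using r that by (cases p) (auto simp: Y_surface_components abs_mult Y_sign_def R_def)
  ultimately have "fst p \<le> B / Y_scale c i" using r by (simp add: field_simps)
  then show False using that by (simp add: R_def)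
 qed
 \<comment> \<open>The factor \<open>max 0 (t - R)\<close> produces a continuous function that
   vanishes almost everywhere on the entire half-line, as \<open>continuous_AE_zero\<close>
   requires.\<close>
 let ?w = "\<lambda>t. face_radial c \<phi> i t * max 0 (t - R)"
 have z: "AE t in lT. ?w t = 0"
  using mean_f[OF d] AE_lM_slices(1)[OF K(2)]
 proof eventually_elim
  case (elim t)
  show ?case
  proof (cases "t > R")
   case True
   have "(LINT y|lC. \<phi> i (?X (t, y))) = (LINT y|lC. 0)"
    by (rule integral_cong_AE) (use elim out[of "(t, _)"] True in \<open>auto dest: borel_measurable_integrable\<close>)
   then show ?thesis using elim by simp
  qed auto
 qed
 have "face_radial c \<phi> i t = 0" if "t > R" for t
 proof -
  have "?w t = 0"
   by (rule continuous_AE_zero[OF _ z]) (use that in \<open>auto intro!: continuous_intros ac_on_continuous[OF circ_mean_facts(4)[OF d]] simp: R_def\<close>)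
  then show ?thesis using that by simp
 qed
 then show thesis by (intro that[of "R + 1"]) auto
qed

lemma trace_mean_sum:
 assumes \<phi>: "finite_energy (Y_surface c) \<phi>"
 shows "(\<Sum>i\<in>UNIV. face_radial c \<phi> i 0) = 0"
proof -
 note i = h1_facts(13)[OF finite_energy_data[OF \<phi>]]
 have "(\<Sum>i\<in>UNIV. (LINT y|lC. edge_trace (Y_surface c i) (\<phi> i) y)) = (LINT y|lC. (\<Sum>i\<in>UNIV. edge_trace (Y_surface c i) (\<phi> i) y))"
  using i by simp
 also have "... = (LINT y|lC. 0)"
 proof (rule integral_cong_AE)
  show "(\<lambda>y. \<Sum>i\<in>UNIV. edge_trace (Y_surface c i) (\<phi> i) y) \<in> borel_measurable lC"
   using borel_measurable_integrable[OF i] by (intro borel_measurable_sum)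
  show "AE y in lC. (\<Sum>i\<in>UNIV. edge_trace (Y_surface c i) (\<phi> i) y) = 0"
   using \<phi> by (simp add: finite_energy_def admissible_def)
 qed simp
 finally have "(\<Sum>i\<in>UNIV. (LINT y|lC. edge_trace (Y_surface c i) (\<phi> i) y)) = 0" by simp
 then show ?thesis unfolding radial_0 trace_mean_def sum_divide_distrib[symmetric] by simp
qed

text \<open>The vanishing edge mean on face 3 makes those of faces 1 and 2 opposite, and
  \<open>tanh\<close> takes opposite values at \<open>Y_shift 1\<close> and
  \<open>Y_shift 2\<close>; so the lower bounds \<open>- u(0)^2 / tanh T\<close> of the two faces
  add up to zero.\<close>

lemma index_form_nonneg:
 assumes \<phi>: "\<phi> \<in> cpt_variations (Y_surface c)"
  and z: "face_radial c \<phi> 1 (- Y_shift 1) = 0" "face_radial c \<phi> 3 0 = 0"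
 shows "0 \<le> index_form (Y_surface c) \<phi> \<phi>"
proof -
 note fe = finite_energyI(1)[OF \<phi>] and d = finite_energy_data[OF finite_energyI(1)[OF \<phi>]]
 let ?u = "\<lambda>i. face_radial c \<phi> i" and ?g = "\<lambda>i. circ_mean (grad_comp 1 (Y_surface c i) (\<phi> i))"
 let ?E = "\<lambda>i. radial_energy (Y_shift i) (?u i) (?g i)"
 have "\<forall>i. \<exists>S. \<forall>t\<ge>S. ?u i t = 0"
 proof
  fix i show "\<exists>S. \<forall>t\<ge>S. ?u i t = 0" by (rule compact_radial_zero[OF \<phi>, of i]) blast
 qed
 from choice[OF this] obtain S where S: "\<And>i t. t \<ge> S i ==> ?u i t = 0" by blast
 have sum: "?u 1 0 + ?u 2 0 + ?u 3 0 = 0" using trace_mean_sum[OF fe] by (simp add: sum_3)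
 have sq: "(?u 1 0)^2 = (?u 2 0)^2"
 proof -
  have "?u 1 0 = - ?u 2 0" using sum z(2) by simp
  then show ?thesis by simp
 qed
 have "- (1 / tanh (Y_shift 1)) * (?u 1 0)^2 \<le> ?E 1" by (rule radial_energy_faces(3)[OF circ_mean_facts(4)[OF d[of 1]] radial_measurable[OF d[of 1]] circ_mean_facts(3)[OF d[of 1]] radial_sech_integrable[OF d[of 1]] S[of 1] Y_shift_signs(1) z(1)])
 moreover have "- (1 / tanh (Y_shift 2)) * (?u 2 0)^2 \<le> ?E 2" by (rule radial_energy_faces(1)[OF circ_mean_facts(4)[OF d[of 2]] radial_measurable[OF d[of 2]] circ_mean_facts(3)[OF d[of 2]] radial_sech_integrable[OF d[of 2]] S[of 2] Y_shift_signs(2)])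
 moreover have "0 \<le> ?E 3" by (rule radial_energy_faces(2)[OF circ_mean_facts(4)[OF d[of 3]] radial_measurable[OF d[of 3]] circ_mean_facts(3)[OF d[of 3]] radial_sech_integrable[OF d[of 3]] S[of 3] Y_shift_signs(3) z(2)])
 moreover have "- (1 / tanh (Y_shift 1)) = 1 / tanh (Y_shift 2)" unfolding tanh_Y_shift_values by simp
 ultimately have "1 / tanh (Y_shift 2) * (?u 2 0)^2 \<le> ?E 1" "- (1 / tanh (Y_shift 2)) * (?u 2 0)^2 \<le> ?E 2" "0 \<le> ?E 3"
  unfolding sq by simp_all
 then have "0 \<le> ?E 1 + ?E 2 + ?E 3" unfolding mult_minus_left by linarith
 then have "0 \<le> 2 * pi * (?E 1 + ?E 2 + ?E 3)" by simp
 also have "... = 2 * pi * ?E 1 + 2 * pi * ?E 2 + 2 * pi * ?E 3" by (simp only: distrib_left)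
 also have "... \<le> face_energy c \<phi> 1 + face_energy c \<phi> 2 + face_energy c \<phi> 3"
  by (intro add_mono energy_ge_radial d)
 finally show ?thesis unfolding index_form_energy[OF fe] by (simp add: sum_3)
qed

lemma face_radial_lin_comb:
 assumes V: "V \<subseteq> cpt_variations (Y_surface c)" "linear_subspace V" and b: "\<And>j. j < n ==> b j \<in> V" and t: "t \<ge> 0"
 shows "face_radial c (lin_comb n a b) i t = (\<Sum>j<n. a j * face_radial c (b j) i t)"
 using b
proof (induction n)
 case 0
 have fe: "finite_energy (Y_surface c) (lin_comb 0 a b)" using finite_energyI(1) V lin_comb_mem[of V 0 b a] by auto
 note d = finite_energy_data[OF fe, of i]
 have "face_radial c (lin_comb 0 a b) i t = face_radial c (lin_comb 0 a b) i t + 1 * face_radial c (lin_comb 0 a b) i t"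
  by (rule radial_linear[OF d d d _ t]) (simp add: lin_comb_def)
 then show ?case by simp
next
 case (Suc n)
 have fe: "finite_energy (Y_surface c) (lin_comb n a b)" "finite_energy (Y_surface c) (lin_comb (Suc n) a b)" "finite_energy (Y_surface c) (b n)"
  using finite_energyI(1) V Suc.prems lin_comb_mem[of V n b a] lin_comb_mem[of V "Suc n" b a] by auto
 have "face_radial c (lin_comb (Suc n) a b) i t = face_radial c (lin_comb n a b) i t + a n * face_radial c (b n) i t"
  by (rule radial_linear[OF finite_energy_data[OF fe(1)] finite_energy_data[OF fe(3)] finite_energy_data[OF fe(2)] _ t])
    (simp add: lin_comb_Suc)
 then show ?case using Suc by simp
qed

text \<open>The two prescribed point values are linear functionals on the given space, so three
  independent fields admit a nontrivial combination on which both vanish; there the form would be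
  negative and nonnegative at once.\<close>

lemma morse_index_upper: "morse_index (Y_surface c) \<le> 2"
 unfolding morse_index_def triple_dim_def
proof (rule Sup_least, clarify, rule Sup_least, clarify)
 fix V n b
 assume V: "V \<subseteq> cpt_variations (Y_surface c)" "linear_subspace V"
  and neg: "\<forall>\<phi>\<in>V. \<not> null_triple (Y_surface c) \<phi> \<longrightarrow> index_form (Y_surface c) \<phi> \<phi> < 0"
  and b: "\<forall>j<n. b j \<in> V" and li: "lin_indep (Y_surface c) n b"
 define w where "w j k = (if k = 0 then face_radial c (b j) 1 (- Y_shift 1) else face_radial c (b j) 3 0)" for j and k :: nat
 have "n \<le> 2"
 proof (rule ccontr)
  assume "\<not> n \<le> 2"
  then have "\<exists>a. (\<exists>j\<in>{..<n}. a j \<noteq> 0) \<and> (\<forall>k<2. (\<Sum>j\<in>{..<n}. a j * w j k) = 0)"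
   by (intro linear_dependence) auto
  then obtain a where a: "\<exists>j\<in>{..<n}. a j \<noteq> 0" "\<And>k. k < 2 ==> (\<Sum>j<n. a j * w j k) = 0" by blast
  have mem: "lin_comb n a b \<in> V" using lin_comb_mem[OF V(2)] b by blast
  have nn: "\<not> null_triple (Y_surface c) (lin_comb n a b)" using li a(1) unfolding lin_indep_def by auto
  have "face_radial c (lin_comb n a b) 1 (- Y_shift 1) = 0"
   using face_radial_lin_comb[OF V, of n b "- Y_shift 1" 1 a] b a(2)[of 0] Y_shift_signs by (simp add: w_def)
  moreover have "face_radial c (lin_comb n a b) 3 0 = 0"
   using face_radial_lin_comb[OF V, of n b 0 3 a] b a(2)[of 1] by (simp add: w_def)
  ultimately have "0 \<le> index_form (Y_surface c) (lin_comb n a b) (lin_comb n a b)"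
   using mem V(1) by (intro index_form_nonneg) auto
  with neg mem nn show False by fastforce
 qed
 then show "enat n \<le> 2" by (simp add: numeral_eq_enat)
qed

end

section \<open>Test fields for the lower bound of the index\<close>

lemma integrable_lM_fst:
 assumes "integrable lT (w :: real => real)"
 shows "integrable lM (\<lambda>p. w (fst p))" "(LINT p|lM. w (fst p)) = 2 * pi * (LINT t|lT. w t)"
 using integrable_lM_mult[OF assms, of "\<lambda>_. 1"] measure_lC by simp_all

definition const_mode :: "real^3" where "const_mode = vector [1, 0, 0]"

lemma fourier_const: "fourier const_mode y = 1" "fourier' const_mode y = 0" "const_mode $ 2 = 0 \<and> const_mode $ 3 = 0"
 by (simp_all add: fourier_def fourier'_def const_mode_def)

text \<open>The cutoffs \<open>\<eta>\<close> have Dirichlet energy of order \<open>\<epsilon>\<close>, while the potential term tends to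
 \<open>2 - 2 * tanh T\<close>.\<close>

lemma slow_cutoff:
 obtains \<eta> \<eta>' R where "smooth \<eta>" "\<And>t. (\<eta> has_real_derivative \<eta>' t) (at t)" "continuous_on UNIV \<eta>'" "\<eta> 0 = 1"
  "\<And>t. t > R ==> \<eta> t = 0" "\<And>t. t > R ==> \<eta>' t = 0"
  "\<And>i. (LINT t|lT. (\<eta>' t)^2) - 2 * (LINT t|lT. (sech (t + Y_shift i))^2 * (\<eta> t)^2) - tanh (Y_shift i) < 0"
proof -
 obtain S' where S': "\<And>t. (smooth_step has_real_derivative S' t) (at t)" "continuous_on UNIV S'"
  using C1k_obtain_derivative[OF C1k_step] by blast
 have "bounded (S' ` {0..2})"
  by (rule compact_imp_bounded[OF compact_continuous_image]) (auto intro: continuous_on_subset[OF S'(2)])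
 then obtain B where B: "\<And>t. t \<in> {0..2} ==> \<bar>S' t\<bar> \<le> B" unfolding bounded_iff by (auto simp del: atLeastAtMost_iff)
 \<comment> \<open>The expression bounds the radial energy of the cutoff from above:
   \<open>2 \<epsilon> B^2\<close> for the gradient on an interval of length
   \<open>2 / \<epsilon>\<close>, and the integral of \<open>2 sech^2\<close> over
   \<open>[0, 1 / \<epsilon>]\<close>, where the cutoff is 1, in closed form. Its limit
   \<open>tanh T - 2\<close> is negative for every \<open>T\<close>, so one
   \<open>\<epsilon>\<close> serves all faces.\<close>
 have lim: "((\<lambda>\<epsilon>. 2 * \<epsilon> * B^2 - 2 * tanh (1 / \<epsilon> + T) + tanh T) \<longlongrightarrow> 2 * 0 * B^2 - 2 * 1 + tanh T) (at_right 0)" for T :: real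
 proof -
  have "filterlim (\<lambda>\<epsilon>. 1 / \<epsilon> + T) at_top (at_right (0::real))"
   using filterlim_tendsto_add_at_top[OF tendsto_const[of T] filterlim_inverse_at_top_right]
   by (simp add: inverse_eq_divide add.commute)
  then have "((\<lambda>\<epsilon>. tanh (1 / \<epsilon> + T)) \<longlongrightarrow> 1) (at_right 0)" by (rule filterlim_compose[OF tanh_real_at_top])
  then show ?thesis by (intro tendsto_intros)
 qed
 have neg: "2 * 0 * B^2 - 2 * 1 + tanh T < 0" for T :: real using tanh_real_lt_1[of T] by simp
 have "\<forall>\<^sub>F \<epsilon> in at_right 0. \<forall>i\<in>UNIV. 2 * \<epsilon> * B^2 - 2 * tanh (1 / \<epsilon> + Y_shift i) + tanh (Y_shift i) < 0"
  by (intro eventually_ball_finite ballI order_tendstoD(2)[OF lim neg]) simp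
 then have "\<forall>\<^sub>F \<epsilon> in at_right (0::real). 0 < \<epsilon> \<and> (\<forall>i. 2 * \<epsilon> * B^2 - 2 * tanh (1 / \<epsilon> + Y_shift i) + tanh (Y_shift i) < 0)"
  using eventually_at_right_less[of 0] by eventually_elim auto
 then obtain \<epsilon> :: real where \<epsilon>: "\<epsilon> > 0" "\<And>i. 2 * \<epsilon> * B^2 - 2 * tanh (1 / \<epsilon> + Y_shift i) + tanh (Y_shift i) < 0"
  using eventually_happens'[of "at_right (0::real)"] by auto
 define \<eta> where "\<eta> t = smooth_step ((- \<epsilon>) * t + 2)" for t
 define \<eta>' where "\<eta>' t = - \<epsilon> * S' ((- \<epsilon>) * t + 2)" for t
 have s: "smooth \<eta>" unfolding smooth_def \<eta>_def[abs_def] by (intro allI C1k_step_affine)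
 have d: "(\<eta> has_real_derivative \<eta>' t) (at t)" for t
 proof -
  have "((\<lambda>t. (- \<epsilon>) * t + 2) has_real_derivative - \<epsilon>) (at t)" by (auto intro!: derivative_eq_intros)
  from DERIV_chain2[OF S'(1) this] show ?thesis unfolding \<eta>_def[abs_def] \<eta>'_def by (simp add: mult.commute)
 qed
 have c': "continuous_on UNIV \<eta>'" unfolding \<eta>'_def[abs_def]
  by (intro continuous_intros continuous_on_compose2[OF S'(2)]) auto
 have z: "\<eta> t = 0" if "t > 2 / \<epsilon>" for t
  unfolding \<eta>_def by (rule step_0) (use that \<epsilon>(1) in \<open>simp add: field_simps\<close>)
 have z': "\<eta>' t = 0" if "t > 2 / \<epsilon>" for t by (rule derivative_zero_outside[OF d z that])
 have one: "\<eta> t = 1" if "t \<le> 1 / \<epsilon>" for t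
  unfolding \<eta>_def by (rule step_1) (use that \<epsilon>(1) in \<open>simp add: field_simps\<close>)
 have cs: "continuous_on UNIV (\<lambda>t. (sech (t + T))^2 * (\<eta> t)^2)" for T
  by (intro continuous_intros sech_tanh_continuous(1) smooth_continuous[OF s])
 have grad: "(LINT t|lT. (\<eta>' t)^2) \<le> 2 * \<epsilon> * B^2"
 proof -
  have i: "set_integrable lborel {0..2 / \<epsilon>} (\<lambda>t. (\<eta>' t)^2)"
   by (intro set_integrable_continuous_Icc continuous_on_power continuous_on_subset[OF c']) auto
  have "(LINT t|lT. (\<eta>' t)^2) = (LINT t:{0..2 / \<epsilon>}|lborel. (\<eta>' t)^2)"
   unfolding integral_lT set_lebesgue_integral_def
   by (rule LINT_cong) (use z' in \<open>auto simp: indicator_def\<close>)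
  also have "... \<le> (LINT t:{0..2 / \<epsilon>}|lborel. \<epsilon>^2 * B^2)"
  proof (rule set_integral_mono[OF i])
   show "set_integrable lborel {0..2 / \<epsilon>} (\<lambda>t. \<epsilon>^2 * B^2)" by (rule set_integrable_continuous_Icc) simp
   fix t assume "t \<in> {0..2 / \<epsilon>}"
   then have "(- \<epsilon>) * t + 2 \<in> {0..2}" using \<epsilon>(1) by (auto simp: field_simps)
   then have "(S' ((- \<epsilon>) * t + 2))^2 \<le> B^2" using B by (metis abs_ge_zero power2_abs power_mono)
   then show "(\<eta>' t)^2 \<le> \<epsilon>^2 * B^2" unfolding \<eta>'_def power_mult_distrib power2_minus by (rule mult_left_mono) simp
  qed
  also have "... = 2 / \<epsilon> * (\<epsilon>^2 * B^2)" using \<epsilon>(1) by (simp add: set_lebesgue_integral_def)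
  also have "... = 2 * \<epsilon> * B^2" using \<epsilon>(1) by (simp add: power2_eq_square)
  finally show ?thesis .
 qed
 have pot: "tanh (1 / \<epsilon> + T) - tanh T \<le> (LINT t|lT. (sech (t + T))^2 * (\<eta> t)^2)" for T
 proof -
  have e0: "1 / \<epsilon> \<ge> 0" using \<epsilon>(1) by simp
  have ac: "ac_on 0 (1 / \<epsilon>) (\<lambda>t. tanh (t + T)) (\<lambda>t. (sech (t + T))^2)"
   by (rule ac_on_C1[OF tanh_derivative]) (intro continuous_on_power continuous_on_subset[OF sech_tanh_continuous(1)], simp)
  have "integrable lT (\<lambda>t. (sech (t + T))^2 * (\<eta> t)^2)"
   by (rule integrable_lT_compact[OF cs, of "2 / \<epsilon>"]) (use z in simp)
  then have i: "set_integrable lborel {0..} (\<lambda>t. (sech (t + T))^2 * (\<eta> t)^2)" by (simp add: integrable_lT)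
  have "tanh (1 / \<epsilon> + T) - tanh T = (LINT t:{0..1 / \<epsilon>}|lborel. (sech (t + T))^2)"
   using ac_on_FTC[OF ac e0] by simp
  also have "... = (LINT t:{0..1 / \<epsilon>}|lborel. (sech (t + T))^2 * (\<eta> t)^2)"
   unfolding set_lebesgue_integral_def
   by (rule LINT_cong) (use one in \<open>auto simp: indicator_def\<close>)
  also have "... \<le> (LINT t|lT. (sech (t + T))^2 * (\<eta> t)^2)"
   unfolding integral_lT set_lebesgue_integral_def
  proof (rule integral_mono)
   show "integrable lborel (\<lambda>t. indicator {0..1 / \<epsilon>} t *\<^sub>R ((sech (t + T))^2 * (\<eta> t)^2))"
    using set_integrable_subset[OF i, of "{0..1 / \<epsilon>}"] by (auto simp: set_integrable_def)
   show "integrable lborel (\<lambda>t. indicator {0..} t *\<^sub>R ((sech (t + T))^2 * (\<eta> t)^2))"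
    using i by (simp add: set_integrable_def)
  qed (auto simp: indicator_def)
  finally show ?thesis .
 qed
 have "(LINT t|lT. (\<eta>' t)^2) - 2 * (LINT t|lT. (sech (t + Y_shift i))^2 * (\<eta> t)^2) - tanh (Y_shift i) < 0" for i
  using grad pot[of "Y_shift i"] \<epsilon>(2)[of i] by linarith
 from that[OF s d c' one z z' this] \<epsilon>(1) show thesis by simp
qed

lemma energy_cong:
 assumes d: "h1_data f g h \<tau>"
  and m: "f1 \<in> borel_measurable lM" "g1 \<in> borel_measurable lM" "h1 \<in> borel_measurable lM" "\<tau>1 \<in> borel_measurable lC"
  and e: "AE p in lM. f p = f1 p" "AE p in lM. g p = g1 p" "AE p in lM. h p = h1 p" "AE y in lC. \<tau> y = \<tau>1 y"
 shows "energy T f g h \<tau> = energy T f1 g1 h1 \<tau>1"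
proof -
 note F = h1_facts[OF d]
 note [measurable] = F(4,5,7,9) m sech_tanh_measurable(1)[of T]
 have q: "AE p in lM. (g p)^2 = (g1 p)^2" "AE p in lM. (h p)^2 = (h1 p)^2"
  "AE p in lM. (sech (fst p + T))^2 * (f p)^2 = (sech (fst p + T))^2 * (f1 p)^2"
  "AE y in lC. (\<tau> y)^2 = (\<tau>1 y)^2"
  by (rule eventually_mono[OF e(2)] eventually_mono[OF e(3)] eventually_mono[OF e(1)] eventually_mono[OF e(4)], simp)+
 have "(LINT p|lM. (g p)^2) = (LINT p|lM. (g1 p)^2)" "(LINT p|lM. (h p)^2) = (LINT p|lM. (h1 p)^2)"
  "(LINT p|lM. (sech (fst p + T))^2 * (f p)^2) = (LINT p|lM. (sech (fst p + T))^2 * (f1 p)^2)"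
  "(LINT y|lC. (\<tau> y)^2) = (LINT y|lC. (\<tau>1 y)^2)"
  by (rule integral_cong_AE[OF _ _ q(1)] integral_cong_AE[OF _ _ q(2)] integral_cong_AE[OF _ _ q(3)] integral_cong_AE[OF _ _ q(4)]; measurable)+
 then show ?thesis unfolding energy_def by simp
qed

context
 fixes c :: real assumes c: "c > 0"
begin

text \<open>With the same cutoff on all faces the form is diagonal in the coefficients
  \<open>x\<close>, with three negative entries; the junction condition cuts out the plane of
  coefficient sum zero.\<close>

lemma morse_index_lower: "2 \<le> morse_index (Y_surface c)"
proof -
 obtain \<eta> \<eta>' R where \<eta>: "smooth \<eta>" "\<And>t. (\<eta> has_real_derivative \<eta>' t) (at t)" "continuous_on UNIV \<eta>'" "\<eta> 0 = 1"
  "\<And>t. t > R ==> \<eta> t = 0" "\<And>t. t > R ==> \<eta>' t = 0"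
  and neg: "\<And>i. (LINT t|lT. (\<eta>' t)^2) - 2 * (LINT t|lT. (sech (t + Y_shift i))^2 * (\<eta> t)^2) - tanh (Y_shift i) < 0"
  using slow_cutoff by blast
 define \<phi> where "\<phi> x = prod_triple c (\<lambda>i t. x i * \<eta> t) (\<lambda>_. const_mode)" for x :: "3 => real"
 define V where "V = {\<phi> x | x. (\<Sum>i\<in>UNIV. x i) = 0}"
 have sm: "smooth (\<lambda>t. r * \<eta> t)" for r using \<eta>(1) unfolding smooth_def by (auto intro: C1k_cmult)
 have d: "((\<lambda>t. r * \<eta> t) has_real_derivative r * \<eta>' t) (at t)" for r t by (rule DERIV_cmult[OF \<eta>(2)])
 have c': "continuous_on UNIV (\<lambda>t. r * \<eta>' t)" for r by (intro continuous_intros \<eta>(3))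
 have c\<eta>: "continuous_on UNIV \<eta>" by (rule smooth_continuous[OF \<eta>(1)])
 have val: "\<phi> x i (Y_surface c i p) = x i * \<eta> (fst p)" for x i p
  unfolding \<phi>_def prod_triple_def prodf_Y'[OF c] fourier_const by simp
 have mem: "\<phi> x \<in> cpt_variations (Y_surface c)" if "(\<Sum>i\<in>UNIV. x i) = 0" for x
  unfolding \<phi>_def by (rule prod_triple_compact(2)[OF c sm]) (use \<eta>(4,5) that in \<open>auto simp: fourier_const\<close>)
 have lin: "(\<lambda>i y. \<phi> x i y + \<phi> x' i y) = \<phi> (\<lambda>i. x i + x' i)" "(\<lambda>i y. r * \<phi> x i y) = \<phi> (\<lambda>i. r * x i)" "(\<lambda>i y. 0) = \<phi> (\<lambda>i. 0)" for x x' r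
  unfolding \<phi>_def prod_triple_def prodf_def Let_def by (auto simp: fun_eq_iff const_mode_def distrib_right)
 have sub: "linear_subspace V"
  unfolding linear_subspace_def
 proof (intro conjI ballI allI)
  show "(\<lambda>i x. 0) \<in> V" unfolding lin(3) V_def by (intro CollectI exI[of _ "\<lambda>i. 0"]) simp
 next
  fix a b assume "a \<in> V" "b \<in> V"
  then obtain x x' where "a = \<phi> x" "b = \<phi> x'" "(\<Sum>i\<in>UNIV. x i) = 0" "(\<Sum>i\<in>UNIV. x' i) = 0" unfolding V_def by blast
  then show "(\<lambda>i y. a i y + b i y) \<in> V" unfolding V_def
   by (intro CollectI exI[of _ "\<lambda>i. x i + x' i"]) (simp add: lin(1) sum.distrib)
 next
  fix r a assume "a \<in> V"
  then obtain x where "a = \<phi> x" "(\<Sum>i\<in>UNIV. x i) = 0" unfolding V_def by blast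
  then show "(\<lambda>i y. r * a i y) \<in> V" unfolding V_def
   by (intro CollectI exI[of _ "\<lambda>i. r * x i"]) (simp add: lin(2) sum_distrib_left[symmetric])
 qed
 have E: "face_energy c (\<phi> x) i = 2 * pi * (x i)^2 * ((LINT t|lT. (\<eta>' t)^2) - 2 * (LINT t|lT. (sech (t + Y_shift i))^2 * (\<eta> t)^2) - tanh (Y_shift i))"
  if "(\<Sum>i\<in>UNIV. x i) = 0" for x i
 proof -
  have Px: "\<phi> x i = prodf c i (\<lambda>t. x i * \<eta> t) const_mode" unfolding \<phi>_def prod_triple_def ..
  note P = prodf_facts[OF c sm[of "x i"] d[of "x i"] c'[of "x i"], where i = i and v = const_mode, folded Px, unfolded fourier_const mult_1_right mult_zero_right]
  have "face_energy c (\<phi> x) i = energy (Y_shift i) (\<lambda>p. x i * \<eta> (fst p)) (\<lambda>p. x i * \<eta>' (fst p)) (\<lambda>p. 0) (\<lambda>s. x i * \<eta> 0)"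
  proof (rule energy_cong[OF finite_energy_data[OF c finite_energyI(1)[OF mem[OF that]]] _ _ _ _ _ P(2) P(3) P(5)])
   show "AE p in lM. \<phi> x i (Y_surface c i p) = x i * \<eta> (fst p)" by (simp add: val)
  qed (auto intro!: borel_measurable_lM_cont continuous_intros continuous_on_fst_snd c\<eta> \<eta>(3))
  also have "... = 2 * pi * (x i)^2 * ((LINT t|lT. (\<eta>' t)^2) - 2 * (LINT t|lT. (sech (t + Y_shift i))^2 * (\<eta> t)^2) - tanh (Y_shift i))"
  proof -
   have i: "integrable lT (\<lambda>t. (\<eta>' t)^2)" "integrable lT (\<lambda>t. (sech (t + Y_shift i))^2 * (\<eta> t)^2)"
    by (rule integrable_lT_compact[of _ R]; use \<eta>(5,6) in \<open>auto intro!: continuous_intros c\<eta> \<eta>(3) sech_tanh_continuous\<close>)+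
   have e: "(sech (fst p + Y_shift i))^2 * (x i * \<eta> (fst p))^2 = (x i)^2 * ((sech (fst p + Y_shift i))^2 * (\<eta> (fst p))^2)" for p :: "real \<times> real"
    by (simp add: power_mult_distrib)
   have "(LINT p|lM. (x i * \<eta>' (fst p))^2) = (x i)^2 * (2 * pi * (LINT t|lT. (\<eta>' t)^2))"
    unfolding power_mult_distrib integral_mult_right_zero integrable_lM_fst(2)[OF i(1)] ..
   moreover have "(LINT p|lM. (sech (fst p + Y_shift i))^2 * (x i * \<eta> (fst p))^2) = (x i)^2 * (2 * pi * (LINT t|lT. (sech (t + Y_shift i))^2 * (\<eta> t)^2))"
    unfolding e integral_mult_right_zero integrable_lM_fst(2)[OF i(2)] ..
   moreover have "(LINT s|lC. (x i * \<eta> 0)^2) = (x i)^2 * (2 * pi)" using measure_lC \<eta>(4) by simp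
   moreover have "(LINT p|lM. (0::real)^2) = 0" by simp
   ultimately show ?thesis unfolding energy_def by algebra
  qed
  finally show ?thesis .
 qed
 have negV: "\<forall>a\<in>V. \<not> null_triple (Y_surface c) a \<longrightarrow> index_form (Y_surface c) a a < 0"
 proof (intro ballI impI)
  fix a assume a: "a \<in> V" "\<not> null_triple (Y_surface c) a"
  then obtain x where x: "a = \<phi> x" "(\<Sum>i\<in>UNIV. x i) = 0" unfolding V_def by blast
  have le: "face_energy c (\<phi> x) i \<le> 0" for i
   unfolding E[OF x(2)] using neg[of i] by (intro mult_nonneg_nonpos) auto
  obtain j where "x j \<noteq> 0"
  proof (rule ccontr)
   assume "\<not> thesis"
   then have "x i = 0" for i using that by blast
   then have "null_triple (Y_surface c) (\<phi> x)" unfolding null_triple_def AE_area[OF c] val by simp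
   then show False using a(2) x(1) by simp
  qed
  then have "face_energy c (\<phi> x) j < 0" unfolding E[OF x(2)] using neg[of j] by (intro mult_pos_neg) auto
  moreover have "(\<Sum>i\<in>UNIV. face_energy c (\<phi> x) i) = face_energy c (\<phi> x) j + (\<Sum>i\<in>UNIV - {j}. face_energy c (\<phi> x) i)"
   by (rule sum.remove) auto
  moreover have "(\<Sum>i\<in>UNIV - {j}. face_energy c (\<phi> x) i) \<le> 0" by (rule sum_nonpos[OF le])
  ultimately have "(\<Sum>i\<in>UNIV. face_energy c (\<phi> x) i) < 0" by linarith
  then show "index_form (Y_surface c) a a < 0"
   unfolding x(1) index_form_energy[OF c finite_energyI(1)[OF mem[OF x(2)]]] by simp
 qed
 \<comment> \<open>The coefficient vectors \<open>(1, 0, -1)\<close> and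
   \<open>(0, 1, -1)\<close>.\<close>
 define b where "b j = \<phi> (\<lambda>i. if i = 3 then -1 else if j = 0 \<and> i = 1 \<or> j = 1 \<and> i = 2 then 1 else 0)" for j :: nat
 have bV: "b j \<in> V" if "j < 2" for j
  unfolding V_def b_def using that by (intro CollectI exI conjI refl) (auto simp: sum_3 less_2_cases_iff)
 have "lin_indep (Y_surface c) 2 b"
  unfolding lin_indep_def
 proof (intro allI impI)
  fix a j assume n: "null_triple (Y_surface c) (lin_comb 2 a b)" and j: "j < (2::nat)"
  have ev: "lin_comb 2 a b i (Y_surface c i p) = (a 0 * (if i = 3 then -1 else if i = 1 then 1 else 0) + a 1 * (if i = 3 then -1 else if i = 2 then 1 else 0)) * \<eta> (fst p)" for i p
   unfolding lin_comb_def b_def val by (simp add: numeral_2_eq_2 algebra_simps)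
  have z: "k = 0" if e: "AE p in lM. k * \<eta> (fst p) = 0" for k
  proof -
   have "continuous_on {0..R} (\<lambda>t. k * \<eta> t)" for R by (intro continuous_intros continuous_on_subset[OF c\<eta>]) auto
   from continuous_AE_zero[OF this AE_lM_fstD[OF e] order_refl] show "k = 0" using \<eta>(4) by simp
  qed
  have "a 0 = 0" using n[unfolded null_triple_def AE_area[OF c] ev, rule_format, of 1] by (intro z) simp
  moreover have "a 1 = 0" using n[unfolded null_triple_def AE_area[OF c] ev, rule_format, of 2] by (intro z) simp
  ultimately show "a j = 0" using j by (auto simp: less_2_cases_iff)
 qed
 then have "2 \<le> triple_dim (Y_surface c) V"
  unfolding triple_dim_def by (intro Sup_upper CollectI exI[of _ 2] conjI) (use bV in \<open>auto simp: numeral_eq_enat\<close>)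
 also have "... \<le> morse_index (Y_surface c)"
  unfolding morse_index_def by (intro Sup_upper CollectI exI[of _ V] conjI sub negV) (use mem in \<open>auto simp: V_def\<close>)
 finally show ?thesis .
qed

end

section \<open>The nullity\<close>

text \<open>\<open>1 + t \<le> 2 exp (t/2)\<close> and \<open>(1 + t)^2 \<le> 8 exp (t/2)\<close>
  combine to \<open>(1 + t)^3 \<le> 16 exp t\<close>; the remaining factor 2 comes from
  \<open>sech s \<le> 2 exp (- s)\<close>.\<close>

lemma sech_exp_bound: "t \<ge> 0 ==> (1 + t) * sech (t + T) \<le> 32 * exp (- T) * (1 / (1 + t)^2)"
proof -
 assume t: "t \<ge> 0"
 have "exp (t + T) \<le> 2 * cosh (t + T)" by (simp add: cosh_def)
 then have "sech (t + T) \<le> 2 / exp (t + T)" using cosh_real_pos[of "t + T"] by (simp add: sech_def field_simps)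
 also have "... = 2 * exp (- T) / exp t" by (simp add: exp_add exp_minus field_simps)
 finally have 1: "sech (t + T) \<le> 2 * exp (- T) / exp t" .
 have q: "1 + t / 2 + (t / 2)^2 / 2 \<le> exp (t / 2)" by (rule exp_lower_Taylor_quadratic) (use t in simp)
 have t2: "0 \<le> t^2" by simp
 have "(1 + t)^2 \<le> 8 * exp (t / 2)" using q t t2 by (simp add: power2_eq_square field_simps)
 moreover have "1 + t \<le> 2 * exp (t / 2)" using exp_ge_add_one_self[of "t / 2"] t by linarith
 ultimately have "(1 + t) * (1 + t)^2 \<le> (2 * exp (t / 2)) * (8 * exp (t / 2))" by (intro mult_mono) (use t in auto)
 also have "... = 16 * exp t" by (simp add: mult_exp_exp)
 finally have "(1 + t) / exp t \<le> 16 / (1 + t)^2" using t by (simp add: field_simps)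
 then have "2 * exp (- T) * ((1 + t) / exp t) \<le> 2 * exp (- T) * (16 / (1 + t)^2)" by (rule mult_left_mono) simp
 moreover have "(1 + t) * sech (t + T) \<le> (1 + t) * (2 * exp (- T) / exp t)" using 1 t by (intro mult_left_mono) auto
 moreover have "(1 + t) * (2 * exp (- T) / exp t) = 2 * exp (- T) * ((1 + t) / exp t)"
  "2 * exp (- T) * (16 / (1 + t)^2) = 32 * exp (- T) * (1 / (1 + t)^2)" by simp_all
 ultimately show ?thesis by linarith
qed

lemma integrable_sech_growth:
 assumes u: "u \<in> borel_measurable lT" "\<And>t. t \<ge> 0 ==> \<bar>u t\<bar> \<le> C * (1 + t)" "C \<ge> 0"
 shows "integrable lT (\<lambda>t. u t * sech (t + T))"
proof (rule L1_bound[OF integrable_mult_right[of "C * (32 * exp (- T))", OF integrable_inverse_square]])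
 have "(\<lambda>t. sech (t + T)) \<in> borel_measurable lT"
  using borel_measurable_continuous_onI[OF sech_tanh_continuous(1)] by (simp add: measurable_restrict_space1 measurable_lborel1)
 then show "(\<lambda>t. u t * sech (t + T)) \<in> borel_measurable lT" using u(1) by measurable
 show "AE t in lT. norm (u t * sech (t + T)) \<le> norm (C * (32 * exp (- T)) * (1 / (1 + t)^2))"
 proof (rule AE_I2)
  fix t assume "t \<in> space lT"
  then have t: "t \<ge> 0" by (simp add: space_restrict_space)
  have s: "sech (t + T) > 0" by (rule sech_bounds)
  have "norm (u t * sech (t + T)) = \<bar>u t\<bar> * sech (t + T)" using s by (simp add: abs_mult)
  also have "... \<le> C * (1 + t) * sech (t + T)" using u(2)[OF t] s by (intro mult_right_mono) auto
  also have "... = C * ((1 + t) * sech (t + T))" by simp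
  also have "... \<le> C * (32 * exp (- T) * (1 / (1 + t)^2))" by (rule mult_left_mono[OF sech_exp_bound[OF t] u(3)])
  also have "... \<le> norm (C * (32 * exp (- T)) * (1 / (1 + t)^2))" unfolding real_norm_def mult.assoc by (rule abs_ge_self)
  finally show "norm (u t * sech (t + T)) \<le> norm (C * (32 * exp (- T)) * (1 / (1 + t)^2))" .
 qed
qed

lemma lT_continuous_measurable: "continuous_on UNIV w ==> w \<in> borel_measurable lT" for w :: "real => real"
 using borel_measurable_continuous_onI[of w] by (simp add: measurable_restrict_space1 measurable_lborel1)

lemma lC_continuous_measurable: "continuous_on UNIV w ==> w \<in> borel_measurable lC" for w :: "real => real"
 using borel_measurable_continuous_onI[of w] by (simp add: measurable_restrict_space1 measurable_lborel1)

lemma sech_powers_integrable: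
 "integrable lT (\<lambda>t. (sech (t + T))^2)" "integrable lT (\<lambda>t. ((sech (t + T))^2)^2)" "integrable lT (\<lambda>t. (- sech (t + T) * tanh (t + T))^2)"
proof -
 show "integrable lT (\<lambda>t. (sech (t + T))^2)" using integrable_sech_sq_growth[of "\<lambda>_. 1" 1 T] by simp
 have s: "(sech (x::real))^2 \<le> 1" "(tanh x)^2 \<le> 1" for x
 proof -
  show "(sech x)^2 \<le> 1" using sech_bounds[of x] by (intro power_le_one) auto
  show "(tanh x)^2 \<le> 1" unfolding tanh_sech by simp
 qed
 have "integrable lT (\<lambda>t. (sech (t + T))^2 * (sech (t + T))^2)"
  by (rule integrable_sech_sq_growth[of _ 1]) (use s order_trans in \<open>auto intro!: lT_continuous_measurable sech_tanh_continuous intro: order_trans[OF s(1)]\<close>)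
 then show "integrable lT (\<lambda>t. ((sech (t + T))^2)^2)" by (simp add: power2_eq_square[of "(sech _)^2"])
 have "integrable lT (\<lambda>t. (sech (t + T))^2 * (tanh (t + T))^2)"
  by (rule integrable_sech_sq_growth[of _ 1]) (auto intro!: lT_continuous_measurable sech_tanh_continuous intro: order_trans[OF s(2)])
 then show "integrable lT (\<lambda>t. (- sech (t + T) * tanh (t + T))^2)" by (simp add: power_mult_distrib)
qed

lemma fourier_bounded: "\<bar>fourier v y\<bar> \<le> \<bar>v $ 1\<bar> + \<bar>v $ 2\<bar> + \<bar>v $ 3\<bar>" "\<bar>fourier' v y\<bar> \<le> \<bar>v $ 2\<bar> + \<bar>v $ 3\<bar>"
proof -
 have 1: "\<bar>x * sin y\<bar> \<le> \<bar>x\<bar>" "\<bar>x * cos y\<bar> \<le> \<bar>x\<bar>" for x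
  unfolding abs_mult by (rule mult_left_le; simp)+
 show "\<bar>fourier v y\<bar> \<le> \<bar>v $ 1\<bar> + \<bar>v $ 2\<bar> + \<bar>v $ 3\<bar>" "\<bar>fourier' v y\<bar> \<le> \<bar>v $ 2\<bar> + \<bar>v $ 3\<bar>"
  using 1[of "v $ 2"] 1[of "v $ 3"] unfolding fourier_def fourier'_def by linarith+
qed

lemma fourier_measurable: "(\<lambda>p. fourier v (snd p)) \<in> borel_measurable lM" "(\<lambda>p. fourier' v (snd p)) \<in> borel_measurable lM"
 by (intro borel_measurable_lM_cont continuous_on_fst_snd fourier'_continuous)+

context
 fixes f g h \<tau> assumes d: "h1_data f g h \<tau>"
begin

text \<open>The fluctuation of \<open>f\<close> is square integrable and pairs with the square
  integrable \<open>sech\<close>; the radial part, of at most linear growth, is beaten by the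
  exponential decay.\<close>

lemma f_sech_integrable: "integrable lM (\<lambda>p. f p * sech (fst p + T))"
proof -
 note d0 = h1_data_mean_zero[OF d]
 have f0: "integrable lM (\<lambda>p. (f p - radial \<tau> g (fst p))^2)"
  by (rule h1_wirtinger(2)[OF d0(1)]) (use d0(2) in simp)
 have 1: "integrable lM (\<lambda>p. (f p - radial \<tau> g (fst p)) * sech (fst p + T))"
  by (intro L2_product_integrable h1_facts(4)[OF d0(1)] sech_tanh_measurable f0 integrable_lM_fst(1)[OF sech_powers_integrable(1)])
 define C where "C = 1 + (2 * (trace_mean \<tau>)^2 + 2 * (LINT t|lT. (circ_mean g t)^2))"
 have C: "C \<ge> 1" unfolding C_def by (simp add: LINT_nonneg_sq)
 have "\<bar>radial \<tau> g t\<bar> \<le> C * (1 + t)" if t: "t \<ge> 0" for t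
 proof -
  have "0 \<le> (\<bar>radial \<tau> g t\<bar> - 1 / 2)^2" by simp
  then have "\<bar>radial \<tau> g t\<bar> \<le> 1 + (radial \<tau> g t)^2" by (simp add: power2_diff power_divide)
  also have "... \<le> 1 * (1 + t) + (C - 1) * (1 + t)" using radial_growth[OF d t] t unfolding C_def by (intro add_mono) auto
  finally show ?thesis by (simp add: algebra_simps)
 qed
 then have "integrable lT (\<lambda>t. radial \<tau> g t * sech (t + T))"
  by (intro integrable_sech_growth[OF radial_measurable[OF d]]) (use C in auto)
 from L1_add[OF 1 integrable_lM_fst(1)[OF this]]
 show ?thesis by (simp add: left_diff_distrib)
qed

text \<open>Line by line this is \<open>half_line_FTC\<close>. The tests are not compactly
  supported, so the integrability of the three products is supplied by the caller.\<close>

lemma integral_by_parts_t: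
 assumes b: "\<And>t. (b has_real_derivative b' t) (at t)" "continuous_on UNIV b'"
  and k: "k \<in> borel_measurable lC"
  and i: "integrable lM (\<lambda>p. g p * (b (fst p) * k (snd p)))" "integrable lM (\<lambda>p. f p * (b' (fst p) * k (snd p)))"
   "integrable lM (\<lambda>p. f p * (b (fst p) * k (snd p)))"
 shows "(LINT p|lM. g p * (b (fst p) * k (snd p)) + f p * (b' (fst p) * k (snd p))) = - b 0 * (LINT y|lC. \<tau> y * k y)"
proof -
 have ii: "integrable lM (\<lambda>p. g p * (b (fst p) * k (snd p)) + f p * (b' (fst p) * k (snd p)))"
  by (rule L1_add[OF i(1,2)])
 have "AE y in lC. (LINT t|lT. g (t, y) * (b t * k y) + f (t, y) * (b' t * k y)) = - b 0 * (\<tau> y * k y)"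
  using h1_slice_t[OF d] slice_integrable(2)[OF i(1)] slice_integrable(2)[OF i(2)] slice_integrable(2)[OF i(3)]
 proof eventually_elim
  case (elim y)
  let ?r = "\<lambda>t. rep \<tau> g (t, y)"
  have e: "AE t in lT. f (t, y) = ?r t" and ac: "\<And>R. ac_on 0 R ?r (\<lambda>t. g (t, y))"
   and m: "?r \<in> borel_measurable lT" "(\<lambda>t. g (t, y)) \<in> borel_measurable lT" using elim(1) by auto
  have cb: "continuous_on UNIV b" using b(1) by (meson DERIV_isCont continuous_at_imp_continuous_on)
  note mb = lT_continuous_measurable[OF b(2)] lT_continuous_measurable[OF cb]
  have acb: "ac_on 0 R (\<lambda>t. b t * k y) (\<lambda>t. b' t * k y)" for R
   by (rule ac_on_C1) (auto intro!: DERIV_cmult_right b(1) continuous_intros continuous_on_subset[OF b(2)])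
  have i1: "integrable lT (\<lambda>t. ?r t * (b t * k y))"
   using elim(4) by (rule integrable_cong_AE[THEN iffD1, rotated -1])
    (use e m mb elim(4) in \<open>auto dest: borel_measurable_integrable elim!: eventually_mono\<close>)
  have i2: "integrable lT (\<lambda>t. ?r t * (b' t * k y))"
   using elim(3) by (rule integrable_cong_AE[THEN iffD1, rotated -1])
    (use e m mb elim(3) in \<open>auto dest: borel_measurable_integrable elim!: eventually_mono\<close>)
  have i3: "integrable lT (\<lambda>t. g (t, y) * (b t * k y))" using elim(2) by simp
  have "(LINT t|lT. g (t, y) * (b t * k y) + f (t, y) * (b' t * k y)) = (LINT t|lT. g (t, y) * (b t * k y) + ?r t * (b' t * k y))"
  proof (rule integral_cong_AE)
   show "AE t in lT. g (t, y) * (b t * k y) + f (t, y) * (b' t * k y) = g (t, y) * (b t * k y) + ?r t * (b' t * k y)"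
    using e by eventually_elim simp
  qed (use borel_measurable_integrable[OF i3] borel_measurable_integrable[OF i2] borel_measurable_integrable[OF elim(3)] in auto)
  also have "... = - (?r 0 * (b 0 * k y))"
   by (rule half_line_FTC[OF ac_on_mult[OF ac acb] i1 L1_add[OF i3 i2]])
  finally show ?case by (simp add: rep_0)
 qed
 then have "(LINT y|lC. LINT t|lT. g (t, y) * (b t * k y) + f (t, y) * (b' t * k y)) = (LINT y|lC. - b 0 * (\<tau> y * k y))"
  using borel_measurable_integrable[OF slice_integrable(5)[OF ii]] k h1_facts(9)[OF d] by (intro integral_cong_AE) auto
 then show ?thesis using slice_integrable(6)[OF ii] by (simp only: fst_conv snd_conv integral_mult_right_zero)
qed

text \<open>\<open>v $ 1 = 0\<close> makes \<open>- fourier v\<close> the derivative of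
  \<open>fourier' v\<close>, and periodicity leaves no boundary terms on the circle.\<close>

lemma integral_by_parts_c:
 assumes v: "v $ 1 = 0"
  and i: "integrable lM (\<lambda>p. h p * (b (fst p) * fourier' v (snd p)))" "integrable lM (\<lambda>p. f p * (b (fst p) * fourier v (snd p)))"
 shows "(LINT p|lM. h p * (b (fst p) * fourier' v (snd p))) = (LINT p|lM. f p * (b (fst p) * fourier v (snd p)))"
proof -
 have d': "(fourier' v has_real_derivative - fourier v y) (at y)" for y
  unfolding fourier'_def[abs_def] fourier_def using v by (auto intro!: derivative_eq_intros)
 have "AE t in lT. (LINT y|lC. h (t, y) * (b t * fourier' v y)) = (LINT y|lC. f (t, y) * (b t * fourier v y))"
  using h1_slice_c[OF d] slice_integrable(1)[OF i(1)] slice_integrable(1)[OF i(2)]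
 proof eventually_elim
  case (elim t)
  then obtain w where w: "ac_on 0 (2*pi) w (\<lambda>y. h (t, y))" "w 0 = w (2*pi)" "AE y in lC. f (t, y) = w y" by blast
  have ack: "ac_on 0 (2*pi) (fourier' v) (\<lambda>y. - fourier v y)"
   by (rule ac_on_C1[OF d']) (intro continuous_intros continuous_on_subset[OF fourier'_continuous(2)], simp)
  have iw: "integrable lC (\<lambda>y. w y * fourier v y)" unfolding integrable_lC
   by (intro set_integrable_continuous_Icc continuous_on_mult ac_on_continuous[OF w(1)] continuous_on_subset[OF fourier'_continuous(2)]) simp
  have ih: "integrable lC (\<lambda>y. h (t, y) * fourier' v y)" unfolding integrable_lC
   using set_integrable_mult_continuous[OF ac_on_integrable[OF w(1)] ac_on_continuous[OF ack]] by simp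
  have "(LINT y|lC. h (t, y) * fourier' v y + w y * - fourier v y) = w (2*pi) * fourier' v (2*pi) - w 0 * fourier' v 0"
   unfolding integral_lC by (rule ac_on_FTC[OF ac_on_mult[OF w(1) ack]]) simp
  then have "(LINT y|lC. h (t, y) * fourier' v y) = (LINT y|lC. w y * fourier v y)"
   using iw ih w(2) by (simp add: fourier'_def)
  also have "b t * ... = (LINT y|lC. f (t, y) * (b t * fourier v y))"
  proof -
   have "b t * (LINT y|lC. w y * fourier v y) = (LINT y|lC. b t * (w y * fourier v y))" by simp
   also have "... = (LINT y|lC. f (t, y) * (b t * fourier v y))"
   proof (rule integral_cong_AE)
    show "(\<lambda>y. b t * (w y * fourier v y)) \<in> borel_measurable lC" using borel_measurable_integrable[OF iw] by simp
    show "(\<lambda>y. f (t, y) * (b t * fourier v y)) \<in> borel_measurable lC" using borel_measurable_integrable[OF elim(3)] by simp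
    show "AE y in lC. b t * (w y * fourier v y) = f (t, y) * (b t * fourier v y)" using w(3) by eventually_elim simp
   qed
   finally show ?thesis .
  qed
  finally have "b t * (LINT y|lC. h (t, y) * fourier' v y) = (LINT y|lC. f (t, y) * (b t * fourier v y))" .
  moreover have "b t * (LINT y|lC. h (t, y) * fourier' v y) = (LINT y|lC. h (t, y) * (b t * fourier' v y))"
   unfolding integral_mult_right_zero[symmetric] by (simp add: mult_ac)
  ultimately show ?case by simp
 qed
 then have "(LINT t|lT. LINT y|lC. h (t, y) * (b t * fourier' v y)) = (LINT t|lT. LINT y|lC. f (t, y) * (b t * fourier v y))"
  using borel_measurable_integrable[OF slice_integrable(3)[OF i(1)]] borel_measurable_integrable[OF slice_integrable(3)[OF i(2)]]
  by (intro integral_cong_AE) auto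
 then show ?thesis using slice_integrable(4)[OF i(1)] slice_integrable(4)[OF i(2)] by (simp only: fst_conv snd_conv)
qed

text \<open>\<open>tanh s\<close> solves the radial equation, so integration by parts leaves only
  edge terms, with coefficient \<open>sech^2 T + tanh^2 T = 1\<close>. The outcome no longer
  involves \<open>T\<close>, so the junction condition makes the sum over the faces vanish.\<close>

lemma energy_form_tanh:
 "energy_form T f g h \<tau> (\<lambda>p. tanh (fst p + T) * fourier const_mode (snd p)) (\<lambda>p. (sech (fst p + T))^2 * fourier const_mode (snd p))
   (\<lambda>p. tanh (fst p + T) * fourier' const_mode (snd p)) (\<lambda>y. tanh (0 + T) * fourier const_mode y) = - (LINT y|lC. \<tau> y)"
proof -
 note F = h1_facts[OF d]
 have b: "((\<lambda>t. (sech (t + T))^2) has_real_derivative - 2 * (sech (t + T))^2 * tanh (t + T)) (at t)" for t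
  using jac_derivatives(2)[of T t] by (simp add: jac_p'_def[abs_def] jac_p_def)
 have c: "continuous_on UNIV (\<lambda>t. - 2 * (sech (t + T))^2 * tanh (t + T))" by (intro continuous_intros sech_tanh_continuous)
 have tb: "\<bar>tanh (x::real)\<bar> \<le> 1" "\<bar>sech x\<bar> \<le> 1" for x using tanh_real_bounds[of x] sech_bounds[of x] by (auto simp: abs_le_iff)
 have i1: "integrable lM (\<lambda>p. g p * (sech (fst p + T))^2)"
  by (intro L2_product_integrable F(5,6) borel_measurable_power sech_tanh_measurable integrable_lM_fst(1)[OF sech_powers_integrable(2)])
 have i3: "integrable lM (\<lambda>p. f p * (sech (fst p + T))^2)"
  using integrable_mult_bounded[OF f_sech_integrable[of T] sech_tanh_measurable(1)[of T] tb(2)] by (simp add: power2_eq_square mult_ac)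
 have i2: "integrable lM (\<lambda>p. f p * (- 2 * (sech (fst p + T))^2 * tanh (fst p + T)))"
  using integrable_mult_right[OF integrable_mult_bounded[OF i3 sech_tanh_measurable(2)[of T] tb(1)], of "-2"] by (simp add: mult_ac)
 have E: "(LINT p|lM. g p * (sech (fst p + T))^2 + f p * (- 2 * (sech (fst p + T))^2 * tanh (fst p + T))) = - (sech T)\<^sup>2 * (LINT y|lC. \<tau> y)"
  using integral_by_parts_t[OF b c borel_measurable_const[of 1]] i1 i2 i3 by simp
 have e: "g p * (sech (fst p + T))^2 - 2 * (sech (fst p + T))^2 * f p * tanh (fst p + T)
   = g p * (sech (fst p + T))^2 + f p * (- 2 * (sech (fst p + T))^2 * tanh (fst p + T))" for p
  by algebra
 have "energy_form T f g h \<tau> (\<lambda>p. tanh (fst p + T) * fourier const_mode (snd p)) (\<lambda>p. (sech (fst p + T))^2 * fourier const_mode (snd p))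
   (\<lambda>p. tanh (fst p + T) * fourier' const_mode (snd p)) (\<lambda>y. tanh (0 + T) * fourier const_mode y)
   = - (sech T)\<^sup>2 * (LINT y|lC. \<tau> y) - tanh T * ((LINT y|lC. \<tau> y) * tanh T)"
  unfolding energy_form_def fourier_const mult_1_right mult_zero_right add_0_right add_0_left e E integral_mult_left_zero ..
 also have "... = - ((sech T)^2 + (tanh T)^2) * (LINT y|lC. \<tau> y)" by algebra
 finally show ?thesis by (simp add: tanh_sech)
qed

text \<open>\<open>sech s\<close> times a first angular mode solves the Jacobi equation and also the
  natural edge condition of its own face: the edge derivative \<open>- sech T tanh T\<close> cancels
  the term with \<open>tanh T\<close>. The form thus vanishes on each face separately.\<close>

lemma energy_form_sech:
 assumes v: "v $ 1 = 0"
 shows "energy_form T f g h \<tau> (\<lambda>p. sech (fst p + T) * fourier v (snd p)) (\<lambda>p. (- sech (fst p + T) * tanh (fst p + T)) * fourier v (snd p))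
   (\<lambda>p. sech (fst p + T) * fourier' v (snd p)) (\<lambda>y. sech (0 + T) * fourier v y) = 0"
proof -
 note F = h1_facts[OF d]
 \<comment> \<open>\<open>?b\<close> and \<open>?b'\<close> are the first two derivatives of
   \<open>sech (t + T)\<close>, the second one simplified by
   \<open>tanh^2 = 1 - sech^2\<close>.\<close>
 let ?b = "\<lambda>t. - sech (t + T) * tanh (t + T)" and ?b' = "\<lambda>t. sech (t + T) - 2 * (sech (t + T))^2 * sech (t + T)"
 have b: "(?b has_real_derivative ?b' t) (at t)" for t
 proof -
  have "(?b has_real_derivative - (- sech (t + T) * tanh (t + T)) * tanh (t + T) + (sech (t + T))^2 * - sech (t + T)) (at t)"
   by (rule DERIV_mult[OF DERIV_minus[OF sech_derivative] tanh_derivative])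
  then show ?thesis by (rule DERIV_cong) (use tanh_sech[of "t + T"] in algebra)
 qed
 have c: "continuous_on UNIV ?b'" by (intro continuous_intros sech_tanh_continuous)
 have tb: "\<bar>tanh (x::real)\<bar> \<le> 1" "\<bar>sech x\<bar> \<le> 1" for x using tanh_real_bounds[of x] sech_bounds[of x] by (auto simp: abs_le_iff)
 note [measurable] = sech_tanh_measurable[of T] F(4,5,7) fourier_measurable[of v]
 have i0: "integrable lM (\<lambda>p. f p * (sech (fst p + T) * fourier v (snd p)))"
  using integrable_mult_bounded[OF f_sech_integrable[of T] fourier_measurable(1) fourier_bounded(1)] by (simp add: mult_ac)
 have ih: "integrable lM (\<lambda>p. h p * (sech (fst p + T) * fourier' v (snd p)))"
  using integrable_mult_bounded[OF L2_product_integrable[OF F(7) sech_tanh_measurable(1)[of T] F(8) integrable_lM_fst(1)[OF sech_powers_integrable(1)]] fourier_measurable(2) fourier_bounded(2)]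
  by (simp add: mult_ac)
 have ig: "integrable lM (\<lambda>p. g p * (?b (fst p) * fourier v (snd p)))"
  using integrable_mult_bounded[OF L2_product_integrable[OF F(5) _ F(6) integrable_lM_fst(1)[OF sech_powers_integrable(3)[of T]]] fourier_measurable(1) fourier_bounded(1)]
  by (simp add: mult_ac)
 have if1: "integrable lM (\<lambda>p. f p * (?b (fst p) * fourier v (snd p)))"
  using integrable_mult_right[OF integrable_mult_bounded[OF i0 sech_tanh_measurable(2)[of T] tb(1)], of "-1"] by (simp add: mult_ac)
 have s2: "\<bar>1 - 2 * (sech (x::real))^2\<bar> \<le> 1" for x
 proof -
  have "(sech x)^2 \<le> 1" using sech_bounds[of x] by (intro power_le_one) auto
  moreover have "0 \<le> (sech x)^2" by simp
  ultimately show ?thesis by (simp add: abs_le_iff)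
 qed
 have if2: "integrable lM (\<lambda>p. f p * (?b' (fst p) * fourier v (snd p)))"
 proof -
  have "integrable lM (\<lambda>p. (1 - 2 * (sech (fst p + T))^2) * (f p * (sech (fst p + T) * fourier v (snd p))))"
   by (rule integrable_mult_bounded[OF i0 _ s2]) measurable
  moreover have "(1 - 2 * (sech (fst p + T))^2) * (f p * (sech (fst p + T) * fourier v (snd p))) = f p * (?b' (fst p) * fourier v (snd p))" for p
   by algebra
  ultimately show ?thesis by simp
 qed
 have P: "(LINT p|lM. g p * (?b (fst p) * fourier v (snd p))) + (LINT p|lM. f p * (?b' (fst p) * fourier v (snd p)))
   = sech T * tanh T * (LINT y|lC. \<tau> y * fourier v y)"
  using integral_by_parts_t[OF b c _ ig if2 if1] lC_continuous_measurable[OF fourier'_continuous(2)] LINT_add[OF ig if2] by simp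
 have H: "(LINT p|lM. h p * (sech (fst p + T) * fourier' v (snd p))) = (LINT p|lM. f p * (sech (fst p + T) * fourier v (snd p)))"
  by (rule integral_by_parts_c[where b="\<lambda>t. sech (t + T)", OF v ih i0])
 have S: "(LINT p|lM. f p * (?b' (fst p) * fourier v (snd p))) = (LINT p|lM. f p * (sech (fst p + T) * fourier v (snd p)))
   - (LINT p|lM. 2 * (sech (fst p + T))^2 * f p * (sech (fst p + T) * fourier v (snd p)))"
  and i4: "integrable lM (\<lambda>p. 2 * (sech (fst p + T))^2 * f p * (sech (fst p + T) * fourier v (snd p)))"
 proof -
  have e: "2 * (sech (fst p + T))^2 * f p * (sech (fst p + T) * fourier v (snd p))
   = f p * (sech (fst p + T) * fourier v (snd p)) - f p * (?b' (fst p) * fourier v (snd p))" for p by algebra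
  show "integrable lM (\<lambda>p. 2 * (sech (fst p + T))^2 * f p * (sech (fst p + T) * fourier v (snd p)))"
   unfolding e by (rule L1_diff[OF i0 if2])
  show "(LINT p|lM. f p * (?b' (fst p) * fourier v (snd p))) = (LINT p|lM. f p * (sech (fst p + T) * fourier v (snd p)))
   - (LINT p|lM. 2 * (sech (fst p + T))^2 * f p * (sech (fst p + T) * fourier v (snd p)))"
   unfolding e LINT_diff[OF i0 if2] by simp
 qed
 have B: "(LINT y|lC. \<tau> y * (sech (0 + T) * fourier v y)) = sech T * (LINT y|lC. \<tau> y * fourier v y)"
  unfolding integral_mult_right_zero[symmetric] by (simp add: mult_ac)
 show ?thesis unfolding energy_form_def B
   LINT_diff[OF L1_add[OF ig ih] i4] LINT_add[OF ig ih]
  using P H S by algebra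
qed

end

section \<open>Explicit null fields\<close>

lemma prod_triple_Y: "c > 0 ==> prod_triple c a v i (Y_surface c i p) = a i (fst p) * fourier (v i) (snd p)"
 by (simp add: prod_triple_def prodf_Y')

lemma smooth_tanh_sech: "smooth (\<lambda>t. tanh (t + T))" "smooth (\<lambda>t. sech (t + T))"
 unfolding smooth_def by (auto intro: C1k_tanh C1k_sech)

text \<open>The vertical components of the unit normals, that is, the Jacobi field of vertical
  translations.\<close>

definition tanh_triple :: "real => triple" where
 "tanh_triple c = prod_triple c (\<lambda>i t. tanh (t + Y_shift i)) (\<lambda>i. const_mode)"

text \<open>Horizontal translations have this form. They give two of the four dimensions allowed by
  the relations in \<open>sech_triple_null\<close>: six first-mode coefficients subject to two edge
  equations.\<close>

definition sech_triple :: "real => (3 => real^3) => triple" where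
 "sech_triple c v = prod_triple c (\<lambda>i t. sech (t + Y_shift i)) v"

definition null_space :: "real => triple set" where
 "null_space c = {\<phi> \<in> D_space (Y_surface c). \<forall>\<psi>\<in>D_space (Y_surface c). index_form (Y_surface c) \<phi> \<psi> = 0}"

context
 fixes c :: real assumes c: "c > 0"
begin

lemma index_form_prod_triple:
 assumes \<phi>: "finite_energy (Y_surface c) \<phi>" and fe: "finite_energy (Y_surface c) (prod_triple c a v)"
  and a: "\<And>i. smooth (a i)" "\<And>i t. (a i has_real_derivative a' i t) (at t)" "\<And>i. continuous_on UNIV (a' i)"
 shows "index_form (Y_surface c) \<phi> (prod_triple c a v) = (\<Sum>i\<in>UNIV. energy_form (Y_shift i)
   (\<lambda>p. \<phi> i (Y_surface c i p)) (grad_comp 1 (Y_surface c i) (\<phi> i)) (grad_comp 2 (Y_surface c i) (\<phi> i)) (edge_trace (Y_surface c i) (\<phi> i))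
   (\<lambda>p. a i (fst p) * fourier (v i) (snd p)) (\<lambda>p. a' i (fst p) * fourier (v i) (snd p)) (\<lambda>p. a i (fst p) * fourier' (v i) (snd p)) (\<lambda>y. a i 0 * fourier (v i) y))"
 unfolding index_form_energy_form[OF c \<phi> fe]
proof (rule sum.cong[OF refl])
 fix i :: 3
 note P = prodf_facts[OF c a(1)[of i] a(2)[of i] a(3)[of i], of i "v i"]
 have Pi: "prod_triple c a v i = prodf c i (a i) (v i)" by (simp add: prod_triple_def)
 note ca = smooth_continuous[OF a(1)]
 show "energy_form (Y_shift i)
   (\<lambda>p. \<phi> i (Y_surface c i p)) (grad_comp 1 (Y_surface c i) (\<phi> i)) (grad_comp 2 (Y_surface c i) (\<phi> i)) (edge_trace (Y_surface c i) (\<phi> i))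
   (\<lambda>p. prod_triple c a v i (Y_surface c i p)) (grad_comp 1 (Y_surface c i) (prod_triple c a v i)) (grad_comp 2 (Y_surface c i) (prod_triple c a v i)) (edge_trace (Y_surface c i) (prod_triple c a v i))
  = energy_form (Y_shift i)
   (\<lambda>p. \<phi> i (Y_surface c i p)) (grad_comp 1 (Y_surface c i) (\<phi> i)) (grad_comp 2 (Y_surface c i) (\<phi> i)) (edge_trace (Y_surface c i) (\<phi> i))
   (\<lambda>p. a i (fst p) * fourier (v i) (snd p)) (\<lambda>p. a' i (fst p) * fourier (v i) (snd p)) (\<lambda>p. a i (fst p) * fourier' (v i) (snd p)) (\<lambda>y. a i 0 * fourier (v i) y)"
 proof (rule energy_form_cong[OF finite_energy_data[OF c \<phi>] finite_energy_data[OF c fe] _ _ _ _ _ P(2,3,5)[folded Pi]])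
  show "AE p in lM. prod_triple c a v i (Y_surface c i p) = a i (fst p) * fourier (v i) (snd p)" by (simp add: prod_triple_Y[OF c])
 qed (auto intro!: borel_measurable_lM_cont continuous_intros continuous_on_fst_snd fourier'_continuous ca a(3) lC_continuous_measurable)
qed

lemma tanh_triple_null: "tanh_triple c \<in> null_space c"
proof -
 have tb: "\<bar>tanh (x::real)\<bar> \<le> 1" for x using tanh_real_bounds[of x] by (auto simp: abs_le_iff)
 have D: "tanh_triple c \<in> D_space (Y_surface c)" unfolding tanh_triple_def
 proof (rule prod_triple_D[OF c smooth_tanh_sech(1) tanh_derivative])
  show "(\<Sum>i\<in>UNIV. tanh (0 + Y_shift i) * fourier const_mode y) = 0" for y
   by (simp add: fourier_const sum_3 tanh_Y_shift_values)
 qed (use tb sech_powers_integrable(2) fourier_const(3) in \<open>auto intro!: continuous_intros sech_tanh_continuous\<close>)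
 have "index_form (Y_surface c) (tanh_triple c) \<psi> = 0" if \<psi>: "\<psi> \<in> D_space (Y_surface c)" for \<psi>
 proof -
  note fe = finite_energyI(2)[OF D] finite_energyI(2)[OF \<psi>]
  have "index_form (Y_surface c) (tanh_triple c) \<psi> = index_form (Y_surface c) \<psi> (tanh_triple c)"
   unfolding index_form_energy_form[OF c fe] index_form_energy_form[OF c fe(2,1)] by (subst energy_form_commute) (rule refl)
  also have "... = (\<Sum>i\<in>UNIV. - (LINT y|lC. edge_trace (Y_surface c i) (\<psi> i) y))"
   unfolding tanh_triple_def index_form_prod_triple[OF fe(2) fe(1)[unfolded tanh_triple_def] smooth_tanh_sech(1) tanh_derivative
    continuous_on_power[OF sech_tanh_continuous(1)]] energy_form_tanh[OF finite_energy_data[OF c fe(2)]] ..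
  also have "... = - (2 * pi) * (\<Sum>i\<in>UNIV. face_radial c \<psi> i 0)"
   unfolding radial_0 trace_mean_def sum_distrib_left by simp
  also have "... = 0" unfolding trace_mean_sum[OF c fe(2)] by simp
  finally show ?thesis .
 qed
 then show ?thesis using D by (simp add: null_space_def)
qed

lemma sech_triple_null:
 assumes v: "\<And>i. v i $ 1 = 0" "(\<Sum>i\<in>UNIV. sech (Y_shift i) *\<^sub>R v i) = 0"
 shows "sech_triple c v \<in> null_space c"
proof -
 have sb: "\<bar>sech (x::real)\<bar> \<le> 1" for x using sech_bounds[of x] by (auto simp: abs_le_iff)
 have z: "(\<Sum>i\<in>UNIV. sech (0 + Y_shift i) * fourier (v i) y) = 0" for y
 proof -
  have "(\<Sum>i\<in>UNIV. sech (0 + Y_shift i) * fourier (v i) y) = fourier (\<Sum>i\<in>UNIV. sech (Y_shift i) *\<^sub>R v i) y"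
   by (simp add: fourier_def sum_component sum_distrib_left sum_distrib_right sum.distrib algebra_simps)
  also have "... = 0" unfolding v(2) by (simp add: fourier_def)
  finally show ?thesis .
 qed
 have D: "sech_triple c v \<in> D_space (Y_surface c)" unfolding sech_triple_def
  by (rule prod_triple_D[OF c smooth_tanh_sech(2) sech_derivative _ z sb])
    (use sech_powers_integrable in \<open>auto intro!: continuous_intros sech_tanh_continuous\<close>)
 have "index_form (Y_surface c) (sech_triple c v) \<psi> = 0" if \<psi>: "\<psi> \<in> D_space (Y_surface c)" for \<psi>
 proof -
  note fe = finite_energyI(2)[OF D] finite_energyI(2)[OF \<psi>]
  have "index_form (Y_surface c) (sech_triple c v) \<psi> = index_form (Y_surface c) \<psi> (sech_triple c v)"
   unfolding index_form_energy_form[OF c fe] index_form_energy_form[OF c fe(2,1)] by (subst energy_form_commute) (rule refl)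
  also have "... = (\<Sum>i::3\<in>UNIV. 0)"
   unfolding sech_triple_def index_form_prod_triple[OF fe(2) fe(1)[unfolded sech_triple_def] smooth_tanh_sech(2) sech_derivative
    continuous_on_mult[OF continuous_on_minus[OF sech_tanh_continuous(1)] sech_tanh_continuous(2)]] energy_form_sech[OF finite_energy_data[OF c fe(2)] v(1)] ..
  finally show ?thesis by simp
 qed
 then show ?thesis using D by (simp add: null_space_def)
qed

text \<open>On a circle with \<open>tanh (t + T)\<close> nonzero, the values at the angles
  \<open>0\<close>, \<open>pi\<close> and \<open>pi / 2\<close> separate the constant mode from
  cosine and sine.\<close>

lemma tanh_sech_independent:
 assumes e: "AE p in lM. A * tanh (fst p + T) + sech (fst p + T) * fourier v (snd p) = 0" and v: "v $ 1 = 0"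
 shows "A = 0" "v = 0"
proof -
 have "AE t in lT. t \<noteq> - T" using AE_lborel_singleton[of "- T"] by (simp add: AE_restrict_space_iff) (auto elim!: eventually_mono)
 then have "AE t in lT. A = 0 \<and> v = 0"
  using AE_lM_slices(1)[OF e]
 proof eventually_elim
  case (elim t)
  let ?F = "\<lambda>y. A * tanh (t + T) + sech (t + T) * fourier v y"
  have c2: "continuous_on {0..2*pi} (\<lambda>y. (?F y)^2)"
   by (intro continuous_intros continuous_on_subset[OF fourier'_continuous(2)]) simp
  have "(LINT y|lC. (?F y)^2) = (LINT y|lC. 0)"
   by (rule integral_cong_AE) (use elim(2) lC_continuous_measurable[OF fourier'_continuous(2)] in auto)
  then have "(LINT y:{0..2*pi}|lborel. (?F y)^2) = 0" by (simp add: integral_lC)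
  from continuous_nonneg_integral_zero[OF c2 _ this]
  have F: "?F y = 0" if "y \<in> {0..2*pi}" for y using that by auto
  have s: "sech (t + T) > 0" by (rule sech_bounds)
  have "A * tanh (t + T) + sech (t + T) * v $ 2 = 0" using F[of 0] v by (simp add: fourier_def)
  moreover have "A * tanh (t + T) - sech (t + T) * v $ 2 = 0" using F[of pi] v by (simp add: fourier_def)
  ultimately have 1: "A * tanh (t + T) = 0" "sech (t + T) * v $ 2 = 0" by linarith+
  have "A * tanh (t + T) + sech (t + T) * v $ 3 = 0" using F[of "pi / 2"] v by (simp add: fourier_def)
  then have "v $ 2 = 0" "v $ 3 = 0" "A = 0" using 1 s elim(1) by auto
  then show ?case using v by (simp add: vec_eq_iff forall_3)
 qed
 from AE_lT_const[OF this] show "A = 0" "v = 0" by auto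
qed

text \<open>Indices 1 and 2 place a mode on face 1, indices 3 and 4 on face 2, balanced by the
  opposite mode on face 3; odd indices are cosines, even ones sines. Division by
  \<open>sech (Y_shift i)\<close> gives the edge traces amplitude plus or minus 1, so that they
  cancel.\<close>

definition face_weight :: "nat => 3 => real^3" where
 "face_weight j i = (if i = 3 then -1 else if (i = 1) = (j \<in> {1, 2}) then 1 else 0)
   *\<^sub>R (inverse (sech (Y_shift i)) *\<^sub>R axis (if odd j then 2 else 3) 1)"

lemma nullity_lower: "5 \<le> nullity (Y_surface c)"
proof -
 define b where "b j = (if j = 0 then tanh_triple c else sech_triple c (face_weight j))" for j :: nat
 have s: "sech (Y_shift i) \<noteq> 0" for i using sech_bounds(1)[of "Y_shift i"] by linarith
 have w: "sech_triple c (face_weight j) \<in> null_space c" if "j \<in> {1..4}" for j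
 proof (rule sech_triple_null)
  show "face_weight j i $ 1 = 0" for i by (simp add: face_weight_def axis_def)
  show "(\<Sum>i\<in>UNIV. sech (Y_shift i) *\<^sub>R face_weight j i) = 0"
   using s by (auto simp: face_weight_def sum_3)
 qed
 have mem: "b j \<in> null_space c" if "j < 5" for j
  using tanh_triple_null w[of j] that by (auto simp: b_def)
 have "lin_indep (Y_surface c) 5 b"
  unfolding lin_indep_def
 proof (intro allI impI)
  fix a j assume n: "null_triple (Y_surface c) (lin_comb 5 a b)" and j: "j < (5::nat)"
  define v where "v i = a 1 *\<^sub>R face_weight 1 i + a 2 *\<^sub>R face_weight 2 i + a 3 *\<^sub>R face_weight 3 i + a 4 *\<^sub>R face_weight 4 i" for i
  have sum5: "(\<Sum>j<5. F j) = F 0 + F 1 + F 2 + F 3 + F 4" for F :: "nat => real" by (simp add: eval_nat_numeral)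
  have ev: "lin_comb 5 a b i (Y_surface c i p) = a 0 * tanh (fst p + Y_shift i) + sech (fst p + Y_shift i) * fourier (v i) (snd p)" for i p
   unfolding lin_comb_def sum5 b_def tanh_triple_def sech_triple_def v_def
   by (simp add: prod_triple_Y[OF c] fourier_const) (simp add: fourier_def algebra_simps)
  have v1: "v i $ 1 = 0" for i by (simp add: v_def face_weight_def axis_def)
  have "AE p in lM. a 0 * tanh (fst p + Y_shift i) + sech (fst p + Y_shift i) * fourier (v i) (snd p) = 0" for i
   using n unfolding null_triple_def AE_area[OF c] ev by blast
  note Z = tanh_sech_independent[OF this v1]
  have "v 1 $ 2 = 0" "v 1 $ 3 = 0" "v 2 $ 2 = 0" "v 2 $ 3 = 0" using Z(2) by simp_all
  then have "a 1 = 0" "a 2 = 0" "a 3 = 0" "a 4 = 0" using s by (simp_all add: v_def face_weight_def axis_def)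
  moreover have "j \<in> {0, 1, 2, 3, 4}" using j by auto
  ultimately show "a j = 0" using Z(1) by auto
 qed
 then show ?thesis
  unfolding nullity_def triple_dim_def null_space_def[symmetric]
  by (intro Sup_upper CollectI exI[of _ 5] conjI) (use mem in \<open>auto simp: numeral_eq_enat\<close>)
qed

end

section \<open>Classification of null fields\<close>

lemma loc_int_fst:
 assumes m: "W \<in> borel_measurable lT" and i: "\<And>R. set_integrable lborel {0..R} (W :: real => real)"
 shows "loc_int (\<lambda>p. W (fst p))"
 unfolding loc_int_def
proof (intro conjI allI)
 show "(\<lambda>p. W (fst p)) \<in> borel_measurable lM"
  using measurable_compose[OF measurable_fst[of lT lC] m] by (simp only: lM_pair)
 fix R
 have "integrable lT (\<lambda>t. indicator {..R} t * W t)"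
 proof (rule integrable_lT_set_support)
  show "set_integrable lborel {0..R} (\<lambda>t. indicator {..R} t * W t)"
   using i[of R] by (rule set_integrable_cong[THEN iffD1, rotated -1]) auto
 qed auto
 then show "integrable lM (\<lambda>p. indicator {..R} (fst p) * W (fst p))" by (rule integrable_lM_fst(1))
qed

lemma jac_smooth: "smooth (jac_p T)" "smooth (jac_q T)"
proof -
 show "smooth (jac_p T)" unfolding jac_p_def[abs_def] by (rule smooth_tanh_sech)
 have "C1k k (\<lambda>t. 1 + (-1) * ((1 * t + T) * tanh (t + T)))" for k
  by (rule C1k_add[OF C1k_const C1k_cmult[OF C1k_mult[OF C1k_affine C1k_tanh]]])
 then show "smooth (jac_q T)" unfolding smooth_def jac_q_def[abs_def] by simp
qed

lemma jac_wronskian: "jac_p T t * jac_q' T t - jac_p' T t * jac_q T t = - 1"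
 using tanh_sech[of "t + T"] unfolding jac_p_def jac_q_def jac_p'_def jac_q'_def by algebra

text \<open>Tests vanish at the edge, so this expresses the equation in the interior of a face; the
  coupling at the junction is exploited separately, with tests that do not vanish there.\<close>

definition weak_jacobi :: "real => (real => real) => (real => real) => bool" where
 "weak_jacobi T u u' \<longleftrightarrow> (\<forall>a a' R. smooth a \<longrightarrow> (\<forall>t. (a has_real_derivative a' t) (at t)) \<longrightarrow> continuous_on UNIV a' \<longrightarrow> a 0 = 0 \<longrightarrow>
   (\<forall>t>R. a t = 0) \<longrightarrow> (\<forall>t>R. a' t = 0) \<longrightarrow> (LINT t|lT. u' t * a' t - u t * (2 * (sech (t + T))^2 * a t)) = 0)"

context
 fixes f g h \<tau> assumes d: "h1_data f g h \<tau>"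
begin

lemma circ_mean_square_bound:
 "set_integrable lborel {0..R} (circ_mean g)"
 by (rule ac_on_integrable[OF circ_mean_facts(4)[OF d]])

lemma radial_pairing_integrable:
 assumes w: "continuous_on UNIV w" "\<And>t. t > R ==> w t = 0"
 shows "integrable lT (\<lambda>t. circ_mean g t * w t)" "integrable lT (\<lambda>t. radial \<tau> g t * w t)"
proof -
 show "integrable lT (\<lambda>t. circ_mean g t * w t)"
 proof (rule integrable_lT_set_support[of R])
  show "set_integrable lborel {0..R} (\<lambda>t. circ_mean g t * w t)"
   by (rule set_integrable_mult_continuous[OF circ_mean_square_bound continuous_on_subset[OF w(1)]]) simp
 qed (simp add: w(2))
 show "integrable lT (\<lambda>t. radial \<tau> g t * w t)"
 proof (rule integrable_lT_set_support[of R])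
  show "set_integrable lborel {0..R} (\<lambda>t. radial \<tau> g t * w t)"
   by (intro set_integrable_continuous_Icc continuous_on_mult ac_on_continuous[OF circ_mean_facts(4)[OF d]] continuous_on_subset[OF w(1)]) simp
 qed (simp add: w(2))
qed

text \<open>A test without angular dependence sees only the circle means of \<open>g\<close> and
  \<open>f\<close>, which are \<open>circ_mean g\<close> and \<open>radial \<tau> g\<close>.\<close>

lemma energy_form_radial:
 assumes a: "continuous_on UNIV a" "continuous_on UNIV a'" "\<And>t. t > R ==> a t = 0" "\<And>t. t > R ==> a' t = 0"
 shows "energy_form T f g h \<tau> (\<lambda>p. a (fst p) * fourier const_mode (snd p)) (\<lambda>p. a' (fst p) * fourier const_mode (snd p))
   (\<lambda>p. a (fst p) * fourier' const_mode (snd p)) (\<lambda>y. a 0 * fourier const_mode y)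
  = 2 * pi * ((LINT t|lT. circ_mean g t * a' t - radial \<tau> g t * (2 * (sech (t + T))^2 * a t)) - tanh T * radial \<tau> g 0 * a 0)"
proof -
 note F = h1_facts[OF d]
 have cs: "continuous_on UNIV (\<lambda>t. 2 * (sech (t + T))^2 * a t)" by (intro continuous_intros sech_tanh_continuous a)
 have i1: "integrable lM (\<lambda>p. g p * (a' (fst p) * 1))" by (rule loc_int_mult_integrable[OF F(2) a(2,4)]) auto
 have i2: "integrable lM (\<lambda>p. f p * ((2 * (sech (fst p + T))^2 * a (fst p)) * 1))"
  by (rule loc_int_mult_integrable[OF F(1) cs, of R]) (use a(3) in auto)
 have i: "integrable lM (\<lambda>p. g p * a' (fst p) - f p * (2 * (sech (fst p + T))^2 * a (fst p)))"
  using L1_diff[OF i1 i2] by simp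
 have "(LINT p|lM. g p * a' (fst p) - f p * (2 * (sech (fst p + T))^2 * a (fst p)))
  = (LINT t|lT. LINT y|lC. g (t, y) * a' t - f (t, y) * (2 * (sech (t + T))^2 * a t))"
  using slice_integrable(4)[OF i] by simp
 also have "... = (LINT t|lT. 2 * pi * (circ_mean g t * a' t - radial \<tau> g t * (2 * (sech (t + T))^2 * a t)))"
 proof (rule integral_cong_AE)
  show "(\<lambda>t. LINT y|lC. g (t, y) * a' t - f (t, y) * (2 * (sech (t + T))^2 * a t)) \<in> borel_measurable lT"
   using borel_measurable_integrable[OF slice_integrable(3)[OF i]] by simp
  show "(\<lambda>t. 2 * pi * (circ_mean g t * a' t - radial \<tau> g t * (2 * (sech (t + T))^2 * a t))) \<in> borel_measurable lT"
   using circ_mean_facts(1)[OF d] radial_measurable[OF d] lT_continuous_measurable[OF a(2)] lT_continuous_measurable[OF cs] by measurable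
  show "AE t in lT. (LINT y|lC. g (t, y) * a' t - f (t, y) * (2 * (sech (t + T))^2 * a t))
   = 2 * pi * (circ_mean g t * a' t - radial \<tau> g t * (2 * (sech (t + T))^2 * a t))"
   using mean_f[OF d] loc_int_slice_c[OF F(2)]
  proof eventually_elim
   case (elim t)
   have gm: "(LINT y|lC. g (t, y)) = 2 * pi * circ_mean g t" by (simp add: circ_mean_def)
   have "(LINT y|lC. g (t, y) * a' t - f (t, y) * (2 * (sech (t + T))^2 * a t))
    = (LINT y|lC. g (t, y)) * a' t - (LINT y|lC. f (t, y)) * (2 * (sech (t + T))^2 * a t)"
    using elim by (subst LINT_diff) auto
   then show ?case unfolding gm conjunct2[OF elim(1)] by algebra
  qed
 qed
 finally have 1: "(LINT p|lM. g p * a' (fst p) - f p * (2 * (sech (fst p + T))^2 * a (fst p)))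
  = 2 * pi * (LINT t|lT. circ_mean g t * a' t - radial \<tau> g t * (2 * (sech (t + T))^2 * a t))" by simp
 have e: "g p * a' (fst p) - 2 * (sech (fst p + T))^2 * f p * a (fst p) = g p * a' (fst p) - f p * (2 * (sech (fst p + T))^2 * a (fst p))" for p
  by simp
 have t: "(LINT y|lC. \<tau> y) = 2 * pi * radial \<tau> g 0" by (simp add: radial_0 trace_mean_def)
 show ?thesis
  unfolding energy_form_def fourier_const mult_1_right mult_zero_right add_0_right e 1 integral_mult_left_zero t by algebra
qed

text \<open>Testing the weak equation with \<open>w * Z\<close> and integrating the term with \<open>w1\<close> by parts leaves the Wronskian
 against \<open>Z'\<close>; no regularity of the weak solution is needed.\<close>

lemma wronskian_constant:
 assumes weak: "weak_jacobi T (radial \<tau> g) (circ_mean g)"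
  and w: "smooth w" "\<And>t. (w has_real_derivative w1 t) (at t)" "\<And>t. (w1 has_real_derivative - 2 * (sech (t + T))^2 * w t) (at t)"
 obtains m where "AE t in lT. circ_mean g t * w t - radial \<tau> g t * w1 t = m"
proof (rule constant_of_weak_derivative_zero)
 have cw: "continuous_on UNIV w" "continuous_on UNIV w1"
  using w(2,3) by (meson DERIV_isCont continuous_at_imp_continuous_on)+
 note ac = circ_mean_facts(4)[OF d]
 show "loc_int (\<lambda>p. circ_mean g (fst p) * w (fst p) - radial \<tau> g (fst p) * w1 (fst p))"
 proof (rule loc_int_fst)
  show "(\<lambda>t. circ_mean g t * w t - radial \<tau> g t * w1 t) \<in> borel_measurable lT"
   using circ_mean_facts(1)[OF d] radial_measurable[OF d] lT_continuous_measurable[OF cw(1)] lT_continuous_measurable[OF cw(2)] by measurable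
  show "set_integrable lborel {0..R} (\<lambda>t. circ_mean g t * w t - radial \<tau> g t * w1 t)" for R
  proof (rule set_integral_diff(1))
   show "set_integrable lborel {0..R} (\<lambda>t. circ_mean g t * w t)"
    by (rule set_integrable_mult_continuous[OF circ_mean_square_bound continuous_on_subset[OF cw(1)]]) simp
   show "set_integrable lborel {0..R} (\<lambda>t. radial \<tau> g t * w1 t)"
    by (intro set_integrable_continuous_Icc continuous_on_mult ac_on_continuous[OF ac] continuous_on_subset[OF cw(2)]) simp
  qed
 qed
 fix Z Z' :: "real => real" and R :: real
 assume Z: "\<And>k. C1k k Z" "\<And>t. (Z has_real_derivative Z' t) (at t)" "continuous_on UNIV Z'" "Z 0 = 0"
  "\<And>t. t > R ==> Z t = 0" "\<And>t. t > R ==> Z' t = 0"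
 have cZ: "continuous_on UNIV Z" by (rule C1k_continuous[OF Z(1)])
 let ?S = "\<lambda>t. - 2 * (sech (t + T))^2 * w t"
 have cS: "continuous_on UNIV ?S" by (intro continuous_intros sech_tanh_continuous cw)
 have A: "(LINT t|lT. circ_mean g t * (w1 t * Z t + Z' t * w t) - radial \<tau> g t * (2 * (sech (t + T))^2 * (w t * Z t))) = 0"
 proof (rule weak[unfolded weak_jacobi_def, rule_format, where R = R])
  show "smooth (\<lambda>t. w t * Z t)" using w(1) Z(1) unfolding smooth_def by (auto intro: C1k_mult)
  show "((\<lambda>t. w t * Z t) has_real_derivative w1 t * Z t + Z' t * w t) (at t)" for t
   by (rule DERIV_mult[OF w(2) Z(2)])
  show "continuous_on UNIV (\<lambda>t. w1 t * Z t + Z' t * w t)" by (intro continuous_intros cw cZ Z(3))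
 qed (use Z in auto)
 have d1: "((\<lambda>t. w1 t * Z t) has_real_derivative ?S t * Z t + Z' t * w1 t) (at t)" for t
  by (rule DERIV_mult[OF w(3) Z(2)])
 have c1: "continuous_on UNIV (\<lambda>t. w1 t * Z t)" "continuous_on UNIV (\<lambda>t. ?S t * Z t + Z' t * w1 t)"
  by (intro continuous_intros cw cZ Z(3) sech_tanh_continuous)+
 have ac1: "ac_on 0 R' (\<lambda>t. w1 t * Z t) (\<lambda>t. ?S t * Z t + Z' t * w1 t)" for R'
  by (rule ac_on_C1[OF d1 continuous_on_subset[OF c1(2)]]) simp
 note I1 = radial_pairing_integrable[OF c1(1), of R] and I2 = radial_pairing_integrable[OF c1(2), of R]
 have B: "(LINT t|lT. circ_mean g t * (w1 t * Z t) + radial \<tau> g t * (?S t * Z t + Z' t * w1 t)) = - (radial \<tau> g 0 * (w1 0 * Z 0))"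
  by (rule half_line_FTC[OF ac_on_mult[OF ac ac1]]) (use I1 I2 Z(5,6) in \<open>auto intro!: L1_add\<close>)
 have cA: "continuous_on UNIV (\<lambda>t. w1 t * Z t + Z' t * w t)" "continuous_on UNIV (\<lambda>t. 2 * (sech (t + T))^2 * (w t * Z t))"
  by (intro continuous_intros cw cZ Z(3) sech_tanh_continuous)+
 have iA: "integrable lT (\<lambda>t. circ_mean g t * (w1 t * Z t + Z' t * w t) - radial \<tau> g t * (2 * (sech (t + T))^2 * (w t * Z t)))"
  by (intro L1_diff radial_pairing_integrable[OF cA(1), of R] radial_pairing_integrable[OF cA(2), of R]) (use Z(5,6) in auto)
 have iB: "integrable lT (\<lambda>t. circ_mean g t * (w1 t * Z t) + radial \<tau> g t * (?S t * Z t + Z' t * w1 t))"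
  using I1(1) I2(2) Z(5,6) by (intro L1_add) auto
 have "(LINT t|lT. (circ_mean g t * w t - radial \<tau> g t * w1 t) * Z' t)
  = (LINT t|lT. (circ_mean g t * (w1 t * Z t + Z' t * w t) - radial \<tau> g t * (2 * (sech (t + T))^2 * (w t * Z t)))
    - (circ_mean g t * (w1 t * Z t) + radial \<tau> g t * (?S t * Z t + Z' t * w1 t)))"
  by (rule LINT_cong[OF refl]) algebra
 also have "... = 0" unfolding LINT_diff[OF iA iB] A B by (simp add: Z(4))
 finally show "(LINT t|lT. (circ_mean g t * w t - radial \<tau> g t * w1 t) * Z' t) = 0" .
qed

text \<open>The two constant Wronskians form a linear system of determinant \<open>-1\<close> for
  the radial part and its derivative, which are therefore combinations of the two known solutions.
  Square root growth excludes \<open>jac_q\<close>, whose quotient by \<open>1 + t\<close> has a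
  nonzero limit.\<close>

lemma radial_tanh:
 assumes weak: "weak_jacobi T (radial \<tau> g) (circ_mean g)"
 obtains K where "\<And>t. t \<ge> 0 ==> radial \<tau> g t = K * tanh (t + T)" "AE t in lT. circ_mean g t = K * (sech (t + T))^2"
proof -
 obtain m where m: "AE t in lT. circ_mean g t * jac_p T t - radial \<tau> g t * jac_p' T t = m"
  by (rule wronskian_constant[OF weak jac_smooth(1) jac_derivatives(1,2)]) (rule that, blast)
 obtain n where n: "AE t in lT. circ_mean g t * jac_q T t - radial \<tau> g t * jac_q' T t = n"
  by (rule wronskian_constant[OF weak jac_smooth(2) jac_derivatives(3,4)]) (rule that, blast)
 note ac = circ_mean_facts(4)[OF d]
 have cq: "continuous_on UNIV (jac_q T)" "continuous_on UNIV (jac_p T)" by (intro smooth_continuous jac_smooth)+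
 have cu: "continuous_on {0..R} (\<lambda>t. radial \<tau> g t - (n * jac_p T t - m * jac_q T t))" for R
  by (intro continuous_intros ac_on_continuous[OF ac] continuous_on_subset[OF cq(1)] continuous_on_subset[OF cq(2)]) auto
 have "AE t in lT. radial \<tau> g t - (n * jac_p T t - m * jac_q T t) = 0"
  using m n
 proof eventually_elim
  case (elim t)
  have "n * jac_p T t - m * jac_q T t = - radial \<tau> g t * (jac_p T t * jac_q' T t - jac_p' T t * jac_q T t)"
   unfolding elim[symmetric] by algebra
  then show ?case unfolding jac_wronskian by simp
 qed
 from continuous_AE_zero[OF cu this]
 have U: "radial \<tau> g t = n * jac_p T t - m * jac_q T t" if "t \<ge> 0" for t using that by fastforce
 have G: "AE t in lT. circ_mean g t = n * jac_p' T t - m * jac_q' T t"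
  using m n
 proof eventually_elim
  case (elim t)
  have "n * jac_p' T t - m * jac_q' T t = - circ_mean g t * (jac_p T t * jac_q' T t - jac_p' T t * jac_q T t)"
   unfolding elim[symmetric] by algebra
  then show ?case unfolding jac_wronskian by simp
 qed
 have "m = 0"
 proof -
  define C where "C = 2 * (trace_mean \<tau>)^2 + 2 * (LINT t|lT. (circ_mean g t)^2)"
  have "filterlim (\<lambda>t. t + T) at_top at_top"
   using filterlim_tendsto_add_at_top[OF tendsto_const[of T] filterlim_ident] by (simp add: add.commute)
  then have th: "((\<lambda>t. tanh (t + T)) \<longlongrightarrow> 1) at_top" by (rule filterlim_compose[OF tanh_real_at_top])
  have inv: "((\<lambda>t. 1 / (1 + t)) \<longlongrightarrow> (0::real)) at_top"
   by (intro tendsto_divide_0[OF tendsto_const] filterlim_at_top_imp_at_infinity filterlim_tendsto_add_at_top[OF tendsto_const] filterlim_ident)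
  have "((\<lambda>t. (n * tanh (t + T) - m) * (1 / (1 + t)) + m * ((1 + (T - 1) * (1 / (1 + t))) * tanh (t + T))) \<longlongrightarrow> (n * 1 - m) * 0 + m * ((1 + (T - 1) * 0) * 1)) at_top"
   by (intro tendsto_intros th inv)
  moreover have "\<forall>\<^sub>F t in at_top. (n * tanh (t + T) - m) * (1 / (1 + t)) + m * ((1 + (T - 1) * (1 / (1 + t))) * tanh (t + T)) = radial \<tau> g t * (1 / (1 + t))"
   using eventually_ge_at_top[of 0]
  proof eventually_elim
   case (elim t)
   have "1 + (T - 1) * (1 / (1 + t)) = (t + T) * (1 / (1 + t))" using elim by (simp add: field_simps)
   then show ?case unfolding U[OF elim] jac_p_def jac_q_def by algebra
  qed
  ultimately have "((\<lambda>t. radial \<tau> g t * (1 / (1 + t))) \<longlongrightarrow> m) at_top"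
   by (subst (asm) tendsto_cong) auto
  then have l1: "((\<lambda>t. (radial \<tau> g t * (1 / (1 + t)))^2) \<longlongrightarrow> m^2) at_top" by (rule tendsto_power)
  have l2: "((\<lambda>t. C * (1 / (1 + t))) \<longlongrightarrow> C * 0) at_top" by (intro tendsto_intros inv)
  have "\<forall>\<^sub>F t in at_top. (radial \<tau> g t * (1 / (1 + t)))^2 \<le> C * (1 / (1 + t))"
   using eventually_ge_at_top[of 0]
  proof eventually_elim
   case (elim t)
   have "(radial \<tau> g t)^2 * (1 / (1 + t))^2 \<le> C * (1 + t) * (1 / (1 + t))^2"
    using radial_growth[OF d elim] unfolding C_def by (rule mult_right_mono) simp
   also have "... = C * (1 / (1 + t))" using elim by (simp add: power2_eq_square)
   finally show ?case by (simp only: power_mult_distrib)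
  qed
  from tendsto_le[OF _ l2 l1 this] have "m^2 \<le> 0" by simp
  then show "m = 0" by simp
 qed
 show thesis
  by (rule that[of n]) (use U G \<open>m = 0\<close> in \<open>auto simp: jac_p_def jac_p'_def\<close>)
qed

end

text \<open>Vanishing of the square is a first-order equation along each line, solved by multiples
  of \<open>sech s\<close>. Vanishing of the deficit means equality in Wirtinger's inequality on
  almost every circle, so the angular factor is a first mode.\<close>

lemma mean_zero_extremal:
 assumes d: "h1_data f g h \<tau>" and mean: "AE t in lT. (LINT y|lC. f (t, y)) = 0"
  and g0: "(LINT p|lM. (g p + tanh (fst p + T) * f p)^2) = 0" and h0: "(LINT p|lM. (h p)^2) = (LINT p|lM. (f p)^2)"
 obtains v where "v $ 1 = 0" "AE p in lM. f p = sech (fst p + T) * fourier v (snd p)" "AE y in lC. \<tau> y = sech T * fourier v y"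
proof -
 note F = h1_facts[OF d] and W = h1_wirtinger[OF d mean]
 note [measurable] = F(4) F(5) sech_tanh_measurable[of T]
 have "AE p in lM. (g p + tanh (fst p + T) * f p)^2 = 0"
  using integral_nonneg_eq_0_iff_AE[OF mean_zero_identity(1)[OF d mean, of T]] g0 by simp
 then have "AE p in lM. g p = - tanh (fst p + T) * f p" by eventually_elim (simp add: eq_neg_iff_add_eq_0)
 then have gf: "AE p in lM. g p = - tanh (fst p + T) * rep \<tau> g p" using F(11) by eventually_elim simp
 have cosh0: "cosh x > 0" for x :: real by (rule cosh_real_pos)
 have "AE y in lC. \<forall>t\<ge>0. rep \<tau> g (t, y) = sech (t + T) * (cosh T * \<tau> y)"
  using h1_slice_t[OF d] AE_lM_slices(2)[OF gf]
 proof eventually_elim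
  case (elim y)
  let ?r = "\<lambda>t. rep \<tau> g (t, y)"
  \<comment> \<open>\<open>cosh s\<close> is the integrating factor: its product with the solution
    is constant on the line.\<close>
  have "ac_on 0 R (\<lambda>t. cosh (t + T)) (\<lambda>t. sinh (t + T))" for R
   by (rule ac_on_C1) (auto intro!: derivative_eq_intros continuous_intros)
  from ac_on_mult[OF conjunct1[OF elim(1), rule_format] this]
  have ac: "ac_on 0 R (\<lambda>t. ?r t * cosh (t + T)) (\<lambda>t. g (t, y) * cosh (t + T) + ?r t * sinh (t + T))" for R .
  have z: "AE t in lT. g (t, y) * cosh (t + T) + ?r t * sinh (t + T) = 0"
   using elim(2) by eventually_elim (use cosh0 in \<open>simp add: tanh_def less_imp_neq[symmetric]\<close>)
  show ?case
  proof (intro allI impI)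
   fix t :: real assume t: "t \<ge> 0"
   have "AE s in lborel. s \<in> {0..} \<longrightarrow> g (s, y) * cosh (s + T) + ?r s * sinh (s + T) = 0"
    using z by (simp add: AE_restrict_space_iff)
   then have "(LINT s:{0..t}|lborel. g (s, y) * cosh (s + T) + ?r s * sinh (s + T)) = (LINT s:{0..t}|lborel. 0)"
    unfolding set_lebesgue_integral_def
    by (intro integral_cong_AE) (use borel_measurable_integrable[OF ac_on_integrable[OF ac[of t], unfolded set_integrable_def]] in \<open>auto simp: indicator_def\<close>)
   then have "?r t * cosh (t + T) = ?r 0 * cosh (0 + T)" using ac_on_FTC[OF ac t] by (simp add: set_lebesgue_integral_def)
   then show "?r t = sech (t + T) * (cosh T * \<tau> y)"
    using cosh0[of "t + T"] by (simp add: rep_0 sech_def field_simps)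
  qed
 qed
 from AE_lM_snd[OF this] have fs: "AE p in lM. f p = sech (fst p + T) * (cosh T * \<tau> (snd p))"
  using F(11) AE_space
  by eventually_elim (auto simp: space_restrict_space cyl_def)
 have s0: "sech x > 0" for x :: real by (rule sech_bounds)
 \<comment> \<open>The deficit is nonnegative on almost every circle and has total integral
   zero.\<close>
 have "AE t in lT. (LINT y|lC. (h (t, y))^2) - (LINT y|lC. (f (t, y))^2) = 0"
 proof -
  have i: "integrable lT (\<lambda>t. (LINT y|lC. (h (t, y))^2) - (LINT y|lC. (f (t, y))^2))"
   by (rule L1_diff[OF slice_integrable(3)[OF F(8)] slice_integrable(3)[OF W(2)]])
  have "(LINT t|lT. (LINT y|lC. (h (t, y))^2) - (LINT y|lC. (f (t, y))^2)) = 0"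
   unfolding LINT_diff[OF slice_integrable(3)[OF F(8)] slice_integrable(3)[OF W(2)]]
   using slice_integrable(4)[OF F(8)] slice_integrable(4)[OF W(2)] h0 by simp
  moreover have "AE t in lT. 0 \<le> (LINT y|lC. (h (t, y))^2) - (LINT y|lC. (f (t, y))^2)" using W(1) by eventually_elim simp
  ultimately show ?thesis using integral_nonneg_eq_0_iff_AE[OF i] by simp
 qed
 then have "AE t in lT. \<exists>v. v $ 1 = 0 \<and> (AE y in lC. cosh T * \<tau> y = fourier v y)"
  using h1_slice_c[OF d] AE_lM_slices(1)[OF fs] mean AE_space
 proof eventually_elim
  case (elim t)
  then obtain w where w: "ac_on 0 (2*pi) w (\<lambda>y. h (t, y))" "w 0 = w (2*pi)" "set_integrable lborel {0..2*pi} (\<lambda>y. (h (t, y))^2)"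
   "AE y in lC. f (t, y) = w y" by blast
  have iw: "integrable lC w" unfolding integrable_lC by (rule set_integrable_continuous_Icc[OF ac_on_continuous[OF w(1)]])
  have fm: "(\<lambda>y. f (t, y)) \<in> borel_measurable lC" by (rule slice_measurable(2)[OF F(4) elim(5)])
  note wm = borel_measurable_integrable[OF iw]
  have "(LINT y|lC. w y) = (LINT y|lC. f (t, y))"
   by (rule integral_cong_AE[OF wm fm]) (rule eventually_mono[OF w(4)], simp)
  then have m: "(LINT y:{0..2*pi}|lborel. w y) = 0" unfolding integral_lC[symmetric] using elim(4) by (rule trans)
  have "(LINT y|lC. (w y)^2) = (LINT y|lC. (f (t, y))^2)"
   by (rule integral_cong_AE[OF borel_measurable_power[OF wm] borel_measurable_power[OF fm]]) (rule eventually_mono[OF w(4)], simp)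
  then have q: "(LINT y:{0..2*pi}|lborel. (h (t, y))^2) = (LINT y:{0..2*pi}|lborel. (w y)^2)"
   unfolding integral_lC[symmetric] using elim(1) by simp
  obtain a b where ab: "\<And>y. y \<in> {0..2*pi} ==> w y = a * cos y + b * sin y"
   using wirtinger_equality[OF w(1,3,2) m q] by blast
  define v :: "real^3" where "v = vector [0, a / sech (t + T), b / sech (t + T)]"
  have "AE y in lC. cosh T * \<tau> y = fourier v y"
   using elim(3) w(4) AE_space
  proof eventually_elim
   case (elim y)
   then have "sech (t + T) * (cosh T * \<tau> y) = a * cos y + b * sin y" using ab[of y] by (simp add: space_restrict_space)
   then show ?case using s0[of "t + T"] by (simp add: v_def fourier_def field_simps)
  qed
  moreover have "v $ 1 = 0" by (simp add: v_def)
  ultimately show ?case by blast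
 qed
 \<comment> \<open>The angular factor \<open>cosh T * \<tau>\<close> is common to all circles, so a
   single good circle determines \<open>v\<close>.\<close>
 from AE_lT_const[OF this] obtain v where v: "v $ 1 = 0" "AE y in lC. cosh T * \<tau> y = fourier v y" by blast
 show thesis
 proof (rule that[OF v(1)])
  show "AE p in lM. f p = sech (fst p + T) * fourier v (snd p)" using fs AE_lM_snd[OF v(2)] by eventually_elim simp
  show "AE y in lC. \<tau> y = sech T * fourier v y" using v(2)
   by eventually_elim (use cosh0[of T] in \<open>simp add: sech_def field_simps\<close>)
 qed
qed

context
 fixes c :: real assumes c: "c > 0"
begin

lemma null_space_radial_test:
 assumes \<phi>: "\<phi> \<in> null_space c"
  and a: "\<And>i. smooth (a i)" "\<And>i t. (a i has_real_derivative a' i t) (at t)" "\<And>i. continuous_on UNIV (a' i)"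
   "\<And>i t. t > R ==> a i t = 0" "\<And>i t. t > R ==> a' i t = 0" "(\<Sum>i\<in>UNIV. a i 0) = 0"
 shows "(\<Sum>i\<in>UNIV. (LINT t|lT. circ_mean (grad_comp 1 (Y_surface c i) (\<phi> i)) t * a' i t - face_radial c \<phi> i t * (2 * (sech (t + Y_shift i))^2 * a i t))
   - tanh (Y_shift i) * face_radial c \<phi> i 0 * a i 0) = 0"
proof -
 have D: "\<phi> \<in> D_space (Y_surface c)" using \<phi> by (simp add: null_space_def)
 have P: "prod_triple c a (\<lambda>_. const_mode) \<in> D_space (Y_surface c)"
  by (rule prod_triple_compact(1)[OF c a(1,4)]) (use a(6) in \<open>simp_all add: fourier_const\<close>)
 note fe = finite_energyI(2)[OF D] finite_energyI(2)[OF P]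
 have "0 = index_form (Y_surface c) \<phi> (prod_triple c a (\<lambda>_. const_mode))" using \<phi> P by (simp add: null_space_def)
 also have "... = (\<Sum>i\<in>UNIV. 2 * pi * ((LINT t|lT. circ_mean (grad_comp 1 (Y_surface c i) (\<phi> i)) t * a' i t - face_radial c \<phi> i t * (2 * (sech (t + Y_shift i))^2 * a i t))
   - tanh (Y_shift i) * face_radial c \<phi> i 0 * a i 0))"
  unfolding index_form_prod_triple[OF c fe a(1-3)]
  by (intro sum.cong refl energy_form_radial[OF finite_energy_data[OF c fe(1)] smooth_continuous[OF a(1)] a(3-5)])
 finally show ?thesis unfolding sum_distrib_left[symmetric] by simp
qed

lemma null_space_radial:
 assumes \<phi>: "\<phi> \<in> null_space c"
 obtains K where "\<And>i t. t \<ge> 0 ==> face_radial c \<phi> i t = K * tanh (t + Y_shift i)"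
proof -
 have D: "\<phi> \<in> D_space (Y_surface c)" using \<phi> by (simp add: null_space_def)
 note d = finite_energy_data[OF c finite_energyI(2)[OF D]]
 let ?U = "\<lambda>i. face_radial c \<phi> i" and ?G = "\<lambda>i. circ_mean (grad_comp 1 (Y_surface c i) (\<phi> i))"
 have zero: "smooth (\<lambda>t. 0)" unfolding smooth_def by (auto intro: C1k_const)
 have weak: "weak_jacobi (Y_shift i) (?U i) (?G i)" for i
  unfolding weak_jacobi_def
 proof (intro allI impI)
  fix a a' :: "real => real" and R :: real
  assume a: "smooth a" "\<forall>t. (a has_real_derivative a' t) (at t)" "continuous_on UNIV a'" "a 0 = 0" "\<forall>t>R. a t = 0" "\<forall>t>R. a' t = 0"
  \<comment> \<open>A test that vanishes at the edge may be placed on one face alone, which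
    decouples the equations of the faces.\<close>
  let ?a = "\<lambda>j t. if j = i then a t else 0" and ?a' = "\<lambda>j t. if j = i then a' t else 0"
  have "(\<Sum>j\<in>UNIV. (LINT t|lT. ?G j t * ?a' j t - ?U j t * (2 * (sech (t + Y_shift j))^2 * ?a j t)) - tanh (Y_shift j) * ?U j 0 * ?a j 0) = 0"
  proof (rule null_space_radial_test[OF \<phi>, where R = R])
   show "smooth (?a j)" for j using a(1) zero by (cases "j = i") simp_all
   show "(?a j has_real_derivative ?a' j t) (at t)" for j t using a(2) by (cases "j = i") simp_all
   show "continuous_on UNIV (?a' j)" for j using a(3) by (cases "j = i") simp_all
  qed (use a in auto)
  moreover have "(LINT t|lT. ?G j t * ?a' j t - ?U j t * (2 * (sech (t + Y_shift j))^2 * ?a j t)) - tanh (Y_shift j) * ?U j 0 * ?a j 0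
   = (if j = i then (LINT t|lT. ?G i t * a' t - ?U i t * (2 * (sech (t + Y_shift i))^2 * a t)) else 0)" for j
   using a(4) by (cases "j = i") simp_all
  ultimately show "(LINT t|lT. ?G i t * a' t - ?U i t * (2 * (sech (t + Y_shift i))^2 * a t)) = 0" by simp
 qed
 have "\<forall>i. \<exists>K. (\<forall>t\<ge>0. ?U i t = K * tanh (t + Y_shift i)) \<and> (AE t in lT. ?G i t = K * (sech (t + Y_shift i))^2)"
 proof
  fix i show "\<exists>K. (\<forall>t\<ge>0. ?U i t = K * tanh (t + Y_shift i)) \<and> (AE t in lT. ?G i t = K * (sech (t + Y_shift i))^2)"
   by (rule radial_tanh[OF d weak]) blast
 qed
 from choice[OF this] obtain K where U: "\<And>i t. t \<ge> 0 ==> ?U i t = K i * tanh (t + Y_shift i)"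
  and G: "\<And>i. AE t in lT. ?G i t = K i * (sech (t + Y_shift i))^2" by blast
 obtain \<eta> \<eta>' R where \<eta>: "smooth \<eta>" "\<And>t. (\<eta> has_real_derivative \<eta>' t) (at t)" "continuous_on UNIV \<eta>'" "\<eta> 0 = 1"
  "\<And>t. t > R ==> \<eta> t = 0" "\<And>t. t > R ==> \<eta>' t = 0"
  "\<And>i. (LINT t|lT. (\<eta>' t)^2) - 2 * (LINT t|lT. (sech (t + Y_shift i))^2 * (\<eta> t)^2) - tanh (Y_shift i) < 0"
  using slow_cutoff by blast
 have c\<eta>: "continuous_on UNIV \<eta>" by (rule smooth_continuous[OF \<eta>(1)])
 \<comment> \<open>For the radial part \<open>K tanh s\<close> the test \<open>x \<eta>\<close>
   leaves \<open>- K x (sech^2 T + tanh^2 T) = - K x\<close>, the same expression on every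
   face.\<close>
 have val: "(LINT t|lT. ?G i t * (x * \<eta>' t) - ?U i t * (2 * (sech (t + Y_shift i))^2 * (x * \<eta> t))) - tanh (Y_shift i) * ?U i 0 * (x * \<eta> 0) = - K i * x" for i x
 proof -
  let ?T = "Y_shift i"
  let ?P = "\<lambda>t. (- 2 * (sech (t + ?T))^2 * tanh (t + ?T)) * \<eta> t + \<eta>' t * (sech (t + ?T))^2"
  have dP: "((\<lambda>t. (sech (t + ?T))^2 * \<eta> t) has_real_derivative ?P t) (at t)" for t
   using DERIV_mult[OF jac_derivatives(2)[of ?T t] \<eta>(2)[of t]] by (simp add: jac_p'_def[abs_def] jac_p_def)
  have cP: "continuous_on UNIV ?P" "continuous_on UNIV (\<lambda>t. (sech (t + ?T))^2 * \<eta> t)"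
   by (intro continuous_intros sech_tanh_continuous c\<eta> \<eta>(3))+
  have "(LINT t|lT. ?P t) = - ((sech (0 + ?T))^2 * \<eta> 0)"
  proof (rule half_line_FTC)
   show "ac_on 0 R' (\<lambda>t. (sech (t + ?T))^2 * \<eta> t) ?P" for R' by (rule ac_on_C1[OF dP continuous_on_subset[OF cP(1)]]) simp
  qed (rule integrable_lT_compact[OF cP(2), of R], simp add: \<eta>(5), rule integrable_lT_compact[OF cP(1), of R], simp add: \<eta>(5,6))
  then have P: "(LINT t|lT. ?P t) = - (sech ?T)\<^sup>2" using \<eta>(4) by simp
  have "(LINT t|lT. ?G i t * (x * \<eta>' t) - ?U i t * (2 * (sech (t + ?T))^2 * (x * \<eta> t))) = (LINT t|lT. K i * x * ?P t)"
  proof (rule integral_cong_AE)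
   show "AE t in lT. ?G i t * (x * \<eta>' t) - ?U i t * (2 * (sech (t + ?T))^2 * (x * \<eta> t)) = K i * x * ?P t"
    using G[of i] AE_space
   proof eventually_elim
    case (elim t)
    then have "?U i t = K i * tanh (t + ?T)" by (intro U) (simp add: space_restrict_space)
    then show ?case unfolding elim(1) by algebra
   qed
   show "(\<lambda>t. K i * x * ?P t) \<in> borel_measurable lT" by (intro lT_continuous_measurable continuous_on_mult continuous_on_const cP)
   have "continuous_on UNIV (\<lambda>t. x * \<eta>' t)" "continuous_on UNIV (\<lambda>t. 2 * (sech (t + ?T))^2 * (x * \<eta> t))"
    by (intro continuous_intros sech_tanh_continuous c\<eta> \<eta>(3))+
   then show "(\<lambda>t. ?G i t * (x * \<eta>' t) - ?U i t * (2 * (sech (t + ?T))^2 * (x * \<eta> t))) \<in> borel_measurable lT"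
    by (intro borel_measurable_diff borel_measurable_times lT_continuous_measurable circ_mean_facts(1)[OF d] radial_measurable[OF d])
  qed
  also have "... = K i * x * - (sech ?T)\<^sup>2" unfolding integral_mult_right_zero P ..
  finally have 1: "(LINT t|lT. ?G i t * (x * \<eta>' t) - ?U i t * (2 * (sech (t + ?T))^2 * (x * \<eta> t))) = K i * x * - (sech ?T)\<^sup>2" .
  have 2: "?U i 0 = K i * tanh ?T" using U[of 0 i] by simp
  show ?thesis unfolding 1 2 \<eta>(4) using tanh_sech[of ?T] by algebra
 qed
 have "(\<Sum>i\<in>UNIV. - K i * x i) = 0" if x: "(\<Sum>i\<in>UNIV. x i) = 0" for x
 proof -
  have "(\<Sum>i\<in>UNIV. (LINT t|lT. ?G i t * (x i * \<eta>' t) - ?U i t * (2 * (sech (t + Y_shift i))^2 * (x i * \<eta> t))) - tanh (Y_shift i) * ?U i 0 * (x i * \<eta> 0)) = 0"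
  proof (rule null_space_radial_test[OF \<phi>, where R = R])
   show "smooth (\<lambda>t. x i * \<eta> t)" for i using \<eta>(1) unfolding smooth_def by (auto intro: C1k_cmult)
   show "((\<lambda>t. x i * \<eta> t) has_real_derivative x i * \<eta>' t) (at t)" for i t by (rule DERIV_cmult[OF \<eta>(2)])
   show "continuous_on UNIV (\<lambda>t. x i * \<eta>' t)" for i by (intro continuous_intros \<eta>(3))
  qed (use \<eta>(4-6) x in auto)
  then show ?thesis unfolding val .
 qed
 \<comment> \<open>\<open>K\<close> is orthogonal to all coefficient vectors of sum zero;
   \<open>(1, 0, -1)\<close> and \<open>(0, 1, -1)\<close> force its entries to coincide.\<close>
 from this[of "\<lambda>i. if i = 1 then 1 else if i = 3 then -1 else 0"] this[of "\<lambda>i. if i = 2 then 1 else if i = 3 then -1 else 0"]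
 have "K 1 = K 3" "K 2 = K 3" by (simp_all add: sum_3)
 then have "K i = K 3" for i using exhaust_3[of i] by auto
 then show thesis by (intro that[of "K 3"]) (use U in simp)
qed

text \<open>Subtracting \<open>K\<close> times the explicit radial field leaves mean zero, where the
  energy is a sum of nonnegative squares and deficits. Expanding bilinearly, this energy vanishes
  because both fields lie in the null space; hence every summand does, and the equality case applies
  on each face.\<close>

lemma null_space_shape:
 assumes \<phi>: "\<phi> \<in> null_space c"
 shows "\<exists>K v. (\<forall>i. v i $ 1 = 0) \<and> (\<Sum>i\<in>UNIV. sech (Y_shift i) *\<^sub>R v i) = 0 \<and>
  (\<forall>i. AE p in lM. \<phi> i (Y_surface c i p) = K * tanh (fst p + Y_shift i) + sech (fst p + Y_shift i) * fourier (v i) (snd p))"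
proof -
 have D: "\<phi> \<in> D_space (Y_surface c)" "tanh_triple c \<in> D_space (Y_surface c)"
  using \<phi> tanh_triple_null[OF c] by (simp_all add: null_space_def)
 note fe = finite_energyI(2)[OF D(1)] finite_energyI(2)[OF D(2)]
 note d = finite_energy_data[OF c fe(1)] and e = finite_energy_data[OF c fe(2)]
 obtain K where U: "\<And>i t. t \<ge> 0 ==> face_radial c \<phi> i t = K * tanh (t + Y_shift i)"
  using null_space_radial[OF \<phi>] by blast
 let ?f = "\<lambda>i p. \<phi> i (Y_surface c i p) + - K * tanh_triple c i (Y_surface c i p)"
 let ?g = "\<lambda>i p. grad_comp 1 (Y_surface c i) (\<phi> i) p + - K * grad_comp 1 (Y_surface c i) (tanh_triple c i) p"
 let ?h = "\<lambda>i p. grad_comp 2 (Y_surface c i) (\<phi> i) p + - K * grad_comp 2 (Y_surface c i) (tanh_triple c i) p"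
 let ?\<tau> = "\<lambda>i y. edge_trace (Y_surface c i) (\<phi> i) y + - K * edge_trace (Y_surface c i) (tanh_triple c i) y"
 have h1: "h1_data (?f i) (?g i) (?h i) (?\<tau> i)" for i by (rule h1_data_linear[OF d e])
 have tv: "tanh_triple c i (Y_surface c i p) = tanh (fst p + Y_shift i)" for i p
  by (simp add: tanh_triple_def prod_triple_Y[OF c] fourier_const)
 have mean: "AE t in lT. (LINT y|lC. ?f i (t, y)) = 0" for i
  using mean_f[OF d[of i]] AE_space
 proof eventually_elim
  case (elim t)
  then have "(LINT y|lC. ?f i (t, y)) = (LINT y|lC. \<phi> i (Y_surface c i (t, y))) - 2 * pi * (K * tanh (t + Y_shift i))"
   using measure_lC by (simp add: tv)
  then show ?case using elim U[of t i] by (simp add: space_restrict_space)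
 qed
 let ?A = "\<lambda>i. (LINT p|lM. (?g i p + tanh (fst p + Y_shift i) * ?f i p)^2)"
 let ?B = "\<lambda>i. (LINT p|lM. (?h i p)^2) - (LINT p|lM. (?f i p)^2)"
 have E: "energy (Y_shift i) (?f i) (?g i) (?h i) (?\<tau> i) = ?A i + ?B i" for i
  unfolding energy_def by (rule mean_zero_identity(2)[OF h1 mean])
 have A0: "0 \<le> ?A i" and B0: "0 \<le> ?B i" for i
  using LINT_nonneg_sq h1_wirtinger(3)[OF h1 mean, of i] by auto
 have "(\<Sum>i\<in>UNIV. energy (Y_shift i) (?f i) (?g i) (?h i) (?\<tau> i))
  = index_form (Y_surface c) \<phi> \<phi> + 2 * - K * index_form (Y_surface c) \<phi> (tanh_triple c) + (- K)^2 * index_form (Y_surface c) (tanh_triple c) (tanh_triple c)"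
  unfolding energy_linear[OF d e] index_form_energy[OF c fe(1)] index_form_energy[OF c fe(2)] index_form_energy_form[OF c fe]
   sum.distrib sum_distrib_left ..
 also have "... = 0" using \<phi> D tanh_triple_null[OF c] by (simp add: null_space_def)
 finally have "(\<Sum>i\<in>UNIV. ?A i + ?B i) = 0" unfolding E .
 moreover have "?A i + ?B i \<ge> 0" for i by (rule add_nonneg_nonneg[OF A0 B0])
 ultimately have S: "?A i + ?B i = 0" for i
  using sum_nonneg_eq_0_iff[of UNIV "\<lambda>i. ?A i + ?B i"] by simp
 have AB: "?A i = 0" "?B i = 0" for i using S[of i] A0[of i] B0[of i] by linarith+
 have "\<forall>i. \<exists>v. v $ 1 = 0 \<and> (AE p in lM. ?f i p = sech (fst p + Y_shift i) * fourier v (snd p)) \<and> (AE y in lC. ?\<tau> i y = sech (Y_shift i) * fourier v y)"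
 proof
  fix i show "\<exists>v. v $ 1 = 0 \<and> (AE p in lM. ?f i p = sech (fst p + Y_shift i) * fourier v (snd p)) \<and> (AE y in lC. ?\<tau> i y = sech (Y_shift i) * fourier v y)"
   by (rule mean_zero_extremal[OF h1[of i] mean AB(1)]) (use AB(2)[of i] in simp, blast)
 qed
 from choice[OF this] obtain v where v: "\<And>i. v i $ 1 = 0" "\<And>i. AE p in lM. ?f i p = sech (fst p + Y_shift i) * fourier (v i) (snd p)"
  "\<And>i. AE y in lC. ?\<tau> i y = sech (Y_shift i) * fourier (v i) y" by blast
 let ?V = "\<Sum>i\<in>UNIV. sech (Y_shift i) *\<^sub>R v i"
 have V1: "?V $ 1 = 0" by (simp add: sum_component v(1))
 have tr: "AE y in lC. (\<Sum>i\<in>UNIV. edge_trace (Y_surface c i) (\<psi> i) y) = 0" if "finite_energy (Y_surface c) \<psi>" for \<psi>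
  using that by (simp add: finite_energy_def admissible_def)
 have "AE y in lC. \<forall>i\<in>UNIV. ?\<tau> i y = sech (Y_shift i) * fourier (v i) y" using v(3) by (intro AE_finite_allI) auto
 then have "AE y in lC. fourier ?V y = 0"
  using tr[OF fe(1)] tr[OF fe(2)]
 proof eventually_elim
  case (elim y)
  have "fourier ?V y = (\<Sum>i\<in>UNIV. sech (Y_shift i) * fourier (v i) y)"
   by (simp add: fourier_def sum_component sum_distrib_left sum_distrib_right sum.distrib algebra_simps)
  also have "... = (\<Sum>i\<in>UNIV. ?\<tau> i y)" using elim(1) by (intro sum.cong) auto
  also have "... = (\<Sum>i\<in>UNIV. edge_trace (Y_surface c i) (\<phi> i) y) + - K * (\<Sum>i\<in>UNIV. edge_trace (Y_surface c i) (tanh_triple c i) y)"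
   unfolding sum.distrib sum_distrib_left ..
  finally show ?case using elim by simp
 qed
 \<comment> \<open>The sum of the traces is a single angular mode vanishing almost everywhere;
   independence, applied with \<open>A = 0\<close> and \<open>T = 0\<close>, shows that its
   coefficient vector is zero.\<close>
 from AE_lM_snd[OF this] have "AE p in lM. 0 * tanh (fst p + 0) + sech (fst p + 0) * fourier ?V (snd p) = 0"
  by eventually_elim simp
 from tanh_sech_independent(2)[OF c this V1] have "?V = 0" .
 moreover have "AE p in lM. \<phi> i (Y_surface c i p) = K * tanh (fst p + Y_shift i) + sech (fst p + Y_shift i) * fourier (v i) (snd p)" for i
  using v(2)[of i] by eventually_elim (simp add: tv)
 ultimately show ?thesis using v(1) by blast
qed

text \<open>Modulo null triples, a null field is determined by \<open>K\<close> and the four angular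
  coefficients on faces 1 and 2, since the edge relation yields those on face 3. Six fields would
  admit a nontrivial combination with all five data zero.\<close>

lemma nullity_upper: "nullity (Y_surface c) \<le> 5"
 unfolding nullity_def triple_dim_def null_space_def[symmetric]
proof (rule Sup_least, clarify)
 fix n b assume b: "\<forall>j<n. b j \<in> null_space c" and li: "lin_indep (Y_surface c) n b"
 have "\<forall>j. \<exists>K v. j < n \<longrightarrow> (\<forall>i. v i $ 1 = 0) \<and> (\<Sum>i\<in>UNIV. sech (Y_shift i) *\<^sub>R v i) = 0 \<and>
  (\<forall>i. AE p in lM. b j i (Y_surface c i p) = K * tanh (fst p + Y_shift i) + sech (fst p + Y_shift i) * fourier (v i) (snd p))"
 proof
  fix j show "\<exists>K v. j < n \<longrightarrow> (\<forall>i. v i $ 1 = 0) \<and> (\<Sum>i\<in>UNIV. sech (Y_shift i) *\<^sub>R v i) = 0 \<and>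
  (\<forall>i. AE p in lM. b j i (Y_surface c i p) = K * tanh (fst p + Y_shift i) + sech (fst p + Y_shift i) * fourier (v i) (snd p))"
   using null_space_shape[of "b j"] b by (cases "j < n") auto
 qed
 from choice[OF this] obtain K where "\<forall>j. \<exists>v. j < n \<longrightarrow> (\<forall>i. v i $ 1 = 0) \<and> (\<Sum>i\<in>UNIV. sech (Y_shift i) *\<^sub>R v i) = 0 \<and>
  (\<forall>i. AE p in lM. b j i (Y_surface c i p) = K j * tanh (fst p + Y_shift i) + sech (fst p + Y_shift i) * fourier (v i) (snd p))"
  by (rule exE)
 from choice[OF this] obtain v where v: "\<And>j i. j < n ==> v j i $ 1 = 0" "\<And>j. j < n ==> (\<Sum>i\<in>UNIV. sech (Y_shift i) *\<^sub>R v j i) = 0"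
  and bv: "\<And>j i. j < n ==> AE p in lM. b j i (Y_surface c i p) = K j * tanh (fst p + Y_shift i) + sech (fst p + Y_shift i) * fourier (v j i) (snd p)"
  by blast
 define w where "w j k = (if k = 0 then K j else if k = 1 then v j 1 $ 2 else if k = 2 then v j 1 $ 3 else if k = 3 then v j 2 $ 2 else v j 2 $ 3)"
  for j and k :: nat
 have "n \<le> 5"
 proof (rule ccontr)
  assume "\<not> n \<le> 5"
  then have "\<exists>a. (\<exists>j\<in>{..<n}. a j \<noteq> 0) \<and> (\<forall>k<5. (\<Sum>j\<in>{..<n}. a j * w j k) = 0)"
   by (intro linear_dependence) auto
  then obtain a where a: "\<exists>j\<in>{..<n}. a j \<noteq> 0" "\<And>k. k < 5 ==> (\<Sum>j<n. a j * w j k) = 0" by blast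
  define V where "V i = (\<Sum>j<n. a j *\<^sub>R v j i)" for i
  have K0: "(\<Sum>j<n. a j * K j) = 0" using a(2)[of 0] by (simp add: w_def)
  have "V 1 $ 2 = 0" "V 1 $ 3 = 0" "V 2 $ 2 = 0" "V 2 $ 3 = 0"
   using a(2)[of 1] a(2)[of 2] a(2)[of 3] a(2)[of 4] by (simp_all add: w_def V_def sum_component)
  moreover have "V i $ 1 = 0" for i by (simp add: V_def sum_component v(1))
  ultimately have V12: "V 1 = 0" "V 2 = 0" by (simp_all add: vec_eq_iff forall_3)
  have "(\<Sum>i\<in>UNIV. sech (Y_shift i) *\<^sub>R V i) = (\<Sum>j<n. a j *\<^sub>R (\<Sum>i\<in>UNIV. sech (Y_shift i) *\<^sub>R v j i))"
   unfolding V_def scaleR_sum_right by (subst sum.swap) (simp add: mult.commute)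
  also have "... = 0" using v(2) by simp
  finally have "sech (Y_shift 3) *\<^sub>R V 3 = 0" using V12 by (simp add: sum_3)
  then have "V 3 = 0" using sech_bounds(1)[of "Y_shift 3"] by simp
  then have V0: "V i = 0" for i using V12 exhaust_3[of i] by auto
  have "AE p in lM. lin_comb n a b i (Y_surface c i p) = 0" for i
  proof -
   have "AE p in lM. \<forall>j\<in>{..<n}. b j i (Y_surface c i p) = K j * tanh (fst p + Y_shift i) + sech (fst p + Y_shift i) * fourier (v j i) (snd p)"
    using bv by (intro AE_finite_allI) auto
   then show ?thesis
   proof eventually_elim
    case (elim p)
    have "lin_comb n a b i (Y_surface c i p) = (\<Sum>j<n. a j * (K j * tanh (fst p + Y_shift i) + sech (fst p + Y_shift i) * fourier (v j i) (snd p)))"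
     unfolding lin_comb_def using elim by (intro sum.cong) auto
    also have "... = (\<Sum>j<n. a j * K j) * tanh (fst p + Y_shift i) + sech (fst p + Y_shift i) * fourier (V i) (snd p)"
     by (simp add: V_def fourier_def sum_component sum_distrib_left sum_distrib_right sum.distrib algebra_simps)
    also have "... = 0" unfolding K0 V0 by (simp add: fourier_def)
    finally show ?case .
   qed
  qed
  then have "null_triple (Y_surface c) (lin_comb n a b)" unfolding null_triple_def AE_area[OF c] by blast
  then show False using li a(1) unfolding lin_indep_def by auto
 qed
 then show "enat n \<le> 5" by (simp add: numeral_eq_enat)
qed

end

theorem theorem4p9:
  fixes c :: real
  assumes "c > 0"
  shows "morse_index (Y_surface c) = 2 \<and> nullity (Y_surface c) = 5"
  using morse_index_upper[OF assms] morse_index_lower[OF assms] nullity_upper[OF assms] nullity_lower[OF assms]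
  by (auto intro: antisym)

end
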